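(* Let $\Omega$ be a Jordan domain in $\overline{\mathbb{C}}$ bounded by a Jordan curve $\Gamma$. For any collar neighbourhood $A$ of $\Gamma$ in $\Omega$, the bounce operator $\mathbf{G}_{A,\Omega}$ is bounded with respect to Dirichlet energy; that is, there is a constant $C$ such that $$D_\Omega(\mathbf{G}_{A,\Omega}h)\le C\,D_A(h)$$ for all $h\in\mathcal{D}_{\mathrm{harm}}(A)$.
   Context: $\overline{\mathbb{C}}$ is the Riemann sphere, $\mathbb{D}^+=\{|z|<1\}$, $\mathbb{S}^1=\{|z|=1\}$; harmonicity at $\infty$ is defined using the coordinate $1/z$. For an open connected $U\subset\overline{\mathbb{C}}$, $D_U(h)=\frac1\pi\iint_{U\setminus\{\infty\}}\left(|\partial h/\partial z|^2+|\partial h/\partial\bar z|^2\right)dA$ and $\mathcal{D}_{\mathrm{harm}}(U)$ is the set of complex-valued harmonic functions on $U$ with $D_U(h)<\infty$. A collar neighbourhood of $\Gamma$ in $\Omega$ is a set $f(\{z: r<|z|<1\})$ with $r\in(0,1)$ and $f:\mathbb{D}^+\to\Omega$ a biholomorphism. Biholomorphisms $f:\mathbb{D}^+\to\Omega$ extend to homeomorphisms of closures. A set $I\subset\Gamma$ is null with respect to $\Omega$ if it is Borel and $f^{-1}(I)$ has logarithmic capacity zero for some (equivalently every) such $f$. A function $h$ defined on $\Omega$ or on a collar neighbourhood has CNT (conformally non-tangential) limit $\zeta$ at $p\in\Gamma$ if, for a biholomorphism $f:\mathbb{D}^+\to\Omega$, $h\circ f$ has non-tangential limit $\zeta$ at $f^{-1}(p)$,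 i.e. for every $M>1$, $h(f(z))\to\zeta$ as $z\to f^{-1}(p)$ within $\{z\in\mathbb{D}^+:|f^{-1}(p)-z|<M(1-|z|)\}$. The bounce operator $\mathbf{G}_{A,\Omega}:\mathcal{D}_{\mathrm{harm}}(A)\to\mathcal{D}_{\mathrm{harm}}(\Omega)$ takes $h$ to the unique $H\in\mathcal{D}_{\mathrm{harm}}(\Omega)$ whose CNT boundary values on $\Gamma$ agree with those of $h$ except possibly on a set null with respect to $\Omega$ (such $H$ exists and is unique). *)

theory Defs
  imports "HOL-Complex_Analysis.Complex_Analysis" "HOL-Probability.Probability"
begin

section \<open>The Riemann sphere\<close>

text \<open>
  The Riemann sphere is the one-point compactification of the plane; \<^term>\<open>None\<close> is the point
  at infinity. The involution \<open>recip\<close> is \<open>z \<mapsto> 1/z\<close> on the sphere: the coordinate at infinity is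
  \<open>p \<mapsto> the (recip p)\<close>, and its inverse, defined on the whole plane, is \<open>w \<mapsto> recip (Some w)\<close>.
\<close>

type_synonym csphere = "complex option"

definition riemann_sphere :: "csphere topology" where
  "riemann_sphere = Alexandroff_compactification (euclidean :: complex topology)"

definition recip :: "csphere \<Rightarrow> csphere" where
  "recip p = (case p of None \<Rightarrow> Some 0 | Some z \<Rightarrow> if z = 0 then None else Some (1 / z))"

section \<open>Harmonic functions and Dirichlet energy\<close>

definition dx :: "(complex \<Rightarrow> complex) \<Rightarrow> complex \<Rightarrow> complex" where
  "dx h z = frechet_derivative h (at z) 1"

definition dy :: "(complex \<Rightarrow> complex) \<Rightarrow> complex \<Rightarrow> complex" where
  "dy h z = frechet_derivative h (at z) \<i>"

definition C1_on :: "(complex \<Rightarrow> complex) \<Rightarrow> complex set \<Rightarrow> bool" where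
  "C1_on h V \<longleftrightarrow> (\<forall>z\<in>V. h differentiable (at z)) \<and>
     continuous_on V (dx h) \<and> continuous_on V (dy h)"

definition plane_harmonic_on :: "(complex \<Rightarrow> complex) \<Rightarrow> complex set \<Rightarrow> bool" where
  "plane_harmonic_on h V \<longleftrightarrow> C1_on h V \<and> C1_on (dx h) V \<and> C1_on (dy h) V \<and>
     (\<forall>z\<in>V. dx (dx h) z + dy (dy h) z = 0)"

text \<open>
  Harmonicity on an open subset of the sphere is required in both coordinates. On the overlap of
  the two charts the conditions agree, so the second one only adds harmonicity at infinity.
\<close>

definition harmonic_on :: "(csphere \<Rightarrow> complex) \<Rightarrow> csphere set \<Rightarrow> bool" where
  "harmonic_on h U \<longleftrightarrow>
     plane_harmonic_on (\<lambda>z. h (Some z)) {z. Some z \<in> U} \<and>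
     plane_harmonic_on (\<lambda>w. h (recip (Some w))) {w. recip (Some w) \<in> U}"

text \<open>The Wirtinger derivatives \<open>\<partial>h/\<partial>z\<close> and \<open>\<partial>h/\<partial>\<close>(conjugate of \<open>z\<close>).\<close>

definition d_z :: "(complex \<Rightarrow> complex) \<Rightarrow> complex \<Rightarrow> complex" where
  "d_z h z = (dx h z - \<i> * dy h z) / 2"

definition d_zbar :: "(complex \<Rightarrow> complex) \<Rightarrow> complex \<Rightarrow> complex" where
  "d_zbar h z = (dx h z + \<i> * dy h z) / 2"

definition dirichlet_energy :: "csphere set \<Rightarrow> (csphere \<Rightarrow> complex) \<Rightarrow> ennreal" where
  "dirichlet_energy U h = ennreal (1 / pi) *
     (\<integral>\<^sup>+ z \<in> {z. Some z \<in> U}.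
        ennreal ((cmod (d_z (\<lambda>z. h (Some z)) z))\<^sup>2 +
                 (cmod (d_zbar (\<lambda>z. h (Some z)) z))\<^sup>2) \<partial>lborel)"

definition D_harm :: "csphere set \<Rightarrow> (csphere \<Rightarrow> complex) set" where
  "D_harm U = {h. harmonic_on h U \<and> dirichlet_energy U h < \<infinity>}"

section \<open>Jordan domains, biholomorphisms and collar neighbourhoods\<close>

definition jordan_curve :: "csphere set \<Rightarrow> bool" where
  "jordan_curve \<Gamma> \<longleftrightarrow>
     subtopology riemann_sphere \<Gamma> homeomorphic_space top_of_set (sphere (0::complex) 1)"

definition jordan_domain :: "csphere set \<Rightarrow> csphere set \<Rightarrow> bool" where
  "jordan_domain \<Omega> \<Gamma> \<longleftrightarrow> jordan_curve \<Gamma> \<and> openin riemann_sphere \<Omega> \<and>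
     connectedin riemann_sphere \<Omega> \<and> riemann_sphere frontier_of \<Omega> = \<Gamma>"

text \<open>Holomorphy of maps into and out of the sphere, expressed in the two charts.\<close>

definition holomorphic_to_sphere :: "(complex \<Rightarrow> csphere) \<Rightarrow> complex set \<Rightarrow> bool" where
  "holomorphic_to_sphere f V \<longleftrightarrow> continuous_map (top_of_set V) riemann_sphere f \<and>
     (\<lambda>z. the (f z)) holomorphic_on {z \<in> V. f z \<noteq> None} \<and>
     (\<lambda>z. the (recip (f z))) holomorphic_on {z \<in> V. f z \<noteq> Some 0}"

definition holomorphic_from_sphere :: "(csphere \<Rightarrow> complex) \<Rightarrow> csphere set \<Rightarrow> bool" where
  "holomorphic_from_sphere g U \<longleftrightarrow>
     (\<lambda>z. g (Some z)) holomorphic_on {z. Some z \<in> U} \<and>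
     (\<lambda>w. g (recip (Some w))) holomorphic_on {w. recip (Some w) \<in> U}"

definition biholomorphism :: "(complex \<Rightarrow> csphere) \<Rightarrow> csphere set \<Rightarrow> bool" where
  "biholomorphism f \<Omega> \<longleftrightarrow> bij_betw f (ball 0 1) \<Omega> \<and>
     holomorphic_to_sphere f (ball 0 1) \<and>
     holomorphic_from_sphere (inv_into (ball 0 1) f) \<Omega>"

text \<open>
  A biholomorphism from the disc onto a Jordan domain, together with its homeomorphic extension
  to the closures. By Caratheodory's theorem every biholomorphism has exactly one such extension,
  so the values on the closed disc carry no additional choice.
\<close>

definition extended_biholomorphism :: "(complex \<Rightarrow> csphere) \<Rightarrow> csphere set \<Rightarrow> bool" where
  "extended_biholomorphism f \<Omega> \<longleftrightarrow> biholomorphism f \<Omega> \<and>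
     homeomorphic_map (top_of_set (cball 0 1))
       (subtopology riemann_sphere (riemann_sphere closure_of \<Omega>)) f"

definition collar_nbhd :: "csphere set \<Rightarrow> csphere set \<Rightarrow> bool" where
  "collar_nbhd A \<Omega> \<longleftrightarrow> (\<exists>f r. biholomorphism f \<Omega> \<and> 0 < r \<and> r < 1 \<and>
     A = f ` {z. r < cmod z \<and> cmod z < 1})"

section \<open>Logarithmic capacity and null sets\<close>

text \<open>
  The energy of \<open>\<mu>\<close> is the double integral of \<open>ln |z - w|\<close>, with value \<open>-\<infinity>\<close> of the integrand on
  the diagonal, split into positive and negative part (\<^const>\<open>ennreal\<close> truncates negative reals
  to 0, and \<^term>\<open>ln (0::real) = 0\<close>). The positive part is finite for compactly supported \<open>\<mu>\<close>.
\<close>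

definition log_energy :: "complex measure \<Rightarrow> ereal" where
  "log_energy \<mu> =
     enn2ereal (\<integral>\<^sup>+ z. \<integral>\<^sup>+ w. ennreal (ln (cmod (z - w))) \<partial>\<mu> \<partial>\<mu>) -
     enn2ereal (\<integral>\<^sup>+ z. \<integral>\<^sup>+ w. (if z = w then \<infinity> else ennreal (- ln (cmod (z - w)))) \<partial>\<mu> \<partial>\<mu>)"

text \<open>
  The capacity of \<open>E\<close> is the supremum of \<open>exp (log_energy \<mu>)\<close> over the Borel probability measures
  \<open>\<mu>\<close> with compact support in \<open>E\<close>.
\<close>

definition log_capacity :: "complex set \<Rightarrow> ennreal" where
  "log_capacity E =
     (SUP \<mu> \<in> {\<mu>. prob_space \<mu> \<and> sets \<mu> = sets borel \<and>
                   (\<exists>K. compact K \<and> K \<subseteq> E \<and> emeasure \<mu> K = 1)}.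
        if log_energy \<mu> = - \<infinity> then 0 else ennreal (exp (real_of_ereal (log_energy \<mu>))))"

definition null_wrt :: "csphere set \<Rightarrow> csphere set \<Rightarrow> bool" where
  "null_wrt \<Omega> I \<longleftrightarrow> I \<subseteq> riemann_sphere frontier_of \<Omega> \<and>
     I \<in> sigma_sets UNIV {U. openin riemann_sphere U} \<and>
     (\<exists>f. extended_biholomorphism f \<Omega> \<and> log_capacity {q \<in> sphere 0 1. f q \<in> I} = 0)"

section \<open>Conformally non-tangential limits and the bounce operator\<close>

definition nontangential_limit :: "(complex \<Rightarrow> complex) \<Rightarrow> complex \<Rightarrow> complex \<Rightarrow> bool" where
  "nontangential_limit u q \<zeta> \<longleftrightarrow> (\<forall>M>1.
     (u \<longlongrightarrow> \<zeta>) (at q within {z \<in> ball 0 1. cmod (q - z) < M * (1 - cmod z)}))"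

text \<open>
  Only the values of \<open>h\<close> near the boundary matter, so \<open>h\<close> need only be meaningful on a collar
  neighbourhood.
\<close>

definition has_CNT_limit :: "csphere set \<Rightarrow> (csphere \<Rightarrow> complex) \<Rightarrow> csphere \<Rightarrow> complex \<Rightarrow> bool" where
  "has_CNT_limit \<Omega> h p \<zeta> \<longleftrightarrow> (\<exists>f q. extended_biholomorphism f \<Omega> \<and> q \<in> sphere 0 1 \<and> f q = p \<and>
     nontangential_limit (h \<circ> f) q \<zeta>)"

definition CNT_agree :: "csphere set \<Rightarrow> (csphere \<Rightarrow> complex) \<Rightarrow> (csphere \<Rightarrow> complex) \<Rightarrow> bool" where
  "CNT_agree \<Omega> h H \<longleftrightarrow> (\<exists>I. null_wrt \<Omega> I \<and>
     (\<forall>p \<in> riemann_sphere frontier_of \<Omega> - I. \<exists>\<zeta>. has_CNT_limit \<Omega> h p \<zeta> \<and> has_CNT_limit \<Omega> H p \<zeta>))"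

text \<open>
  Functions on \<open>\<Omega>\<close> are total functions here; requiring the value \<^term>\<open>undefined\<close> outside \<open>\<Omega>\<close> is
  what makes \<open>H\<close> unique.
\<close>

definition bounce ::
    "csphere set \<Rightarrow> csphere set \<Rightarrow> (csphere \<Rightarrow> complex) \<Rightarrow> csphere \<Rightarrow> complex" where
  "bounce A \<Omega> = (\<lambda>h \<in> D_harm A. THE H. H \<in> D_harm \<Omega> \<inter> extensional \<Omega> \<and> CNT_agree \<Omega> h H)"

end

theory Submission imports Defs begin

text \<open>
  By Caratheodory's theorem the parametrization \<open>f\<close> of the collar extends to the closed disc, so
  everything takes place in the disc with an annulus \<open>r < |z| < 1\<close> in place of the collar. Laurent
  splitting of the derivatives of a harmonic function \<open>u\<close> of finite energy on the annulus gives
  \<open>u(z) = \<Phi>(z) - X(1/z) + cnj (\<Psi>(z) - Y(1/z)) + 2\<kappa> ln |z| + c\<close> near the circle, where \<open>\<Phi>\<close>, \<open>\<Psi>\<close> are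
  holomorphic in the disc and \<open>X\<close>, \<open>Y\<close> beyond it. Replacing \<open>1/z\<close> by the reflected point \<open>cnj z\<close> and
  dropping the logarithm changes \<open>u\<close> by a function that tends to 0 at the circle and produces a
  harmonic function \<open>U\<close> on the whole disc, whose energy is bounded by that of \<open>u\<close> through Cauchy
  estimates on a middle circle.

  It remains to identify \<open>U\<close> with the bounce of \<open>u\<close>. By Beurling's argument \<open>U\<close> has a non-tangential
  limit at \<open>q\<close> whenever the Riesz potential of \<open>|\<nabla>U|\<close> is finite at \<open>q\<close>, and for a square integrable
  density this potential is infinite only on a set of capacity zero. Hence \<open>u\<close> and \<open>U\<close> have equal
  limits off a null set. Uniqueness follows because sets of capacity zero have length zero and the
  mean value property passes to the radial limits by dominated convergence; applied after a disc
  automorphism, it recovers the value of a harmonic function of finite energy at every point.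
\<close>

subsection \<open>Conformal change of variables\<close>

text \<open>Non-tangential limits and null sets are defined through some extended parametrization,
  while a collar comes from a biholomorphism of the open disc alone. Two facts about
  parametrizations bridge this: each extends to the closed disc, and any two differ by a disc
  automorphism, under which Stolz regions and the logarithmic kernel stay under control. Extension
  is a length-area argument: finite area bounds the energy of the map in logarithmic coordinates at
  a boundary point, so some small circle there has an image of small diameter, and planar separation
  confines what that image cuts off. A Moebius map first makes the domain bounded. The obstacle to
  splitting \<open>u\<close> itself is its residue, which has no single-valued primitive; so the
  derivatives are split and integrated term by term. Their principal parts are Cauchy integrals over
  a smaller circle, hence holomorphic across the unit circle, which is what permits reflection.
  Constants come from crude estimates; what matters is that they do not depend on \<open>h\<close>.
  Polar coordinates are treated as a conformal map given by an exponential, so that the conformal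
  change of variables applies to them.\<close>

definition plane_of :: "real^2 \<Rightarrow> complex" where "plane_of v = Complex (v $ 1) (v $ 2)"
definition vec_of :: "complex \<Rightarrow> real^2" where "vec_of z = vector [Re z, Im z]"

lemma plane_vec [simp]: "plane_of (vec_of z) = z"
  by (simp add: plane_of_def vec_of_def)

lemma vec_plane [simp]: "vec_of (plane_of v) = v"
  by (simp add: plane_of_def vec_of_def vec_eq_iff forall_2)

lemma bounded_linear_plane_of: "bounded_linear plane_of"
  by (intro linear_conv_bounded_linear[THEN iffD1] linearI) (auto simp: plane_of_def complex_eq_iff)

lemma bounded_linear_vec_of: "bounded_linear vec_of"
  by (intro linear_conv_bounded_linear[THEN iffD1] linearI) (auto simp: vec_of_def vec_eq_iff forall_2)

lemma plane_of_borel [measurable]: "plane_of \<in> borel_measurable borel"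
  by (intro borel_measurable_continuous_onI linear_continuous_on bounded_linear_plane_of)

lemma vec_of_borel [measurable]: "vec_of \<in> borel_measurable borel"
  by (intro borel_measurable_continuous_onI linear_continuous_on bounded_linear_vec_of)

text \<open>Lebesgue measure is determined by its values on open boxes, and an open box pulls back
  to a box with the same sides. This moves areas between the plane and \<open>real^2\<close>, where
  the Jacobian formula is stated.\<close>

lemma distr_plane_of: "distr lborel borel plane_of = lborel"
proof (rule lborel_eqI[symmetric])
  fix l u :: complex
  assume le: "\<And>b. b \<in> Basis \<Longrightarrow> l \<bullet> b \<le> u \<bullet> b"
  have le': "Re l \<le> Re u" "Im l \<le> Im u"
    using le[of 1] le[of \<i>] by (auto simp: Basis_complex_def)
  have B: "(Basis :: (real^2) set) = {axis 1 1, axis 2 1}"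
    by (auto simp: Basis_vec_def) (metis exhaust_2)+
  have "plane_of -` box l u = box (vec_of l) (vec_of u)"
    by (auto simp: plane_of_def vec_of_def mem_box_cart forall_2 mem_box Basis_complex_def)
  then have "emeasure (distr lborel borel plane_of) (box l u) = emeasure lborel (box (vec_of l) (vec_of u))"
    by (subst emeasure_distr) auto
  also have "\<dots> = (\<Prod>b\<in>Basis. (vec_of u - vec_of l) \<bullet> b)"
    using le' by (subst emeasure_lborel_box)
       (auto simp: vec_of_def B inner_axis)
  also have "\<dots> = (\<Prod>b\<in>Basis. (u - l) \<bullet> b)"
  proof -
    have "axis 1 1 \<noteq> (axis 2 1 :: real^2)" by (simp add: axis_eq_axis)
    then show ?thesis unfolding B Basis_complex_def
      by (simp add: inner_axis vec_of_def)
  qed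
  finally show "emeasure (distr lborel borel plane_of) (box l u) = (\<Prod>b\<in>Basis. (u - l) \<bullet> b)" .
qed simp

lemma distr_Complex: "distr (lborel \<Otimes>\<^sub>M lborel) borel (\<lambda>(x, y). Complex x y) = lborel"
proof (rule lborel_eqI[symmetric])
  have [measurable]: "(\<lambda>(x, y). Complex x y) \<in> borel_measurable (borel \<Otimes>\<^sub>M borel)"
    unfolding Complex_eq by measurable
  fix l u :: complex
  assume le: "\<And>b. b \<in> Basis \<Longrightarrow> l \<bullet> b \<le> u \<bullet> b"
  have le': "Re l \<le> Re u" "Im l \<le> Im u"
    using le[of 1] le[of \<i>] by (auto simp: Basis_complex_def)
  have "(\<lambda>(x, y). Complex x y) -` box l u = {Re l<..<Re u} \<times> {Im l<..<Im u}"
    by (auto simp: box_def Basis_complex_def)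
  then have "emeasure (distr (lborel \<Otimes>\<^sub>M lborel) borel (\<lambda>(x, y). Complex x y)) (box l u)
     = emeasure (lborel \<Otimes>\<^sub>M lborel) ({Re l<..<Re u} \<times> {Im l<..<Im u})"
    by (subst emeasure_distr) (auto simp: space_pair_measure)
  also have "\<dots> = ennreal ((Re u - Re l) * (Im u - Im l))"
    using le' by (subst lborel.emeasure_pair_measure_Times) (auto simp: ennreal_mult)
  finally show "emeasure (distr (lborel \<Otimes>\<^sub>M lborel) borel (\<lambda>(x, y). Complex x y)) (box l u) = (\<Prod>b\<in>Basis. (u - l) \<bullet> b)"
    by (simp add: Basis_complex_def)
qed simp

lemma nn_integral_complex_iterated:
  fixes F :: "complex \<Rightarrow> ennreal"
  assumes [measurable]: "F \<in> borel_measurable borel"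
  shows "(\<integral>\<^sup>+ z. F z \<partial>lborel) = (\<integral>\<^sup>+ x. \<integral>\<^sup>+ y. F (Complex x y) \<partial>lborel \<partial>lborel)"
proof -
  have [measurable]: "(\<lambda>(x, y). Complex x y) \<in> borel_measurable (borel \<Otimes>\<^sub>M borel)"
    unfolding Complex_eq by measurable
  have "(\<integral>\<^sup>+ z. F z \<partial>lborel) = (\<integral>\<^sup>+ p. F (case p of (x, y) \<Rightarrow> Complex x y) \<partial>(lborel \<Otimes>\<^sub>M lborel))"
    by (subst distr_Complex[symmetric], subst nn_integral_distr) (auto simp: distr_Complex)
  also have "\<dots> = (\<integral>\<^sup>+ x. \<integral>\<^sup>+ y. F (Complex x y) \<partial>lborel \<partial>lborel)"
    by (subst lborel.nn_integral_fst[symmetric]) auto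
  finally show ?thesis .
qed

text \<open>The real Jacobian formula, with the determinant of a complex derivative
  computed.\<close>

lemma emeasure_conformal_image:
  assumes hol: "g holomorphic_on S" and S: "open S" and inj: "inj_on g S"
    and B: "B \<subseteq> S" "B \<in> sets borel" and gB: "g ` B \<in> sets borel"
  shows "emeasure lborel (g ` B) = (\<integral>\<^sup>+ z\<in>B. ennreal ((cmod (deriv g z))\<^sup>2) \<partial>lborel)"
proof -
  define h where "h = vec_of \<circ> g \<circ> plane_of"
  define h' where "h' v = vec_of \<circ> (\<lambda>w. deriv g (plane_of v) * w) \<circ> plane_of" for v
  let ?B = "vec_of ` B"
  have vB: "vec_of ` X = plane_of -` X" for X
    by (auto simp: image_iff) (metis vec_plane)
  have mB: "?B \<in> sets borel" unfolding vB using measurable_sets[OF plane_of_borel B(2)] by simp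
  have mgB: "vec_of ` g ` B \<in> sets borel" unfolding vB using measurable_sets[OF plane_of_borel gB] by simp
  have em: "emeasure lborel X = emeasure lborel (vec_of ` X)" if "X \<in> sets borel" for X
    unfolding vB using that by (subst distr_plane_of[symmetric], subst emeasure_distr) auto
  have hB: "h ` ?B = vec_of ` g ` B" by (auto simp: h_def image_iff)
  have der: "(h has_derivative h' v) (at v within ?B)" if "v \<in> ?B" for v
  proof -
    have "plane_of v \<in> S" using that B by auto
    then have "(g has_field_derivative deriv g (plane_of v)) (at (plane_of v))"
      using hol S holomorphic_derivI by blast
    then have 1: "(g has_derivative (\<lambda>w. deriv g (plane_of v) * w)) (at (plane_of v))"
      by (simp add: has_field_derivative_def)
    have 2: "(plane_of has_derivative plane_of) (at v)" "(vec_of has_derivative vec_of) (at (g (plane_of v)))"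
      by (auto intro: bounded_linear_imp_has_derivative bounded_linear_plane_of bounded_linear_vec_of)
    show ?thesis unfolding h_def h'_def
      by (rule has_derivative_at_withinI) (intro diff_chain_at 1 2; simp add: 1 2)
  qed
  have inj': "inj_on h ?B"
    using inj B(1) unfolding h_def inj_on_def by (auto) (metis plane_vec subsetD)
  \<comment> \<open>Multiplication by \<open>a + b * \<i>\<close> is a real matrix of determinant
    \<open>a^2 + b^2\<close>.\<close>
  have det: "\<bar>det (matrix (h' v))\<bar> = (cmod (deriv g (plane_of v)))\<^sup>2" for v
    by (simp add: h'_def matrix_def det_2 plane_of_def vec_of_def axis_def flip: power2_eq_square)
       (simp add: cmod_power2 flip: power2_eq_square)
  \<comment> \<open>This equivalence speaks of finite measures only; hence the case distinction
    below, where an infinite integral is shown to exclude an image of finite area.\<close>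
  have key: "h ` ?B \<in> lmeasurable \<and> measure lebesgue (h ` ?B) = m
       \<longleftrightarrow> ((\<lambda>x. \<bar>det (matrix (h' x))\<bar>) has_integral m) ?B" for m
    by (rule has_measure_differentiable_image) (use mB der inj' in auto)
  have dm: "(\<lambda>v. indicator ?B v *\<^sub>R (cmod (deriv g (plane_of v)))\<^sup>2) \<in> borel_measurable borel"
  proof -
    have "deriv g holomorphic_on S" using hol S by (rule holomorphic_deriv)
    then have "continuous_on B (deriv g)" using B holomorphic_on_imp_continuous_on continuous_on_subset by blast
    then have "continuous_on ?B (\<lambda>v. deriv g (plane_of v))"
      by (rule continuous_on_compose2[OF _ linear_continuous_on[OF bounded_linear_plane_of]]) auto
    then show ?thesis
      by (intro borel_measurable_continuous_on_indicator mB continuous_intros) 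
  qed
  have nn: "(\<integral>\<^sup>+ z\<in>B. ennreal ((cmod (deriv g z))\<^sup>2) \<partial>lborel)
     = (\<integral>\<^sup>+ v. ennreal (indicator ?B v *\<^sub>R (cmod (deriv g (plane_of v)))\<^sup>2) \<partial>lborel)"
  proof -
    have [measurable]: "(\<lambda>z. ennreal ((cmod (deriv g z))\<^sup>2) * indicator B z) \<in> borel_measurable borel"
    proof -
      have "(\<lambda>z. indicator ?B (vec_of z) *\<^sub>R (cmod (deriv g (plane_of (vec_of z))))\<^sup>2) \<in> borel_measurable borel"
        using measurable_compose[OF vec_of_borel dm] by simp
      then have "(\<lambda>z. ennreal (indicator ?B (vec_of z) *\<^sub>R (cmod (deriv g (plane_of (vec_of z))))\<^sup>2)) \<in> borel_measurable borel"
        by measurable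
      moreover have "ennreal (indicator ?B (vec_of z) *\<^sub>R (cmod (deriv g (plane_of (vec_of z))))\<^sup>2)
         = ennreal ((cmod (deriv g z))\<^sup>2) * indicator B z" for z
        by (cases "z \<in> B") (auto simp: indicator_def image_iff dest: arg_cong[where f = plane_of])
      ultimately show ?thesis by (simp only:)
    qed
    have "(\<integral>\<^sup>+ z\<in>B. ennreal ((cmod (deriv g z))\<^sup>2) \<partial>lborel)
        = (\<integral>\<^sup>+ z\<in>B. ennreal ((cmod (deriv g z))\<^sup>2) \<partial>distr lborel borel plane_of)"
      by (simp only: distr_plane_of)
    also have "\<dots> = (\<integral>\<^sup>+ v. ennreal ((cmod (deriv g (plane_of v)))\<^sup>2) * indicator B (plane_of v) \<partial>lborel)"
      by (rule nn_integral_distr) simp_all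
    also have "\<dots> = (\<integral>\<^sup>+ v. ennreal (indicator ?B v *\<^sub>R (cmod (deriv g (plane_of v)))\<^sup>2) \<partial>lborel)"
      by (rule nn_integral_cong) (auto simp: vB split: split_indicator)
    finally show ?thesis .
  qed
  have ind: "(\<lambda>v. indicator ?B v *\<^sub>R (cmod (deriv g (plane_of v)))\<^sup>2)
      = (\<lambda>v. if v \<in> ?B then (cmod (deriv g (plane_of v)))\<^sup>2 else 0)"
    by (auto simp: indicator_def)
  show ?thesis
  proof (cases "(\<integral>\<^sup>+ z\<in>B. ennreal ((cmod (deriv g z))\<^sup>2) \<partial>lborel) < \<infinity>")
    case True
    then obtain m where m: "0 \<le> m" "(\<integral>\<^sup>+ z\<in>B. ennreal ((cmod (deriv g z))\<^sup>2) \<partial>lborel) = ennreal m"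
      by (cases "\<integral>\<^sup>+ z\<in>B. ennreal ((cmod (deriv g z))\<^sup>2) \<partial>lborel") auto
    have "((\<lambda>v. indicator ?B v *\<^sub>R (cmod (deriv g (plane_of v)))\<^sup>2) has_integral m) UNIV"
      by (rule nn_integral_has_integral) (use m nn dm in auto)
    then have "((\<lambda>v. (cmod (deriv g (plane_of v)))\<^sup>2) has_integral m) ?B"
      unfolding ind has_integral_restrict_UNIV .
    then have "h ` ?B \<in> lmeasurable \<and> measure lebesgue (h ` ?B) = m"
      using key by (simp add: det)
    then have "emeasure lebesgue (h ` ?B) = m"
      by (auto simp: emeasure_eq_measure2 fmeasurableD2)
    then show ?thesis using m mgB em[OF gB] by (simp add: hB)
  next
    case False
    have "emeasure lborel (g ` B) = \<infinity>"
    proof (rule ccontr)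
      assume "emeasure lborel (g ` B) \<noteq> \<infinity>"
      then have "emeasure lebesgue (h ` ?B) < \<infinity>" using mgB em[OF gB] by (simp add: hB top.not_eq_extremum)
      then have "h ` ?B \<in> lmeasurable" using mgB by (auto simp: hB fmeasurable_def)
      then have "((\<lambda>x. \<bar>det (matrix (h' x))\<bar>) has_integral (measure lebesgue (h ` ?B))) ?B"
        using key by blast
      then have "((\<lambda>v. (cmod (deriv g (plane_of v)))\<^sup>2) has_integral measure lebesgue (h ` ?B)) ?B" by (simp add: det)
      then have "((\<lambda>v. indicator ?B v *\<^sub>R (cmod (deriv g (plane_of v)))\<^sup>2) has_integral measure lebesgue (h ` ?B)) UNIV"
        unfolding ind has_integral_restrict_UNIV .
      then have "(\<integral>\<^sup>+ v. ennreal (indicator ?B v *\<^sub>R (cmod (deriv g (plane_of v)))\<^sup>2) \<partial>lborel) = ennreal (measure lebesgue (h ` ?B))"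
        by (intro nn_integral_has_integral_lborel) (use dm in auto)
      then show False using False nn by simp
    qed
    then show ?thesis using False unfolding infinity_ennreal_def less_top[symmetric] by simp
  qed
qed

text \<open>The area formula says that \<open>g\<close> pushes the measure of density
  \<open>|g'|^2\<close> on \<open>S\<close> forward to Lebesgue measure on the image; integrating
  \<open>F\<close> against both sides gives the claim.\<close>

lemma nn_integral_conformal:
  fixes F :: "complex \<Rightarrow> ennreal"
  assumes hol: "g holomorphic_on S" and S: "open S" and inj: "inj_on g S"
    and F: "F \<in> borel_measurable borel"
  shows "(\<integral>\<^sup>+ z\<in>g ` S. F z \<partial>lborel) = (\<integral>\<^sup>+ z\<in>S. F (g z) * ennreal ((cmod (deriv g z))\<^sup>2) \<partial>lborel)"
proof -
  have og: "open (g ` X)" if "open X" "X \<subseteq> S" for X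
    using open_mapping_thm3[of g X] that hol inj by (meson holomorphic_on_subset inj_on_subset)
  have contg: "continuous_on S g" using hol holomorphic_on_imp_continuous_on by blast
  \<comment> \<open>Off \<open>S\<close> any measurable value would do, since the density
    \<open>d\<close> vanishes there.\<close>
  define G where "G z = (if z \<in> S then g z else 0)" for z
  define d where "d z = (if z \<in> S then ennreal ((cmod (deriv g z))\<^sup>2) else 0)" for z
  have mS[measurable]: "S \<in> sets borel" using S by simp
  have mG[measurable]: "G \<in> borel_measurable borel"
    using borel_measurable_continuous_on_if[OF mS contg, of "\<lambda>_. 0"] unfolding G_def by simp
  have md[measurable]: "d \<in> borel_measurable borel"
  proof -
    have "continuous_on S (\<lambda>z. ennreal ((cmod (deriv g z))\<^sup>2))"
      by (intro continuous_on_ennreal continuous_intros holomorphic_on_imp_continuous_on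
          holomorphic_deriv[OF hol S])
    from borel_measurable_continuous_on_if[OF mS this, of "\<lambda>_. 0"]
    show ?thesis unfolding d_def by simp
  qed
  define M where "M = density lborel d"
  have "distr M borel G = density lborel (indicator (g ` S))"
  proof (rule measure_eqI)
    fix X assume "X \<in> sets (distr M borel G)"
    then have X[measurable]: "X \<in> sets borel" by simp
    let ?B = "S \<inter> G -` X"
    have mB[measurable]: "?B \<in> sets borel" using measurable_sets[OF mG X] by auto
    have gB: "g ` ?B = g ` S \<inter> X" by (auto simp: G_def)
    have mgB: "g ` S \<inter> X \<in> sets borel" using og[of S] S by auto
    have "emeasure (distr M borel G) X = emeasure M (G -` X)"
      by (subst emeasure_distr) (auto simp: M_def)
    also have "\<dots> = (\<integral>\<^sup>+ z. d z * indicator (G -` X) z \<partial>lborel)"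
      unfolding M_def using measurable_sets[OF mG X] by (subst emeasure_density) auto
    also have "\<dots> = (\<integral>\<^sup>+ z\<in>?B. ennreal ((cmod (deriv g z))\<^sup>2) \<partial>lborel)"
      by (rule nn_integral_cong) (auto simp: d_def indicator_def)
    also have "\<dots> = emeasure lborel (g ` ?B)"
      by (rule emeasure_conformal_image[symmetric, OF hol S inj]) (auto simp: gB mgB)
    also have "\<dots> = emeasure (density lborel (indicator (g ` S))) X"
    proof -
      have "emeasure (density lborel (indicator (g ` S))) X
          = (\<integral>\<^sup>+ z. indicator (g ` S) z * indicator X z \<partial>lborel)"
        using og[of S] S by (subst emeasure_density) auto
      also have "\<dots> = (\<integral>\<^sup>+ z. indicator (g ` S \<inter> X) z \<partial>lborel)"
        by (rule nn_integral_cong) (auto simp: indicator_def)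
      finally show ?thesis using mgB by (simp add: gB)
    qed
    finally show "emeasure (distr M borel G) X = emeasure (density lborel (indicator (g ` S))) X" .
  qed simp
  then have "(\<integral>\<^sup>+ z. F z \<partial>distr M borel G) = (\<integral>\<^sup>+ z. F z \<partial>density lborel (indicator (g ` S)))" by simp
  moreover have "(\<integral>\<^sup>+ z. F z \<partial>distr M borel G) = (\<integral>\<^sup>+ z\<in>S. F (g z) * ennreal ((cmod (deriv g z))\<^sup>2) \<partial>lborel)"
  proof -
    have "(\<integral>\<^sup>+ z. F z \<partial>distr M borel G) = (\<integral>\<^sup>+ z. d z * F (G z) \<partial>lborel)"
      using F unfolding M_def by (subst nn_integral_distr) (auto simp: nn_integral_density)
    also have "\<dots> = (\<integral>\<^sup>+ z\<in>S. F (g z) * ennreal ((cmod (deriv g z))\<^sup>2) \<partial>lborel)"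
      by (rule nn_integral_cong) (auto simp: d_def G_def mult.commute)
    finally show ?thesis .
  qed
  moreover have "(\<integral>\<^sup>+ z. F z \<partial>density lborel (indicator (g ` S))) = (\<integral>\<^sup>+ z\<in>g ` S. F z \<partial>lborel)"
    using F og[of S] S by (subst nn_integral_density) (auto simp: mult.commute)
  ultimately show ?thesis by simp
qed

subsection \<open>Harmonic functions as holomorphic plus antiholomorphic\<close>

lemma frechet_derivative_components:
  fixes h :: "complex \<Rightarrow> complex"
  assumes "h differentiable (at z)"
  shows "frechet_derivative h (at z) v = of_real (Re v) * dx h z + of_real (Im v) * dy h z"
proof -
  have lin: "linear (frechet_derivative h (at z))"
    using assms frechet_derivative_works has_derivative_linear by blast
  have "v = Re v *\<^sub>R 1 + Im v *\<^sub>R \<i>" by (simp add: complex_eq_iff)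
  then have "frechet_derivative h (at z) v = Re v *\<^sub>R dx h z + Im v *\<^sub>R dy h z"
    unfolding dx_def dy_def using linear_add[OF lin] linear_scale[OF lin] by metis
  then show ?thesis by (simp add: scaleR_conv_of_real)
qed

section \<open>Symmetry of mixed partial derivatives\<close>

lemma mean_value_affine:
  fixes g :: "real \<Rightarrow> complex"
  assumes "0 \<le> t" "0 \<le> B" and der: "\<And>s. s \<in> {0..t} \<Longrightarrow> (g has_vector_derivative g' s) (at s within {0..t})"
    and bd: "\<And>s. s \<in> {0..t} \<Longrightarrow> norm (g' s - c) \<le> B"
  shows "norm (g t - g 0 - t *\<^sub>R c) \<le> t * B"
proof -
  have "(g' has_integral (g t - g 0)) {0..t}"
    by (rule fundamental_theorem_of_calculus) (use assms in auto)
  moreover have "((\<lambda>s. c) has_integral (t *\<^sub>R c)) {0..t}"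
    using has_integral_const_real[of c 0 t] assms(1) by simp
  ultimately have "((\<lambda>s. g' s - c) has_integral (g t - g 0 - t *\<^sub>R c)) {0..t}"
    by (rule has_integral_diff)
  from has_integral_bound_real[OF assms(2) _ this, of "{}"] bd assms(1)
  show ?thesis by (simp add: mult.commute)
qed

lemma line_has_vector_derivative:
  fixes h :: "complex \<Rightarrow> complex"
  assumes "h differentiable (at (p + of_real s * u))"
  shows "((\<lambda>s. h (p + of_real s * u)) has_vector_derivative
            frechet_derivative h (at (p + of_real s * u)) u) (at s within S)"
proof -
  have "((\<lambda>s. p + of_real s * u) has_vector_derivative u) (at s within S)"
    by (auto intro!: derivative_eq_intros simp: has_vector_derivative_def scaleR_conv_of_real)
  from vector_derivative_diff_chain_within[OF this has_derivative_at_withinI[OF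
      assms[unfolded frechet_derivative_works]]]
  show ?thesis by (simp add: o_def)
qed

text \<open>Two mean value estimates, first along \<open>v\<close> for the derivative in direction
  \<open>u\<close>, then along \<open>u\<close>. The second difference is symmetric in
  \<open>u\<close> and \<open>v\<close> while the derivative is not visibly so, which is the point
  of the lemma.\<close>

lemma second_difference_bound:
  fixes h :: "complex \<Rightarrow> complex"
  defines "D \<equiv> \<lambda>u h z. frechet_derivative h (at z) u"
  assumes uv: "norm u \<le> 1" "norm v \<le> 1" and e: "0 < e"
    and h: "\<And>w. w \<in> ball p e \<Longrightarrow> h differentiable (at w)"
    and h': "\<And>w. w \<in> ball p e \<Longrightarrow> D u h differentiable (at w)"
    and cont: "isCont (D v (D u h)) p" and "0 < \<epsilon>"
  shows "\<exists>\<delta>>0. \<forall>t\<in>{0<..<\<delta>}. norm (h (p + of_real t * u + of_real t * v) - h (p + of_real t * u)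
      - h (p + of_real t * v) + h p - of_real (t * t) * D v (D u h) p) \<le> t * t * \<epsilon>"
proof -
  obtain d where d: "d > 0" "\<And>w. dist w p < d \<Longrightarrow> dist (D v (D u h) w) (D v (D u h) p) < \<epsilon>"
    using cont \<open>0 < \<epsilon>\<close> unfolding continuous_at_eps_delta by metis
  show ?thesis
  \<comment> \<open>Two sides of length at most \<open>t\<close> reach at most \<open>2 * t\<close>
    away from \<open>p\<close>, which stays below both \<open>d\<close> and
    \<open>e\<close>.\<close>
  proof (intro exI[of _ "min d e / 2"] conjI ballI)
    show "min d e / 2 > 0" using d e by auto
  next
    fix t :: real assume t: "t \<in> {0<..<min d e / 2}"
    have near: "norm (of_real a * u + of_real b * v) < min d e" if "a \<in> {0..t}" "b \<in> {0..t}" for a b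
    proof -
      have "norm (of_real a * u + of_real b * v) \<le> a * norm u + b * norm v"
        using norm_triangle_ineq[of "of_real a * u" "of_real b * v"] that by (simp add: norm_mult)
      also have "\<dots> \<le> t * 1 + t * 1" by (intro add_mono mult_mono) (use uv that in auto)
      finally show ?thesis using t by auto
    qed
    have nb: "p + of_real a * u + of_real b * v \<in> ball p e" if "a \<in> {0..t}" "b \<in> {0..t}" for a b
      using near[OF that] by (simp add: dist_norm norm_minus_commute algebra_simps)
    define A where "A = D v (D u h) p"
    have inner: "norm (D u h (p + of_real s * u + of_real t * v) - D u h (p + of_real s * u) - t *\<^sub>R A) \<le> t * \<epsilon>"
      if s: "s \<in> {0..t}" for s
    proof -
      have "norm ((\<lambda>b. D u h (p + of_real s * u + of_real b * v)) t - (\<lambda>b. D u h (p + of_real s * u + of_real b * v)) 0 - t *\<^sub>R A) \<le> t * \<epsilon>"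
      proof (rule mean_value_affine)
        fix b assume b: "b \<in> {0..t}"
        show "((\<lambda>b. D u h (p + of_real s * u + of_real b * v)) has_vector_derivative
            D v (D u h) (p + of_real s * u + of_real b * v)) (at b within {0..t})"
          unfolding D_def by (rule line_has_vector_derivative) (use h'[OF nb[OF s b]] in \<open>simp add: D_def\<close>)
        have "dist (p + of_real s * u + of_real b * v) p < d"
          using near[OF s b] by (simp add: dist_norm algebra_simps)
        from d(2)[OF this] show "norm (D v (D u h) (p + of_real s * u + of_real b * v) - A) \<le> \<epsilon>"
          by (simp add: dist_norm A_def)
      qed (use t \<open>0 < \<epsilon>\<close> in auto)
      then show ?thesis by simp
    qed
    \<comment> \<open>The difference of \<open>h\<close> across two opposite sides, as a function of
      \<open>s\<close>; \<open>inner\<close> has just estimated its derivative.\<close>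
    have "norm ((\<lambda>s. h (p + of_real t * v + of_real s * u) - h (p + of_real s * u)) t - (\<lambda>s. h (p + of_real t * v + of_real s * u) - h (p + of_real s * u)) 0 - t *\<^sub>R (t *\<^sub>R A)) \<le> t * (t * \<epsilon>)"
    proof (rule mean_value_affine)
      fix s assume s: "s \<in> {0..t}"
      have "p + of_real t * v + of_real s * u \<in> ball p e" using nb[OF s, of t] t by (simp add: algebra_simps)
      moreover have "p + of_real s * u \<in> ball p e" using nb[OF s, of 0] t by simp
      ultimately show "((\<lambda>s. h (p + of_real t * v + of_real s * u) - h (p + of_real s * u)) has_vector_derivative
           D u h (p + of_real t * v + of_real s * u) - D u h (p + of_real s * u)) (at s within {0..t})"
        unfolding D_def by (intro has_vector_derivative_diff line_has_vector_derivative h)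
      show "norm (D u h (p + of_real t * v + of_real s * u) - D u h (p + of_real s * u) - t *\<^sub>R A) \<le> t * \<epsilon>"
        using inner[OF s] by (simp add: add.assoc add.left_commute add.commute)
    qed (use t \<open>0 < \<epsilon>\<close> in auto)
    then show "norm (h (p + of_real t * u + of_real t * v) - h (p + of_real t * u)
      - h (p + of_real t * v) + h p - of_real (t * t) * D v (D u h) p) \<le> t * t * \<epsilon>"
      by (simp add: A_def scaleR_conv_of_real algebra_simps)
  qed
qed

text \<open>Both mixed derivatives are limits of one second difference, taken with the directions
  \<open>1\<close> and \<open>\<i>\<close> in either order.\<close>

lemma dx_dy_commute:
  assumes "open V" "p \<in> V" "C1_on h V" "C1_on (dx h) V" "C1_on (dy h) V"
  shows "dx (dy h) p = dy (dx h) p"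
proof (rule ccontr)
  assume ne: "dx (dy h) p \<noteq> dy (dx h) p"
  \<comment> \<open>Two errors of size \<open>\<epsilon>\<close> cannot fill a gap of
    \<open>4 * \<epsilon>\<close>.\<close>
  define \<epsilon> where "\<epsilon> = norm (dx (dy h) p - dy (dx h) p) / 4"
  have ep: "\<epsilon> > 0" using ne by (simp add: \<epsilon>_def)
  obtain e where e: "e > 0" "ball p e \<subseteq> V" using assms openE by blast
  have cont: "isCont (dx (dy h)) p" "isCont (dy (dx h)) p"
    using assms by (auto simp: C1_on_def continuous_on_eq_continuous_at)
  note eq = dx_def[abs_def] dy_def[abs_def]
  obtain d1 where d1: "d1 > 0" "\<And>t. t \<in> {0<..<d1} \<Longrightarrow> norm (h (p + of_real t * 1 + of_real t * \<i>) - h (p + of_real t * 1)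
      - h (p + of_real t * \<i>) + h p - of_real (t * t) * dy (dx h) p) \<le> t * t * \<epsilon>"
    using second_difference_bound[of 1 \<i> e p h \<epsilon>] ep e assms cont(2) unfolding C1_on_def eq by (auto simp: subset_iff)
  obtain d2 where d2: "d2 > 0" "\<And>t. t \<in> {0<..<d2} \<Longrightarrow> norm (h (p + of_real t * \<i> + of_real t * 1) - h (p + of_real t * \<i>)
      - h (p + of_real t * 1) + h p - of_real (t * t) * dx (dy h) p) \<le> t * t * \<epsilon>"
    using second_difference_bound[of \<i> 1 e p h \<epsilon>] ep e assms cont(1) unfolding C1_on_def eq by (auto simp: subset_iff)
  define t where "t = min d1 d2 / 2"
  have t: "t \<in> {0<..<d1}" "t \<in> {0<..<d2}" using d1(1) d2(1) by (auto simp: t_def)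
  define X where "X = h (p + of_real t * 1 + of_real t * \<i>) - h (p + of_real t * 1) - h (p + of_real t * \<i>) + h p"
  have "norm (X - of_real (t * t) * dy (dx h) p) \<le> t * t * \<epsilon>" using d1(2)[OF t(1)] by (simp add: X_def)
  moreover have "norm (X - of_real (t * t) * dx (dy h) p) \<le> t * t * \<epsilon>"
    using d2(2)[OF t(2)] by (simp add: X_def algebra_simps)
  ultimately have "norm ((X - of_real (t * t) * dy (dx h) p) - (X - of_real (t * t) * dx (dy h) p)) \<le> t * t * \<epsilon> + t * t * \<epsilon>"
    by (meson norm_triangle_ineq4 add_mono order_trans)
  also have "(X - of_real (t * t) * dy (dx h) p) - (X - of_real (t * t) * dx (dy h) p) = of_real (t * t) * (dx (dy h) p - dy (dx h) p)"
    by (simp add: algebra_simps)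
  also have "norm \<dots> = t * t * (4 * \<epsilon>)" using t by (simp add: norm_mult \<epsilon>_def)
  finally have "t * t * \<epsilon> \<le> 0" by (simp add: algebra_simps)
  moreover have "t * t * \<epsilon> > 0" using t ep by simp
  ultimately show False by simp
qed

text \<open>A real linear map that commutes with multiplication by \<open>\<i>\<close> is complex
  linear.\<close>

lemma has_field_derivative_of_complex_linear:
  assumes "(f has_derivative L) (at z)" and "L \<i> = \<i> * L 1"
  shows "(f has_field_derivative L 1) (at (z::complex))"
proof -
  have lin: "linear L" using assms(1) has_derivative_linear by blast
  have "L = (*) (L 1)"
  proof
    fix v :: complex
    have "v = Re v *\<^sub>R 1 + Im v *\<^sub>R \<i>" by (simp add: complex_eq_iff)
    then have "L v = Re v *\<^sub>R L 1 + Im v *\<^sub>R L \<i>"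
      using linear_add[OF lin] linear_scale[OF lin] by metis
    also have "\<dots> = L 1 * v" by (simp add: assms(2) complex_eq_iff)
    finally show "L v = L 1 * v" .
  qed
  then show ?thesis using assms(1) unfolding has_field_derivative_def by metis
qed

text \<open>The Cauchy-Riemann equation for \<open>d_z h\<close> is the Laplace equation together
  with the symmetry of mixed derivatives, and likewise for the conjugate of
  \<open>d_zbar h\<close>.\<close>

lemma plane_harmonic_wirtinger_holomorphic:
  assumes V: "open V" and h: "plane_harmonic_on h V"
  shows "d_z h holomorphic_on V" "(\<lambda>z. cnj (d_zbar h z)) holomorphic_on V"
proof -
  have C: "C1_on h V" "C1_on (dx h) V" "C1_on (dy h) V" and L: "\<And>z. z \<in> V \<Longrightarrow> dx (dx h) z + dy (dy h) z = 0"
    using h by (auto simp: plane_harmonic_on_def)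
  have "(d_z h has_field_derivative (dx (dx h) z - \<i> * dx (dy h) z) / 2) (at z) \<and>
     ((\<lambda>z. cnj (d_zbar h z)) has_field_derivative cnj ((dx (dx h) z + \<i> * dx (dy h) z) / 2)) (at z)" if z: "z \<in> V" for z
  proof
    have x: "(dx h has_derivative frechet_derivative (dx h) (at z)) (at z)"
      and y: "(dy h has_derivative frechet_derivative (dy h) (at z)) (at z)"
      unfolding frechet_derivative_works[symmetric] using C(2,3) z by (simp_all add: C1_on_def)
    have sym: "dx (dy h) z = dy (dx h) z" by (rule dx_dy_commute[OF V z C])
    have yy: "dy (dy h) z = - dx (dx h) z" using L[OF z] by (simp add: eq_neg_iff_add_eq_0 add.commute)
    have "(d_z h has_derivative (\<lambda>v. (frechet_derivative (dx h) (at z) v - \<i> * frechet_derivative (dy h) (at z) v) / 2)) (at z)"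
      unfolding d_z_def[abs_def] 
      by (intro bounded_linear.has_derivative[OF bounded_linear_divide] has_derivative_diff
          bounded_linear.has_derivative[OF bounded_linear_mult_right] x y)
    from has_field_derivative_of_complex_linear[OF this]
    show "(d_z h has_field_derivative (dx (dx h) z - \<i> * dx (dy h) z) / 2) (at z)"
      using sym yy by (simp add: dx_def[symmetric] dy_def[symmetric] algebra_simps)
    have "((\<lambda>z. cnj (d_zbar h z)) has_derivative (\<lambda>v. cnj ((frechet_derivative (dx h) (at z) v + \<i> * frechet_derivative (dy h) (at z) v) / 2))) (at z)"
      unfolding d_zbar_def[abs_def] 
      by (intro bounded_linear.has_derivative[OF bounded_linear_cnj] bounded_linear.has_derivative[OF bounded_linear_divide] has_derivative_add
          bounded_linear.has_derivative[OF bounded_linear_mult_right] x y)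
    from has_field_derivative_of_complex_linear[OF this]
    show "((\<lambda>z. cnj (d_zbar h z)) has_field_derivative cnj ((dx (dx h) z + \<i> * dx (dy h) z) / 2)) (at z)"
      using sym yy by (simp add: dx_def[symmetric] dy_def[symmetric] algebra_simps)
  qed
  then show "d_z h holomorphic_on V" "(\<lambda>z. cnj (d_zbar h z)) holomorphic_on V"
    using V by (meson holomorphic_on_open)+
qed

text \<open>Primitives of the two holomorphic Wirtinger derivatives exist on a convex set, and
  subtracting them from \<open>h\<close> leaves a function of zero derivative.\<close>

lemma plane_harmonic_decompose:
  assumes V: "open V" "convex V" and h: "plane_harmonic_on h V"
  obtains F G where "F holomorphic_on V" "G holomorphic_on V" "\<And>z. z \<in> V \<Longrightarrow> h z = F z + cnj (G z)"
proof (cases "V = {}")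
  case True then show ?thesis using that[of "\<lambda>_. 0" "\<lambda>_. 0"] by auto
next
  case False
  then obtain p where p: "p \<in> V" by auto
  note hol = plane_harmonic_wirtinger_holomorphic[OF V(1) h]
  obtain F where F: "\<And>z. z \<in> V \<Longrightarrow> (F has_field_derivative d_z h z) (at z)"
    using holomorphic_convex_primitive'[OF V(2,1) hol(1)] at_within_open[OF _ V(1)] by metis
  obtain G where G: "\<And>z. z \<in> V \<Longrightarrow> (G has_field_derivative cnj (d_zbar h z)) (at z)"
    using holomorphic_convex_primitive'[OF V(2,1) hol(2)] at_within_open[OF _ V(1)] by metis
  have "((\<lambda>z. h z - F z - cnj (G z)) has_derivative (\<lambda>v. 0)) (at z within V)" if z: "z \<in> V" for z
  proof -
    have d: "h differentiable (at z)" using h z by (auto simp: plane_harmonic_on_def C1_on_def)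
    have "((\<lambda>z. h z - F z - cnj (G z)) has_derivative (\<lambda>v. frechet_derivative h (at z) v - d_z h z * v - cnj (cnj (d_zbar h z) * v))) (at z)"
      by (intro has_derivative_diff bounded_linear.has_derivative[OF bounded_linear_cnj]
           d[unfolded frechet_derivative_works] F[OF z, unfolded has_field_derivative_def] G[OF z, unfolded has_field_derivative_def])
    moreover have "frechet_derivative h (at z) v - d_z h z * v - cnj (cnj (d_zbar h z) * v) = 0" for v
      unfolding frechet_derivative_components[OF d] d_z_def d_zbar_def
      by (simp add: complex_eq_iff field_simps)
    ultimately show ?thesis by (simp add: has_derivative_at_withinI)
  qed
  from has_derivative_zero_constant[OF V(2) this]
  obtain c where c: "\<And>z. z \<in> V \<Longrightarrow> h z - F z - cnj (G z) = c" by blast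
  show ?thesis
  proof (rule that[of "\<lambda>z. F z + c" G])
    show "(\<lambda>z. F z + c) holomorphic_on V" "G holomorphic_on V"
      using F G holomorphic_on_open[OF V(1)] holomorphic_on_add[OF _ holomorphic_on_const]
      by blast+
    show "h z = F z + c + cnj (G z)" if "z \<in> V" for z using c[OF that] by (simp add: algebra_simps)
  qed
qed

lemma hol_antihol_derivatives:
  assumes V: "open V" and F: "F holomorphic_on V" and G: "G holomorphic_on V"
    and h: "\<And>z. z \<in> V \<Longrightarrow> h z = F z + cnj (G z)" and z: "z \<in> V"
  shows "h differentiable (at z)" "dx h z = deriv F z + cnj (deriv G z)"
    "dy h z = \<i> * deriv F z + cnj (\<i> * deriv G z)"
    "d_z h z = deriv F z" "d_zbar h z = cnj (deriv G z)"
proof -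
  have F': "(F has_derivative (*) (deriv F z)) (at z)" and G': "(G has_derivative (*) (deriv G z)) (at z)"
    using holomorphic_derivI[OF F V z] holomorphic_derivI[OF G V z] by (auto simp: has_field_derivative_def)
  have "((\<lambda>z. F z + cnj (G z)) has_derivative (\<lambda>v. deriv F z * v + cnj (deriv G z * v))) (at z)"
    by (intro has_derivative_add bounded_linear.has_derivative[OF bounded_linear_cnj] F' G')
  then have D: "(h has_derivative (\<lambda>v. deriv F z * v + cnj (deriv G z * v))) (at z)"
    by (rule has_derivative_transform_within_open[OF _ V z]) (simp add: h)
  then show "h differentiable (at z)" by (auto simp: differentiable_def)
  have fr: "frechet_derivative h (at z) = (\<lambda>v. deriv F z * v + cnj (deriv G z * v))"
    using frechet_derivative_at[OF D] by simp
  show x: "dx h z = deriv F z + cnj (deriv G z)" and y: "dy h z = \<i> * deriv F z + cnj (\<i> * deriv G z)"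
    by (simp_all add: dx_def dy_def fr)
  show "d_z h z = deriv F z" "d_zbar h z = cnj (deriv G z)"
    unfolding d_z_def d_zbar_def x y by (simp_all add: complex_eq_iff)
qed

lemma C1_on_hol_antihol:
  assumes V: "open V" and F: "F holomorphic_on V" and G: "G holomorphic_on V"
    and h: "\<And>z. z \<in> V \<Longrightarrow> h z = F z + cnj (G z)"
  shows "C1_on h V"
proof -
  note D = hol_antihol_derivatives[OF V F G h]
  have c: "continuous_on V (deriv F)" "continuous_on V (deriv G)"
    using F G V holomorphic_deriv holomorphic_on_imp_continuous_on by blast+
  have "continuous_on V (dx h) \<longleftrightarrow> continuous_on V (\<lambda>z. deriv F z + cnj (deriv G z))"
    by (rule continuous_on_cong) (use D in auto)
  moreover have "continuous_on V (dy h) \<longleftrightarrow> continuous_on V (\<lambda>z. \<i> * deriv F z + cnj (\<i> * deriv G z))"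
    by (rule continuous_on_cong) (use D in auto)
  ultimately show ?thesis using D(1) c by (auto simp: C1_on_def intro!: continuous_intros)
qed

text \<open>The partial derivatives of such a sum are again holomorphic plus antiholomorphic, so the
  first-order lemma can be applied once more to them.\<close>

lemma plane_harmonic_hol_antihol:
  assumes V: "open V" and F: "F holomorphic_on V" and G: "G holomorphic_on V"
    and h: "\<And>z. z \<in> V \<Longrightarrow> h z = F z + cnj (G z)"
  shows "plane_harmonic_on h V"
proof -
  note D = hol_antihol_derivatives[OF V F G h]
  note F' = holomorphic_deriv[OF F V] and G' = holomorphic_deriv[OF G V]
  have iF: "(\<lambda>z. \<i> * deriv F z) holomorphic_on V" "(\<lambda>z. \<i> * deriv G z) holomorphic_on V"
    using F' G' by (auto intro!: holomorphic_intros)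
  have "C1_on (dx h) V" by (rule C1_on_hol_antihol[OF V F' G']) (use D in auto)
  moreover have "C1_on (dy h) V" by (rule C1_on_hol_antihol[OF V iF]) (use D in auto)
  moreover have "dx (dx h) z + dy (dy h) z = 0" if z: "z \<in> V" for z
  proof -
    have "dx (dx h) z = deriv (deriv F) z + cnj (deriv (deriv G) z)"
      by (rule hol_antihol_derivatives(2)[OF V F' G' _ z]) (use D in auto)
    moreover have "dy (dy h) z = \<i> * deriv (\<lambda>z. \<i> * deriv F z) z + cnj (\<i> * deriv (\<lambda>z. \<i> * deriv G z) z)"
      by (rule hol_antihol_derivatives(3)[OF V iF _ z]) (use D in auto)
    moreover have "deriv (\<lambda>z. \<i> * deriv F z) z = \<i> * deriv (deriv F) z"
        "deriv (\<lambda>z. \<i> * deriv G z) z = \<i> * deriv (deriv G) z"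
      using F' G' V z by (auto intro!: deriv_cmult simp: holomorphic_on_imp_differentiable_at)
    ultimately show ?thesis by (simp add: complex_eq_iff)
  qed
  ultimately show ?thesis using C1_on_hol_antihol[OF V F G h] by (auto simp: plane_harmonic_on_def)
qed

section \<open>Locality, and composition with holomorphic maps\<close>

lemma C1_on_subset: "C1_on h V \<Longrightarrow> W \<subseteq> V \<Longrightarrow> C1_on h W"
  by (auto simp: C1_on_def intro: continuous_on_subset)

lemma plane_harmonic_on_subset: "plane_harmonic_on h V \<Longrightarrow> W \<subseteq> V \<Longrightarrow> plane_harmonic_on h W"
  by (auto simp: plane_harmonic_on_def intro: C1_on_subset)

lemma C1_on_local:
  assumes "\<And>z. z \<in> V \<Longrightarrow> \<exists>W. open W \<and> z \<in> W \<and> W \<subseteq> V \<and> C1_on h W"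
  shows "C1_on h V"
proof -
  have "h differentiable (at z) \<and> isCont (dx h) z \<and> isCont (dy h) z" if "z \<in> V" for z
    using assms[OF that] by (auto simp: C1_on_def continuous_on_eq_continuous_at)
  then show ?thesis by (auto simp: C1_on_def intro: continuous_at_imp_continuous_on)
qed

lemma plane_harmonic_on_local:
  assumes "\<And>z. z \<in> V \<Longrightarrow> \<exists>W. open W \<and> z \<in> W \<and> W \<subseteq> V \<and> plane_harmonic_on h W"
  shows "plane_harmonic_on h V"
proof -
  have loc: "\<exists>W. open W \<and> z \<in> W \<and> W \<subseteq> V \<and> C1_on k W"
    if "z \<in> V" "k \<in> {h, dx h, dy h}" for z k
    using assms[OF that(1)] that(2) unfolding plane_harmonic_on_def by auto
  have "C1_on h V" "C1_on (dx h) V" "C1_on (dy h) V"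
    by (rule C1_on_local; erule loc; simp)+
  moreover have "dx (dx h) z + dy (dy h) z = 0" if "z \<in> V" for z
    using assms[OF that] by (auto simp: plane_harmonic_on_def)
  ultimately show ?thesis by (auto simp: plane_harmonic_on_def)
qed

lemma plane_harmonic_on_local_decompose:
  assumes V: "open V" and h: "plane_harmonic_on h V" and z: "z \<in> V"
  obtains e F G where "0 < e" "ball z e \<subseteq> V" "F holomorphic_on ball z e" "G holomorphic_on ball z e"
    "\<And>w. w \<in> ball z e \<Longrightarrow> h w = F w + cnj (G w)"
proof -
  obtain e where e: "0 < e" "ball z e \<subseteq> V" using V z openE by blast
  obtain F G where "F holomorphic_on ball z e" "G holomorphic_on ball z e"
    "\<And>w. w \<in> ball z e \<Longrightarrow> h w = F w + cnj (G w)"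
    using plane_harmonic_decompose[OF _ _ plane_harmonic_on_subset[OF h e(2)]] by blast
  then show ?thesis using e that by blast
qed

text \<open>Derivatives at a point see a neighbourhood, so the passage from \<open>h\<close> to
  \<open>h'\<close> goes through the decomposition on small balls inside the open set.\<close>

lemma plane_harmonic_on_cong_open:
  assumes V: "open V" and h: "plane_harmonic_on h V" and eq: "\<And>z. z \<in> V \<Longrightarrow> h' z = h z"
  shows "plane_harmonic_on h' V"
proof (rule plane_harmonic_on_local)
  fix z assume "z \<in> V"
  from plane_harmonic_on_local_decompose[OF V h this]
  obtain e F G where *: "0 < e" "ball z e \<subseteq> V" "F holomorphic_on ball z e" "G holomorphic_on ball z e"
    "\<And>w. w \<in> ball z e \<Longrightarrow> h w = F w + cnj (G w)" by blast
  then have "plane_harmonic_on h' (ball z e)"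
    by (intro plane_harmonic_hol_antihol[of _ F G]) (auto simp: eq subset_iff)
  then show "\<exists>W. open W \<and> z \<in> W \<and> W \<subseteq> V \<and> plane_harmonic_on h' W"
    using * by (intro exI[of _ "ball z e"]) auto
qed

text \<open>Composing with \<open>f\<close> acts on the two holomorphic summands separately, so the
  chain rule for both Wirtinger derivatives is the complex one.\<close>

lemma plane_harmonic_compose_local:
  assumes V: "open V" and h: "plane_harmonic_on h V" and W: "open W" and f: "f holomorphic_on W"
    and fW: "f ` W \<subseteq> V" and z: "z \<in> W"
  obtains e F G where "0 < e" "ball z e \<subseteq> W" "F holomorphic_on ball z e" "G holomorphic_on ball z e"
    "\<And>w. w \<in> ball z e \<Longrightarrow> h (f w) = F w + cnj (G w)"
    "deriv F z = d_z h (f z) * deriv f z" "deriv G z = cnj (d_zbar h (f z)) * deriv f z"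
proof -
  obtain e F G where *: "0 < e" "ball (f z) e \<subseteq> V" "F holomorphic_on ball (f z) e" "G holomorphic_on ball (f z) e"
    "\<And>w. w \<in> ball (f z) e \<Longrightarrow> h w = F w + cnj (G w)"
    using plane_harmonic_on_local_decompose[OF V h, of "f z"] fW z by blast
  have "open (W \<inter> f -` ball (f z) e)"
    using f W by (simp add: continuous_open_preimage holomorphic_on_imp_continuous_on)
  then obtain d where d: "0 < d" "ball z d \<subseteq> W \<inter> f -` ball (f z) e"
    using z * by (metis IntI centre_in_ball openE vimageI)
  have fd: "f holomorphic_on ball z d" using f d by (auto intro: holomorphic_on_subset)
  have im: "f ` ball z d \<subseteq> ball (f z) e" using d by auto
  show ?thesis
  proof (rule that[of d "F \<circ> f" "G \<circ> f"])
    show "F \<circ> f holomorphic_on ball z d" "G \<circ> f holomorphic_on ball z d"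
      using holomorphic_on_compose_gen fd im *(3,4) by blast+
    have fz: "f field_differentiable at z"
      using fd d(1) by (meson centre_in_ball holomorphic_on_imp_differentiable_at open_ball)
    have "F field_differentiable at (f z)" "G field_differentiable at (f z)"
      using *(1,3,4) by (meson centre_in_ball holomorphic_on_imp_differentiable_at open_ball)+
    then have "deriv (F \<circ> f) z = deriv F (f z) * deriv f z" "deriv (G \<circ> f) z = deriv G (f z) * deriv f z"
      using deriv_chain fz by blast+
    moreover have "d_z h (f z) = deriv F (f z)" "d_zbar h (f z) = cnj (deriv G (f z))"
      using hol_antihol_derivatives(4,5)[OF _ *(3,4,5)] *(1) by auto
    ultimately show "deriv (F \<circ> f) z = d_z h (f z) * deriv f z" "deriv (G \<circ> f) z = cnj (d_zbar h (f z)) * deriv f z"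
      by simp_all
  qed (use d * im in \<open>auto simp: image_subset_iff\<close>)
qed

lemma plane_harmonic_compose:
  assumes V: "open V" and h: "plane_harmonic_on h V" and W: "open W" and f: "f holomorphic_on W"
    and fW: "f ` W \<subseteq> V"
  shows "plane_harmonic_on (\<lambda>z. h (f z)) W"
    and "z \<in> W \<Longrightarrow> d_z (\<lambda>z. h (f z)) z = d_z h (f z) * deriv f z"
    and "z \<in> W \<Longrightarrow> d_zbar (\<lambda>z. h (f z)) z = d_zbar h (f z) * cnj (deriv f z)"
proof -
  show "plane_harmonic_on (\<lambda>z. h (f z)) W"
  proof (rule plane_harmonic_on_local)
    fix z assume z: "z \<in> W"
    obtain e F G where *: "0 < e" "ball z e \<subseteq> W" "F holomorphic_on ball z e" "G holomorphic_on ball z e"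
      "\<And>w. w \<in> ball z e \<Longrightarrow> h (f w) = F w + cnj (G w)"
      by (rule plane_harmonic_compose_local[OF V h W f fW z]) (rule that; assumption)
    then have "plane_harmonic_on (\<lambda>z. h (f z)) (ball z e)"
      by (intro plane_harmonic_hol_antihol[of _ F G]) auto
    then show "\<exists>U. open U \<and> z \<in> U \<and> U \<subseteq> W \<and> plane_harmonic_on (\<lambda>z. h (f z)) U"
      using * by (intro exI[of _ "ball z e"]) auto
  qed
  assume z: "z \<in> W"
  obtain e F G where *: "0 < e" "ball z e \<subseteq> W" "F holomorphic_on ball z e" "G holomorphic_on ball z e"
    "\<And>w. w \<in> ball z e \<Longrightarrow> h (f w) = F w + cnj (G w)"
    "deriv F z = d_z h (f z) * deriv f z" "deriv G z = cnj (d_zbar h (f z)) * deriv f z"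
    by (rule plane_harmonic_compose_local[OF V h W f fW z]) (rule that; assumption)
  from hol_antihol_derivatives(4,5)[OF _ *(3,4,5), of z] *
  show "d_z (\<lambda>z. h (f z)) z = d_z h (f z) * deriv f z" "d_zbar (\<lambda>z. h (f z)) z = d_zbar h (f z) * cnj (deriv f z)"
    by auto
qed

definition energy_density :: "(complex \<Rightarrow> complex) \<Rightarrow> complex \<Rightarrow> real" where
  "energy_density h z = (cmod (d_z h z))\<^sup>2 + (cmod (d_zbar h z))\<^sup>2"

lemma energy_density_nonneg: "0 \<le> energy_density h z"
  by (simp add: energy_density_def)

text \<open>The factor \<open>|f'|^2\<close> is the Jacobian of \<open>f\<close>: this is the
  pointwise form of conformal invariance of energy.\<close>

lemma energy_density_compose:
  assumes "open V" "plane_harmonic_on h V" "open W" "f holomorphic_on W" "f ` W \<subseteq> V" "z \<in> W"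
  shows "energy_density (\<lambda>z. h (f z)) z = energy_density h (f z) * (cmod (deriv f z))\<^sup>2"
  unfolding energy_density_def plane_harmonic_compose(2,3)[OF assms]
  by (simp add: norm_mult power_mult_distrib algebra_simps)

lemma continuous_on_energy_density:
  assumes "plane_harmonic_on h V"
  shows "continuous_on V (energy_density h)"
  using assms unfolding energy_density_def[abs_def] plane_harmonic_on_def C1_on_def d_z_def[abs_def] d_zbar_def[abs_def]
  by (auto intro!: continuous_intros)

lemma energy_density_cong:
  assumes V: "open V" and h: "plane_harmonic_on h V" and eq: "\<And>z. z \<in> V \<Longrightarrow> h' z = h z" and z: "z \<in> V"
  shows "energy_density h' z = energy_density h z"
proof -
  from plane_harmonic_on_local_decompose[OF V h z]
  obtain e F G where *: "0 < e" "ball z e \<subseteq> V" "F holomorphic_on ball z e" "G holomorphic_on ball z e"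
    "\<And>w. w \<in> ball z e \<Longrightarrow> h w = F w + cnj (G w)" by blast
  then have **: "\<And>w. w \<in> ball z e \<Longrightarrow> h' w = F w + cnj (G w)" by (auto simp: eq subset_iff)
  show ?thesis unfolding energy_density_def
    using hol_antihol_derivatives(4,5)[OF _ *(3,4,5), of z] hol_antihol_derivatives(4,5)[OF _ *(3,4) **, of z] *(1)
    by auto
qed

subsection \<open>Caratheodory's theorem for bounded domains\<close>

lemma norm_cis_diff_one_sq: "(cmod (cis t - 1))\<^sup>2 = 2 - 2 * cos t"
proof -
  have "(cmod (cis t - 1))\<^sup>2 = (cos t - 1)\<^sup>2 + (sin t)\<^sup>2" by (simp add: cmod_power2)
  also have "\<dots> = 2 - 2 * cos t" using sin_cos_squared_add[of t] by (simp add: power2_eq_square algebra_simps)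
  finally show ?thesis .
qed

lemma norm_cis_diff: "cmod (cis s - cis t) = cmod (cis (s - t) - 1)"
proof -
  have "cis s - cis t = cis t * (cis (s - t) - 1)" by (simp add: algebra_simps cis_mult)
  then show ?thesis by (simp add: norm_mult)
qed

text \<open>The chord has length \<open>2 * |sin ((s - t) / 2)|\<close>.\<close>

lemma norm_cis_diff_le: "cmod (cis s - cis t) \<le> \<bar>s - t\<bar>"
proof -
  have "(cmod (cis s - cis t))\<^sup>2 = 4 * (sin ((s - t) / 2))\<^sup>2"
  proof -
    have eq: "2 * ((s - t) / 2) = s - t" by simp
    have "cos (s - t) = 1 - 2 * (sin ((s - t) / 2))\<^sup>2"
      using cos_double_sin[of "(s - t) / 2"] by (simp only: eq)
    then show ?thesis using norm_cis_diff_one_sq[of "s - t"] by (simp add: norm_cis_diff[of s t])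
  qed
  also have "\<dots> \<le> 4 * ((s - t) / 2)\<^sup>2"
    using abs_sin_x_le_abs_x[of "(s - t) / 2"] unfolding abs_le_square_iff by simp
  also have "\<dots> = (s - t)\<^sup>2" by (simp add: power2_eq_square)
  finally show ?thesis by (simp add: abs_le_square_iff[symmetric])
qed

lemma sphere_eq_cis: "q \<in> sphere 0 1 \<Longrightarrow> \<exists>t. -pi < t \<and> t \<le> pi \<and> q = cis t"
proof -
  assume "q \<in> sphere 0 1"
  then have n: "norm q = 1" by simp
  then have "q \<noteq> 0" by auto
  then have "cis (Arg q) = q" using n by (simp add: cis_Arg sgn_div_norm)
  then show ?thesis using Arg_bounded[of q] by metis
qed

text \<open>Cosine is even and decreasing on \<open>{0..pi}\<close>. Bounds on chords, and the
  slices of a crosscut further below, become conditions of this shape.\<close>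

lemma is_interval_cos_ge: "is_interval {t \<in> {-pi..pi}. c \<le> cos t}"
  unfolding is_interval_1
proof (intro ballI allI impI, elim conjE)
  fix a b x assume ab: "a \<in> {t \<in> {-pi..pi}. c \<le> cos t}" "b \<in> {t \<in> {-pi..pi}. c \<le> cos t}" "a \<le> x" "x \<le> b"
  have "c \<le> cos \<bar>x\<bar>"
  proof (cases "\<bar>x\<bar> \<le> \<bar>a\<bar>")
    case True
    then have "cos \<bar>a\<bar> \<le> cos \<bar>x\<bar>" using ab by (intro cos_monotone_0_pi_le) auto
    then show ?thesis using ab by auto
  next
    case False
    then have "\<bar>x\<bar> \<le> \<bar>b\<bar>" using ab by auto
    then have "cos \<bar>b\<bar> \<le> cos \<bar>x\<bar>" using ab by (intro cos_monotone_0_pi_le) auto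
    then show ?thesis using ab by auto
  qed
  then show "x \<in> {t \<in> {-pi..pi}. c \<le> cos t}" using ab by auto
qed

text \<open>After rotating \<open>a\<close> to 1, the bound on the chord is a lower bound on the
  cosine of the angle.\<close>

lemma connected_circle_arc:
  assumes "a \<in> sphere 0 1"
  shows "connected (sphere 0 1 \<inter> cball (a::complex) r)"
proof (cases "0 \<le> r")
  case False then show ?thesis by simp
next
  case True
  have na: "norm a = 1" using assms by simp
  have "sphere 0 1 \<inter> cball a r = (\<lambda>t. a * cis t) ` {t \<in> {-pi..pi}. (2 - r\<^sup>2) / 2 \<le> cos t}" (is "?L = ?R")
  proof -
    have d: "dist a (a * cis t) \<le> r \<longleftrightarrow> (2 - r\<^sup>2) / 2 \<le> cos t" for t
    proof -
      have "dist a (a * cis t) = norm (a * (cis t - 1))"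
        by (simp add: dist_norm norm_minus_commute algebra_simps)
      then have "dist a (a * cis t) = norm (cis t - 1)" using na by (simp add: norm_mult)
      then have "dist a (a * cis t) \<le> r \<longleftrightarrow> (norm (cis t - 1))\<^sup>2 \<le> r\<^sup>2"
        using True by (simp add: power2_le_iff_abs_le)
      then show ?thesis unfolding norm_cis_diff_one_sq by (auto simp: field_simps)
    qed
    have "z \<in> ?R" if z: "z \<in> ?L" for z
    proof -
      have "z / a \<in> sphere 0 1" using z na by (simp add: norm_divide)
      then obtain t where t: "-pi < t" "t \<le> pi" "z / a = cis t" using sphere_eq_cis by blast
      then have "a * cis t = a * (z / a)" by simp
      then have "z = a * cis t" using na by auto
      then show ?thesis using d[of t] t z by auto
    qed
    moreover have "?R \<subseteq> ?L" using d na by (auto simp: norm_mult)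
    ultimately show ?thesis by blast
  qed
  moreover have "connected ?R"
    by (intro connected_continuous_image continuous_intros is_interval_connected is_interval_cos_ge)
  ultimately show ?thesis by simp
qed

text \<open>Angles are measured from the antipode of \<open>a\<close>, so that \<open>a\<close>
  itself corresponds to the excluded ends \<open>-pi\<close> and \<open>pi\<close>.\<close>

lemma connected_circle_minus_point:
  assumes "a \<in> sphere 0 1"
  shows "connected (sphere 0 1 - {a::complex})"
proof -
  have na: "norm a = 1" using assms by simp
  have "sphere 0 1 - {a} = (\<lambda>t. - a * cis t) ` {-pi<..<pi}"
  proof -
    have 1: "z \<in> (\<lambda>t. - a * cis t) ` {-pi<..<pi}" if z: "z \<in> sphere 0 1 - {a}" for z
    proof -
      have "- z / a \<in> sphere 0 1" using z na by (simp add: norm_divide)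
      then obtain t where t: "-pi < t" "t \<le> pi" "- z / a = cis t" using sphere_eq_cis by blast
      have "t \<noteq> pi" using t z na by (auto simp: field_simps)
      moreover have "a * cis t = - z" unfolding t(3)[symmetric] using na by auto
      then have "z = - a * cis t" by simp
      ultimately show ?thesis using t by auto
    qed
    have "- a * cis t \<noteq> a" if "t \<in> {-pi<..<pi}" for t
    proof
      assume "- a * cis t = a"
      moreover have "a * (cis t + 1) = - (- a * cis t) + a" by (simp add: algebra_simps)
      ultimately have "a * (cis t + 1) = 0" by simp
      then have "cis t = -1" using na by (auto simp: eq_neg_iff_add_eq_0)
      then have "cos \<bar>t\<bar> = -1" by (simp add: complex_eq_iff)
      moreover have "cos pi < cos \<bar>t\<bar>" using that by (intro cos_monotone_0_pi) auto
      ultimately show False by simp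
    qed
    moreover have "- a * cis t \<in> sphere 0 1" for t using na by (simp add: norm_mult)
    ultimately have "(\<lambda>t. - a * cis t) ` {-pi<..<pi} \<subseteq> sphere 0 1 - {a}" by (intro image_subsetI) simp
    then show ?thesis using 1 by (meson equalityI subsetI)
  qed
  moreover have "connected ((\<lambda>t. - a * cis t) ` {-pi<..<pi})"
    by (intro connected_continuous_image continuous_intros connected_Ioo)
  ultimately show ?thesis by (simp only:)
qed

text \<open>Uniform continuity of \<open>\<gamma>'\<close> puts a small subset of the curve into a
  short arc of parameters, and uniform continuity of \<open>\<gamma>\<close> keeps the image of that
  arc small. An empty \<open>T\<close> gets an empty \<open>S\<close>, so that nothing is added when
  a crosscut image does not reach the curve.\<close>

lemma jordan_curve_small_connected:
  fixes \<Gamma> :: "complex set" and \<gamma> :: "complex \<Rightarrow> complex"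
  assumes hom: "homeomorphism (sphere 0 1) \<Gamma> \<gamma> \<gamma>'" and \<epsilon>: "0 < \<epsilon>"
  obtains \<delta> where "0 < \<delta>"
    "\<And>T. \<lbrakk>T \<subseteq> \<Gamma>; \<And>x y. x \<in> T \<Longrightarrow> y \<in> T \<Longrightarrow> dist x y < \<delta>\<rbrakk> \<Longrightarrow>
       \<exists>S. T \<subseteq> S \<and> S \<subseteq> \<Gamma> \<and> compact S \<and> connected S \<and> (\<forall>x\<in>S. \<forall>y\<in>S. dist x y < \<epsilon>) \<and> (T = {} \<longrightarrow> S = {})"
proof -
  have c: "continuous_on (sphere 0 1) \<gamma>" "continuous_on \<Gamma> \<gamma>'" and im: "\<gamma> ` sphere 0 1 = \<Gamma>" "\<gamma>' ` \<Gamma> = sphere 0 1"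
    and inv: "\<And>x. x \<in> \<Gamma> \<Longrightarrow> \<gamma> (\<gamma>' x) = x"
    using hom by (auto simp: homeomorphism_def)
  have comp: "compact \<Gamma>" using compact_continuous_image[OF c(1) compact_sphere] im(1) by simp
  have u1: "uniformly_continuous_on (sphere 0 1) \<gamma>" using c(1) compact_uniformly_continuous compact_sphere by blast
  have u2: "uniformly_continuous_on \<Gamma> \<gamma>'" using c(2) compact_uniformly_continuous comp by blast
  obtain \<eta> where \<eta>: "0 < \<eta>" "\<And>a b. a \<in> sphere 0 1 \<Longrightarrow> b \<in> sphere 0 1 \<Longrightarrow> dist a b < \<eta> \<Longrightarrow> dist (\<gamma> a) (\<gamma> b) < \<epsilon>"
    using u1 \<epsilon> unfolding uniformly_continuous_on_def by metis
  \<comment> \<open>An arc inside a disc of radius \<open>\<eta> / 3\<close> has diameter at most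
    \<open>2 * \<eta> / 3\<close>, still below \<open>\<eta>\<close>.\<close>
  obtain \<delta> where \<delta>: "0 < \<delta>" "\<And>a b. a \<in> \<Gamma> \<Longrightarrow> b \<in> \<Gamma> \<Longrightarrow> dist a b < \<delta> \<Longrightarrow> dist (\<gamma>' a) (\<gamma>' b) < \<eta> / 3"
    using u2[unfolded uniformly_continuous_on_def, rule_format, of "\<eta> / 3"] \<eta>(1) by (auto simp: dist_commute)
  show ?thesis
  proof (rule that[OF \<delta>(1)])
    fix T assume T: "T \<subseteq> \<Gamma>" "\<And>x y. x \<in> T \<Longrightarrow> y \<in> T \<Longrightarrow> dist x y < \<delta>"
    show "\<exists>S. T \<subseteq> S \<and> S \<subseteq> \<Gamma> \<and> compact S \<and> connected S \<and> (\<forall>x\<in>S. \<forall>y\<in>S. dist x y < \<epsilon>) \<and> (T = {} \<longrightarrow> S = {})"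
    proof (cases "T = {}")
      case True then show ?thesis by auto
    next
      case False
      then obtain x0 where x0: "x0 \<in> T" by auto
      define A where "A = sphere 0 1 \<inter> cball (\<gamma>' x0) (\<eta> / 3)"
      have x0s: "\<gamma>' x0 \<in> sphere 0 1" using x0 T im by blast
      have cA: "continuous_on A \<gamma>" using c(1) by (rule continuous_on_subset) (auto simp: A_def)
      have "T \<subseteq> \<gamma> ` A"
      proof
        fix x assume x: "x \<in> T"
        then have "\<gamma>' x \<in> A" using T(2)[OF x0 x] \<delta>(2)[of x0 x] x0 T(1) im(2) by (fastforce simp: A_def)
        moreover have "x = \<gamma> (\<gamma>' x)" using inv x T(1) by auto
        ultimately show "x \<in> \<gamma> ` A" by blast
      qed
      moreover have "\<gamma> ` A \<subseteq> \<Gamma>" using im(1) by (auto simp: A_def)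
      moreover have "compact (\<gamma> ` A)" by (intro compact_continuous_image cA) (auto simp: A_def)
      moreover have "connected (\<gamma> ` A)" using connected_circle_arc[OF x0s] cA connected_continuous_image A_def by metis
      moreover have "dist x y < \<epsilon>" if xy: "x \<in> \<gamma> ` A" "y \<in> \<gamma> ` A" for x y
      proof -
        obtain a b where ab: "a \<in> A" "b \<in> A" "x = \<gamma> a" "y = \<gamma> b" using xy by auto
        have "dist a b \<le> dist (\<gamma>' x0) a + dist (\<gamma>' x0) b" by (simp add: dist_triangle3)
        also have "\<dots> < \<eta>" using ab \<eta>(1) by (auto simp: A_def)
        finally show ?thesis using ab \<eta>(2)[of a b] by (auto simp: A_def)
      qed
      ultimately show ?thesis using False by blast
    qed
  qed
qed

text \<open>The range \<open>x < X\<close> has infinite length, so finite total energy cannot leave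
  at least \<open>\<kappa>\<close> on every vertical line there.\<close>

lemma small_energy_slice:
  fixes E :: "complex \<Rightarrow> ennreal"
  assumes [measurable]: "E \<in> borel_measurable borel" and fin: "(\<integral>\<^sup>+ z. E z \<partial>lborel) < \<infinity>" and \<kappa>: "(0::real) < \<kappa>"
  obtains x where "x < X" "(\<integral>\<^sup>+ y. E (Complex x y) \<partial>lborel) < ennreal \<kappa>"
proof (rule ccontr)
  assume no: "\<not> thesis"
  note * = that
  have ge: "ennreal \<kappa> \<le> (\<integral>\<^sup>+ y. E (Complex x y) \<partial>lborel)" if "x < X" for x
    using *[OF that] no not_less by blast
  have "(\<integral>\<^sup>+ x. ennreal \<kappa> * indicator {..<X} x \<partial>lborel) \<le> (\<integral>\<^sup>+ x. \<integral>\<^sup>+ y. E (Complex x y) \<partial>lborel \<partial>lborel)"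
    by (rule nn_integral_mono) (auto simp: ge split: split_indicator)
  also have "\<dots> = (\<integral>\<^sup>+ z. E z \<partial>lborel)" by (rule nn_integral_complex_iterated[symmetric]) simp
  finally have "ennreal \<kappa> * emeasure lborel {..<X} < \<infinity>" using fin by (simp add: nn_integral_cmult)
  moreover have "emeasure lborel {..<X} = \<infinity>"
  proof -
    have "ennreal n \<le> emeasure lborel {..<X}" if "0 \<le> n" for n :: real
      using emeasure_mono[of "{X - n<..<X}" "{..<X}" lborel] that by (auto simp: subset_iff)
    note big = this
    show ?thesis
    proof (cases "emeasure lborel {..<X}")
      case (real r)
      then show ?thesis using big[of "r + 1"] by simp
    qed simp
  qed
  ultimately show False using \<kappa> by (simp add: ennreal_mult_top)
qed

text \<open>The fundamental theorem along the slice, with Cauchy-Schwarz in its additive form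
  \<open>2 * a \<le> a^2 / s + s\<close>; the weight \<open>s\<close> is left free for later
  choice.\<close>

lemma slice_oscillation:
  assumes W: "open W" and G: "G holomorphic_on W" and y: "y1 \<le> y2" and seg: "\<And>y. y \<in> {y1..y2} \<Longrightarrow> Complex x y \<in> W"
    and en: "(\<integral>\<^sup>+ y. ennreal ((cmod (deriv G (Complex x y)))\<^sup>2) * indicator W (Complex x y) \<partial>lborel) \<le> ennreal \<kappa>"
    and s: "0 < s" "0 \<le> \<kappa>"
  shows "dist (G (Complex x y1)) (G (Complex x y2)) \<le> (\<kappa> / s + (y2 - y1) * s) / 2"
proof -
  have cont: "continuous_on {y1..y2} (\<lambda>y. deriv G (Complex x y))"
  proof -
    have "continuous_on W (deriv G)" using holomorphic_deriv[OF G W] holomorphic_on_imp_continuous_on by blast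
    moreover have "continuous_on {y1..y2} (\<lambda>y. Complex x y)" unfolding Complex_eq by (intro continuous_intros)
    ultimately show ?thesis by (rule continuous_on_compose2) (use seg in auto)
  qed
  have "((\<lambda>y. \<i> * deriv G (Complex x y)) has_integral (G (Complex x y2) - G (Complex x y1))) {y1..y2}"
  proof (rule fundamental_theorem_of_calculus[OF y])
    fix y assume yy: "y \<in> {y1..y2}"
    have "((\<lambda>y. Complex x y) has_vector_derivative \<i>) (at y within {y1..y2})"
      unfolding Complex_eq by (auto intro!: derivative_eq_intros simp: has_vector_derivative_def scaleR_conv_of_real)
    from field_vector_diff_chain_within[OF this, of G "deriv G (Complex x y)"]
    show "((\<lambda>y. G (Complex x y)) has_vector_derivative \<i> * deriv G (Complex x y)) (at y within {y1..y2})"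
      using holomorphic_derivI[OF G W seg[OF yy]] by (simp add: o_def has_field_derivative_at_within)
  qed
  then have "G (Complex x y2) - G (Complex x y1) = integral {y1..y2} (\<lambda>y. \<i> * deriv G (Complex x y))"
    by (rule integral_unique[symmetric])
  also have "norm \<dots> \<le> integral {y1..y2} (\<lambda>y. ((cmod (deriv G (Complex x y)))\<^sup>2 / s + s) / 2)"
  proof (rule integral_norm_bound_integral)
    show "(\<lambda>y. \<i> * deriv G (Complex x y)) integrable_on {y1..y2}"
      by (intro integrable_continuous_interval continuous_intros cont)
    show "(\<lambda>y. ((cmod (deriv G (Complex x y)))\<^sup>2 / s + s) / 2) integrable_on {y1..y2}"
      using s by (intro integrable_continuous_interval continuous_intros cont) auto
    fix y
    have "2 * a \<le> a\<^sup>2 / s + s" for a :: real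
    proof -
      have "0 \<le> (a - s)\<^sup>2 / s" using s by simp
      also have "\<dots> = a\<^sup>2 / s + s - 2 * a" using s by (simp add: power2_eq_square field_simps)
      finally show ?thesis by simp
    qed
    from this[of "cmod (deriv G (Complex x y))"]
    show "norm (\<i> * deriv G (Complex x y)) \<le> ((cmod (deriv G (Complex x y)))\<^sup>2 / s + s) / 2"
      by (simp add: norm_mult)
  qed
  also have "\<dots> = (integral {y1..y2} (\<lambda>y. (cmod (deriv G (Complex x y)))\<^sup>2) / s + (y2 - y1) * s) / 2"
  proof -
    have "(\<lambda>y. (cmod (deriv G (Complex x y)))\<^sup>2) integrable_on {y1..y2}"
      by (intro integrable_continuous_interval continuous_intros cont)
    then have "((\<lambda>y. (cmod (deriv G (Complex x y)))\<^sup>2) has_integral integral {y1..y2} (\<lambda>y. (cmod (deriv G (Complex x y)))\<^sup>2)) {y1..y2}"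
      by (rule integrable_integral)
    then have "((\<lambda>y. ((cmod (deriv G (Complex x y)))\<^sup>2 / s + s) / 2) has_integral (integral {y1..y2} (\<lambda>y. (cmod (deriv G (Complex x y)))\<^sup>2) / s + (y2 - y1) *\<^sub>R s) / 2) {y1..y2}"
      using y has_integral_const_real[of s y1 y2]
      by (intro has_integral_divide has_integral_add) (auto simp: has_integral_divide)
    then show ?thesis by (simp only: integral_unique real_scaleR_def)
  qed
  also have "\<dots> \<le> (\<kappa> / s + (y2 - y1) * s) / 2"
  proof -
    have "(\<lambda>y. (cmod (deriv G (Complex x y)))\<^sup>2) integrable_on {y1..y2}"
      by (intro integrable_continuous_interval continuous_intros cont)
    then have "ennreal (integral {y1..y2} (\<lambda>y. (cmod (deriv G (Complex x y)))\<^sup>2))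
       = (\<integral>\<^sup>+ y. ennreal ((cmod (deriv G (Complex x y)))\<^sup>2) * indicator {y1..y2} y \<partial>lborel)"
      by (intro nn_integral_has_integral_lebesgue'[symmetric] integrable_integral) auto
    also have "\<dots> \<le> (\<integral>\<^sup>+ y. ennreal ((cmod (deriv G (Complex x y)))\<^sup>2) * indicator W (Complex x y) \<partial>lborel)"
      by (rule nn_integral_mono) (use seg in \<open>auto split: split_indicator\<close>)
    also note en
    finally have "integral {y1..y2} (\<lambda>y. (cmod (deriv G (Complex x y)))\<^sup>2) \<le> \<kappa>"
      using s by simp
    then show ?thesis using s by (simp add: divide_right_mono)
  qed
  finally show ?thesis by (simp add: dist_norm norm_minus_commute)
qed


text \<open>With \<open>u = 1 - z / q\<close>, the condition \<open>|1 - u| < 1\<close> forces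
  \<open>Re u > 0\<close>, so the principal argument of \<open>u\<close> is a valid
  coordinate.\<close>

lemma circular_crosscut_coordinates:
  assumes q: "q \<in> sphere 0 1" and \<rho>: "0 < \<rho>" "\<rho> < 1" and z: "z \<in> ball 0 1 \<inter> sphere q \<rho>"
  obtains y where "\<bar>y\<bar> < pi / 2" "z = q * (1 - exp (Complex (ln \<rho>) y))"
proof -
  define u where "u = 1 - z / q"
  have nq: "norm q = 1" using q by simp
  have nu: "norm u = \<rho>"
  proof -
    have "norm (q * u) = \<rho>" using z nq by (auto simp: u_def dist_norm right_diff_distrib)
    then show ?thesis using nq by (simp add: norm_mult)
  qed
  have "norm (1 - u) < 1" using z nq by (simp add: u_def norm_divide)
  then have "Re u > 0"
    using abs_Re_le_cmod[of "1 - u"] by auto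
  then have "\<bar>Arg u\<bar> < pi / 2" using Re_Ln_pos_lt[of u] by (metis Arg_eq_Im_Ln less_irrefl zero_complex.sel(1))
  moreover have "u = exp (Complex (ln \<rho>) (Arg u))"
  proof -
    have "exp (Complex (ln \<rho>) (Arg u)) = of_real \<rho> * cis (Arg u)"
      using \<rho> by (simp add: exp_eq_polar)
    also have "\<dots> = u" using rcis_cmod_Arg[of u] nu by (simp add: rcis_def)
    finally show ?thesis by simp
  qed
  moreover have "z = q * (1 - u)" using nq by (auto simp: u_def)
  ultimately show ?thesis using that by metis
qed

text \<open>The length-area principle. In the coordinate \<open>\<zeta>\<close> with
  \<open>z = q * (1 - exp \<zeta>)\<close>, circles about \<open>q\<close> are vertical lines, and
  the energy of \<open>f\<close> is the area of its image, which is finite; so a line arbitrarily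
  far to the left carries little energy and its image has small diameter.\<close>

lemma small_crosscut_image:
  assumes f: "f holomorphic_on ball 0 1" "inj_on f (ball 0 1)" "bounded (f ` ball 0 1)"
    and q: "q \<in> sphere 0 1" and \<rho>0: "0 < \<rho>0" "\<rho>0 \<le> 1" and \<eta>: "0 < \<eta>"
  obtains \<rho> where "0 < \<rho>" "\<rho> < \<rho>0"
    "\<And>z w. z \<in> ball 0 1 \<inter> sphere q \<rho> \<Longrightarrow> w \<in> ball 0 1 \<inter> sphere q \<rho> \<Longrightarrow> dist (f z) (f w) < \<eta>"
proof -
  define T where "T \<zeta> = q * (1 - exp \<zeta>)" for \<zeta>
  define W where "W = {\<zeta>. \<bar>Im \<zeta>\<bar> < pi / 2} \<inter> T -` ball 0 1"
  define G where "G = f \<circ> T"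
  have nq: "norm q = 1" "q \<noteq> 0" using q by auto
  have Thol: "T holomorphic_on X" for X unfolding T_def by (intro holomorphic_intros)
  have oW: "open W"
  proof -
    have "open {\<zeta>. \<bar>Im \<zeta>\<bar> < pi / 2}"
      by (intro open_Collect_less continuous_intros)
    moreover have "open (T -` ball 0 1)"
      using Thol holomorphic_on_imp_continuous_on by (intro open_vimage) auto
    ultimately show ?thesis unfolding W_def by (rule open_Int)
  qed
  have injT: "inj_on T W"
  proof (rule inj_onI)
    fix a b assume ab: "a \<in> W" "b \<in> W" "T a = T b"
    then have "exp a = exp b" using nq by (simp add: T_def)
    moreover have "\<bar>Im a - Im b\<bar> < 2 * pi" using ab by (auto simp: W_def)
    ultimately show "a = b" by (rule exp_complex_eqI[rotated])
  qed
  have TW: "T ` W \<subseteq> ball 0 1" by (auto simp: W_def)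
  have Ghol: "G holomorphic_on W" unfolding G_def
    by (rule holomorphic_on_compose_gen[OF Thol f(1) TW])
  have injG: "inj_on G W" unfolding G_def
    using comp_inj_on[OF injT] inj_on_subset[OF f(2) TW] by blast
  define E where "E \<zeta> = ennreal ((cmod (deriv G \<zeta>))\<^sup>2) * indicator W \<zeta>" for \<zeta>
  have mE: "E \<in> borel_measurable borel"
  proof -
    have "continuous_on W (\<lambda>z. (cmod (deriv G z))\<^sup>2)"
      using holomorphic_deriv[OF Ghol oW] holomorphic_on_imp_continuous_on by (intro continuous_intros) blast
    then have "(\<lambda>z. indicator W z *\<^sub>R (cmod (deriv G z))\<^sup>2) \<in> borel_measurable borel"
      by (intro borel_measurable_continuous_on_indicator) (use oW in auto)
    then have "(\<lambda>z. ennreal (indicator W z *\<^sub>R (cmod (deriv G z))\<^sup>2)) \<in> borel_measurable borel" by measurable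
    moreover have "(\<lambda>z. ennreal (indicator W z *\<^sub>R (cmod (deriv G z))\<^sup>2)) = E"
      by (auto simp: E_def fun_eq_iff split: split_indicator)
    ultimately show ?thesis by (simp only:)
  qed
  have fin: "(\<integral>\<^sup>+ \<zeta>. E \<zeta> \<partial>lborel) < \<infinity>"
  proof -
    have "(\<integral>\<^sup>+ \<zeta>. E \<zeta> \<partial>lborel) = (\<integral>\<^sup>+ z\<in>G ` W. 1 \<partial>lborel)"
      unfolding E_def by (subst nn_integral_conformal[OF Ghol oW injG]) auto
    also have "\<dots> = emeasure lborel (G ` W)"
      using open_mapping_thm3[OF Ghol oW injG] by simp
    also have "\<dots> < \<infinity>"
    proof (rule emeasure_bounded_finite)
      have "G ` W \<subseteq> f ` ball 0 1" using TW by (auto simp: G_def)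
      then show "bounded (G ` W)" using f(3) bounded_subset by blast
    qed
    finally show ?thesis .
  qed
  \<comment> \<open>With this \<open>s\<close> and \<open>\<kappa>\<close>, both
    \<open>\<kappa> / s\<close> and \<open>pi * s\<close> equal \<open>\<eta> / 2\<close>, so the
    oscillation bound becomes \<open>\<eta> / 2\<close>.\<close>
  define s where "s = \<eta> / (2 * pi)"
  define \<kappa> where "\<kappa> = \<eta> * s / 2"
  have s: "s > 0" "\<kappa> > 0" using \<eta> by (simp_all add: s_def \<kappa>_def)
  obtain x where x: "x < ln \<rho>0" and en: "(\<integral>\<^sup>+ y. E (Complex x y) \<partial>lborel) < ennreal \<kappa>"
    using small_energy_slice[OF mE fin s(2)] by blast
  define \<rho> where "\<rho> = exp x"
  have \<rho>: "0 < \<rho>" "\<rho> < \<rho>0" "\<rho> < 1" "ln \<rho> = x"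
  proof -
    have "exp x < exp (ln \<rho>0)" using x by simp
    then show "\<rho> < \<rho>0" using \<rho>0 by (simp add: \<rho>_def)
    then show "\<rho> < 1" using \<rho>0 by simp
  qed (auto simp: \<rho>_def)
  \<comment> \<open>Integration between two points of a slice needs the whole segment in
    \<open>W\<close>: on a fixed line, membership in the disc reads
    \<open>exp x / 2 < cos y\<close>, which cuts out an interval.\<close>
  have slice: "Complex x y \<in> W" if ab: "Complex x a \<in> W" "Complex x b \<in> W" and y: "a \<le> y" "y \<le> b" for a b y
  proof -
    have crit: "Complex x y \<in> W \<longleftrightarrow> \<bar>y\<bar> < pi / 2 \<and> exp x / 2 < cos y" for y
    proof -
      have "norm (T (Complex x y)) < 1 \<longleftrightarrow> (norm (1 - exp (Complex x y)))\<^sup>2 < 1"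
        using nq abs_square_less_1[of "norm (1 - exp (Complex x y))"] by (simp add: T_def norm_mult)
      also have "(norm (1 - exp (Complex x y)))\<^sup>2 = (1 - exp x * cos y)\<^sup>2 + (exp x * sin y)\<^sup>2"
        by (simp add: cmod_power2 Re_exp Im_exp)
      also have "\<dots> = 1 - 2 * exp x * cos y + (exp x)\<^sup>2 * ((sin y)\<^sup>2 + (cos y)\<^sup>2)"
        by algebra
      also have "\<dots> = 1 + exp x * (2 * (exp x / 2 - cos y))"
        unfolding sin_cos_squared_add by (simp add: power2_eq_square algebra_simps)
      also have "\<dots> < 1 \<longleftrightarrow> exp x / 2 < cos y"
        by (simp add: mult_less_0_iff mult.commute)
      finally show ?thesis by (auto simp: W_def)
    qed
    have "exp x / 2 < cos a" "exp x / 2 < cos b" "\<bar>a\<bar> < pi / 2" "\<bar>b\<bar> < pi / 2" using ab by (auto simp: crit)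
    moreover have "min (cos a) (cos b) \<le> cos y"
    proof -
      have m: "{a, b} \<subseteq> {t \<in> {-pi..pi}. min (cos a) (cos b) \<le> cos t}"
        using calculation by auto
      have "y \<in> {t \<in> {-pi..pi}. min (cos a) (cos b) \<le> cos t}"
        using is_interval_cos_ge[unfolded is_interval_1, rule_format, of a _ b y] m y by blast
      then show ?thesis by simp
    qed
    ultimately show ?thesis using y by (auto simp: crit)
  qed
  have osc: "dist (G (Complex x a)) (G (Complex x b)) < \<eta>"
    if ab: "Complex x a \<in> W" "Complex x b \<in> W" "a \<le> b" for a b
  proof -
    have "dist (G (Complex x a)) (G (Complex x b)) \<le> (\<kappa> / s + (b - a) * s) / 2"
      using s by (intro slice_oscillation[OF oW Ghol ab(3) _ less_imp_le[OF en[unfolded E_def]]])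
        (auto intro: slice[OF ab(1,2)])
    also have "\<dots> \<le> (\<kappa> / s + pi * s) / 2"
    proof -
      have "b - a \<le> pi" using ab by (auto simp: W_def)
      then show ?thesis using s by (simp add: mult_right_mono)
    qed
    also have "\<dots> < \<eta>" using \<eta> s by (simp add: \<kappa>_def) (simp add: s_def)
    finally show ?thesis .
  qed
  show ?thesis
  proof (rule that[OF \<rho>(1,2)])
    fix z w assume zw: "z \<in> ball 0 1 \<inter> sphere q \<rho>" "w \<in> ball 0 1 \<inter> sphere q \<rho>"
    obtain a where a: "\<bar>a\<bar> < pi / 2" "z = T (Complex x a)"
      using circular_crosscut_coordinates[OF q \<rho>(1,3) zw(1)] \<rho>(4) by (auto simp: T_def)
    obtain b where b: "\<bar>b\<bar> < pi / 2" "w = T (Complex x b)"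
      using circular_crosscut_coordinates[OF q \<rho>(1,3) zw(2)] \<rho>(4) by (auto simp: T_def)
    have "Complex x a \<in> W" "Complex x b \<in> W" using a b zw by (auto simp: W_def)
    then have "dist (G (Complex x a)) (G (Complex x b)) < \<eta>"
      using osc[of a b] osc[of b a] by (metis dist_commute linear)
    then show "dist (f z) (f w) < \<eta>" using a b by (simp add: G_def)
  qed
qed

text \<open>The inverse map is continuous, so the preimage of a compact set is compact and stays
  away from the circle.\<close>

lemma conformal_map_proper:
  assumes f: "f holomorphic_on ball 0 1" "inj_on f (ball 0 1)" and L: "compact L" "L \<subseteq> f ` ball 0 1"
  obtains r where "0 < r" "r < 1" "\<And>z. z \<in> ball 0 1 \<Longrightarrow> f z \<in> L \<Longrightarrow> norm z \<le> r"
proof -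
  obtain k where k: "k holomorphic_on f ` ball 0 1" "\<And>z. z \<in> ball 0 1 \<Longrightarrow> k (f z) = z"
    using holomorphic_has_inverse[OF f(1) open_ball f(2)] by metis
  have "compact (k ` L)"
    using k(1) L by (intro compact_continuous_image) (auto intro: continuous_on_subset holomorphic_on_imp_continuous_on)
  moreover have "k ` L \<subseteq> ball 0 1" using L k(2) by fastforce
  ultimately obtain r0 where r0: "r0 < 1" "k ` L \<subseteq> cball 0 r0" 
  proof (cases "k ` L = {}")
    case True then show ?thesis using that[of 0] by auto
  next
    case False
    obtain z0 where z0: "z0 \<in> k ` L" "\<And>z. z \<in> k ` L \<Longrightarrow> norm z \<le> norm z0"
      using continuous_attains_sup[OF \<open>compact (k ` L)\<close> False, of norm] continuous_on_norm_id by blast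
    then show ?thesis using that[of "norm z0"] \<open>k ` L \<subseteq> ball 0 1\<close> by force
  qed
  show ?thesis
  proof (rule that[of "max r0 (1/2)"])
    fix z assume "z \<in> ball 0 1" "f z \<in> L"
    then have "z \<in> k ` L" using k(2) by (metis imageI)
    then show "norm z \<le> max r0 (1/2)" using r0(2) by force
  qed (use r0 in auto)
qed

section \<open>Boundary behaviour of a conformal map onto a bounded Jordan domain\<close>

locale jordan_disc_map =
  fixes f :: "complex \<Rightarrow> complex" and \<gamma> \<gamma>' :: "complex \<Rightarrow> complex"
  assumes hol: "f holomorphic_on ball 0 1" and inj: "inj_on f (ball 0 1)" and bdd: "bounded (f ` ball 0 1)"
    and jordan: "homeomorphism (sphere 0 1) (frontier (f ` ball 0 1)) \<gamma> \<gamma>'"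
begin

lemma open_image: "open (f ` ball 0 1)"
  using open_mapping_thm3[OF hol open_ball inj] .

lemma frontier_disjoint: "frontier (f ` ball 0 1) \<inter> f ` ball 0 1 = {}"
  using open_image by (auto simp: frontier_def interior_open)

lemma boundary_oscillation:
  assumes q: "q \<in> sphere 0 1" and \<epsilon>: "0 < \<epsilon>"
  obtains \<rho> where "0 < \<rho>" "\<And>z w. z \<in> ball 0 1 \<inter> ball q \<rho> \<Longrightarrow> w \<in> ball 0 1 \<inter> ball q \<rho> \<Longrightarrow> dist (f z) (f w) < \<epsilon>"
proof -
  let ?\<Gamma> = "frontier (f ` ball 0 1)"
  obtain d0 where d0: "0 < d0" "cball (f 0) d0 \<subseteq> f ` ball 0 1"
    using open_image open_contains_cball by (metis centre_in_ball imageI zero_less_one)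
  \<comment> \<open>A crosscut of radius below \<open>1 - r\<close> has its midpoint outside the
    disc of radius \<open>r\<close>, so the image of the midpoint is at least \<open>d0\<close> away
    from \<open>f 0\<close>.\<close>
  obtain r where r: "0 < r" "r < 1" "\<And>z. z \<in> ball 0 1 \<Longrightarrow> f z \<in> cball (f 0) d0 \<Longrightarrow> norm z \<le> r"
    using conformal_map_proper[OF hol inj compact_cball d0(2)] by metis
  \<comment> \<open>\<open>2 * e \<le> d0\<close> keeps \<open>f 0\<close> outside the small disc
    about \<open>f c\<close>; \<open>4 * e \<le> \<epsilon>\<close> turns two distances to
    \<open>f c\<close> into the claimed bound.\<close>
  define e where "e = min d0 (\<epsilon> / 2) / 2"
  have e: "0 < e" "2 * e \<le> d0" "4 * e \<le> \<epsilon>" using d0 \<epsilon> by (auto simp: e_def)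
  obtain \<delta> where \<delta>: "0 < \<delta>" "\<And>T. \<lbrakk>T \<subseteq> ?\<Gamma>; \<And>x y. x \<in> T \<Longrightarrow> y \<in> T \<Longrightarrow> dist x y < \<delta>\<rbrakk> \<Longrightarrow>
       \<exists>S. T \<subseteq> S \<and> S \<subseteq> ?\<Gamma> \<and> compact S \<and> connected S \<and> (\<forall>x\<in>S. \<forall>y\<in>S. dist x y < e) \<and> (T = {} \<longrightarrow> S = {})"
    using jordan_curve_small_connected[OF jordan e(1)] by blast
  obtain \<rho> where \<rho>: "0 < \<rho>" "\<rho> < 1 - r" and osc: "\<And>z w. z \<in> ball 0 1 \<inter> sphere q \<rho> \<Longrightarrow> w \<in> ball 0 1 \<inter> sphere q \<rho> \<Longrightarrow> dist (f z) (f w) < min \<delta> e / 2"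
    using small_crosscut_image[OF hol inj bdd q, of "1 - r" "min \<delta> e / 2"] r e \<delta>(1) by auto
  define C where "C = ball 0 1 \<inter> sphere q \<rho>"
  have nq: "norm q = 1" using q by simp
  have cl: "dist x y \<le> min \<delta> e / 2" if "x \<in> closure (f ` C)" "y \<in> closure (f ` C)" for x y
  proof -
    have "f ` C \<times> f ` C \<subseteq> {p. dist (fst p) (snd p) \<le> min \<delta> e / 2}"
      using osc by (force simp: C_def)
    moreover have "closed {p :: complex \<times> complex. dist (fst p) (snd p) \<le> min \<delta> e / 2}"
      by (intro closed_Collect_le continuous_intros)
    ultimately have "closure (f ` C \<times> f ` C) \<subseteq> {p. dist (fst p) (snd p) \<le> min \<delta> e / 2}"
      by (rule closure_minimal)
    then show ?thesis using that by (auto simp: closure_Times)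
  qed
  \<comment> \<open>Where the crosscut image ends on the boundary curve. The set \<open>S1\<close>
    below is a small connected piece of the curve containing these ends, as Janiszewski's theorem
    asks for a connected intersection.\<close>
  define T where "T = closure (f ` C) \<inter> ?\<Gamma>"
  have "\<And>x y. x \<in> T \<Longrightarrow> y \<in> T \<Longrightarrow> dist x y < \<delta>"
    using cl \<delta>(1) e(1) by (fastforce simp: T_def)
  then have "\<exists>S. T \<subseteq> S \<and> S \<subseteq> ?\<Gamma> \<and> compact S \<and> connected S \<and> (\<forall>x\<in>S. \<forall>y\<in>S. dist x y < e) \<and> (T = {} \<longrightarrow> S = {})"
    by (intro \<delta>(2)) (auto simp: T_def)
  then obtain S1 where S1: "T \<subseteq> S1" "S1 \<subseteq> ?\<Gamma>" "compact S1" "connected S1" "\<And>x y. x \<in> S1 \<Longrightarrow> y \<in> S1 \<Longrightarrow> dist x y < e" "T = {} \<Longrightarrow> S1 = {}"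
    by blast
  define S where "S = closure (f ` C) \<union> S1"
  have "compact (closure (f ` C))"
    using bdd by (intro compact_closure[THEN iffD2] bounded_subset[OF bdd]) (auto simp: C_def)
  then have cS: "compact S" using S1(3) by (simp add: S_def compact_Un)
  have SG: "S \<inter> ?\<Gamma> = S1" using S1(1,2) by (auto simp: S_def T_def)
  define c where "c = q * of_real (1 - \<rho>)"
  have c: "c \<in> C"
  proof -
    have "q - c = q * of_real \<rho>" by (simp add: c_def algebra_simps)
    then have "dist q c = \<rho>" using \<rho> nq by (simp add: dist_norm norm_mult)
    moreover have "norm c < 1" using \<rho> nq r by (simp add: c_def norm_mult del: of_real_diff)
    ultimately show ?thesis by (simp add: C_def)
  qed
  have Sb: "S \<subseteq> ball (f c) (2 * e)"
  proof
    fix x assume x: "x \<in> S"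
    have fc: "f c \<in> closure (f ` C)" using c closure_subset[of "f ` C"] by auto
    show "x \<in> ball (f c) (2 * e)"
    proof (cases "x \<in> closure (f ` C)")
      case True
      then show ?thesis using cl[OF fc True] e by (simp add: min_def split: if_splits)
    next
      case False
      then have "x \<in> S1" using x by (simp add: S_def)
      then obtain t where t: "t \<in> T" using S1(6) by auto
      then have "dist x t < e" using S1(1,5) \<open>x \<in> S1\<close> by auto
      moreover have "dist (f c) t \<le> min \<delta> e / 2" using cl[OF fc] t by (auto simp: T_def)
      ultimately show ?thesis using e dist_triangle2[of "f c" x t] by (simp add: min_def split: if_splits)
    qed
  qed
  have fz: "f z \<in> ball (f c) (2 * e)" if z: "z \<in> ball 0 1 \<inter> ball q \<rho>" for z
  proof (rule ccontr)
    assume out: "f z \<notin> ball (f c) (2 * e)"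
    have "f c \<notin> cball (f 0) d0"
    proof
      assume "f c \<in> cball (f 0) d0"
      then have "norm c \<le> r" using r(3)[of c] c by (auto simp: C_def)
      moreover have "norm c = 1 - \<rho>" using \<rho> nq r by (simp add: c_def norm_mult del: of_real_diff)
      ultimately show False using \<rho> by simp
    qed
    then have out0: "f 0 \<notin> ball (f c) (2 * e)" using e by (auto simp: dist_commute)
    \<comment> \<open>\<open>S\<close> lies in a disc that contains neither point, and the
      complement of a disc in the plane is connected.\<close>
    have 1: "connected_component (- S) (f 0) (f z)"
      unfolding connected_component_def
    proof (intro exI conjI)
      show "connected (- ball (f c) (2 * e))" by (rule connected_complement_bounded_convex) auto
    qed (use Sb out out0 in auto)
    have 2: "connected_component (- ?\<Gamma>) (f 0) (f z)"
      unfolding connected_component_def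
    proof (intro exI conjI)
      show "connected (f ` ball 0 1)"
        using hol by (intro connected_continuous_image holomorphic_on_imp_continuous_on) auto
    qed (use frontier_disjoint z in auto)
    have "connected_component (- (S \<union> ?\<Gamma>)) (f 0) (f z)"
      by (rule Janiszewski[OF cS _ _ 1 2]) (use SG S1 in auto)
    then obtain N where N: "connected N" "N \<subseteq> - (S \<union> ?\<Gamma>)" "f 0 \<in> N" "f z \<in> N"
      unfolding connected_component_def by blast
    have Nf: "N \<subseteq> f ` ball 0 1"
    proof -
      have "f 0 \<in> f ` ball 0 1" by simp
      then show ?thesis using connected_Int_frontier[OF N(1), of "f ` ball 0 1"] N(2,3) by blast
    qed
    obtain k where k: "k holomorphic_on f ` ball 0 1" "\<And>z. z \<in> ball 0 1 \<Longrightarrow> k (f z) = z"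
      using holomorphic_has_inverse[OF hol open_ball inj] by metis
    \<comment> \<open>Along \<open>N\<close> the distance of the preimage from \<open>q\<close>
      varies continuously from 1 to below \<open>\<rho>\<close>, so it takes the value
      \<open>\<rho>\<close>, and there \<open>N\<close> meets the crosscut image.\<close>
    have "connected ((\<lambda>w. dist q (k w)) ` N)"
      using k(1) Nf N(1) by (intro connected_continuous_image continuous_intros)
         (auto intro: continuous_on_subset holomorphic_on_imp_continuous_on)
    moreover have "dist q (k (f 0)) \<in> (\<lambda>w. dist q (k w)) ` N" "dist q (k (f z)) \<in> (\<lambda>w. dist q (k w)) ` N"
      using N by auto
    moreover have "dist q (k (f 0)) = 1" using k(2) nq by simp
    moreover have "dist q (k (f z)) < \<rho>" using k(2) z by simp
    ultimately have "\<rho> \<in> (\<lambda>w. dist q (k w)) ` N"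
      using \<rho> r by (elim connectedD_interval[of _ "dist q (k (f z))" "dist q (k (f 0))"]) auto
    then obtain w where w: "w \<in> N" "dist q (k w) = \<rho>" by auto
    then obtain u where u: "u \<in> ball 0 1" "w = f u" using Nf by auto
    then have "u \<in> C" using w k(2) by (simp add: C_def)
    then have "w \<in> S" using u closure_subset[of "f ` C"] by (auto simp: S_def)
    then show False using w N by auto
  qed
  show ?thesis
  proof (rule that[OF \<rho>(1)])
    fix z w assume "z \<in> ball 0 1 \<inter> ball q \<rho>" "w \<in> ball 0 1 \<inter> ball q \<rho>"
    from fz[OF this(1)] fz[OF this(2)] show "dist (f z) (f w) < \<epsilon>"
      using e dist_triangle3[of "f z" "f w" "f c"] by simp
  qed
qed

text \<open>Small oscillation near every point of the closed disc becomes uniform continuity by a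
  Lebesgue number argument, and uniformly continuous maps extend to the closure.\<close>

lemma continuous_extension:
  obtains g where "continuous_on (cball 0 1) g" "\<And>z. z \<in> ball 0 1 \<Longrightarrow> g z = f z"
proof -
  have "uniformly_continuous_on (ball 0 1) f"
    unfolding uniformly_continuous_on_def
  proof (intro allI impI)
    fix \<epsilon> :: real assume \<epsilon>: "0 < \<epsilon>"
    have "\<exists>\<rho>>0. \<forall>z \<in> ball 0 1 \<inter> ball p \<rho>. \<forall>w \<in> ball 0 1 \<inter> ball p \<rho>. dist (f z) (f w) < \<epsilon>" if p: "p \<in> cball 0 1" for p
    proof (cases "p \<in> sphere 0 1")
      case True
      then show ?thesis using boundary_oscillation[OF True \<epsilon>] by metis
    next
      case False
      then have pb: "p \<in> ball 0 1" using p by auto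
      then obtain d where d: "d > 0" "\<And>z. z \<in> ball 0 1 \<Longrightarrow> dist z p < d \<Longrightarrow> dist (f z) (f p) < \<epsilon> / 2"
        using holomorphic_on_imp_continuous_on[OF hol] \<epsilon> unfolding continuous_on_iff by (meson half_gt_zero)
      have "dist (f z) (f w) < \<epsilon>" if "z \<in> ball 0 1 \<inter> ball p d" "w \<in> ball 0 1 \<inter> ball p d" for z w
        using d(2)[of z] d(2)[of w] that dist_triangle2[of "f z" "f w" "f p"] by (auto simp: dist_commute)
      then show ?thesis using d(1) by blast
    qed
    then obtain \<rho> where \<rho>: "\<And>p. p \<in> cball 0 1 \<Longrightarrow> 0 < \<rho> p"
      "\<And>p z w. p \<in> cball 0 1 \<Longrightarrow> z \<in> ball 0 1 \<inter> ball p (\<rho> p) \<Longrightarrow> w \<in> ball 0 1 \<inter> ball p (\<rho> p) \<Longrightarrow> dist (f z) (f w) < \<epsilon>"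
      by metis
    obtain d where d: "0 < d" "\<And>x. x \<in> cball 0 1 \<Longrightarrow> \<exists>G \<in> (\<lambda>p. ball p (\<rho> p)) ` cball 0 1. ball x d \<subseteq> G"
    proof (rule Heine_Borel_lemma[of "cball (0::complex) 1" "(\<lambda>p. ball p (\<rho> p)) ` cball 0 1"])
      show "cball 0 1 \<subseteq> \<Union> ((\<lambda>p. ball p (\<rho> p)) ` cball 0 1)" using \<rho>(1) by force
    qed auto
    show "\<exists>d>0. \<forall>x\<in>ball 0 1. \<forall>x'\<in>ball 0 1. dist x' x < d \<longrightarrow> dist (f x') (f x) < \<epsilon>"
    proof (intro exI conjI ballI impI)
      fix x x' :: complex assume x: "x \<in> ball 0 1" "x' \<in> ball 0 1" "dist x' x < d"
      obtain p where p: "p \<in> cball 0 1" "ball x d \<subseteq> ball p (\<rho> p)" using d(2)[of x] x by force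
      have "x \<in> ball x d" "x' \<in> ball x d" using x d(1) by (auto simp: dist_commute)
      then show "dist (f x') (f x) < \<epsilon>" using \<rho>(2)[OF p(1), of x' x] p x by blast
    qed (rule d(1))
  qed
  from uniformly_continuous_on_extension_on_closure[OF this]
  obtain g where g: "uniformly_continuous_on (closure (ball 0 1)) g" "\<And>x. x \<in> ball 0 1 \<Longrightarrow> f x = g x" by metis
  then show ?thesis using that[of g] uniformly_continuous_imp_continuous by force
qed

text \<open>If \<open>g q\<close> were an interior value, properness would keep all points with
  nearby values inside a smaller disc, yet points close to \<open>q\<close> have such
  values.\<close>

lemma extension_boundary:
  assumes g: "continuous_on (cball 0 1) g" "\<And>z. z \<in> ball 0 1 \<Longrightarrow> g z = f z" and q: "q \<in> sphere 0 1"
  shows "g q \<in> frontier (f ` ball 0 1)"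
proof -
  have "g ` closure (ball 0 1) \<subseteq> closure (g ` ball 0 1)"
    using g(1) by (intro image_closure_subset) (auto intro: subsetD[OF closure_subset])
  moreover have "g ` ball 0 1 = f ` ball 0 1" using g(2) by (intro image_cong) auto
  ultimately have "g q \<in> closure (f ` ball 0 1)" using q by auto
  moreover have "g q \<notin> f ` ball 0 1"
  proof
    assume "g q \<in> f ` ball 0 1"
    then obtain d where d: "0 < d" "cball (g q) d \<subseteq> f ` ball 0 1"
      using open_image open_contains_cball by blast
    obtain r where r: "0 < r" "r < 1" "\<And>z. z \<in> ball 0 1 \<Longrightarrow> f z \<in> cball (g q) d \<Longrightarrow> norm z \<le> r"
      using conformal_map_proper[OF hol inj compact_cball d(2)] by metis
    obtain e where e: "0 < e" "\<And>z. z \<in> cball 0 1 \<Longrightarrow> dist z q < e \<Longrightarrow> dist (g z) (g q) < d"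
      using g(1) q d(1) unfolding continuous_on_iff by (metis mem_sphere_0 mem_cball_0 order_refl)
    \<comment> \<open>A radius beyond \<open>r\<close> that puts \<open>t * q\<close> within
      \<open>e\<close> of \<open>q\<close>.\<close>
    define t where "t = max ((1 + r) / 2) (1 - e / 2)"
    have t: "r < t" "t < 1" "1 - t < e" "0 < t" using r e(1) by (auto simp: t_def max_def field_simps)
    define z where "z = of_real t * q"
    have nz: "norm z = t" using q t by (simp add: z_def norm_mult)
    have "q - z = of_real (1 - t) * q" by (simp add: z_def algebra_simps)
    then have "norm (q - z) = 1 - t" using q t by (simp only: norm_mult norm_of_real) simp
    then have "dist z q < e" using t by (simp add: dist_norm norm_minus_commute)
    then have "dist (f z) (g q) < d" using e(2)[of z] nz t g(2)[of z] by simp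
    then have "norm z \<le> r" using r(3)[of z] nz t by (simp add: dist_commute)
    then show False using nz t by simp
  qed
  ultimately show ?thesis using open_image by (simp add: frontier_def interior_open)
qed

text \<open>Finitely many rotations of a boundary arc cover the circle, so a product of rotated copies of
  \<open>g - p\<close> vanishes on the whole circle.\<close>

lemma extension_not_constant_on_arc:
  assumes g: "continuous_on (cball 0 1) g" "\<And>z. z \<in> ball 0 1 \<Longrightarrow> g z = f z"
    and w0: "w0 \<in> sphere 0 1" and r: "0 < r" and c: "\<And>w. w \<in> sphere 0 1 \<inter> ball w0 r \<Longrightarrow> g w = p"
  shows False
proof -
  \<comment> \<open>The rotation step \<open>2 * pi / n\<close> is shorter than \<open>r\<close>, so
    every point of the circle has a rotate on the arc.\<close>
  obtain n :: nat where n: "2 * pi / r < real n" using reals_Archimedean2 by blast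
  have n0: "n > 0" using n r by (metis divide_pos_pos gr0I less_trans of_nat_0 pi_gt_zero less_irrefl mult_pos_pos zero_less_numeral)
  define \<omega> where "\<omega> k = cis (2 * pi * real k / real n)" for k
  define P where "P z = (\<Prod>k<n. g (\<omega> k * z) - p)" for z
  have nw: "norm (\<omega> k * z) = norm z" for k z by (simp add: \<omega>_def norm_mult)
  have sphere0: "P u = 0" if u: "norm u = 1" for u
  proof -
    have u0: "u \<noteq> 0" using u by auto
    have "w0 / u \<in> sphere 0 1" using w0 u by (simp add: norm_divide)
    then obtain t where t: "-pi < t" "t \<le> pi" "w0 / u = cis t" using sphere_eq_cis by blast
    define s where "s = (if 0 \<le> t then t else t + 2 * pi)"
    have s: "0 \<le> s" "s < 2 * pi" "w0 / u = cis s"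
      using t pi_gt_zero by (auto simp: s_def cis_mult[symmetric])
    define k where "k = nat \<lfloor>s * real n / (2 * pi)\<rfloor>"
    have k: "real k \<le> s * real n / (2 * pi)" "s * real n / (2 * pi) < real k + 1"
      using s by (auto simp: k_def)
    have "s * real n / (2 * pi) < real n" using s n0 by (simp add: field_simps)
    then have kn: "k < n" using k(1) by simp
    have "norm (\<omega> k * u - w0) = norm (cis (2 * pi * real k / real n) - cis s)"
    proof -
      have "w0 = cis s * u" using s(3) u0 by (simp add: field_simps)
      then have "\<omega> k * u - w0 = (cis (2 * pi * real k / real n) - cis s) * u" by (simp add: \<omega>_def algebra_simps)
      then show ?thesis using u by (simp add: norm_mult)
    qed
    also have "\<dots> \<le> \<bar>2 * pi * real k / real n - s\<bar>" by (rule norm_cis_diff_le)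
    also have "\<dots> \<le> 2 * pi / real n"
    proof -
      have "2 * pi * real k / real n \<le> s" using k(1) n0 pi_gt_zero by (simp add: field_simps)
      moreover have "s \<le> 2 * pi * real k / real n + 2 * pi / real n" using k(2) n0 pi_gt_zero by (simp add: field_simps)
      ultimately show ?thesis by simp
    qed
    also have "\<dots> < r" using n n0 r by (simp add: field_simps)
    finally have "\<omega> k * u \<in> sphere 0 1 \<inter> ball w0 r" using u by (simp add: nw dist_norm norm_minus_commute)
    from c[OF this] show ?thesis using kn by (auto simp: P_def)
  qed
  have cont: "continuous_on (cball 0 1) P"
    unfolding P_def by (intro continuous_intros continuous_on_compose2[OF g(1)]) (auto simp: nw)
  have hP: "P holomorphic_on ball 0 1"
  proof -
    have "(\<lambda>z. f (\<omega> k * z)) holomorphic_on ball 0 1" for k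
    proof -
      have "(\<lambda>z. \<omega> k * z) holomorphic_on ball 0 1" by (intro holomorphic_intros)
      moreover have "(\<lambda>z. \<omega> k * z) ` ball 0 1 \<subseteq> ball 0 1" by (auto simp: nw)
      ultimately show ?thesis using holomorphic_on_compose_gen[OF _ hol] by (auto simp: o_def)
    qed
    then have "(\<lambda>z. \<Prod>k<n. f (\<omega> k * z) - p) holomorphic_on ball 0 1" by (intro holomorphic_intros)
    then show ?thesis by (rule holomorphic_transform) (auto simp: P_def g(2) nw)
  qed
  have zero: "P z = 0" if "z \<in> ball 0 1" for z
  proof -
    have "norm (P z) \<le> 0"
      by (rule maximum_modulus_frontier[of P "cball 0 1"]) (use hP cont sphere0 that in auto)
    then show ?thesis by simp
  qed
  have "ball 0 1 \<subseteq> (\<Union>k<n. {z \<in> ball 0 1. f (\<omega> k * z) = p})"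
  proof
    fix z :: complex assume z: "z \<in> ball 0 1"
    obtain k where "k < n" "g (\<omega> k * z) = p" using zero[OF z] by (auto simp: P_def)
    then show "z \<in> (\<Union>k<n. {z \<in> ball 0 1. f (\<omega> k * z) = p})" using z by (auto simp: g(2) nw)
  qed
  \<comment> \<open>Once the maximum principle has made the product vanish on the disc, the disc is
    a finite union of zero sets of the factors; \<open>f\<close> is injective, so each has at most
    one point.\<close>
  moreover have "finite {z \<in> ball 0 1. f (\<omega> k * z) = p}" for k
  proof (rule finite_subset)
    have "a = b" if "a \<in> ball 0 1" "f (\<omega> k * a) = p" "b \<in> ball 0 1" "f (\<omega> k * b) = p" for a b
    proof -
      have "\<omega> k * a = \<omega> k * b" by (rule inj_onD[OF inj]) (use that in \<open>auto simp: nw\<close>)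
      then show ?thesis by (simp add: \<omega>_def)
    qed
    then show "{z \<in> ball 0 1. f (\<omega> k * z) = p} \<subseteq> {SOME z. z \<in> ball 0 1 \<and> f (\<omega> k * z) = p}"
      by (auto intro!: some_equality[symmetric])
  qed simp
  ultimately have "finite (ball (0::complex) 1)" by (meson finite_UN finite_lessThan finite_subset)
  then show False using uncountable_ball[of 1 "0::complex"] countable_finite by auto
qed

text \<open>If two boundary points had one image \<open>p\<close>, the chord between them would map
  to a Jordan curve \<open>J\<close> touching the boundary curve only at \<open>p\<close>. The
  boundary curve without \<open>p\<close> is connected, hence on one side of \<open>J\<close>, while
  one half of the disc is mapped to the other side. The circular arc of that half can then only go
  to \<open>p\<close>, and \<open>g\<close> would be constant on an arc.\<close>

lemma extension_inj_sphere:
  assumes g: "continuous_on (cball 0 1) g" "\<And>z. z \<in> ball 0 1 \<Longrightarrow> g z = f z"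
    and q1: "q1 \<in> sphere 0 1" and q2: "q2 \<in> sphere 0 1" and eq: "g q1 = g q2"
  shows "q1 = q2"
proof (rule ccontr)
  assume ne: "q1 \<noteq> q2"
  let ?\<Gamma> = "frontier (f ` ball 0 1)"
  define p where "p = g q1"
  define c where "c = g \<circ> linepath q1 q2"
  define J where "J = path_image c"
  \<comment> \<open>Vanishes exactly on the line through \<open>q1\<close> and \<open>q2\<close> and
    has opposite signs on its two sides.\<close>
  define side where "side z = Im ((z - q1) / (q2 - q1))" for z
  have n1: "norm q1 = 1" "norm q2 = 1" using q1 q2 by auto
  \<comment> \<open>Strict convexity of the disc in quantitative form: the interior of the chord
    lies in the open disc, its ends do not.\<close>
  have chord: "(norm (q1 + of_real t * (q2 - q1)))\<^sup>2 = 1 + (norm (q2 - q1))\<^sup>2 * (t * (t - 1))" for t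
  proof -
    have "(Re q1)\<^sup>2 + (Im q1)\<^sup>2 = 1" "(Re q2)\<^sup>2 + (Im q2)\<^sup>2 = 1"
      using n1 by (simp_all flip: cmod_power2)
    then show ?thesis unfolding cmod_power2 by simp algebra
  qed
  have lp: "linepath q1 q2 t = q1 + of_real t * (q2 - q1)" for t
    by (simp add: linepath_def scaleR_conv_of_real algebra_simps)
  have inb: "q1 + of_real t * (q2 - q1) \<in> ball 0 1 \<longleftrightarrow> 0 < t \<and> t < 1" for t
  proof -
    have "norm (q1 + of_real t * (q2 - q1)) < 1 \<longleftrightarrow> (norm (q1 + of_real t * (q2 - q1)))\<^sup>2 < 1"
      using abs_square_less_1[of "norm (q1 + of_real t * (q2 - q1))"] by simp
    also have "\<dots> \<longleftrightarrow> t * (t - 1) < 0"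
      unfolding chord using ne by (simp add: mult_less_0_iff)
    also have "\<dots> \<longleftrightarrow> 0 < t \<and> t < 1" by (auto simp: mult_less_0_iff)
    finally show ?thesis by simp
  qed
  have seg: "linepath q1 q2 t \<in> cball 0 1" if "t \<in> {0..1}" for t
  proof (cases "t = 0 \<or> t = 1")
    case True then show ?thesis using n1 by (auto simp: lp)
  next
    case False
    then have "linepath q1 q2 t \<in> ball 0 1" unfolding lp inb using that by auto
    then show ?thesis by simp
  qed
  have side_lp: "side (linepath q1 q2 t) = 0" for t
    using ne by (simp add: side_def lp)
  have side0: "\<exists>t. 0 < t \<and> t < 1 \<and> z = linepath q1 q2 t" if z: "z \<in> ball 0 1" "side z = 0" for z
  proof -
    define t where "t = Re ((z - q1) / (q2 - q1))"
    have "(z - q1) / (q2 - q1) = of_real t" using z(2) by (simp add: side_def t_def complex_eq_iff)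
    then have "z = q1 + of_real t * (q2 - q1)" using ne by (simp add: field_simps)
    then show ?thesis using inb[of t] z(1) by (auto simp: lp)
  qed
  have pG: "p \<in> ?\<Gamma>" unfolding p_def by (rule extension_boundary[OF g q1])
  have ct: "c t = (if t = 0 \<or> t = 1 then p else f (linepath q1 q2 t))" if "t \<in> {0..1}" for t
    using that inb[of t] g(2) eq by (auto simp: c_def p_def lp)
  have Jf: "f z \<in> J \<longleftrightarrow> side z = 0" if z: "z \<in> ball 0 1" for z
  proof
    assume "f z \<in> J"
    then obtain t where t: "t \<in> {0..1}" "f z = c t" by (auto simp: J_def path_image_def)
    have "f z \<noteq> p" using pG frontier_disjoint z by auto
    then have t1: "t \<noteq> 0" "t \<noteq> 1" using t ct[OF t(1)] by auto
    then have "linepath q1 q2 t \<in> ball 0 1" unfolding lp inb using t by auto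
    then have "z = linepath q1 q2 t" using inj_onD[OF inj _ z] t ct[OF t(1)] t1 by auto
    then show "side z = 0" using side_lp by simp
  next
    assume "side z = 0"
    then obtain t where t: "0 < t" "t < 1" "z = linepath q1 q2 t" using side0[OF z] by auto
    then have "f z = c t" using ct[of t] by auto
    then show "f z \<in> J" using t by (auto simp: J_def path_image_def)
  qed
  have JG: "J \<inter> ?\<Gamma> \<subseteq> {p}"
  proof
    fix x assume x: "x \<in> J \<inter> ?\<Gamma>"
    then obtain t where t: "t \<in> {0..1}" "x = c t" by (auto simp: J_def path_image_def)
    show "x \<in> {p}"
    proof (cases "t = 0 \<or> t = 1")
      case True then show ?thesis using t ct[OF t(1)] by simp
    next
      case False
      then have "linepath q1 q2 t \<in> ball 0 1" unfolding lp inb using t by auto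
      then have "x \<in> f ` ball 0 1" using False t ct[OF t(1)] by auto
      then show ?thesis using x frontier_disjoint by auto
    qed
  qed
  have simple: "simple_path c"
    unfolding simple_path_def
  proof
    show "path c" unfolding path_def c_def
      by (intro continuous_on_compose continuous_on_subset[OF g(1)] continuous_on_linepath) (use seg in auto)
    show "loop_free c"
      unfolding loop_free_def
    proof (intro ballI impI)
      fix x y assume xy: "x \<in> {0..1}" "y \<in> {0..1}" "c x = c y"
      have ins: "linepath q1 q2 t \<in> ball 0 1" if "t \<in> {0..1}" "t \<noteq> 0" "t \<noteq> 1" for t
        unfolding lp inb using that by auto
      show "x = y \<or> x = 0 \<and> y = 1 \<or> x = 1 \<and> y = 0"
      proof (cases "(x = 0 \<or> x = 1) \<or> (y = 0 \<or> y = 1)")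
        case True
        have "f w \<noteq> p" if "w \<in> ball 0 1" for w using pG frontier_disjoint that by auto
        then show ?thesis using True xy ct[OF xy(1)] ct[OF xy(2)] ins[OF xy(1)] ins[OF xy(2)] by metis
      next
        case False
        then have "linepath q1 q2 x = linepath q1 q2 y"
          using xy(3) ct[OF xy(1)] ct[OF xy(2)] ins[OF xy(1)] ins[OF xy(2)] inj_onD[OF inj] by auto
        then show ?thesis using ne by (simp add: lp)
      qed
    qed
  qed
  have "pathfinish c = pathstart c" using eq by (simp add: c_def pathfinish_def pathstart_def linepath_def)
  note Jordan = Jordan_inside_outside[OF simple this, folded J_def]
  define D where "D \<sigma> = {z \<in> ball 0 1. 0 < \<sigma> * side z}" for \<sigma> :: real
  have fD: "f ` D \<sigma> \<inter> J = {}" if "\<sigma> \<noteq> 0" for \<sigma> using Jf that by (auto simp: D_def)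
  have connD: "connected (f ` D \<sigma>)" for \<sigma>
  proof -
    have "side (of_real u * x + of_real v * y) = u * side x + v * side y" if "u + v = 1" for u v x y
    proof -
      have "of_real u * x + of_real v * y - q1 = of_real u * (x - q1) + of_real v * (y - q1)"
      proof -
        have "q1 = (of_real u + of_real v) * q1" using that by (metis mult_1 of_real_1 of_real_add)
        then show ?thesis by (simp add: algebra_simps)
      qed
      then show ?thesis by (simp add: side_def add_divide_distrib times_divide_eq_right[symmetric] del: times_divide_eq_right)
    qed
    note aff = this
    have "convex {z. 0 < \<sigma> * side z}"
    proof (rule convexI)
      fix x y and u v :: real assume *: "x \<in> {z. 0 < \<sigma> * side z}" "y \<in> {z. 0 < \<sigma> * side z}" "0 \<le> u" "0 \<le> v" "u + v = 1"
      have "\<sigma> * side (u *\<^sub>R x + v *\<^sub>R y) = u * (\<sigma> * side x) + v * (\<sigma> * side y)"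
        using aff[OF *(5), of x y] by (simp add: scaleR_conv_of_real algebra_simps)
      also have "\<dots> > 0"
        using * by (cases "u = 0") (auto intro!: add_pos_nonneg)
      finally show "u *\<^sub>R x + v *\<^sub>R y \<in> {z. 0 < \<sigma> * side z}" by simp
    qed
    then have "convex (ball 0 1 \<inter> {z. 0 < \<sigma> * side z})" by (intro convex_Int convex_ball)
    moreover have "D \<sigma> = ball 0 1 \<inter> {z. 0 < \<sigma> * side z}" by (auto simp: D_def)
    ultimately have "connected (D \<sigma>)" by (simp only: convex_connected)
    then show ?thesis
      by (intro connected_continuous_image continuous_on_subset[OF holomorphic_on_imp_continuous_on[OF hol]])
         (auto simp: D_def)
  qed
  have sub: "K \<subseteq> inside J \<or> K \<subseteq> outside J" if K: "connected K" "K \<inter> J = {}" for K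
  proof -
    have "K \<subseteq> inside J \<union> outside J" using K(2) Jordan by auto
    moreover have "open (inside J)" "open (outside J)" "inside J \<inter> outside J = {}" using Jordan by auto
    ultimately have "inside J \<inter> K = {} \<or> outside J \<inter> K = {}"
      by (intro connectedD[OF K(1)]) auto
    then show ?thesis using \<open>K \<subseteq> inside J \<union> outside J\<close> by blast
  qed
  \<comment> \<open>\<open>J\<close> is the frontier of both complementary components, so a
    neighbourhood of the midpoint's image, which lies in the open image of the disc, meets
    \<open>Y\<close>; its preimage there lies off the chord, in one of the half discs.\<close>
  have not_same: False if XY: "open Y" "X \<inter> Y = {}" "frontier Y = J" and D: "f ` D 1 \<subseteq> X" "f ` D (-1) \<subseteq> X" for X Y
  proof -
    define m where "m = linepath q1 q2 (1/2)"
    have m: "m \<in> ball 0 1" unfolding m_def lp inb by simp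
    have "f m \<in> J" using Jf[OF m] side_lp by (simp add: m_def)
    then have "f m \<in> closure Y" using XY(3) by (auto simp: frontier_def)
    then have "Y \<inter> f ` ball 0 1 \<noteq> {}"
      using open_Int_closure_eq_empty[OF open_image, of Y] imageI[OF m, of f] by blast
    then obtain u where u: "u \<in> ball 0 1" "f u \<in> Y" by auto
    have "f u \<notin> J" using u XY(1,3) by (auto simp: frontier_def interior_open)
    then have "side u \<noteq> 0" using Jf u by auto
    then have "u \<in> D 1 \<or> u \<in> D (-1)" using u by (auto simp: D_def)
    then show False using D u XY by auto
  qed
  have "connected (?\<Gamma> - {p})"
  proof -
    have h: "continuous_on (sphere 0 1) \<gamma>" "\<gamma> ` sphere 0 1 = ?\<Gamma>" "\<gamma>' ` ?\<Gamma> = sphere 0 1"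
      "\<And>x. x \<in> ?\<Gamma> \<Longrightarrow> \<gamma> (\<gamma>' x) = x" "\<And>x. x \<in> sphere 0 1 \<Longrightarrow> \<gamma>' (\<gamma> x) = x"
      using jordan by (auto simp: homeomorphism_def)
    have "?\<Gamma> - {p} = \<gamma> ` (sphere 0 1 - {\<gamma>' p})"
    proof (intro equalityI subsetI)
      fix x assume x: "x \<in> ?\<Gamma> - {p}"
      then have x1: "x = \<gamma> (\<gamma>' x)" using h(4)[of x] by simp
      have "\<gamma>' x \<noteq> \<gamma>' p"
      proof
        assume "\<gamma>' x = \<gamma>' p"
        then show False using x x1 h(4)[OF pG] by simp
      qed
      then have "\<gamma>' x \<in> sphere 0 1 - {\<gamma>' p}" using h(3) x by blast
      then show "x \<in> \<gamma> ` (sphere 0 1 - {\<gamma>' p})" by (subst x1) (rule imageI)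
    next
      fix x assume "x \<in> \<gamma> ` (sphere 0 1 - {\<gamma>' p})"
      then show "x \<in> ?\<Gamma> - {p}" using h by auto
    qed
    moreover have "\<gamma>' p \<in> sphere 0 1" using h(3) pG by blast
    ultimately show ?thesis
      using connected_continuous_image[OF continuous_on_subset[OF h(1)] connected_circle_minus_point] by auto
  qed
  then have "?\<Gamma> - {p} \<subseteq> inside J \<or> ?\<Gamma> - {p} \<subseteq> outside J" by (rule sub) (use JG in auto)
  then obtain X Y where XY: "?\<Gamma> - {p} \<subseteq> X" "open X" "open Y" "X \<inter> Y = {}" "frontier X = J" "frontier Y = J"
      "\<And>K. connected K \<Longrightarrow> K \<inter> J = {} \<Longrightarrow> K \<subseteq> X \<or> K \<subseteq> Y"
    using sub Jordan by (metis inf_commute)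
  have "\<not> (f ` D 1 \<subseteq> X \<and> f ` D (-1) \<subseteq> X)" using not_same[OF XY(3,4,6)] by blast
  then obtain \<sigma> where \<sigma>: "\<sigma> \<noteq> 0" "f ` D \<sigma> \<subseteq> Y" "\<sigma> \<in> {1, -1}" 
    using XY(7)[OF connD fD] by (metis insertCI neg_equal_0_iff_equal one_neq_zero)
  \<comment> \<open>Values on the arc are limits of values in \<open>Y\<close>, hence outside the
    open set \<open>X\<close>, and the boundary curve meets the complement of \<open>X\<close> only
    in \<open>p\<close>.\<close>
  have const: "g w = p" if w: "w \<in> sphere 0 1" "0 < \<sigma> * side w" for w
  proof -
    define U where "U = {z. 0 < \<sigma> * side z}"
    have oU: "open U" unfolding U_def side_def using ne by (intro open_Collect_less continuous_intros) auto
    have "w \<in> U \<inter> closure (ball 0 1)" using w by (simp add: U_def)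
    then have wc: "w \<in> closure (D \<sigma>)"
      using open_Int_closure_subset[OF oU, of "ball 0 1"] by (auto simp: D_def U_def Int_def conj_commute)
    have "D \<sigma> \<subseteq> cball 0 1" by (auto simp: D_def)
    then have "closure (D \<sigma>) \<subseteq> cball 0 1" by (rule closure_minimal) simp
    then have "g ` closure (D \<sigma>) \<subseteq> closure (g ` D \<sigma>)"
      using g(1) by (intro image_closure_subset) (auto intro: continuous_on_subset subsetD[OF closure_subset])
    then have "g w \<in> closure (g ` D \<sigma>)" using wc by blast
    moreover have "g ` D \<sigma> = f ` D \<sigma>" using g(2) by (intro image_cong) (auto simp: D_def)
    ultimately have "g w \<in> closure Y" using \<sigma>(2) closure_mono by (metis subsetD)
    then have "g w \<notin> X" using XY(2,4) open_Int_closure_eq_empty[of X Y] by auto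
    then show ?thesis using XY(1) extension_boundary[OF g w(1)] by auto
  qed
  obtain w0 where w0: "w0 \<in> sphere 0 1" "0 < \<sigma> * side w0"
  proof -
    \<comment> \<open>The unit normal of the chord towards the chosen side. Since
      \<open>Re (q1 / (q2 - q1)) = -1/2\<close>, the imaginary part of that quotient is below
      \<open>1 / norm (q2 - q1)\<close> in modulus, so this point of the circle lies beyond the
      chord.\<close>
    define v where "v = of_real \<sigma> * \<i> * ((q2 - q1) / of_real (norm (q2 - q1)))"
    have nv: "norm v = 1" using ne \<sigma>(3) by (auto simp: v_def norm_mult norm_divide)
    have "\<sigma> * side v > 0"
    proof -
      have d: "norm (q2 - q1) > 0" "norm (q2 - q1) \<le> 2" using ne norm_triangle_ineq4[of q2 q1] n1 by auto
      have "v / (q2 - q1) = of_real (\<sigma> / norm (q2 - q1)) * \<i>" using ne by (simp add: v_def field_simps)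
      then have "side v = \<sigma> / norm (q2 - q1) - Im (q1 / (q2 - q1))"
        by (simp add: side_def diff_divide_distrib)
      moreover have "\<bar>Im (q1 / (q2 - q1))\<bar> < 1 / norm (q2 - q1)"
      proof -
        have "(norm (q1 / (q2 - q1)))\<^sup>2 = (Re (q1 / (q2 - q1)))\<^sup>2 + (Im (q1 / (q2 - q1)))\<^sup>2" by (rule cmod_power2)
        moreover have "Re (q1 / (q2 - q1)) = - 1 / 2"
        proof -
          have s: "(Re q1)\<^sup>2 + (Im q1)\<^sup>2 = 1" "(Re q2)\<^sup>2 + (Im q2)\<^sup>2 = 1"
            using n1 by (simp_all flip: cmod_power2)
          have nz: "(Re q2 - Re q1)\<^sup>2 + (Im q2 - Im q1)\<^sup>2 \<noteq> 0"
            using ne by (auto simp: complex_eq_iff sum_power2_eq_zero_iff)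
          have "2 * (Re q1 * (Re q2 - Re q1) + Im q1 * (Im q2 - Im q1)) = - ((Re q2 - Re q1)\<^sup>2 + (Im q2 - Im q1)\<^sup>2)"
            using s by algebra
          then show ?thesis using nz by (simp add: Re_divide field_simps)
        qed
        ultimately have "(Im (q1 / (q2 - q1)))\<^sup>2 < (1 / norm (q2 - q1))\<^sup>2"
          using n1 by (simp add: norm_divide power2_eq_square)
        then have "\<bar>Im (q1 / (q2 - q1))\<bar>\<^sup>2 < (1 / norm (q2 - q1))\<^sup>2" by simp
        then show ?thesis by (rule power2_less_imp_less) simp
      qed
      ultimately show ?thesis using \<sigma>(3) by (auto simp: abs_if split: if_splits)
    qed
    then show ?thesis using that nv by auto
  qed
  have "open {z. 0 < \<sigma> * side z}" unfolding side_def using ne by (intro open_Collect_less continuous_intros) auto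
  then obtain r where r: "0 < r" "ball w0 r \<subseteq> {z. 0 < \<sigma> * side z}" using w0(2) openE by blast
  show False
    by (rule extension_not_constant_on_arc[OF g w0(1) r(1), of p]) (use const r(2) in auto)
qed

end

subsection \<open>Caratheodory's theorem on the sphere\<close>

definition shift :: "complex \<Rightarrow> csphere \<Rightarrow> csphere" where
  "shift a p = (case p of None \<Rightarrow> None | Some z \<Rightarrow> Some (z + a))"

lemma recip_simps [simp]:
  "recip None = Some 0" "recip (Some 0) = None" "z \<noteq> 0 \<Longrightarrow> recip (Some z) = Some (1 / z)"
  by (auto simp: recip_def)

lemma recip_recip [simp]: "recip (recip p) = p"
  by (auto simp: recip_def split: option.split)

lemma recip_eq_None [simp]: "recip p = None \<longleftrightarrow> p = Some 0"
  by (auto simp: recip_def split: option.split)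

lemma recip_eq_0 [simp]: "recip p = Some 0 \<longleftrightarrow> p = None"
  by (auto simp: recip_def split: option.split)

lemma shift_simps [simp]: "shift a None = None" "shift a (Some z) = Some (z + a)"
  by (auto simp: shift_def)

lemma shift_eq_None [simp]: "shift a p = None \<longleftrightarrow> p = None"
  by (auto simp: shift_def split: option.split)

lemma shift_shift [simp]: "shift a (shift (- a) p) = p" "shift (- a) (shift a p) = p"
  by (auto simp: shift_def split: option.split)

lemma topspace_riemann_sphere [simp]: "topspace riemann_sphere = UNIV"
  by (auto simp: riemann_sphere_def) (metis not_None_eq rangeI)

text \<open>Neighbourhoods of infinity are those with compact complement; a complement within radius
  \<open>R\<close> in one chart amounts to a disc of radius \<open>1 / R\<close> about 0 in the
  other.\<close>

lemma openin_sphere_charts: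
  "openin riemann_sphere U \<longleftrightarrow> open {z. Some z \<in> U} \<and> open {w. recip (Some w) \<in> U}"
proof -
  define A where "A = {z. Some z \<in> U}"
  define B where "B = {w. recip (Some w) \<in> U}"
  have oin: "openin riemann_sphere U \<longleftrightarrow> open A \<and> (None \<in> U \<longrightarrow> compact (- A))"
  proof (cases "None \<in> U")
    case False
    have "(\<exists>V. open V \<and> U = Some ` V) \<longleftrightarrow> open A"
    proof
      assume "\<exists>V. open V \<and> U = Some ` V"
      then show "open A" by (auto simp: A_def image_iff)
    next
      assume "open A"
      moreover have "U = Some ` A" 
      proof (rule set_eqI)
        fix p show "p \<in> U \<longleftrightarrow> p \<in> Some ` A" using False by (cases p) (auto simp: A_def)
      qed
      ultimately show "\<exists>V. open V \<and> U = Some ` V" by blast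
    qed
    then show ?thesis using False by (auto simp: riemann_sphere_def openin_Alexandroff_compactification)
  next
    case True
    have "(\<exists>C. compact C \<and> U = insert None (Some ` (- C))) \<longleftrightarrow> compact (- A)"
    proof
      assume "\<exists>C. compact C \<and> U = insert None (Some ` (- C))"
      then obtain C where C: "compact C" "U = insert None (Some ` (- C))" by blast
      then have "- A = C" by (auto simp: A_def)
      then show "compact (- A)" using C by simp
    next
      assume "compact (- A)"
      moreover have "U = insert None (Some ` (- (- A)))"
      proof (rule set_eqI)
        fix p show "p \<in> U \<longleftrightarrow> p \<in> insert None (Some ` (- (- A)))" using True by (cases p) (auto simp: A_def)
      qed
      ultimately show "\<exists>C. compact C \<and> U = insert None (Some ` (- C))" by blast
    qed
    moreover have "compact (- A) \<Longrightarrow> open A" using compact_imp_closed open_closed by blast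
    moreover have "U \<noteq> Some ` V" for V using True by auto
    ultimately show ?thesis using True
      by (simp add: riemann_sphere_def openin_Alexandroff_compactification)
         (metis Compl_eq_Diff_UNIV compact_imp_closed)
  qed
  have B: "B = {w. w \<noteq> 0 \<and> 1 / w \<in> A} \<union> (if None \<in> U then {0} else {})"
    by (auto simp: A_def B_def recip_def split: if_splits)
  have oA: "open {w. w \<noteq> 0 \<and> 1 / w \<in> A}" if "open A"
  proof -
    have "continuous_on (- {0}) (\<lambda>w::complex. 1 / w)" by (intro continuous_intros) auto
    then have "open (- {0} \<inter> (\<lambda>w. 1 / w) -` A)"
      by (rule continuous_open_preimage) (use that in auto)
    moreover have "- {0} \<inter> (\<lambda>w. 1 / w) -` A = {w. w \<noteq> 0 \<and> 1 / w \<in> A}" by auto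
    ultimately show ?thesis by simp
  qed
  have "open A \<Longrightarrow> (None \<in> U \<longrightarrow> compact (- A)) \<longleftrightarrow> open B"
  proof (cases "None \<in> U")
    case True
    assume A: "open A"
    show ?thesis
    proof
      assume "None \<in> U \<longrightarrow> compact (- A)"
      then obtain R where R: "R > 0" "\<And>z. z \<notin> A \<Longrightarrow> norm z \<le> R"
        using True compact_imp_bounded[of "- A"] by (auto simp: bounded_pos)
      have "B = {w. w \<noteq> 0 \<and> 1 / w \<in> A} \<union> ball 0 (1 / R)"
      proof -
        have "1 / w \<in> A" if "w \<noteq> 0" "norm w < 1 / R" for w
        proof (rule ccontr)
          assume "1 / w \<notin> A"
          then have "1 / norm w \<le> R" using R(2)[of "1 / w"] by (simp add: norm_divide)
          then show False using that R(1) by (simp add: field_simps)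
        qed
        then show ?thesis using B True R(1) by auto
      qed
      then show "open B" using oA[OF A] by auto
    next
      assume "open B"
      moreover have "0 \<in> B" using B True by simp
      ultimately obtain e where e: "e > 0" "ball 0 e \<subseteq> B" using openE by blast
      have "- A \<subseteq> cball 0 (1 / e)"
      proof
        fix z assume z: "z \<in> - A"
        show "z \<in> cball 0 (1 / e)"
        proof (rule ccontr)
          assume "z \<notin> cball 0 (1 / e)"
          then have n: "norm z > 1 / e" by simp
          then have "z \<noteq> 0" using e(1) by (metis divide_pos_pos norm_zero not_less_iff_gr_or_eq zero_less_one)
          then have "norm (1 / z) < e" using n e(1) by (simp add: norm_divide field_simps)
          then have "1 / z \<in> B" using e(2) by auto
          then show False using z B \<open>z \<noteq> 0\<close> by (auto split: if_splits)
        qed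
      qed
      then have "bounded (- A)" using bounded_cball bounded_subset by blast
      then show "None \<in> U \<longrightarrow> compact (- A)" using A by (simp add: compact_eq_bounded_closed closed_Compl)
    qed
  next
    case False
    then show "open A \<Longrightarrow> ?thesis" using B oA by simp
  qed
  then show ?thesis using oin by (auto simp: A_def B_def)
qed

lemma continuous_map_recip: "continuous_map riemann_sphere riemann_sphere recip"
  unfolding continuous_map_def openin_sphere_charts by auto

lemma homeomorphic_map_recip: "homeomorphic_map riemann_sphere riemann_sphere recip"
  using homeomorphic_maps_involution[OF continuous_map_recip] homeomorphic_map_maps by auto

text \<open>In the chart at infinity the translation is \<open>w / (1 + a * w)\<close>, regular at
  0. The preimage is covered by this formula and, away from \<open>w = 0\<close>, by the finite
  chart.\<close>

lemma continuous_map_shift: "continuous_map riemann_sphere riemann_sphere (shift a)"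
proof -
  have "open {z. Some z \<in> {x. shift a x \<in> U}} \<and> open {w. recip (Some w) \<in> {x. shift a x \<in> U}}"
    if U: "openin riemann_sphere U" for U
  proof
    have o: "open {z. Some z \<in> U}" "open {w. recip (Some w) \<in> U}" using U by (auto simp: openin_sphere_charts)
    have "open ((\<lambda>z. z + a) -` {z. Some z \<in> U})" by (intro open_vimage o continuous_intros)
    then show "open {z. Some z \<in> {x. shift a x \<in> U}}" by (simp add: vimage_def)
    have o1: "open {w. 1 + a * w \<noteq> 0}" by (intro open_Collect_neq continuous_intros)
    have "open ({w. 1 + a * w \<noteq> 0} \<inter> (\<lambda>w. w / (1 + a * w)) -` {w. recip (Some w) \<in> U})"
      by (intro continuous_open_preimage o o1 continuous_intros) auto
    moreover have "open (- {0} \<inter> (\<lambda>w. 1 / w + a) -` {z. Some z \<in> U})"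
      by (intro continuous_open_preimage o continuous_intros) auto
    moreover have "{w. recip (Some w) \<in> {x. shift a x \<in> U}} =
      ({w. 1 + a * w \<noteq> 0} \<inter> (\<lambda>w. w / (1 + a * w)) -` {w. recip (Some w) \<in> U}) \<union>
      (- {0} \<inter> (\<lambda>w. 1 / w + a) -` {z. Some z \<in> U})"
    proof (rule set_eqI)
      fix w
      show "w \<in> {w. recip (Some w) \<in> {x. shift a x \<in> U}} \<longleftrightarrow> w \<in> ({w. 1 + a * w \<noteq> 0} \<inter> (\<lambda>w. w / (1 + a * w)) -` {w. recip (Some w) \<in> U}) \<union>
        (- {0} \<inter> (\<lambda>w. 1 / w + a) -` {z. Some z \<in> U})"
      proof (cases "w = 0")
        case False
        then have "(1 + a * w) / w = 1 / w + a" by (simp add: field_simps)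
        then show ?thesis using False by auto
      qed auto
    qed
    ultimately show "open {w. recip (Some w) \<in> {x. shift a x \<in> U}}" by (simp only: open_Un)
  qed
  then show ?thesis unfolding continuous_map_def openin_sphere_charts[of "{x \<in> _. _ x}"] by auto
qed

lemma homeomorphic_map_shift: "homeomorphic_map riemann_sphere riemann_sphere (shift a)"
  unfolding homeomorphic_map_maps homeomorphic_maps_def
  by (intro exI[of _ "shift (- a)"]) (auto simp: continuous_map_shift)

lemma Hausdorff_riemann_sphere: "Hausdorff_space riemann_sphere"
  unfolding riemann_sphere_def Hausdorff_space_Alexandroff_compactification
  by (simp add: locally_compact_space_euclidean)

lemma continuous_map_Some_sphere: "continuous_map euclidean riemann_sphere Some"
  unfolding riemann_sphere_def by (rule continuous_map_Some)

lemma openin_Some_image: "openin riemann_sphere (Some ` U) \<longleftrightarrow> open U"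
  unfolding riemann_sphere_def by simp

lemma closedin_Some_image: "closedin riemann_sphere (Some ` K) \<longleftrightarrow> compact K"
  unfolding riemann_sphere_def by (auto simp: compact_imp_closed)

text \<open>Boundedness makes the closure compact, hence closed in the sphere: infinity is not
  adherent.\<close>

lemma closure_of_bounded_image:
  assumes "bounded B"
  shows "riemann_sphere closure_of (Some ` B) = Some ` closure B"
proof
  have "closedin riemann_sphere (Some ` closure B)" using assms by (simp add: closedin_Some_image)
  then show "riemann_sphere closure_of (Some ` B) \<subseteq> Some ` closure B"
    by (intro closure_of_minimal image_mono closure_subset)
  show "Some ` closure B \<subseteq> riemann_sphere closure_of (Some ` B)"
    using continuous_map_image_closure_subset[OF continuous_map_Some_sphere, of B] by simp
qed

lemma frontier_of_bounded_image:
  assumes "bounded B" "open B"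
  shows "riemann_sphere frontier_of (Some ` B) = Some ` frontier B"
proof -
  have "riemann_sphere interior_of (Some ` B) = Some ` B"
    using assms(2) by (simp add: openin_Some_image interior_of_openin)
  then show ?thesis
    unfolding frontier_of_def closure_of_bounded_image[OF assms(1)] frontier_def interior_open[OF assms(2)]
    by (simp add: image_set_diff)
qed

lemma jordan_curve_homeomorphic_image:
  assumes "jordan_curve \<Gamma>" "homeomorphic_map riemann_sphere riemann_sphere \<mu>"
  shows "jordan_curve (\<mu> ` \<Gamma>)"
proof -
  have "homeomorphic_map (subtopology riemann_sphere \<Gamma>) (subtopology riemann_sphere (\<mu> ` \<Gamma>)) \<mu>"
    by (rule homeomorphic_map_subtopologies[OF assms(2)]) auto
  then show ?thesis using assms(1) unfolding jordan_curve_def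
    by (meson homeomorphic_map_imp_homeomorphic_space homeomorphic_space_sym homeomorphic_space_trans)
qed

lemma jordan_curve_finite_homeomorphism:
  assumes "jordan_curve (Some ` K)"
  obtains \<gamma> \<gamma>' :: "complex \<Rightarrow> complex" where "homeomorphism (sphere 0 1) K \<gamma> \<gamma>'"
proof -
  obtain a b where ab: "homeomorphic_maps (subtopology riemann_sphere (Some ` K)) (top_of_set (sphere (0::complex) 1)) a b"
    using assms unfolding jordan_curve_def homeomorphic_space_def by blast
  have S: "homeomorphic_map (top_of_set K) (subtopology riemann_sphere (Some ` K)) Some"
  proof -
    have "embedding_map euclidean riemann_sphere (Some :: complex \<Rightarrow> _)"
      unfolding riemann_sphere_def by (rule embedding_map_Some)
    then have "homeomorphic_map euclidean (subtopology riemann_sphere (range Some)) (Some :: complex \<Rightarrow> _)"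
      by (simp add: embedding_map_def)
    then have "homeomorphic_map (subtopology euclidean K) (subtopology (subtopology riemann_sphere (range Some)) (Some ` K)) Some"
      by (rule homeomorphic_map_subtopologies) auto
    moreover have "range Some \<inter> Some ` K = Some ` K" by auto
    ultimately show ?thesis by (simp add: subtopology_subtopology)
  qed
  have "homeomorphic_map (top_of_set K) (top_of_set (sphere (0::complex) 1)) (a \<circ> Some)"
    using homeomorphic_map_compose[OF S] ab homeomorphic_maps_map by blast
  then obtain c where c: "homeomorphic_maps (top_of_set K) (top_of_set (sphere (0::complex) 1)) (a \<circ> Some) c"
    using homeomorphic_map_maps by blast
  then have c': "continuous_on K (a \<circ> Some)" "continuous_on (sphere 0 1) c"
      "(a \<circ> Some) ` K \<subseteq> sphere 0 1" "c ` sphere 0 1 \<subseteq> K"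
      "\<And>x. x \<in> K \<Longrightarrow> c ((a \<circ> Some) x) = x" "\<And>y. y \<in> sphere 0 1 \<Longrightarrow> (a \<circ> Some) (c y) = y"
    by (auto simp: homeomorphic_maps_def continuous_map_in_subtopology)
  show ?thesis
  proof (rule that[of c "a \<circ> Some"], unfold homeomorphism_def, intro conjI ballI)
    show "c ` sphere 0 1 = K" using c'(3,4,5) by (auto simp: image_iff) (metis image_subset_iff mem_sphere_0)
    show "(a \<circ> Some) ` K = sphere 0 1" using c'(3,4,6) by (metis equalityI image_eqI image_subset_iff subsetI)
  qed (use c' in auto)
qed

lemma holomorphic_to_sphere_recip:
  assumes "holomorphic_to_sphere f V"
  shows "holomorphic_to_sphere (recip \<circ> f) V"
  using assms continuous_map_compose[OF _ continuous_map_recip]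
  by (auto simp: holomorphic_to_sphere_def)

lemma sphere_map_open_preimage:
  assumes "continuous_map (top_of_set V) riemann_sphere f" "open V" "openin riemann_sphere U"
  shows "open {z \<in> V. f z \<in> U}"
  using openin_continuous_map_preimage[OF assms(1,3)] assms(2) openin_open_eq by auto

lemma openin_sphere_delete: "openin riemann_sphere (- {p})"
proof -
  have "closedin riemann_sphere {p}"
    using Hausdorff_riemann_sphere by (simp add: closedin_Hausdorff_singleton)
  then show ?thesis by (simp add: closedin_def Compl_eq_Diff_UNIV)
qed

text \<open>The reciprocal of \<open>f z + a\<close> is holomorphic where \<open>f\<close> is finite
  by the first chart and where \<open>f\<close> is nonzero by the second, as
  \<open>(1 / w) / (1 + a / w)\<close>; the two open sets cover everything but the zeros of
  \<open>f + a\<close>.\<close>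

lemma holomorphic_to_sphere_shift:
  assumes f: "holomorphic_to_sphere f V" and V: "open V"
  shows "holomorphic_to_sphere (shift a \<circ> f) V"
proof -
  have cont: "continuous_map (top_of_set V) riemann_sphere f"
    and h1: "(\<lambda>z. the (f z)) holomorphic_on {z \<in> V. f z \<noteq> None}"
    and h2: "(\<lambda>z. the (recip (f z))) holomorphic_on {z \<in> V. f z \<noteq> Some 0}"
    using f by (auto simp: holomorphic_to_sphere_def)
  have op: "open {z \<in> V. f z \<noteq> p}" for p
    using sphere_map_open_preimage[OF cont V openin_sphere_delete[of p]] by simp
  have "continuous_map (top_of_set V) riemann_sphere (shift a \<circ> f)"
    by (rule continuous_map_compose[OF cont continuous_map_shift])
  moreover have "(\<lambda>z. the ((shift a \<circ> f) z)) holomorphic_on {z \<in> V. (shift a \<circ> f) z \<noteq> None}"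
  proof -
    have "(\<lambda>z. the (f z) + a) holomorphic_on {z \<in> V. f z \<noteq> None}" by (intro holomorphic_intros h1)
    moreover have "{z \<in> V. (shift a \<circ> f) z \<noteq> None} = {z \<in> V. f z \<noteq> None}" by auto
    ultimately show ?thesis by (auto elim!: holomorphic_transform)
  qed
  moreover have "(\<lambda>z. the (recip ((shift a \<circ> f) z))) holomorphic_on {z \<in> V. (shift a \<circ> f) z \<noteq> Some 0}"
  proof -
    let ?A = "{z \<in> V. f z \<noteq> None} \<inter> {z \<in> V. f z \<noteq> Some (- a)}"
    let ?B = "{z \<in> V. f z \<noteq> Some 0} \<inter> {z \<in> V. f z \<noteq> Some (- a)}"
    let ?k = "\<lambda>z. the (recip ((shift a \<circ> f) z))"
    have "(\<lambda>z. 1 / (the (f z) + a)) holomorphic_on ?A"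
      by (intro holomorphic_intros holomorphic_on_subset[OF h1]) (auto simp: add_eq_0_iff2)
    then have A: "?k holomorphic_on ?A"
      by (rule holomorphic_transform) (auto simp: add_eq_0_iff2)
    have nz: "1 + a * the (recip (f z)) \<noteq> 0" if "z \<in> ?B" for z
    proof (cases "f z")
      case None then show ?thesis by simp
    next
      case (Some w)
      then have "w \<noteq> 0" "w + a \<noteq> 0" using that by (auto simp: add_eq_0_iff2)
      then show ?thesis using Some by (simp add: field_simps)
    qed
    have "(\<lambda>z. the (recip (f z)) / (1 + a * the (recip (f z)))) holomorphic_on ?B"
      using nz by (intro holomorphic_intros holomorphic_on_subset[OF h2]) auto
    then have B: "?k holomorphic_on ?B"
    proof (rule holomorphic_transform)
      fix z assume z: "z \<in> ?B"
      show "the (recip (f z)) / (1 + a * the (recip (f z))) = ?k z"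
      proof (cases "f z")
        case None then show ?thesis by simp
      next
        case (Some w)
        then have "w \<noteq> 0" "w + a \<noteq> 0" using z by (auto simp: add_eq_0_iff2)
        then show ?thesis using Some by (simp add: divide_simps)
      qed
    qed
    have "?k holomorphic_on ?A \<union> ?B"
      by (intro holomorphic_on_Un A B open_Int op)
    moreover have "?A \<union> ?B = {z \<in> V. (shift a \<circ> f) z \<noteq> Some 0}"
    proof (rule set_eqI)
      fix z show "z \<in> ?A \<union> ?B \<longleftrightarrow> z \<in> {z \<in> V. (shift a \<circ> f) z \<noteq> Some 0}"
        by (cases "f z") (auto simp: add_eq_0_iff2)
    qed
    ultimately show ?thesis by simp
  qed
  ultimately show ?thesis by (simp add: holomorphic_to_sphere_def)
qed

text \<open>The curve separates the sphere into its inside and the outside with infinity added. A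
  connected set that contains infinity stays in the latter, so any disc in the inside is free of
  it.\<close>

lemma jordan_curve_avoids_exterior:
  assumes \<Gamma>: "jordan_curve \<Gamma>" "None \<notin> \<Gamma>" and \<Omega>: "connectedin riemann_sphere \<Omega>" "None \<in> \<Omega>" "\<Omega> \<inter> \<Gamma> = {}"
  obtains b e where "0 < e" "\<And>z. z \<in> ball b e \<Longrightarrow> Some z \<notin> \<Omega>"
proof -
  define K where "K = {z. Some z \<in> \<Gamma>}"
  have GK: "\<Gamma> = Some ` K"
  proof (rule set_eqI)
    fix p show "p \<in> \<Gamma> \<longleftrightarrow> p \<in> Some ` K" using \<Gamma>(2) by (cases p) (auto simp: K_def)
  qed
  obtain \<gamma> \<gamma>' :: "complex \<Rightarrow> complex" where hom: "homeomorphism (sphere 0 1) K \<gamma> \<gamma>'"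
    using jordan_curve_finite_homeomorphism[of K] \<Gamma>(1) unfolding GK by blast
  define c where "c = \<gamma> \<circ> circlepath 0 1"
  have h: "continuous_on (sphere 0 1) \<gamma>" "\<gamma> ` sphere 0 1 = K" "inj_on \<gamma> (sphere 0 1)"
    using hom by (auto simp: homeomorphism_def intro: inj_on_inverseI[of _ \<gamma>'])
  have pc: "path_image (circlepath 0 1) = sphere (0::complex) 1" by simp
  have "simple_path c" unfolding c_def
    by (intro simple_path_continuous_image) (simp_all add: simple_path_circlepath h)
  moreover have "pathfinish c = pathstart c" by (simp add: c_def pathfinish_compose pathstart_compose)
  moreover have imc: "path_image c = K" unfolding c_def path_image_compose pc by (rule h(2))
  ultimately have J: "inside K \<noteq> {}" "open (inside K)" "bounded (inside K)" "frontier (inside K) = K"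
    "inside K \<union> outside K = - K" "inside K \<inter> outside K = {}" "open (outside K)"
    using Jordan_inside_outside[of c] by auto
  have cK: "compact K" using h compact_continuous_image[OF h(1) compact_sphere] by simp
  define P where "P = Some ` inside K"
  define Q where "Q = insert None (Some ` outside K)"
  have "openin riemann_sphere P" using J by (simp add: P_def openin_Some_image)
  \<comment> \<open>The complement of the outside is the closure of the bounded inside, hence
    compact.\<close>
  moreover have "openin riemann_sphere Q"
  proof -
    have "- outside K = closure (inside K)" 
      unfolding closure_Un_frontier J(4) using J(5,6) by blast
    then have "compact (- outside K)" using J(3) by (simp add: compact_closure)
    moreover have "Q = insert None (Some ` (- (- outside K)))" by (simp add: Q_def)
    ultimately show ?thesis unfolding riemann_sphere_def openin_Alexandroff_compactification
      by (intro disjI2 exI[of _ "- outside K"]) (auto simp: compact_imp_closed)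
  qed
  moreover have "\<Omega> \<subseteq> P \<union> Q"
  proof
    fix p assume p: "p \<in> \<Omega>"
    show "p \<in> P \<union> Q"
    proof (cases p)
      case (Some a)
      then have "a \<in> - K" using p \<Omega>(3) by (auto simp: K_def)
      then have "a \<in> inside K \<union> outside K" by (simp only: J(5))
      then show ?thesis using Some unfolding P_def Q_def by blast
    qed (simp add: Q_def)
  qed
  moreover have "P \<inter> Q \<inter> \<Omega> = {}" using J(6) unfolding P_def Q_def by blast
  moreover have "Q \<inter> \<Omega> \<noteq> {}" using \<Omega>(2) by (auto simp: Q_def)
  ultimately have "P \<inter> \<Omega> = {}" using connectedinD[OF \<Omega>(1)] by blast
  moreover obtain b where "b \<in> inside K" using J(1) by blast
  moreover then obtain e where "0 < e" "ball b e \<subseteq> inside K" using J(2) openE by blast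
  ultimately show ?thesis using that[of e b] by (auto simp: P_def subset_iff)
qed

text \<open>Sending an interior point \<open>c\<close> to infinity puts the curve in the plane and
  makes the domain omit a disc about some \<open>b\<close>; sending \<open>b\<close> to infinity
  then makes the domain bounded.\<close>

lemma jordan_domain_normalization:
  assumes "jordan_domain \<Omega> \<Gamma>" and c: "Some c \<in> \<Omega>"
  obtains b where "bounded {z. Some z \<in> (recip \<circ> shift (- b) \<circ> recip \<circ> shift (- c)) ` \<Omega>}"
    "None \<notin> (recip \<circ> shift (- b) \<circ> recip \<circ> shift (- c)) ` \<Omega>"
proof -
  have \<Omega>: "jordan_curve \<Gamma>" "openin riemann_sphere \<Omega>" "connectedin riemann_sphere \<Omega>" "riemann_sphere frontier_of \<Omega> = \<Gamma>"
    using assms(1) by (auto simp: jordan_domain_def)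
  define \<mu> where "\<mu> = recip \<circ> shift (- c)"
  have hom: "homeomorphic_map riemann_sphere riemann_sphere \<mu>"
    unfolding \<mu>_def by (rule homeomorphic_map_compose[OF homeomorphic_map_shift homeomorphic_map_recip])
  have inj: "inj \<mu>" using hom by (simp add: homeomorphic_map_def)
  have disj: "\<Omega> \<inter> \<Gamma> = {}"
    using \<Omega>(2,4) by (auto simp: frontier_of_def interior_of_openin)
  have mc: "\<mu> (Some c) = None" by (simp add: \<mu>_def)
  obtain b e where be: "0 < e" "\<And>z. z \<in> ball b e \<Longrightarrow> Some z \<notin> \<mu> ` \<Omega>"
  proof (rule jordan_curve_avoids_exterior[of "\<mu> ` \<Gamma>" "\<mu> ` \<Omega>"])
    show "jordan_curve (\<mu> ` \<Gamma>)" by (rule jordan_curve_homeomorphic_image[OF \<Omega>(1) hom])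
    show "None \<in> \<mu> ` \<Omega>" using c mc by (metis imageI)
    then show "None \<notin> \<mu> ` \<Gamma>" using inj disj mc c by (metis IntI emptyE image_iff injD)
    show "connectedin riemann_sphere (\<mu> ` \<Omega>)" using \<Omega>(3) homeomorphic_map_connectedness[OF hom] by simp
    show "\<mu> ` \<Omega> \<inter> \<mu> ` \<Gamma> = {}" using disj inj by (simp add: image_Int[symmetric])
  qed blast
  have eq: "recip \<circ> shift (- b) \<circ> recip \<circ> shift (- c) = recip \<circ> shift (- b) \<circ> \<mu>" by (simp add: \<mu>_def o_assoc)
  show ?thesis
  proof (rule that[of b], unfold eq)
    have far: "norm (z - b) \<ge> e" if "Some z \<in> \<mu> ` \<Omega>" for z
      using be(2)[of z] that by (cases "norm (z - b) < e") (simp_all add: dist_norm norm_minus_commute)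
    have im: "norm z \<le> 1 / e" if "p \<in> \<Omega>" "(recip \<circ> shift (- b) \<circ> \<mu>) p = Some z" for p z
    proof (cases "\<mu> p")
      case None then show ?thesis using that be(1) by auto
    next
      case (Some w)
      then have "norm (w - b) \<ge> e" using far that(1) by (metis imageI)
      moreover from this have "w - b \<noteq> 0" using be(1) by auto
      moreover from calculation have "z = 1 / (w - b)" using that(2) Some by auto
      ultimately show ?thesis using be(1) by (simp add: norm_divide frac_le)
    qed
    then show "bounded {z. Some z \<in> (recip \<circ> shift (- b) \<circ> \<mu>) ` \<Omega>}"
      unfolding bounded_iff by (intro exI[of _ "1 / e"]) (metis (mono_tags, lifting) image_iff mem_Collect_eq)
    show "None \<notin> (recip \<circ> shift (- b) \<circ> \<mu>) ` \<Omega>"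
    proof
      assume "None \<in> (recip \<circ> shift (- b) \<circ> \<mu>) ` \<Omega>"
      then obtain p where p: "p \<in> \<Omega>" "(recip \<circ> shift (- b) \<circ> \<mu>) p = None" by (metis imageE)
      then have p': "shift (- b) (\<mu> p) = Some 0" by simp
      then have "\<mu> p = Some b" by (cases "\<mu> p") simp_all
      then show False using be p(1) by (metis centre_in_ball imageI)
    qed
  qed
qed

text \<open>The bounded case is applied to \<open>f\<close> followed by the normalizing Moebius map
  \<open>\<mu>\<close>, and the result is carried back by the inverse of
  \<open>\<mu>\<close>.\<close>

theorem caratheodory_extension:
  assumes jd: "jordan_domain \<Omega> \<Gamma>" and f: "biholomorphism f \<Omega>"
  obtains f' where "extended_biholomorphism f' \<Omega>" "\<And>z. z \<in> ball 0 1 \<Longrightarrow> f' z = f z"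
proof -
  have \<Omega>: "jordan_curve \<Gamma>" "openin riemann_sphere \<Omega>" "connectedin riemann_sphere \<Omega>" "riemann_sphere frontier_of \<Omega> = \<Gamma>"
    using jd by (auto simp: jordan_domain_def)
  have bij: "bij_betw f (ball 0 1) \<Omega>" and holf: "holomorphic_to_sphere f (ball 0 1)"
    and inv: "holomorphic_from_sphere (inv_into (ball 0 1) f) \<Omega>"
    using f by (auto simp: biholomorphism_def)
  have im: "f ` ball 0 1 = \<Omega>" and injf: "inj_on f (ball 0 1)" using bij by (auto simp: bij_betw_def)
  \<comment> \<open>Two distinct values cannot both be infinity, which yields a finite point of the
    domain.\<close>
  have "f 0 \<noteq> f (1/2)" using inj_onD[OF injf, of 0 "1/2"] by auto
  moreover have "f 0 \<in> \<Omega>" "f (1/2) \<in> \<Omega>" using im by (auto intro!: imageI simp flip: im)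
  ultimately obtain c where c: "Some c \<in> \<Omega>" by (metis option.exhaust)
  obtain b where b: "bounded {z. Some z \<in> (recip \<circ> shift (- b) \<circ> recip \<circ> shift (- c)) ` \<Omega>}"
    "None \<notin> (recip \<circ> shift (- b) \<circ> recip \<circ> shift (- c)) ` \<Omega>"
    using jordan_domain_normalization[OF jd c] by blast
  define \<mu> where "\<mu> = recip \<circ> shift (- b) \<circ> recip \<circ> shift (- c)"
  have hom: "homeomorphic_map riemann_sphere riemann_sphere \<mu>"
    unfolding \<mu>_def by (intro homeomorphic_map_compose[of _ riemann_sphere] homeomorphic_map_shift homeomorphic_map_recip)
  then obtain \<nu> where \<nu>: "homeomorphic_maps riemann_sphere riemann_sphere \<mu> \<nu>" using homeomorphic_map_maps by blast
  then have nm: "\<nu> (\<mu> p) = p" "\<mu> (\<nu> p) = p" and cn: "continuous_map riemann_sphere riemann_sphere \<nu>" for p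
    by (auto simp: homeomorphic_maps_def)
  define F where "F z = the (\<mu> (f z))" for z
  define B where "B = F ` ball 0 1"
  have fin: "\<mu> (f z) = Some (F z)" if "z \<in> ball 0 1" for z
  proof -
    have "\<mu> (f z) \<noteq> None" using b(2) that im unfolding \<mu>_def[symmetric] by (metis imageI)
    then show ?thesis by (simp add: F_def)
  qed
  have mO: "\<mu> ` \<Omega> = Some ` B" using fin im unfolding B_def by (force simp: image_iff)
  have bB: "bounded B" using b(1) unfolding \<mu>_def[symmetric] mO by (simp add: image_iff)
  have "holomorphic_to_sphere (\<mu> \<circ> f) (ball 0 1)"
    unfolding \<mu>_def comp_assoc by (intro holomorphic_to_sphere_recip holomorphic_to_sphere_shift holf) auto
  then have "(\<lambda>z. the ((\<mu> \<circ> f) z)) holomorphic_on {z \<in> ball 0 1. (\<mu> \<circ> f) z \<noteq> None}"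
    unfolding holomorphic_to_sphere_def by blast
  moreover have "{z \<in> ball 0 1. (\<mu> \<circ> f) z \<noteq> None} = ball 0 1" using fin by auto
  ultimately have holF: "F holomorphic_on ball 0 1" by (simp add: F_def[abs_def])
  have injF: "inj_on F (ball 0 1)"
    using injf fin nm(1) unfolding inj_on_def by metis
  have oB: "open B" using open_mapping_thm3[OF holF open_ball injF] by (simp add: B_def)
  have fr: "\<mu> ` \<Gamma> = Some ` frontier B"
    using homeomorphic_map_frontier_of[OF hom, of \<Omega>] frontier_of_bounded_image[OF bB oB] \<Omega>(4) mO by simp
  have cl: "\<mu> ` (riemann_sphere closure_of \<Omega>) = Some ` closure B"
    using homeomorphic_map_closure_of[OF hom, of \<Omega>] closure_of_bounded_image[OF bB] mO by simp
  obtain \<gamma> \<gamma>' :: "complex \<Rightarrow> complex" where "homeomorphism (sphere 0 1) (frontier B) \<gamma> \<gamma>'"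
    using jordan_curve_finite_homeomorphism[of "frontier B"] jordan_curve_homeomorphic_image[OF \<Omega>(1) hom]
    unfolding fr by blast
  then interpret jordan_disc_map F \<gamma> \<gamma>'
    using holF injF bB unfolding B_def by unfold_locales
  obtain g where g: "continuous_on (cball 0 1) g" "\<And>z. z \<in> ball 0 1 \<Longrightarrow> g z = F z"
    using continuous_extension by blast
  \<comment> \<open>Interior points go into the image of the open disc and boundary points to its
    frontier, so equal values occur only within one of the two kinds.\<close>
  have injg: "inj_on g (cball 0 1)"
  proof (rule inj_onI)
    fix x y :: complex assume xy: "x \<in> cball 0 1" "y \<in> cball 0 1" "g x = g y"
    have B: "z \<in> ball 0 1 \<Longrightarrow> g z \<in> F ` ball 0 1" for z using g(2) by auto
    have S: "z \<in> sphere 0 1 \<Longrightarrow> g z \<notin> F ` ball 0 1" for z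
      using extension_boundary[OF g] frontier_disjoint by blast
    have "x \<in> ball 0 1 \<and> y \<in> ball 0 1 \<or> x \<in> sphere 0 1 \<and> y \<in> sphere 0 1"
    proof -
      have "z \<in> ball 0 1 \<or> z \<in> sphere 0 1" if "z \<in> cball 0 1" for z :: complex using that by auto
      from this[OF xy(1)] this[OF xy(2)] show ?thesis using B[of x] B[of y] S[of x] S[of y] xy(3) by metis
    qed
    then show "x = y"
    proof (elim disjE conjE)
      assume "x \<in> ball 0 1" "y \<in> ball 0 1"
      then show ?thesis using xy(3) g(2) inj_onD[OF injF] by auto
    next
      assume "x \<in> sphere 0 1" "y \<in> sphere 0 1"
      then show ?thesis using extension_inj_sphere[OF g] xy(3) by blast
    qed
  qed
  have img: "g ` cball 0 1 = closure B"
  proof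
    have "closed (g ` cball 0 1)" by (intro compact_imp_closed compact_continuous_image g(1)) auto
    moreover have "B \<subseteq> g ` cball 0 1" 
    proof -
      have "B = g ` ball 0 1" unfolding B_def using g(2) by (intro image_cong) auto
      then show ?thesis by (simp add: image_mono ball_subset_cball)
    qed
    ultimately show "closure B \<subseteq> g ` cball 0 1" by (simp add: closure_minimal)
    have "g z \<in> closure B" if "z \<in> cball 0 1" for z
    proof (cases "z \<in> ball 0 1")
      case True then show ?thesis using g(2) closure_subset[of B] by (auto simp: B_def)
    next
      case False
      then have "z \<in> sphere 0 1" using that by auto
      then show ?thesis using extension_boundary[OF g] by (auto simp: B_def frontier_def)
    qed
    then show "g ` cball 0 1 \<subseteq> closure B" by blast
  qed
  define f' where "f' z = \<nu> (Some (g z))" for z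
  have ff': "f' z = f z" if "z \<in> ball 0 1" for z
    using fin[OF that] g(2)[OF that] nm by (simp add: f'_def) (metis nm(1))
  have "homeomorphic_map (top_of_set (cball 0 1)) (subtopology riemann_sphere (riemann_sphere closure_of \<Omega>)) f'"
  \<comment> \<open>A continuous bijection from a compact space onto a Hausdorff space is a
    homeomorphism.\<close>
  proof (rule continuous_imp_homeomorphic_map)
    have im': "f' ` cball 0 1 = riemann_sphere closure_of \<Omega>"
    proof -
      have "f' ` cball 0 1 = \<nu> ` Some ` closure B" using img by (force simp: f'_def image_iff)
      also have "\<dots> = \<nu> ` \<mu> ` (riemann_sphere closure_of \<Omega>)" by (simp add: cl)
      also have "\<dots> = riemann_sphere closure_of \<Omega>" by (simp add: image_image nm)
      finally show ?thesis .
    qed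
    have "continuous_map (top_of_set (cball 0 1)) riemann_sphere (\<nu> \<circ> (Some \<circ> g))"
      by (intro continuous_map_compose[OF _ cn] continuous_map_compose[OF _ continuous_map_Some_sphere])
         (use g(1) in auto)
    moreover have "f' = \<nu> \<circ> (Some \<circ> g)" by (auto simp: f'_def)
    ultimately show "continuous_map (top_of_set (cball 0 1)) (subtopology riemann_sphere (riemann_sphere closure_of \<Omega>)) f'"
      using im' by (auto simp: continuous_map_in_subtopology)
    show "f' ` topspace (top_of_set (cball 0 1)) = topspace (subtopology riemann_sphere (riemann_sphere closure_of \<Omega>))"
      using im' by simp
    show "compact_space (top_of_set (cball (0::complex) 1))" by (simp add: compact_space_subtopology)
    show "Hausdorff_space (subtopology riemann_sphere (riemann_sphere closure_of \<Omega>))"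
      by (rule Hausdorff_space_subtopology[OF Hausdorff_riemann_sphere])
    show "inj_on f' (topspace (top_of_set (cball 0 1)))"
    proof (rule inj_onI)
      fix x y :: complex assume "x \<in> topspace (top_of_set (cball 0 1))" "y \<in> topspace (top_of_set (cball 0 1))" "f' x = f' y"
      moreover from this have "g x = g y" unfolding f'_def by (metis nm(2) option.inject)
      ultimately show "x = y" using inj_onD[OF injg] by auto
    qed
  qed
  moreover have "biholomorphism f' \<Omega>"
  proof -
    have "bij_betw f' (ball 0 1) \<Omega>" using bij bij_betw_cong[of "ball 0 1" f' f \<Omega>] ff' by blast
    \<comment> \<open>The inverse is determined by the values on the open disc, where
      \<open>f'\<close> and \<open>f\<close> agree, so its holomorphy is inherited.\<close>
    moreover have "inv_into (ball 0 1) f' = inv_into (ball 0 1) f"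
      unfolding inv_into_def by (intro ext arg_cong[of _ _ Eps]) (auto simp: ff')
    moreover have "holomorphic_to_sphere f' (ball 0 1)"
    proof -
      have e: "{z \<in> ball 0 1. f' z \<noteq> p} = {z \<in> ball 0 1. f z \<noteq> p}" for p using ff' by auto
      have "continuous_map (top_of_set (ball 0 1)) riemann_sphere f'"
        using holf unfolding holomorphic_to_sphere_def by (auto elim!: continuous_map_eq simp: ff')
      then show ?thesis using holf unfolding holomorphic_to_sphere_def e
        by (auto elim!: holomorphic_transform simp: ff')
    qed
    ultimately show ?thesis using inv by (simp add: biholomorphism_def)
  qed
  ultimately show ?thesis using that ff' by (auto simp: extended_biholomorphism_def)
qed

subsection \<open>Conformal invariance of the Dirichlet energy\<close>

definition plane_energy :: "complex set \<Rightarrow> (complex \<Rightarrow> complex) \<Rightarrow> ennreal" where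
  "plane_energy V u = (\<integral>\<^sup>+ z\<in>V. ennreal (energy_density u z) \<partial>lborel)"

lemma dirichlet_energy_plane:
  "dirichlet_energy U h = ennreal (1 / pi) * plane_energy {z. Some z \<in> U} (\<lambda>z. h (Some z))"
  by (simp add: dirichlet_energy_def plane_energy_def energy_density_def)

lemma measurable_energy_density:
  assumes "open V" "plane_harmonic_on u V"
  shows "(\<lambda>z. ennreal (energy_density u z) * indicator V z) \<in> borel_measurable borel"
proof -
  have "(\<lambda>z. indicator V z *\<^sub>R energy_density u z) \<in> borel_measurable borel"
    using assms by (intro borel_measurable_continuous_on_indicator continuous_on_energy_density) auto
  then have "(\<lambda>z. ennreal (indicator V z *\<^sub>R energy_density u z)) \<in> borel_measurable borel" by measurable
  moreover have "(\<lambda>z. ennreal (indicator V z *\<^sub>R energy_density u z)) = (\<lambda>z. ennreal (energy_density u z) * indicator V z)"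
    by (auto simp: fun_eq_iff split: split_indicator)
  ultimately show ?thesis by (simp only:)
qed

locale disc_param =
  fixes f :: "complex \<Rightarrow> csphere" and \<Omega> :: "csphere set"
  assumes biholo: "biholomorphism f \<Omega>" and open_domain: "openin riemann_sphere \<Omega>"
begin

definition coord :: "csphere \<Rightarrow> complex" where "coord = inv_into (ball 0 1) f"

lemma image_ball: "f ` ball 0 1 = \<Omega>" and inj_ball: "inj_on f (ball 0 1)"
  using biholo by (auto simp: biholomorphism_def bij_betw_def)

lemma to_sphere: "holomorphic_to_sphere f (ball 0 1)"
  using biholo by (simp add: biholomorphism_def)

lemma coord_f [simp]: "z \<in> ball 0 1 \<Longrightarrow> coord (f z) = z"
  unfolding coord_def by (rule inv_into_f_f[OF inj_ball])

lemma f_coord: "p \<in> \<Omega> \<Longrightarrow> coord p \<in> ball 0 1 \<and> f (coord p) = p"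
  using image_ball unfolding coord_def by (metis f_inv_into_f inv_into_into)

lemma coord_holomorphic:
  "(\<lambda>z. coord (Some z)) holomorphic_on {z. Some z \<in> \<Omega>}"
  "(\<lambda>w. coord (recip (Some w))) holomorphic_on {w. recip (Some w) \<in> \<Omega>}"
  using biholo by (auto simp: biholomorphism_def holomorphic_from_sphere_def coord_def)

lemma image_iff_coord: "V \<subseteq> ball 0 1 \<Longrightarrow> p \<in> f ` V \<longleftrightarrow> p \<in> \<Omega> \<and> coord p \<in> V"
  using f_coord image_ball by (auto simp: image_iff subset_iff)

lemma open_charts_image:
  assumes V: "open V" "V \<subseteq> ball 0 1"
  shows "open {z. Some z \<in> f ` V}" "open {w. recip (Some w) \<in> f ` V}"
proof -
  have o: "open {z. Some z \<in> \<Omega>}" "open {w. recip (Some w) \<in> \<Omega>}"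
    using open_domain by (auto simp: openin_sphere_charts)
  have "open ({z. Some z \<in> \<Omega>} \<inter> (\<lambda>z. coord (Some z)) -` V)"
    by (intro continuous_open_preimage holomorphic_on_imp_continuous_on coord_holomorphic o V)
  moreover have "{z. Some z \<in> \<Omega>} \<inter> (\<lambda>z. coord (Some z)) -` V = {z. Some z \<in> f ` V}"
    using image_iff_coord[OF V(2)] by auto
  ultimately show "open {z. Some z \<in> f ` V}" by simp
  have "open ({w. recip (Some w) \<in> \<Omega>} \<inter> (\<lambda>w. coord (recip (Some w))) -` V)"
    by (intro continuous_open_preimage holomorphic_on_imp_continuous_on coord_holomorphic o V)
  moreover have "{w. recip (Some w) \<in> \<Omega>} \<inter> (\<lambda>w. coord (recip (Some w))) -` V = {w. recip (Some w) \<in> f ` V}"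
    using image_iff_coord[OF V(2)] by auto
  ultimately show "open {w. recip (Some w) \<in> f ` V}" by simp
qed

lemma open_delete: "open V \<Longrightarrow> V \<subseteq> ball 0 1 \<Longrightarrow> open {z \<in> V. f z \<noteq> p}"
proof -
  assume V: "open V" "V \<subseteq> ball 0 1"
  have "open {z \<in> ball 0 1. f z \<in> - {p}}"
    by (rule sphere_map_open_preimage[OF _ open_ball openin_sphere_delete])
       (use to_sphere in \<open>simp add: holomorphic_to_sphere_def\<close>)
  then have "open (V \<inter> {z \<in> ball 0 1. f z \<in> - {p}})" using V by auto
  moreover have "V \<inter> {z \<in> ball 0 1. f z \<in> - {p}} = {z \<in> V. f z \<noteq> p}" using V by auto
  ultimately show ?thesis by simp
qed

text \<open>Locally, \<open>f\<close> avoids infinity or avoids 0, and in either case one chart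
  expresses the pullback as a plane harmonic function after a holomorphic map.\<close>

lemma harmonic_pullback:
  assumes V: "open V" "V \<subseteq> ball 0 1" and h: "harmonic_on h (f ` V)"
  shows "plane_harmonic_on (\<lambda>z. h (f z)) V"
proof (rule plane_harmonic_on_local)
  fix z assume z: "z \<in> V"
  have h1: "plane_harmonic_on (\<lambda>z. h (Some z)) {z. Some z \<in> f ` V}"
    and h2: "plane_harmonic_on (\<lambda>w. h (recip (Some w))) {w. recip (Some w) \<in> f ` V}"
    using h by (auto simp: harmonic_on_def)
  have f1: "(\<lambda>z. the (f z)) holomorphic_on {z \<in> V. f z \<noteq> None}"
    and f2: "(\<lambda>z. the (recip (f z))) holomorphic_on {z \<in> V. f z \<noteq> Some 0}"
    using to_sphere V(2) by (auto simp: holomorphic_to_sphere_def elim!: holomorphic_on_subset)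
  show "\<exists>W. open W \<and> z \<in> W \<and> W \<subseteq> V \<and> plane_harmonic_on (\<lambda>z. h (f z)) W"
  proof (cases "f z = None")
    case False
    let ?W = "{z \<in> V. f z \<noteq> None}"
    have "plane_harmonic_on (\<lambda>z. h (Some (the (f z)))) ?W"
      by (rule plane_harmonic_compose(1)[OF open_charts_image(1)[OF V] h1 open_delete[OF V] f1]) (simp add: image_subset_iff)
    then have "plane_harmonic_on (\<lambda>z. h (f z)) ?W"
      by (rule plane_harmonic_on_cong_open[OF open_delete[OF V]]) auto
    then show ?thesis using False z open_delete[OF V, of None] by (intro exI[of _ ?W]) auto
  next
    case True
    let ?W = "{z \<in> V. f z \<noteq> Some 0}"
    have r: "recip (Some (the (recip p))) = p" if "p \<noteq> Some 0" for p
      using that by (cases p) auto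
    have "plane_harmonic_on (\<lambda>z. h (recip (Some (the (recip (f z)))))) ?W"
      by (rule plane_harmonic_compose(1)[OF open_charts_image(2)[OF V] h2 open_delete[OF V] f2]) (auto simp: r)
    then have "plane_harmonic_on (\<lambda>z. h (f z)) ?W"
      by (rule plane_harmonic_on_cong_open[OF open_delete[OF V]]) (auto simp: r)
    then show ?thesis using True z open_delete[OF V, of "Some 0"] by (intro exI[of _ ?W]) auto
  qed
qed

lemma harmonic_pushforward:
  assumes V: "open V" "V \<subseteq> ball 0 1" and u: "plane_harmonic_on u V"
    and h: "\<And>p. p \<in> f ` V \<Longrightarrow> h p = u (coord p)"
  shows "harmonic_on h (f ` V)"
proof -
  have sub: "f ` V \<subseteq> \<Omega>" using V(2) image_ball by blast
  have "plane_harmonic_on (\<lambda>z. u (coord (Some z))) {z. Some z \<in> f ` V}"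
    by (rule plane_harmonic_compose(1)[OF V(1) u open_charts_image(1)[OF V]])
       (use sub image_iff_coord[OF V(2)] in \<open>auto intro: holomorphic_on_subset[OF coord_holomorphic(1)]\<close>)
  then have 1: "plane_harmonic_on (\<lambda>z. h (Some z)) {z. Some z \<in> f ` V}"
    by (rule plane_harmonic_on_cong_open[OF open_charts_image(1)[OF V]]) (simp add: h)
  have "plane_harmonic_on (\<lambda>w. u (coord (recip (Some w)))) {w. recip (Some w) \<in> f ` V}"
    by (rule plane_harmonic_compose(1)[OF V(1) u open_charts_image(2)[OF V]])
       (use sub image_iff_coord[OF V(2)] in \<open>auto intro: holomorphic_on_subset[OF coord_holomorphic(2)]\<close>)
  then have "plane_harmonic_on (\<lambda>w. h (recip (Some w))) {w. recip (Some w) \<in> f ` V}"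
    by (rule plane_harmonic_on_cong_open[OF open_charts_image(2)[OF V]]) (simp add: h)
  with 1 show ?thesis by (simp add: harmonic_on_def)
qed

text \<open>The factor \<open>|g'|^2\<close> in the energy density of the pullback is the one in the
  change of variables.\<close>

lemma energy_conformal:
  assumes V: "open V" "V \<subseteq> ball 0 1" and h: "harmonic_on h (f ` V)"
  shows "dirichlet_energy (f ` V) h = ennreal (1 / pi) * plane_energy V (\<lambda>z. h (f z))"
proof -
  let ?W = "{z \<in> V. f z \<noteq> None}" and ?g = "\<lambda>z. the (f z)" and ?U = "{z. Some z \<in> f ` V}"
  have oW: "open ?W" by (rule open_delete[OF V])
  have oU: "open ?U" by (rule open_charts_image[OF V])
  have h1: "plane_harmonic_on (\<lambda>z. h (Some z)) ?U" using h by (auto simp: harmonic_on_def)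
  have hg: "?g holomorphic_on ?W"
    using to_sphere V(2) by (auto simp: holomorphic_to_sphere_def elim!: holomorphic_on_subset)
  have ig: "inj_on ?g ?W"
  proof (rule inj_onI)
    fix x y assume "x \<in> ?W" "y \<in> ?W" "?g x = ?g y"
    then have "f x = f y" "x \<in> ball 0 1" "y \<in> ball 0 1" using V(2) by (auto simp: option.expand)
    then show "x = y" by (rule inj_onD[OF inj_ball])
  qed
  have im: "?g ` ?W = ?U"
  proof (intro equalityI subsetI)
    fix y assume "y \<in> ?g ` ?W"
    then obtain x where "x \<in> V" "f x = Some y" by auto
    then show "y \<in> ?U" by (metis imageI mem_Collect_eq)
  next
    fix y assume "y \<in> ?U"
    then obtain x where "x \<in> V" "f x = Some y" by (metis imageE mem_Collect_eq)
    then show "y \<in> ?g ` ?W" by (intro image_eqI[of _ _ x]) auto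
  qed
  let ?F = "\<lambda>z. ennreal (energy_density (\<lambda>z. h (Some z)) z) * indicator ?U z"
  have "plane_energy ?U (\<lambda>z. h (Some z)) = (\<integral>\<^sup>+ z\<in>?g ` ?W. ?F z \<partial>lborel)"
    unfolding plane_energy_def im by (rule nn_integral_cong) (auto split: split_indicator)
  also have "\<dots> = (\<integral>\<^sup>+ z\<in>?W. ?F (?g z) * ennreal ((cmod (deriv ?g z))\<^sup>2) \<partial>lborel)"
    by (rule nn_integral_conformal[OF hg oW ig measurable_energy_density[OF oU h1]])
  also have "\<dots> = (\<integral>\<^sup>+ z\<in>?W. ennreal (energy_density (\<lambda>z. h (f z)) z) \<partial>lborel)"
  proof (rule nn_integral_cong)
    fix z
    show "?F (?g z) * ennreal ((cmod (deriv ?g z))\<^sup>2) * indicator ?W z =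
        ennreal (energy_density (\<lambda>z. h (f z)) z) * indicator ?W z"
    proof (cases "z \<in> ?W")
      case True
      have sub: "?g ` ?W \<subseteq> ?U" using im by simp
      have "energy_density (\<lambda>z. h (f z)) z = energy_density (\<lambda>z. h (Some (?g z))) z"
        by (rule energy_density_cong[OF oW plane_harmonic_compose(1)[OF oU h1 oW hg sub] _ True]) auto
      also have "\<dots> = energy_density (\<lambda>z. h (Some z)) (?g z) * (cmod (deriv ?g z))\<^sup>2"
        by (rule energy_density_compose[OF oU h1 oW hg sub True])
      finally show ?thesis using True by (simp add: ennreal_mult energy_density_nonneg)
    qed simp
  qed
  also have "\<dots> = plane_energy V (\<lambda>z. h (f z))"
  proof -
    \<comment> \<open>By injectivity infinity is attained at one point at most, a null set.\<close>
    obtain z0 where z0: "\<And>z. z \<in> V \<Longrightarrow> f z = None \<Longrightarrow> z = z0"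
      using inj_onD[OF inj_ball] V(2) by (metis subsetD)
    have "AE z in lborel. z \<noteq> z0" by (rule AE_lborel_singleton)
    then have "AE z in lborel. ennreal (energy_density (\<lambda>z. h (f z)) z) * indicator ?W z
        = ennreal (energy_density (\<lambda>z. h (f z)) z) * indicator V z"
      by eventually_elim (use z0 in \<open>auto split: split_indicator\<close>)
    then show ?thesis unfolding plane_energy_def by (rule nn_integral_cong_AE)
  qed
  finally show ?thesis by (simp add: dirichlet_energy_plane)
qed

end

subsection \<open>Polar coordinates and kernel estimates\<close>

lemma nn_integral_complex_iterated':
  fixes F :: "complex \<Rightarrow> ennreal"
  assumes [measurable]: "F \<in> borel_measurable borel"
  shows "(\<integral>\<^sup>+ z. F z \<partial>lborel) = (\<integral>\<^sup>+ y. \<integral>\<^sup>+ x. F (Complex x y) \<partial>lborel \<partial>lborel)"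
proof -
  have [measurable]: "(\<lambda>(x, y). Complex x y) \<in> borel_measurable (borel \<Otimes>\<^sub>M borel)"
    unfolding Complex_eq by measurable
  have "(\<lambda>(x, y). F (Complex x y)) \<in> borel_measurable (lborel \<Otimes>\<^sub>M lborel)"
  proof -
    have "(\<lambda>p. F ((\<lambda>(x, y). Complex x y) p)) \<in> borel_measurable (borel \<Otimes>\<^sub>M borel)"
      by (rule measurable_compose[of _ _ borel]) simp_all
    then show ?thesis by (simp add: case_prod_beta')
  qed
  from lborel_pair.Fubini'[OF this] show ?thesis
    by (simp add: nn_integral_complex_iterated)
qed

text \<open>Takes care of the slit that polar coordinates leave uncovered.\<close>

lemma AE_Im_neq: "AE z in lborel. Im z \<noteq> c"
proof -
  have m: "{z. Im z = c} \<in> sets borel" by (intro borel_closed closed_Collect_eq continuous_intros)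
  have "emeasure lborel {z. Im z = c} = (\<integral>\<^sup>+ z. indicator {z. Im z = c} z \<partial>lborel)" using m by simp
  also have "\<dots> = (\<integral>\<^sup>+ x. \<integral>\<^sup>+ y. indicator {z. Im z = c} (Complex x y) \<partial>lborel \<partial>lborel)"
    using m by (intro nn_integral_complex_iterated) auto
  also have "\<dots> = (\<integral>\<^sup>+ x. \<integral>\<^sup>+ y. indicator {c} y \<partial>lborel \<partial>(lborel :: real measure))"
    by (intro nn_integral_cong) (auto split: split_indicator)
  also have "\<dots> = 0" by simp
  finally show ?thesis using m by (intro AE_I[of _ _ "{z. Im z = c}"]) auto
qed

text \<open>Polar coordinates about \<open>w\<close> as a holomorphic map: \<open>Re \<zeta>\<close>
  is the angle in full turns and \<open>exp (- 2 * pi * Im \<zeta>)\<close> the radius, so areas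
  transform by the conformal formula.\<close>

definition polar_map :: "complex \<Rightarrow> complex \<Rightarrow> complex" where
  "polar_map w \<zeta> = w + exp (2 * of_real pi * \<i> * \<zeta>)"

lemma polar_map_holomorphic: "polar_map w holomorphic_on S"
  unfolding polar_map_def by (intro holomorphic_intros)

lemma deriv_polar_map: "deriv (polar_map w) \<zeta> = 2 * of_real pi * \<i> * exp (2 * of_real pi * \<i> * \<zeta>)"
  unfolding polar_map_def by (rule DERIV_imp_deriv) (auto intro!: derivative_eq_intros)

lemma norm_polar_map: "norm (polar_map w \<zeta> - w) = exp (- 2 * pi * Im \<zeta>)"
  by (simp add: polar_map_def)

lemma norm_deriv_polar_map: "(norm (deriv (polar_map w) \<zeta>))\<^sup>2 = 4 * pi\<^sup>2 * exp (- 4 * pi * Im \<zeta>)"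
proof -
  have "(exp (- (2 * pi * Im \<zeta>)))\<^sup>2 = exp (- (4 * pi * Im \<zeta>))"
    by (simp add: power2_eq_square flip: exp_add)
  then show ?thesis by (simp add: deriv_polar_map norm_mult power_mult_distrib)
qed

lemma polar_map_inj: "inj_on (polar_map w) {\<zeta>. 0 < Re \<zeta> \<and> Re \<zeta> < 1}"
proof (rule inj_onI)
  fix a b assume ab: "a \<in> {\<zeta>. 0 < Re \<zeta> \<and> Re \<zeta> < 1}" "b \<in> {\<zeta>. 0 < Re \<zeta> \<and> Re \<zeta> < 1}" "polar_map w a = polar_map w b"
  have "exp (2 * of_real pi * \<i> * a) = exp (2 * of_real pi * \<i> * b)" using ab(3) by (simp add: polar_map_def)
  moreover have "\<bar>Im (2 * of_real pi * \<i> * a) - Im (2 * of_real pi * \<i> * b)\<bar> < 2 * pi"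
  proof -
    have "Im (2 * of_real pi * \<i> * a) - Im (2 * of_real pi * \<i> * b) = 2 * pi * (Re a - Re b)" by (simp add: algebra_simps)
    moreover have "\<bar>Re a - Re b\<bar> < 1" using ab(1,2) by auto
    ultimately show ?thesis by (simp add: abs_mult)
  qed
  ultimately have "2 * of_real pi * \<i> * a = 2 * of_real pi * \<i> * b" by (rule exp_complex_eqI[rotated])
  then show "a = b" by simp
qed

text \<open>The half strip misses only the centre and one radius of the disc, both on the horizontal
  line through \<open>w\<close>. For a point off that line the argument is moved into the open range
  from 0 to \<open>2 * pi\<close>.\<close>

lemma polar_map_image:
  "polar_map w ` {\<zeta>. (0 < Re \<zeta> \<and> Re \<zeta> < 1) \<and> X < Im \<zeta>} \<subseteq> ball w (exp (- 2 * pi * X))"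
  "ball w (exp (- 2 * pi * X)) \<subseteq> polar_map w ` {\<zeta>. (0 < Re \<zeta> \<and> Re \<zeta> < 1) \<and> X < Im \<zeta>} \<union> {z. Im z = Im w}"
proof -
  show "polar_map w ` {\<zeta>. (0 < Re \<zeta> \<and> Re \<zeta> < 1) \<and> X < Im \<zeta>} \<subseteq> ball w (exp (- 2 * pi * X))"
    using norm_polar_map[of w] by (auto simp: dist_norm norm_minus_commute)
  show "ball w (exp (- 2 * pi * X)) \<subseteq> polar_map w ` {\<zeta>. (0 < Re \<zeta> \<and> Re \<zeta> < 1) \<and> X < Im \<zeta>} \<union> {z. Im z = Im w}"
  proof
    fix z assume z: "z \<in> ball w (exp (- 2 * pi * X))"
    show "z \<in> polar_map w ` {\<zeta>. (0 < Re \<zeta> \<and> Re \<zeta> < 1) \<and> X < Im \<zeta>} \<union> {z. Im z = Im w}"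
    proof (cases "Im z = Im w")
      case False
      define u where "u = z - w"
      have u: "Im u \<noteq> 0" "u \<noteq> 0" "norm u < exp (- 2 * pi * X)" using False z by (auto simp: u_def dist_norm norm_minus_commute)
      define t where "t = (if Arg u < 0 then Arg u + 2 * pi else Arg u)"
      have A: "Arg u \<noteq> 0" using u(1) by (metis Arg_eq_0 complex_is_Real_iff)
      have t: "0 < t" "t < 2 * pi" "cis t = cis (Arg u)"
        using A Arg_bounded[of u] by (auto simp: t_def cis_mult[symmetric])
      define \<zeta> where "\<zeta> = Complex (t / (2 * pi)) (- ln (norm u) / (2 * pi))"
      have "ln (norm u) < ln (exp (- 2 * pi * X))" using u by (subst ln_less_cancel_iff) auto
      then have "X < Im \<zeta>" by (simp add: \<zeta>_def field_simps)
      moreover have "0 < Re \<zeta>" "Re \<zeta> < 1" using t by (auto simp: \<zeta>_def)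
      moreover have "polar_map w \<zeta> = z"
      proof -
        have "2 * of_real pi * \<i> * \<zeta> = Complex (ln (norm u)) t" by (simp add: \<zeta>_def complex_eq_iff)
        then have "exp (2 * of_real pi * \<i> * \<zeta>) = of_real (norm u) * cis t" using u by (simp add: exp_eq_polar)
        also have "\<dots> = u" using rcis_cmod_Arg[of u] t by (simp add: rcis_def)
        finally show ?thesis by (simp add: polar_map_def u_def)
      qed
      ultimately show ?thesis by (intro UnI1 image_eqI[of _ _ \<zeta>]) auto
    qed simp
  qed
qed

lemma open_half_strip: "open {\<zeta>. (0 < Re \<zeta> \<and> Re \<zeta> < 1) \<and> X < Im \<zeta>}"
  by (intro open_Collect_conj open_Collect_less continuous_intros)

lemma nn_integral_ball_strip:
  assumes [measurable]: "F \<in> borel_measurable borel"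
  shows "(\<integral>\<^sup>+ z\<in>ball w (exp (- 2 * pi * X)). F z \<partial>lborel) =
    (\<integral>\<^sup>+ \<zeta>\<in>{\<zeta>. (0 < Re \<zeta> \<and> Re \<zeta> < 1) \<and> X < Im \<zeta>}. F (polar_map w \<zeta>) * ennreal (4 * pi\<^sup>2 * exp (- 4 * pi * Im \<zeta>)) \<partial>lborel)"
proof -
  let ?S = "{\<zeta>. (0 < Re \<zeta> \<and> Re \<zeta> < 1) \<and> X < Im \<zeta>}"
  have inj: "inj_on (polar_map w) ?S" by (rule inj_on_subset[OF polar_map_inj]) auto
  have "AE z in lborel. F z * indicator (ball w (exp (- 2 * pi * X))) z = F z * indicator (polar_map w ` ?S) z"
    using AE_Im_neq[of "Im w"]
  proof eventually_elim
    case (elim z)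
    then have "z \<in> ball w (exp (- 2 * pi * X)) \<longleftrightarrow> z \<in> polar_map w ` ?S" using polar_map_image[of w X] by blast
    then show ?case by (simp add: indicator_def)
  qed
  then have "(\<integral>\<^sup>+ z\<in>ball w (exp (- 2 * pi * X)). F z \<partial>lborel) = (\<integral>\<^sup>+ z\<in>polar_map w ` ?S. F z \<partial>lborel)"
    by (rule nn_integral_cong_AE)
  then show ?thesis
    by (simp only: nn_integral_conformal[OF polar_map_holomorphic open_half_strip inj assms] norm_deriv_polar_map)
qed

lemma polar_map_borel [measurable]: "polar_map w \<in> borel_measurable borel"
  by (intro borel_measurable_continuous_onI holomorphic_on_imp_continuous_on polar_map_holomorphic)

lemma nn_integral_polar:
  assumes [measurable]: "F \<in> borel_measurable borel"
  shows "(\<integral>\<^sup>+ z\<in>ball w (exp (- 2 * pi * X)). F z \<partial>lborel) =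
    (\<integral>\<^sup>+ x\<in>{X<..}. (\<integral>\<^sup>+ y\<in>{0..1}. F (polar_map w (Complex y x)) \<partial>lborel) * ennreal (4 * pi\<^sup>2 * exp (- 4 * pi * x)) \<partial>lborel)"
proof -
  let ?S = "{\<zeta>. (0 < Re \<zeta> \<and> Re \<zeta> < 1) \<and> X < Im \<zeta>}"
  let ?e = "\<lambda>x. ennreal (4 * pi\<^sup>2 * exp (- 4 * pi * x))"
  have [measurable]: "?S \<in> sets borel" by (intro borel_open open_half_strip)
  have [measurable]: "(\<lambda>y. Complex y x) \<in> borel_measurable borel" for x
    unfolding Complex_eq by measurable
  have "(\<integral>\<^sup>+ z\<in>ball w (exp (- 2 * pi * X)). F z \<partial>lborel) = (\<integral>\<^sup>+ \<zeta>. F (polar_map w \<zeta>) * ?e (Im \<zeta>) * indicator ?S \<zeta> \<partial>lborel)"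
    by (rule nn_integral_ball_strip) simp
  also have "\<dots> = (\<integral>\<^sup>+ x. \<integral>\<^sup>+ y. F (polar_map w (Complex y x)) * ?e x * indicator ?S (Complex y x) \<partial>lborel \<partial>lborel)"
    by (subst nn_integral_complex_iterated') (simp_all, measurable)
  also have "\<dots> = (\<integral>\<^sup>+ x. \<integral>\<^sup>+ y. (F (polar_map w (Complex y x)) * indicator {0..1} y) * (?e x * indicator {X<..} x) \<partial>lborel \<partial>lborel)"
  proof (rule nn_integral_cong, rule nn_integral_cong_AE)
    fix x
    have "AE y in lborel. y \<noteq> (0::real)" "AE y in lborel. y \<noteq> (1::real)" by (rule AE_lborel_singleton)+
    then show "AE y in lborel. F (polar_map w (Complex y x)) * ?e x * indicator ?S (Complex y x) =
       (F (polar_map w (Complex y x)) * indicator {0..1} y) * (?e x * indicator {X<..} x)"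
      by eventually_elim (auto split: split_indicator)
  qed
  also have "\<dots> = (\<integral>\<^sup>+ x\<in>{X<..}. (\<integral>\<^sup>+ y\<in>{0..1}. F (polar_map w (Complex y x)) \<partial>lborel) * ?e x \<partial>lborel)"
    by (intro nn_integral_cong) (subst nn_integral_multc, simp_all add: mult.assoc)
  finally show ?thesis .
qed

section \<open>Mean values of holomorphic functions\<close>

lemma circle_mean:
  assumes f: "f holomorphic_on ball w \<rho>" and R: "0 < R" "R < \<rho>"
  shows "((\<lambda>y. f (w + of_real R * exp (2 * of_real pi * \<i> * of_real y))) has_integral f w) {0..1}"
proof -
  have "f holomorphic_on cball w R" using f R by (auto elim!: holomorphic_on_subset)
  then have "((\<lambda>u. f u / (u - w)) has_contour_integral (2 * of_real pi * \<i> * f w)) (circlepath w R)"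
    by (rule Cauchy_integral_circlepath_simple) (use R in auto)
  then have "((\<lambda>x. f (circlepath w R x) / (circlepath w R x - w) * vector_derivative (circlepath w R) (at x within {0..1}))
      has_integral (2 * of_real pi * \<i> * f w)) {0..1}"
    by (simp add: has_contour_integral_def)
  then have "((\<lambda>y. (2 * of_real pi * \<i>) * f (w + of_real R * exp (2 * of_real pi * \<i> * of_real y))) has_integral (2 * of_real pi * \<i> * f w)) {0..1}"
  proof (rule has_integral_eq[rotated])
    fix x :: real assume x: "x \<in> {0..1}"
    have v: "vector_derivative (circlepath w R) (at x within {0..1}) = 2 * pi * \<i> * R * exp (2 * of_real pi * \<i> * x)"
      using x by (intro vector_derivative_circlepath01) auto
    have c: "circlepath w R x = w + of_real R * exp (2 * of_real pi * \<i> * of_real x)"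
      by (simp add: circlepath)
    show "f (circlepath w R x) / (circlepath w R x - w) * vector_derivative (circlepath w R) (at x within {0..1}) =
        (2 * of_real pi * \<i>) * f (w + of_real R * exp (2 * of_real pi * \<i> * of_real x))"
      unfolding v unfolding c using R by simp
  qed
  from has_integral_mult_right[OF this, of "1 / (2 * of_real pi * \<i>)"] show ?thesis by simp
qed

lemma circle_mean_norm_le:
  assumes f: "f holomorphic_on ball w \<rho>" and R: "0 < R" "R < \<rho>"
  shows "ennreal (norm (f w)) \<le> (\<integral>\<^sup>+ y\<in>{0..1}. ennreal (norm (f (w + of_real R * exp (2 * of_real pi * \<i> * of_real y)))) \<partial>lborel)"
proof -
  let ?g = "\<lambda>y. f (w + of_real R * exp (2 * of_real pi * \<i> * of_real y))"
  have cont: "continuous_on {0..1} ?g"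
    by (intro continuous_on_compose2[OF holomorphic_on_imp_continuous_on[OF f]] continuous_intros)
       (use R in \<open>auto simp: dist_norm norm_mult\<close>)
  have "norm (f w) = norm (integral {0..1} ?g)" using integral_unique[OF circle_mean[OF assms]] by simp
  also have "\<dots> \<le> integral {0..1} (\<lambda>y. norm (?g y))"
    by (rule integral_norm_bound_integral) (auto intro!: integrable_continuous_interval continuous_intros cont)
  finally have "ennreal (norm (f w)) \<le> ennreal (integral {0..1} (\<lambda>y. norm (?g y)))" by (rule ennreal_leI)
  also have "\<dots> = (\<integral>\<^sup>+ y. ennreal (norm (?g y)) * indicator {0..1} y \<partial>lborel)"
    by (rule nn_integral_has_integral_lebesgue'[symmetric])
       (auto intro!: integrable_integral integrable_continuous_interval continuous_intros cont)
  finally show ?thesis .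
qed

lemma polar_map_circle: "polar_map w (Complex y x) = w + of_real (exp (- 2 * pi * x)) * exp (2 * of_real pi * \<i> * of_real y)"
proof -
  have "2 * of_real pi * \<i> * Complex y x = of_real (- 2 * pi * x) + 2 * of_real pi * \<i> * of_real y"
    by (simp add: complex_eq_iff)
  then show ?thesis unfolding polar_map_def by (simp only: exp_add exp_of_real)
qed

text \<open>The polar weight one unit of the logarithmic radius inside the disc, relative to the
  square of the radius: the smallest weight on the ring used in
  \<open>area_mean_bound\<close>.\<close>

definition area_mean_const :: real where "area_mean_const = 4 * pi\<^sup>2 * exp (- 4 * pi)"

lemma area_mean_const_pos: "0 < area_mean_const"
  by (simp add: area_mean_const_def)

text \<open>The circle means are integrated over a ring only, \<open>X < x < X + 1\<close>; there
  the weight is at least its value at \<open>X + 1\<close>, where \<open>X\<close> corresponds to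
  the radius \<open>\<rho>\<close>.\<close>

lemma area_mean_bound:
  assumes f: "f holomorphic_on ball w \<rho>" and \<rho>: "0 < \<rho>"
  shows "ennreal (area_mean_const * \<rho>\<^sup>2 * norm (f w)) \<le> (\<integral>\<^sup>+ z\<in>ball w \<rho>. ennreal (norm (f z)) \<partial>lborel)"
proof -
  define X where "X = - ln \<rho> / (2 * pi)"
  have eX: "exp (- 2 * pi * X) = \<rho>" using \<rho> by (simp add: X_def)
  define F where "F z = ennreal (norm (f z)) * indicator (ball w \<rho>) z" for z
  have [measurable]: "F \<in> borel_measurable borel"
  proof -
    have "(\<lambda>z. indicator (ball w \<rho>) z *\<^sub>R norm (f z)) \<in> borel_measurable borel"
      by (intro borel_measurable_continuous_on_indicator continuous_intros holomorphic_on_imp_continuous_on f) auto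
    then have "(\<lambda>z. ennreal (indicator (ball w \<rho>) z *\<^sub>R norm (f z))) \<in> borel_measurable borel" by measurable
    moreover have "(\<lambda>z. ennreal (indicator (ball w \<rho>) z *\<^sub>R norm (f z))) = F"
      by (auto simp: F_def fun_eq_iff split: split_indicator)
    ultimately show ?thesis by (simp only:)
  qed
  have lower: "ennreal (norm (f w)) \<le> (\<integral>\<^sup>+ y\<in>{0..1}. F (polar_map w (Complex y x)) \<partial>lborel)" if x: "X < x" for x
  proof -
    have lt: "exp (- 2 * pi * x) < \<rho>" using x unfolding eX[symmetric] by simp
    have "ennreal (norm (f w)) \<le> (\<integral>\<^sup>+ y\<in>{0..1}. ennreal (norm (f (polar_map w (Complex y x)))) \<partial>lborel)"
      unfolding polar_map_circle by (rule circle_mean_norm_le[OF f _ lt]) simp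
    also have "\<dots> = (\<integral>\<^sup>+ y\<in>{0..1}. F (polar_map w (Complex y x)) \<partial>lborel)"
      using lt norm_polar_map[of w] by (auto simp: F_def dist_norm norm_minus_commute intro!: nn_integral_cong)
    finally show ?thesis .
  qed
  have "ennreal (area_mean_const * \<rho>\<^sup>2 * norm (f w)) = (\<integral>\<^sup>+ x. ennreal (norm (f w)) * ennreal (area_mean_const * \<rho>\<^sup>2) * indicator {X<..<X + 1} x \<partial>lborel)"
    by (subst nn_integral_cmult_indicator) (auto simp: ennreal_mult[symmetric] area_mean_const_pos less_imp_le mult.commute)
  also have "\<dots> \<le> (\<integral>\<^sup>+ x\<in>{X<..}. (\<integral>\<^sup>+ y\<in>{0..1}. F (polar_map w (Complex y x)) \<partial>lborel) * ennreal (4 * pi\<^sup>2 * exp (- 4 * pi * x)) \<partial>lborel)"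
  proof (rule nn_integral_mono)
    fix x
    show "ennreal (norm (f w)) * ennreal (area_mean_const * \<rho>\<^sup>2) * indicator {X<..<X + 1} x \<le>
      (\<integral>\<^sup>+ y\<in>{0..1}. F (polar_map w (Complex y x)) \<partial>lborel) * ennreal (4 * pi\<^sup>2 * exp (- 4 * pi * x)) * indicator {X<..} x"
    proof (cases "x \<in> {X<..<X + 1}")
      case True
      have "\<rho>\<^sup>2 = exp (- 4 * pi * X)"
        unfolding eX[symmetric] by (simp add: power2_eq_square flip: exp_add)
      then have "area_mean_const * \<rho>\<^sup>2 = 4 * pi\<^sup>2 * exp (- 4 * pi * (X + 1))"
        by (simp add: area_mean_const_def flip: exp_add) (simp add: algebra_simps)
      also have "\<dots> \<le> 4 * pi\<^sup>2 * exp (- 4 * pi * x)" using True by simp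
      finally have le: "area_mean_const * \<rho>\<^sup>2 \<le> 4 * pi\<^sup>2 * exp (- 4 * pi * x)" .
      have "ennreal (norm (f w)) * ennreal (area_mean_const * \<rho>\<^sup>2) \<le> (\<integral>\<^sup>+ y\<in>{0..1}. F (polar_map w (Complex y x)) \<partial>lborel) * ennreal (4 * pi\<^sup>2 * exp (- 4 * pi * x))"
        by (rule mult_mono[OF lower ennreal_leI[OF le]]) (use True in auto)
      then show ?thesis using True by simp
    qed simp
  qed
  also have "\<dots> = (\<integral>\<^sup>+ z\<in>ball w \<rho>. F z \<partial>lborel)"
    using nn_integral_polar[of F w X] unfolding eX by simp
  also have "\<dots> = (\<integral>\<^sup>+ z\<in>ball w \<rho>. ennreal (norm (f z)) \<partial>lborel)"
    by (rule nn_integral_cong) (auto simp: F_def split: split_indicator)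
  finally show ?thesis .
qed

text \<open>In the coordinate \<open>x\<close> the kernel times the weight is
  \<open>4 * pi^2 * r / max r \<delta>\<close>. For radii above \<open>\<delta>\<close> this is at
  most constant on an interval whose length gives the logarithm; below \<open>\<delta>\<close> it
  decays exponentially and adds \<open>2 * pi\<close>.\<close>

lemma radial_kernel_bound:
  fixes q :: complex
  assumes \<delta>: "0 < \<delta>" "\<delta> \<le> 2"
  shows "(\<integral>\<^sup>+ z\<in>ball q 2. ennreal (1 / (norm (z - q) * max (norm (z - q)) \<delta>)) \<partial>lborel) \<le> ennreal (2 * pi * (1 + ln 2 - ln \<delta>))"
proof -
  define X where "X = - ln 2 / (2 * pi)"
  define x0 where "x0 = - ln \<delta> / (2 * pi)"
  have eX: "exp (- 2 * pi * X) = 2" by (simp add: X_def)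
  have ex0: "exp (- 2 * pi * x0) = \<delta>" using \<delta> by (simp add: x0_def)
  have Xx0: "X \<le> x0" using \<delta> by (simp add: X_def x0_def divide_right_mono)
  let ?F = "\<lambda>z. ennreal (1 / (norm (z - q) * max (norm (z - q)) \<delta>))"
  have "(\<integral>\<^sup>+ z\<in>ball q 2. ?F z \<partial>lborel) =
      (\<integral>\<^sup>+ x\<in>{X<..}. (\<integral>\<^sup>+ y\<in>{0..1}. ?F (polar_map q (Complex y x)) \<partial>lborel) * ennreal (4 * pi\<^sup>2 * exp (- 4 * pi * x)) \<partial>lborel)"
    using nn_integral_polar[of ?F q X] unfolding eX by simp
  also have "\<dots> \<le> (\<integral>\<^sup>+ x. ennreal (4 * pi\<^sup>2) * indicator {X..x0} x + ennreal (4 * pi\<^sup>2 / \<delta> * exp (- 2 * pi * x)) * indicator {x0..} x \<partial>lborel)"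
  proof (rule nn_integral_mono)
    fix x :: real
    let ?r = "exp (- 2 * pi * x)"
    have "(\<integral>\<^sup>+ y\<in>{0..1}. ?F (polar_map q (Complex y x)) \<partial>lborel) = (\<integral>\<^sup>+ y. ennreal (1 / (?r * max ?r \<delta>)) * indicator {0..1} (y::real) \<partial>lborel)"
      by (rule nn_integral_cong) (simp add: norm_polar_map)
    also have "\<dots> = ennreal (1 / (?r * max ?r \<delta>))" by (simp add: nn_integral_cmult_indicator)
    finally have inner: "(\<integral>\<^sup>+ y\<in>{0..1}. ?F (polar_map q (Complex y x)) \<partial>lborel) * ennreal (4 * pi\<^sup>2 * exp (- 4 * pi * x)) = ennreal (1 / (?r * max ?r \<delta>) * (4 * pi\<^sup>2 * exp (- 4 * pi * x)))"
      using \<delta> by (simp add: ennreal_mult[symmetric] max_def)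
    have e2: "exp (- 4 * pi * x) = ?r * ?r" by (simp flip: exp_add)
    have "1 / (?r * max ?r \<delta>) * (4 * pi\<^sup>2 * exp (- 4 * pi * x)) = 4 * pi\<^sup>2 * (?r / max ?r \<delta>)"
      unfolding e2 by simp
    note val = inner[unfolded this]
    consider "x \<le> X" | "X < x" "x \<le> x0" | "x0 < x" "X < x" using Xx0 by linarith
    then show "(\<integral>\<^sup>+ y\<in>{0..1}. ?F (polar_map q (Complex y x)) \<partial>lborel) * ennreal (4 * pi\<^sup>2 * exp (- 4 * pi * x)) * indicator {X<..} x
       \<le> ennreal (4 * pi\<^sup>2) * indicator {X..x0} x + ennreal (4 * pi\<^sup>2 / \<delta> * ?r) * indicator {x0..} x"
    proof cases
      case 1 then show ?thesis by simp
    next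
      case 2
      have "?r / max ?r \<delta> \<le> 1" using \<delta> by (simp add: divide_le_eq max_def)
      then have "4 * pi\<^sup>2 * (?r / max ?r \<delta>) \<le> 4 * pi\<^sup>2" by (rule mult_left_le) simp
      then have "ennreal (4 * pi\<^sup>2 * (?r / max ?r \<delta>)) \<le> ennreal (4 * pi\<^sup>2)" by (rule ennreal_leI)
      then show ?thesis unfolding val using 2 by (simp add: add_increasing2)
    next
      case 3
      have "?r / max ?r \<delta> \<le> ?r / \<delta>" using \<delta> by (intro divide_left_mono) auto
      then have "4 * pi\<^sup>2 * (?r / max ?r \<delta>) \<le> 4 * pi\<^sup>2 * (?r / \<delta>)" by (rule mult_left_mono) simp
      then have "4 * pi\<^sup>2 * (?r / max ?r \<delta>) \<le> 4 * pi\<^sup>2 / \<delta> * ?r" by simp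
      then have "ennreal (4 * pi\<^sup>2 * (?r / max ?r \<delta>)) \<le> ennreal (4 * pi\<^sup>2 / \<delta> * ?r)" by (rule ennreal_leI)
      then show ?thesis unfolding val using 3 by (simp add: add_increasing)
    qed
  qed
  also have "\<dots> = ennreal (4 * pi\<^sup>2) * emeasure lborel {X..x0} + (\<integral>\<^sup>+ x\<in>{x0..}. ennreal (4 * pi\<^sup>2 / \<delta> * exp (- 2 * pi * x)) \<partial>lborel)"
    by (subst nn_integral_add) (auto simp: nn_integral_cmult_indicator)
  also have "(\<integral>\<^sup>+ x\<in>{x0..}. ennreal (4 * pi\<^sup>2 / \<delta> * exp (- 2 * pi * x)) \<partial>lborel) = 0 - (- 2 * pi / \<delta> * exp (- 2 * pi * x0))"
  proof (rule nn_integral_FTC_atLeast)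
    show "((\<lambda>x. - 2 * pi / \<delta> * exp (- 2 * pi * x)) \<longlongrightarrow> 0) at_top" by real_asymp
    show "DERIV (\<lambda>x. - 2 * pi / \<delta> * exp (- 2 * pi * x)) x :> 4 * pi\<^sup>2 / \<delta> * exp (- 2 * pi * x)" for x
      using \<delta>(1) by (auto intro!: derivative_eq_intros simp: power2_eq_square)
  qed (use \<delta> in auto)
  also have "0 - (- 2 * pi / \<delta> * exp (- 2 * pi * x0)) = 2 * pi"
    unfolding ex0 using \<delta>(1) by auto
  also have "ennreal (4 * pi\<^sup>2) * emeasure lborel {X..x0} + ennreal (2 * pi) = ennreal (2 * pi * (1 + ln 2 - ln \<delta>))"
  proof -
    have "4 * pi\<^sup>2 * (x0 - X) + 2 * pi = 2 * pi * (1 + ln 2 - ln \<delta>)"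
      by (simp add: X_def x0_def power2_eq_square field_simps)
    then show ?thesis using Xx0 by (simp add: ennreal_mult[symmetric] ennreal_plus[symmetric] del: ennreal_plus)
  qed
  finally show ?thesis .
qed

text \<open>The integrand of the subtracted term in \<open>log_energy\<close>; values of
  \<open>- ln\<close> below 0 are cut off by \<open>ennreal\<close>.\<close>

definition log_kernel :: "complex \<Rightarrow> complex \<Rightarrow> ennreal" where
  "log_kernel z w = (if z = w then \<infinity> else ennreal (- ln (cmod (z - w))))"

text \<open>In the plane the convolution of two kernels \<open>1 / |z|\<close> has only a
  logarithmic singularity. At each \<open>z\<close> the farther of the two poles contributes at most
  one over the larger of \<open>\<delta>\<close> and the distance to the nearer pole.\<close>

lemma riesz_kernel_bound:
  assumes q: "norm q = 1" "norm q' = 1"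
  shows "(\<integral>\<^sup>+ z\<in>ball 0 1. ennreal (1 / norm (z - q)) * ennreal (1 / norm (z - q')) \<partial>lborel)
    \<le> ennreal (4 * pi * (1 + 2 * ln 2)) + ennreal (4 * pi) * log_kernel q q'"
proof (cases "q = q'")
  case True
  then show ?thesis by (simp add: log_kernel_def ennreal_mult_top)
next
  case False
  \<comment> \<open>Half the distance of the poles, since every point is at least this far from one
    of them.\<close>
  define \<delta> where "\<delta> = norm (q - q') / 2"
  have \<delta>: "0 < \<delta>" "\<delta> \<le> 2" "\<delta> \<le> 1" using False norm_triangle_ineq4[of q q'] q by (auto simp: \<delta>_def)
  let ?K = "\<lambda>q z. ennreal (1 / (norm (z - q) * max (norm (z - q)) \<delta>)) * indicator (ball q 2) z"
  have "(\<integral>\<^sup>+ z\<in>ball 0 1. ennreal (1 / norm (z - q)) * ennreal (1 / norm (z - q')) \<partial>lborel) \<le> (\<integral>\<^sup>+ z. ?K q z + ?K q' z \<partial>lborel)"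
  proof (rule nn_integral_mono)
    fix z :: complex
    show "ennreal (1 / norm (z - q)) * ennreal (1 / norm (z - q')) * indicator (ball 0 1) z \<le> ?K q z + ?K q' z"
    proof (cases "z \<in> ball 0 1")
      case True
      have key: "ennreal (1 / norm (z - a)) * ennreal (1 / norm (z - b)) \<le> ?K a z"
        if ab: "norm a = 1" "norm b = 1" "norm (a - b) = 2 * \<delta>" "norm (z - a) \<le> norm (z - b)" for a b
      proof -
        have za: "0 < norm (z - a)" using True ab(1) by auto
        have "norm (a - b) \<le> norm (z - a) + norm (z - b)" using norm_triangle_ineq4[of "z - b" "z - a"] by simp
        then have "max (norm (z - a)) \<delta> \<le> norm (z - b)" using ab(3,4) by auto
        then have "1 / (norm (z - a) * norm (z - b)) \<le> 1 / (norm (z - a) * max (norm (z - a)) \<delta>)"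
          using za \<delta>(1) ab(4) by (intro divide_left_mono mult_left_mono mult_pos_pos) linarith+
        moreover have "z \<in> ball a 2"
          using norm_triangle_ineq4[of a z] True ab(1) by (simp add: dist_norm)
        ultimately show ?thesis by (simp add: ennreal_mult[symmetric] ennreal_leI)
      qed
      have n: "norm (q - q') = 2 * \<delta>" "norm (q' - q) = 2 * \<delta>" by (simp_all add: \<delta>_def norm_minus_commute)
      show ?thesis
      proof (cases "norm (z - q) \<le> norm (z - q')")
        case le: True
        have "ennreal (1 / norm (z - q)) * ennreal (1 / norm (z - q')) \<le> ?K q z" by (rule key[OF q n(1) le])
        then show ?thesis using True by (simp add: add_increasing2)
      next
        case False
        then have "ennreal (1 / norm (z - q')) * ennreal (1 / norm (z - q)) \<le> ?K q' z" using key[OF q(2,1) n(2)] by simp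
        then show ?thesis using True by (simp add: add_increasing mult.commute)
      qed
    qed simp
  qed
  also have "\<dots> = (\<integral>\<^sup>+ z. ?K q z \<partial>lborel) + (\<integral>\<^sup>+ z. ?K q' z \<partial>lborel)"
  proof -
    have [measurable]: "ball a 2 \<in> sets borel" for a :: complex by simp
    show ?thesis by (rule nn_integral_add; measurable)
  qed
  also have "\<dots> \<le> ennreal (2 * pi * (1 + ln 2 - ln \<delta>)) + ennreal (2 * pi * (1 + ln 2 - ln \<delta>))"
    by (intro add_mono radial_kernel_bound \<delta>)
  also have "\<dots> = ennreal (4 * pi * (1 + ln 2 - ln \<delta>))"
  proof -
    have "ln \<delta> \<le> 0" "(0::real) \<le> ln 2" using \<delta> by simp_all
    then have "0 \<le> 1 + ln 2 - ln \<delta>" by linarith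
    then have "0 \<le> 2 * pi * (1 + ln 2 - ln \<delta>)" by (intro mult_nonneg_nonneg) simp_all
    then show ?thesis by (simp add: ennreal_plus[symmetric] del: ennreal_plus)
  qed
  also have "\<dots> \<le> ennreal (4 * pi * (1 + 2 * ln 2) + 4 * pi * max 0 (- ln (norm (q - q'))))"
  proof (rule ennreal_leI)
    have "ln \<delta> = ln (norm (q - q')) - ln 2" using False by (simp add: \<delta>_def ln_div)
    then have "1 + ln 2 - ln \<delta> \<le> (1 + 2 * ln 2) + max 0 (- ln (norm (q - q')))" by simp
    then have "4 * pi * (1 + ln 2 - ln \<delta>) \<le> 4 * pi * ((1 + 2 * ln 2) + max 0 (- ln (norm (q - q'))))" by (intro mult_left_mono) auto
    then show "4 * pi * (1 + ln 2 - ln \<delta>) \<le> 4 * pi * (1 + 2 * ln 2) + 4 * pi * max 0 (- ln (norm (q - q')))" by (simp only: distrib_left)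
  qed
  also have "\<dots> = ennreal (4 * pi * (1 + 2 * ln 2)) + ennreal (4 * pi) * log_kernel q q'"
  proof -
    have "log_kernel q q' = ennreal (max 0 (- ln (norm (q - q'))))" using False by (simp add: log_kernel_def ennreal_max_0)
    then show ?thesis by (simp add: ennreal_plus ennreal_mult ennreal_max_0)
  qed
  finally show ?thesis .
qed

subsection \<open>Sets of capacity zero on the circle\<close>

text \<open>Capacity zero in terms of the negative part of the logarithm alone; on the circle the
  positive part is bounded, so the two notions agree there.\<close>

definition polar_set :: "complex set \<Rightarrow> bool" where
  "polar_set E \<longleftrightarrow> (\<forall>\<mu> K. prob_space \<mu> \<longrightarrow> sets \<mu> = sets borel \<longrightarrow> compact K \<longrightarrow> K \<subseteq> E \<longrightarrow> emeasure \<mu> K = 1 \<longrightarrow>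
     (\<integral>\<^sup>+ z. \<integral>\<^sup>+ w. log_kernel z w \<partial>\<mu> \<partial>\<mu>) = \<infinity>)"

lemma log_kernel_borel [measurable]: "(\<lambda>(z, w). log_kernel z w) \<in> borel_measurable (borel \<Otimes>\<^sub>M borel)"
  unfolding log_kernel_def by measurable

text \<open>Points of the circle are at distance at most 2, so the positive part contributes at most
  \<open>ln 2\<close>.\<close>

lemma log_energy_eq_minus_infinity_iff:
  assumes \<mu>: "prob_space \<mu>" "sets \<mu> = sets borel" and K: "K \<subseteq> sphere 0 1" "compact K" "emeasure \<mu> K = 1"
  shows "log_energy \<mu> = - \<infinity> \<longleftrightarrow> (\<integral>\<^sup>+ z. \<integral>\<^sup>+ w. log_kernel z w \<partial>\<mu> \<partial>\<mu>) = \<infinity>"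
proof -
  interpret prob_space \<mu> by fact
  have Km: "K \<in> sets \<mu>" using K(2) \<mu>(2) by (simp add: borel_compact)
  have AEK: "AE z in \<mu>. z \<in> K"
    using K(3) Km by (intro AE_prob_1) (simp add: measure_def)
  define A where "A = (\<integral>\<^sup>+ z. \<integral>\<^sup>+ w. ennreal (ln (cmod (z - w))) \<partial>\<mu> \<partial>\<mu>)"
  define B where "B = (\<integral>\<^sup>+ z. \<integral>\<^sup>+ w. log_kernel z w \<partial>\<mu> \<partial>\<mu>)"
  have "A \<le> (\<integral>\<^sup>+ z. ennreal (ln 2) \<partial>\<mu>)"
    unfolding A_def
  proof (rule nn_integral_mono_AE)
    show "AE z in \<mu>. (\<integral>\<^sup>+ w. ennreal (ln (cmod (z - w))) \<partial>\<mu>) \<le> ennreal (ln 2)"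
      using AEK
    proof eventually_elim
      case (elim z)
      have "(\<integral>\<^sup>+ w. ennreal (ln (cmod (z - w))) \<partial>\<mu>) \<le> (\<integral>\<^sup>+ w. ennreal (ln 2) \<partial>\<mu>)"
      proof (rule nn_integral_mono_AE)
        show "AE w in \<mu>. ennreal (ln (cmod (z - w))) \<le> ennreal (ln 2)"
          using AEK
        proof eventually_elim
          case w: (elim w)
          have "norm z = 1" "norm w = 1" using elim w K(1) by auto
          then have le: "cmod (z - w) \<le> 2" using norm_triangle_ineq4[of z w] by simp
          show ?case
          proof (cases "z = w")
            case True then show ?thesis by simp
          next
            case False
            then have "ln (cmod (z - w)) \<le> ln 2" using le by (subst ln_le_cancel_iff) auto
            then show ?thesis by (rule ennreal_leI)
          qed
        qed
      qed
      also have "\<dots> = ennreal (ln 2)" by (simp add: emeasure_space_1)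
      finally show ?case .
    qed
  qed
  then have "A \<le> ennreal (ln 2)" by (simp add: emeasure_space_1)
  then have Afin: "A < \<infinity>" by (simp add: le_less_trans)
  have "log_energy \<mu> = enn2ereal A - enn2ereal B"
    unfolding log_energy_def A_def B_def log_kernel_def ..
  also have "\<dots> = - \<infinity> \<longleftrightarrow> B = \<infinity>"
  proof (cases A; cases B)
    fix a b assume "0 \<le> a" "A = ennreal a" "0 \<le> b" "B = ennreal b"
    then show ?thesis by (simp add: enn2ereal_ennreal)
  qed (use Afin in \<open>auto simp: enn2ereal_ennreal infinity_ennreal_def top_ennreal.rep_eq top_ereal_def\<close>)
  finally show ?thesis by (simp add: B_def)
qed

lemma log_capacity_eq_0_iff:
  assumes E: "E \<subseteq> sphere 0 1"
  shows "log_capacity E = 0 \<longleftrightarrow> polar_set E"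
proof -
  let ?P = "{\<mu>. prob_space \<mu> \<and> sets \<mu> = sets borel \<and> (\<exists>K. compact K \<and> K \<subseteq> E \<and> emeasure \<mu> K = 1)}"
  have "log_capacity E = 0 \<longleftrightarrow> (\<forall>\<mu>\<in>?P. (if log_energy \<mu> = - \<infinity> then 0 else ennreal (exp (real_of_ereal (log_energy \<mu>)))) = 0)"
    unfolding log_capacity_def le_zero_eq[symmetric] SUP_le_iff ..
  also have "\<dots> \<longleftrightarrow> (\<forall>\<mu>\<in>?P. log_energy \<mu> = - \<infinity>)" by (auto simp: not_le)
  also have "\<dots> \<longleftrightarrow> (\<forall>\<mu>\<in>?P. (\<integral>\<^sup>+ z. \<integral>\<^sup>+ w. log_kernel z w \<partial>\<mu> \<partial>\<mu>) = \<infinity>)"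
    using log_energy_eq_minus_infinity_iff E by (intro ball_cong refl) blast
  also have "\<dots> \<longleftrightarrow> polar_set E" unfolding polar_set_def by auto
  finally show ?thesis .
qed

text \<open>A measure on the preimage is pushed forward by \<open>T\<close>, and the lower Lipschitz
  bound lets the kernel grow by no more than \<open>- ln c\<close>. Infinite energy of the image
  measure then forces infinite energy of the original.\<close>

lemma polar_set_preimage:
  assumes E: "polar_set E" and T: "continuous_on (sphere 0 1) T" 
    and c: "0 < c" "\<And>z w. z \<in> sphere 0 1 \<Longrightarrow> w \<in> sphere 0 1 \<Longrightarrow> c * norm (z - w) \<le> norm (T z - T w)"
  shows "polar_set {q \<in> sphere 0 1. T q \<in> E}"
  unfolding polar_set_def
proof (intro allI impI)
  fix \<mu> and K :: "complex set"
  assume \<mu>: "prob_space \<mu>" and s[measurable_cong]: "sets \<mu> = sets borel" and K: "compact K" "K \<subseteq> {q \<in> sphere 0 1. T q \<in> E}" "emeasure \<mu> K = 1"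
  interpret prob_space \<mu> by fact
  have Km: "K \<in> sets \<mu>" using K(1) s by (simp add: borel_compact)
  have AEK: "AE z in \<mu>. z \<in> K"
    using K(3) Km by (intro AE_prob_1) (simp add: measure_def)
  \<comment> \<open>A Borel map on the whole plane; the measure lives on the circle, where it is
    \<open>T\<close>.\<close>
  define T' where "T' z = (if z \<in> sphere 0 1 then T z else 0)" for z
  have T'm[measurable]: "T' \<in> borel_measurable borel"
    unfolding T'_def by (rule borel_measurable_continuous_on_if) (auto intro: T)
  define \<nu> where "\<nu> = distr \<mu> borel T'"
  have K': "compact (T ` K)" using K T by (intro compact_continuous_image) (auto elim!: continuous_on_subset)
  interpret nu: prob_space \<nu> unfolding \<nu>_def by (rule prob_space_distr) simp
  have s\<nu>: "sets \<nu> = sets borel" by (simp add: \<nu>_def)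
  have "emeasure \<nu> (T ` K) = 1"
  proof -
    have "AE z in \<mu>. T' z \<in> T ` K" using AEK by eventually_elim (use K(2) in \<open>auto simp: T'_def\<close>)
    then have "AE z in \<nu>. z \<in> T ` K"
      unfolding \<nu>_def using K' by (subst AE_distr_iff) (auto simp: borel_compact)
    then show ?thesis using K' s\<nu> by (intro nu.emeasure_eq_1_AE) (auto simp: borel_compact)
  qed
  then have "(\<integral>\<^sup>+ z. \<integral>\<^sup>+ w. log_kernel z w \<partial>\<nu> \<partial>\<nu>) = \<infinity>"
    using E K' K(2) s\<nu> nu.prob_space_axioms unfolding polar_set_def by blast
  moreover have "(\<integral>\<^sup>+ z. \<integral>\<^sup>+ w. log_kernel z w \<partial>\<nu> \<partial>\<nu>) = (\<integral>\<^sup>+ z. \<integral>\<^sup>+ w. log_kernel (T' z) (T' w) \<partial>\<mu> \<partial>\<mu>)"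
  proof -
    have "(\<integral>\<^sup>+ w. log_kernel z w \<partial>\<nu>) = (\<integral>\<^sup>+ w. log_kernel z (T' w) \<partial>\<mu>)" for z
      unfolding \<nu>_def by (rule nn_integral_distr) simp_all
    moreover have "(\<lambda>z. \<integral>\<^sup>+ w. log_kernel z (T' w) \<partial>\<mu>) \<in> borel_measurable borel" by measurable
    ultimately show ?thesis unfolding \<nu>_def by (subst nn_integral_distr) simp_all
  qed
  moreover have "\<dots> \<le> (\<integral>\<^sup>+ z. \<integral>\<^sup>+ w. log_kernel z w + ennreal (- ln c) \<partial>\<mu> \<partial>\<mu>)"
  proof (rule nn_integral_mono_AE)
    show "AE z in \<mu>. (\<integral>\<^sup>+ w. log_kernel (T' z) (T' w) \<partial>\<mu>) \<le> (\<integral>\<^sup>+ w. log_kernel z w + ennreal (- ln c) \<partial>\<mu>)"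
      using AEK
    proof eventually_elim
      case (elim z)
      show ?case
      proof (rule nn_integral_mono_AE)
        show "AE w in \<mu>. log_kernel (T' z) (T' w) \<le> log_kernel z w + ennreal (- ln c)"
          using AEK
        proof eventually_elim
          case w: (elim w)
          have zw: "z \<in> sphere 0 1" "w \<in> sphere 0 1" "T' z = T z" "T' w = T w" using elim w K(2) by (auto simp: T'_def)
          show ?case
          proof (cases "z = w")
            case True then show ?thesis by (simp add: log_kernel_def)
          next
            case False
            have pos: "0 < c * norm (z - w)" using False c(1) by simp
            have le: "c * norm (z - w) \<le> norm (T z - T w)" by (rule c(2)[OF zw(1,2)])
            have ne: "T z \<noteq> T w" using pos le by auto
            have "ln (c * norm (z - w)) \<le> ln (norm (T z - T w))" using pos le by (subst ln_le_cancel_iff) auto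
            then have "- ln (norm (T z - T w)) \<le> - ln (norm (z - w)) + - ln c"
              using c(1) False by (simp add: ln_mult)
            also have "\<dots> \<le> max 0 (- ln (norm (z - w))) + max 0 (- ln c)" by simp
            finally have "ennreal (- ln (norm (T z - T w))) \<le> ennreal (max 0 (- ln (norm (z - w))) + max 0 (- ln c))" by (rule ennreal_leI)
            also have "\<dots> = ennreal (- ln (norm (z - w))) + ennreal (- ln c)"
              by (subst ennreal_plus) (simp_all add: ennreal_max_0)
            finally show ?thesis using False ne zw by (simp add: log_kernel_def)
          qed
        qed
      qed
    qed
  qed
  moreover have "(\<integral>\<^sup>+ z. \<integral>\<^sup>+ w. log_kernel z w + ennreal (- ln c) \<partial>\<mu> \<partial>\<mu>) = (\<integral>\<^sup>+ z. \<integral>\<^sup>+ w. log_kernel z w \<partial>\<mu> \<partial>\<mu>) + ennreal (- ln c)"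
    by (simp add: nn_integral_add emeasure_space_1)
  ultimately show "(\<integral>\<^sup>+ z. \<integral>\<^sup>+ w. log_kernel z w \<partial>\<mu> \<partial>\<mu>) = \<infinity>"
    by (simp add: top_unique)
qed

text \<open>For \<open>0 \<le> x \<le> 1/2\<close> the cosine is at least 1/2, so
  \<open>sin x\<close> is at least \<open>x / 2\<close>; the chord is twice the sine of half the
  arc.\<close>

lemma norm_cis_diff_ge:
  assumes "\<bar>s - t\<bar> \<le> 1"
  shows "\<bar>s - t\<bar> / 2 \<le> norm (cis s - cis t)"
proof -
  have sin_ge: "x / 2 \<le> sin x" if x: "0 \<le> x" "x \<le> 1 / 2" for x :: real
  proof -
    have "(\<lambda>x. sin x - x / 2) 0 \<le> (\<lambda>x. sin x - x / 2) x"
    proof (rule DERIV_nonneg_imp_nondecreasing[OF x(1)])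
      fix y assume y: "0 \<le> y" "y \<le> x"
      have "cos (pi / 3) \<le> cos y" using x y pi_gt3 by (intro cos_monotone_0_pi_le) auto
      then have "0 \<le> cos y - 1 / 2" by (simp add: cos_60)
      moreover have "((\<lambda>x. sin x - x / 2) has_real_derivative cos y - 1 / 2) (at y)" by (auto intro!: derivative_eq_intros)
      ultimately show "\<exists>d. ((\<lambda>x. sin x - x / 2) has_real_derivative d) (at y) \<and> 0 \<le> d" by blast
    qed
    then show ?thesis by simp
  qed
  have "\<bar>s - t\<bar> / 2 / 2 \<le> sin (\<bar>s - t\<bar> / 2)" using assms by (intro sin_ge) auto
  then have "(\<bar>s - t\<bar> / 2 / 2)\<^sup>2 \<le> (sin (\<bar>s - t\<bar> / 2))\<^sup>2" by (intro power_mono) auto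
  also have "(sin (\<bar>s - t\<bar> / 2))\<^sup>2 = (sin ((s - t) / 2))\<^sup>2" 
  proof -
    have "(sin \<bar>x\<bar>)\<^sup>2 = (sin x)\<^sup>2" for x :: real by (simp add: abs_if)
    from this[of "(s - t) / 2"] show ?thesis by simp
  qed
  finally have "(\<bar>s - t\<bar> / 2)\<^sup>2 \<le> 4 * (sin ((s - t) / 2))\<^sup>2" by (simp add: power2_eq_square)
  also have "\<dots> = (norm (cis s - cis t))\<^sup>2"
  proof -
    have eq: "2 * ((s - t) / 2) = s - t" by simp
    have "cos (s - t) = 1 - 2 * (sin ((s - t) / 2))\<^sup>2"
      using cos_double_sin[of "(s - t) / 2"] by (simp only: eq)
    then show ?thesis using norm_cis_diff_one_sq[of "s - t"] by (simp add: norm_cis_diff[of s t])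
  qed
  finally show ?thesis by (rule power2_le_imp_le) simp
qed

text \<open>At most 2 from each side of the singularity at \<open>s\<close>.\<close>

lemma nn_integral_inverse_sqrt_le:
  fixes s a :: real
  assumes s: "s \<in> {a..a + 1}"
  shows "(\<integral>\<^sup>+ t\<in>{a..a + 1}. ennreal (\<bar>s - t\<bar> powr (- 1 / 2)) \<partial>lborel) \<le> ennreal 4"
proof -
  let ?g = "\<lambda>x. ennreal (\<bar>x\<bar> powr (- 1 / 2)) * indicator {0..1} x"
  have half: "(\<integral>\<^sup>+ x. ?g x \<partial>lborel) = ennreal 2"
  proof -
    have "((\<lambda>x. x powr (- 1 / 2)) has_integral 2) {0..1::real}"
      using has_integral_powr_from_0[of "- 1 / 2" 1] by simp
    then have "((\<lambda>x. \<bar>x\<bar> powr (- 1 / 2)) has_integral 2) {0..1::real}"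
      by (rule has_integral_eq[rotated]) auto
    then show ?thesis by (intro nn_integral_has_integral_lebesgue') auto
  qed
  have half': "(\<integral>\<^sup>+ x. ?g (- x) \<partial>lborel) = ennreal 2"
    using nn_integral_real_affine[of ?g "-1" 0] half by simp
  have "(\<integral>\<^sup>+ t\<in>{a..a + 1}. ennreal (\<bar>s - t\<bar> powr (- 1 / 2)) \<partial>lborel)
      = (\<integral>\<^sup>+ x. ennreal (\<bar>s - (s + 1 * x)\<bar> powr (- 1 / 2)) * indicator {a..a + 1} (s + 1 * x) \<partial>lborel)"
    by (subst nn_integral_real_affine[of _ 1 s]) auto
  also have "\<dots> \<le> (\<integral>\<^sup>+ x. ?g x + ?g (- x) \<partial>lborel)"
    by (rule nn_integral_mono) (use s in \<open>auto split: split_indicator\<close>)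
  also have "\<dots> = ennreal 2 + ennreal 2" using half half' by (subst nn_integral_add) auto
  also have "\<dots> = ennreal 4" by (simp add: ennreal_plus[symmetric] del: ennreal_plus)
  finally show ?thesis .
qed

text \<open>Writing \<open>- ln y\<close> as \<open>2 * ln (y powr (- 1 / 2))\<close> and bounding
  the logarithm by its argument trades it for an integrable power; the other factor 2 absorbs
  \<open>sqrt 2\<close>.\<close>

lemma log_kernel_cis_le:
  assumes st: "\<bar>s - t\<bar> \<le> 1" "s \<noteq> t"
  shows "log_kernel (cis s) (cis t) \<le> ennreal 4 * ennreal (\<bar>s - t\<bar> powr (- 1 / 2))"
proof -
  define y where "y = \<bar>s - t\<bar> / 2"
  have y: "0 < y" "y \<le> norm (cis s - cis t)" using st norm_cis_diff_ge[OF st(1)] by (auto simp: y_def)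
  have ne: "cis s \<noteq> cis t" using y by auto
  have "- ln (norm (cis s - cis t)) \<le> - ln y" using y ne by simp
  also have "\<dots> = 2 * ln (y powr (- 1 / 2))" using y by (simp add: ln_powr)
  also have "\<dots> \<le> 2 * y powr (- 1 / 2)" using y ln_less_self[of "y powr (- 1 / 2)"] by simp
  also have "\<dots> = 2 * (2 powr (1 / 2) * \<bar>s - t\<bar> powr (- 1 / 2))"
  proof -
    have "(2::real) powr (- 1 / 2) = 1 / (2 powr (1 / 2))" using powr_minus_divide[of 2 "1 / 2 :: real"] by simp
    moreover have "y powr (- 1 / 2) = \<bar>s - t\<bar> powr (- 1 / 2) / 2 powr (- 1 / 2)"
      unfolding y_def by (rule powr_divide)
    ultimately show ?thesis by simp
  qed
  also have "\<dots> \<le> 2 * (2 * \<bar>s - t\<bar> powr (- 1 / 2))"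
  proof -
    have "2 powr (1 / 2) \<le> (2::real)" using powr_mono[of "1 / 2" 1 "2::real"] by simp
    then have "2 powr (1 / 2) * \<bar>s - t\<bar> powr (- 1 / 2) \<le> 2 * \<bar>s - t\<bar> powr (- 1 / 2)"
      by (rule mult_right_mono) simp
    then show ?thesis by simp
  qed
  finally have "ennreal (- ln (norm (cis s - cis t))) \<le> ennreal (4 * \<bar>s - t\<bar> powr (- 1 / 2))" by (intro ennreal_leI) simp
  then show ?thesis using ne by (simp add: log_kernel_def ennreal_mult)
qed

text \<open>On a set of positive length, normalized length on a compact part \<open>C\<close> would
  have energy at most 16 over the length of \<open>C\<close>. Arcs of unit length are what the
  estimate of the kernel by arc length requires.\<close>

lemma polar_set_arc_null_unit:
  assumes E: "polar_set E" "E \<in> sets borel"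
  shows "emeasure lborel {t \<in> {a..a + 1}. cis t \<in> E} = 0"
proof (rule ccontr)
  define \<Theta> where "\<Theta> = {t \<in> {a..a + 1}. cis t \<in> E}"
  assume "emeasure lborel {t \<in> {a..a + 1}. cis t \<in> E} \<noteq> 0"
  then have pos: "emeasure lborel \<Theta> \<noteq> 0" by (simp add: \<Theta>_def)
  have cism[measurable]: "cis \<in> borel_measurable borel" by (intro borel_measurable_continuous_onI continuous_intros)
  have m\<Theta>: "\<Theta> \<in> sets borel" 
  proof -
    have "\<Theta> = {a..a + 1} \<inter> (cis -` E \<inter> space borel)" by (auto simp: \<Theta>_def)
    then show ?thesis using measurable_sets[OF cism E(2)] by simp
  qed
  have fin: "emeasure lborel X \<noteq> \<infinity>" if "X \<subseteq> {a..a + 1}" for X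
    using emeasure_mono[OF that, of lborel] by (auto simp: top_unique)
  have sub: "\<Theta> \<subseteq> {a..a + 1}" by (auto simp: \<Theta>_def)
  define M where "M = uniform_measure lborel \<Theta>"
  interpret M: prob_space M unfolding M_def by (rule prob_space_uniform_measure) (use pos fin[OF sub] in auto)
  have "emeasure M \<Theta> = 1" unfolding M_def using pos fin[OF sub] m\<Theta> by (simp add: emeasure_uniform_measure ennreal_divide_self less_top[symmetric])
  \<comment> \<open>Polarity is tested on measures with compact carriers, so a compact subset of
    positive length is extracted by inner regularity.\<close>
  moreover have "emeasure M \<Theta> = (SUP K \<in> {K. K \<subseteq> \<Theta> \<and> compact K}. emeasure M K)"
  proof (rule inner_regular)
    show "sets M = sets borel" by (simp add: M_def)
    show "emeasure M (space M) \<noteq> \<infinity>" by (simp add: M.emeasure_space_1)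
  qed (rule m\<Theta>)
  ultimately have "\<not> (SUP K \<in> {K. K \<subseteq> \<Theta> \<and> compact K}. emeasure M K) \<le> 0" by simp
  then have "\<not> (\<forall>K\<in>{K. K \<subseteq> \<Theta> \<and> compact K}. emeasure M K \<le> 0)" unfolding SUP_le_iff .
  then obtain C where C: "C \<subseteq> \<Theta>" "compact C" "emeasure M C \<noteq> 0" by auto
  have mC[measurable]: "C \<in> sets borel" using C(2) by (simp add: borel_compact)
  have C0: "emeasure lborel C \<noteq> 0"
  proof
    assume "emeasure lborel C = 0"
    moreover have "\<Theta> \<inter> C = C" using C(1) by auto
    ultimately show False using C(3) m\<Theta> by (simp add: M_def emeasure_uniform_measure)
  qed
  have Csub: "C \<subseteq> {a..a + 1}" using C(1) sub by auto
  note Cfin = fin[OF Csub]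
  define \<nu> where "\<nu> = uniform_measure lborel C"
  have s\<nu>[measurable_cong]: "sets \<nu> = sets borel" by (simp add: \<nu>_def)
  interpret nu: prob_space \<nu> unfolding \<nu>_def by (rule prob_space_uniform_measure) (use C0 Cfin in auto)
  define \<mu> where "\<mu> = distr \<nu> borel cis"
  interpret mu: prob_space \<mu> unfolding \<mu>_def by (rule nu.prob_space_distr) simp
  have s\<mu>: "sets \<mu> = sets borel" by (simp add: \<mu>_def)
  have AEC: "AE t in \<nu>. t \<in> C" unfolding \<nu>_def using C0 Cfin by (intro AE_uniform_measureI) auto
  have K: "compact (cis ` C)" using C(2) by (intro compact_continuous_image continuous_intros)
  have "AE z in \<mu>. z \<in> cis ` C"
    unfolding \<mu>_def using K AEC by (subst AE_distr_iff) (auto simp: borel_compact)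
  then have K1: "emeasure \<mu> (cis ` C) = 1" using K s\<mu> by (intro mu.emeasure_eq_1_AE) (auto simp: borel_compact)
  have "cis ` C \<subseteq> E" using C(1) by (auto simp: \<Theta>_def)
  then have "(\<integral>\<^sup>+ z. \<integral>\<^sup>+ w. log_kernel z w \<partial>\<mu> \<partial>\<mu>) = \<infinity>"
    using E(1)[unfolded polar_set_def, rule_format, OF mu.prob_space_axioms s\<mu> K _ K1] by simp
  moreover have "(\<integral>\<^sup>+ z. \<integral>\<^sup>+ w. log_kernel z w \<partial>\<mu> \<partial>\<mu>) = (\<integral>\<^sup>+ s. \<integral>\<^sup>+ t. log_kernel (cis s) (cis t) \<partial>\<nu> \<partial>\<nu>)"
  proof -
    have "(\<integral>\<^sup>+ w. log_kernel z w \<partial>\<mu>) = (\<integral>\<^sup>+ t. log_kernel z (cis t) \<partial>\<nu>)" for z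
      unfolding \<mu>_def by (rule nn_integral_distr) simp_all
    moreover have "(\<lambda>z. \<integral>\<^sup>+ t. log_kernel z (cis t) \<partial>\<nu>) \<in> borel_measurable borel" by measurable
    ultimately show ?thesis unfolding \<mu>_def by (subst nn_integral_distr) simp_all
  qed
  moreover have "\<dots> \<le> (\<integral>\<^sup>+ s. ennreal 16 / emeasure lborel C \<partial>\<nu>)"
  proof (rule nn_integral_mono_AE)
    show "AE s in \<nu>. (\<integral>\<^sup>+ t. log_kernel (cis s) (cis t) \<partial>\<nu>) \<le> ennreal 16 / emeasure lborel C"
      using AEC
    proof eventually_elim
      case (elim s)
      have s: "s \<in> {a..a + 1}" using elim Csub by auto
      have "(\<integral>\<^sup>+ t. log_kernel (cis s) (cis t) \<partial>\<nu>) = (\<integral>\<^sup>+ t. log_kernel (cis s) (cis t) * indicator C t \<partial>lborel) / emeasure lborel C"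
        unfolding \<nu>_def by (rule nn_integral_uniform_measure) measurable
      also have "\<dots> \<le> ennreal 16 / emeasure lborel C"
      proof (rule divide_right_mono_ennreal)
        have "(\<integral>\<^sup>+ t. log_kernel (cis s) (cis t) * indicator C t \<partial>lborel) \<le> (\<integral>\<^sup>+ t. ennreal 4 * (ennreal (\<bar>s - t\<bar> powr (- 1 / 2)) * indicator {a..a + 1} t) \<partial>lborel)"
        proof (rule nn_integral_mono_AE)
          have "AE t in lborel. t \<noteq> s" by (rule AE_lborel_singleton)
          then show "AE t in lborel. log_kernel (cis s) (cis t) * indicator C t \<le> ennreal 4 * (ennreal (\<bar>s - t\<bar> powr (- 1 / 2)) * indicator {a..a + 1} t)"
          proof eventually_elim
            case t: (elim t)
            show ?case
            proof (cases "t \<in> C")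
              case True
              then have "t \<in> {a..a + 1}" using Csub by auto
              moreover from this have "\<bar>s - t\<bar> \<le> 1" using s by auto
              ultimately show ?thesis using log_kernel_cis_le[of s t] t True by simp
            qed simp
          qed
        qed
        also have "\<dots> = ennreal 4 * (\<integral>\<^sup>+ t\<in>{a..a + 1}. ennreal (\<bar>s - t\<bar> powr (- 1 / 2)) \<partial>lborel)"
          by (rule nn_integral_cmult) measurable
        also have "\<dots> \<le> ennreal 4 * ennreal 4" by (intro mult_left_mono nn_integral_inverse_sqrt_le s) auto
        also have "\<dots> = ennreal 16" by (simp add: ennreal_mult[symmetric])
        finally show "(\<integral>\<^sup>+ t. log_kernel (cis s) (cis t) * indicator C t \<partial>lborel) \<le> ennreal 16" .
      qed
      finally show ?case .
    qed
  qed
  moreover have "\<dots> = ennreal 16 / emeasure lborel C" by (simp add: nu.emeasure_space_1)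
  moreover have "ennreal 16 / emeasure lborel C \<noteq> \<infinity>"
    using C0 by (simp add: ennreal_divide_eq_top_iff)
  ultimately show False by (simp add: top_unique)
qed

lemma polar_set_arc_null:
  assumes E: "polar_set E" "E \<in> sets borel"
  shows "AE t in lborel. cis t \<notin> E"
proof -
  have cism[measurable]: "cis \<in> borel_measurable borel" by (intro borel_measurable_continuous_onI continuous_intros)
  have "AE t in lborel. \<forall>n::int. t \<notin> {t \<in> {of_int n..of_int n + 1}. cis t \<in> E}"
    unfolding AE_all_countable
  proof
    fix n :: int
    have "{t \<in> {of_int n..of_int n + 1}. cis t \<in> E} = {of_int n..of_int n + 1} \<inter> (cis -` E \<inter> space borel)" by auto
    then have "{t \<in> {of_int n..of_int n + 1}. cis t \<in> E} \<in> sets lborel" using measurable_sets[OF cism E(2)] by simp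
    then show "AE t in lborel. t \<notin> {t \<in> {of_int n..of_int n + 1}. cis t \<in> E}"
      using polar_set_arc_null_unit[OF E, of "of_int n"] by (intro AE_not_in) (auto simp: null_sets_def)
  qed
  then show ?thesis
  proof eventually_elim
    case (elim t)
    then have "t \<notin> {t \<in> {of_int \<lfloor>t\<rfloor>..of_int \<lfloor>t\<rfloor> + 1}. cis t \<in> E}" by blast
    then show ?case using of_int_floor_le[of t] real_of_int_floor_add_one_ge[of t] by simp
  qed
qed

subsection \<open>Non-tangential limits off a set of capacity zero\<close>

lemma ball_sets_borel [measurable]: "ball (a::complex) r \<in> sets borel"
  by simp

definition riesz_potential :: "(complex \<Rightarrow> ennreal) \<Rightarrow> complex \<Rightarrow> ennreal" where
  "riesz_potential \<Phi> q = (\<integral>\<^sup>+ z. \<Phi> z * ennreal (1 / norm (z - q)) \<partial>lborel)"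

lemma riesz_potential_borel:
  assumes [measurable]: "\<Phi> \<in> borel_measurable borel"
  shows "riesz_potential \<Phi> \<in> borel_measurable borel"
  unfolding riesz_potential_def[abs_def] by measurable

text \<open>Replaces the Cauchy-Schwarz inequality where only finiteness of an integral
  matters.\<close>

lemma ennreal_mult_le_squares: "a * b \<le> a * a + b * (b::ennreal)"
proof (cases "a \<le> b")
  case True
  then have "a * b \<le> b * b" by (rule mult_right_mono) simp
  then show ?thesis by (simp add: add_increasing)
next
  case False
  then have "a * b \<le> a * a" by (intro mult_left_mono) auto
  then show ?thesis by (simp add: add_increasing2)
qed

text \<open>Duality between the Dirichlet and the logarithmic energy: a measure of finite energy has a
  square integrable Riesz potential, by the bound on the convolution of two Riesz kernels.\<close>

lemma polar_set_riesz_potential: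
  assumes [measurable]: "\<Phi> \<in> borel_measurable borel" and supp: "\<And>z. z \<notin> ball 0 1 \<Longrightarrow> \<Phi> z = 0"
    and fin: "(\<integral>\<^sup>+ z. \<Phi> z * \<Phi> z \<partial>lborel) < \<infinity>"
  shows "polar_set {q \<in> sphere 0 1. riesz_potential \<Phi> q = \<infinity>}"
  unfolding polar_set_def
proof (intro allI impI)
  fix \<mu> and K :: "complex set"
  assume \<mu>: "prob_space \<mu>" and s[measurable_cong]: "sets \<mu> = sets borel" and K: "compact K" "K \<subseteq> {q \<in> sphere 0 1. riesz_potential \<Phi> q = \<infinity>}" "emeasure \<mu> K = 1"
  interpret prob_space \<mu> by fact
  interpret P: pair_sigma_finite lborel \<mu> by unfold_locales
  interpret P': pair_sigma_finite \<mu> lborel by unfold_locales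
  have Km: "K \<in> sets \<mu>" using K(1) s by (simp add: borel_compact)
  have AEK: "AE z in \<mu>. z \<in> K"
    using K(3) Km by (intro AE_prob_1) (simp add: measure_def)
  note [measurable] = riesz_potential_borel
  let ?k = "\<lambda>z q::complex. ennreal (1 / norm (z - q))"
  define P where "P z = (\<integral>\<^sup>+ q. ?k z q \<partial>\<mu>)" for z
  have [measurable]: "P \<in> borel_measurable borel" unfolding P_def[abs_def] by measurable
  have "\<infinity> = (\<integral>\<^sup>+ q. \<infinity> \<partial>\<mu>)" by (simp add: emeasure_space_1)
  also have "\<dots> = (\<integral>\<^sup>+ q. riesz_potential \<Phi> q \<partial>\<mu>)"
    by (rule nn_integral_cong_AE) (use AEK in eventually_elim, use K(2) in auto)
  also have "\<dots> = (\<integral>\<^sup>+ z. \<integral>\<^sup>+ q. \<Phi> z * ?k z q \<partial>\<mu> \<partial>lborel)"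
    unfolding riesz_potential_def by (rule P.Fubini') measurable
  also have "\<dots> = (\<integral>\<^sup>+ z. \<Phi> z * P z \<partial>lborel)"
    unfolding P_def by (intro nn_integral_cong nn_integral_cmult) measurable
  \<comment> \<open>The integral of the potential against \<open>\<mu>\<close> is infinite, while
    the square integral of \<open>\<Phi>\<close> is finite, so the potential \<open>P\<close> of
    \<open>\<mu>\<close> cannot be square integrable on the disc.\<close>
  also have "\<dots> \<le> (\<integral>\<^sup>+ z. \<Phi> z * \<Phi> z + P z * P z * indicator (ball 0 1) z \<partial>lborel)"
    by (rule nn_integral_mono) (use supp ennreal_mult_le_squares in \<open>auto split: split_indicator\<close>)
  also have "\<dots> = (\<integral>\<^sup>+ z. \<Phi> z * \<Phi> z \<partial>lborel) + (\<integral>\<^sup>+ z. P z * P z * indicator (ball 0 1) z \<partial>lborel)"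
    by (rule nn_integral_add) measurable
  finally have "(\<integral>\<^sup>+ z. P z * P z * indicator (ball 0 1) z \<partial>lborel) = \<infinity>"
    using fin by (auto simp: top_unique)
  moreover have "(\<integral>\<^sup>+ z. P z * P z * indicator (ball 0 1) z \<partial>lborel)
      = (\<integral>\<^sup>+ z. \<integral>\<^sup>+ q. (\<integral>\<^sup>+ q'. ?k z q * ?k z q' * indicator (ball 0 1) z \<partial>\<mu>) \<partial>\<mu> \<partial>lborel)"
  proof (rule nn_integral_cong)
    fix z
    have "(\<integral>\<^sup>+ q. (\<integral>\<^sup>+ q'. ?k z q * ?k z q' * indicator (ball 0 1) z \<partial>\<mu>) \<partial>\<mu>) = (\<integral>\<^sup>+ q. ?k z q * (P z * indicator (ball 0 1) z) \<partial>\<mu>)"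
      unfolding P_def by (intro nn_integral_cong) (simp add: mult.assoc nn_integral_cmult nn_integral_multc)
    also have "\<dots> = P z * P z * indicator (ball 0 1) z"
      unfolding P_def[of z] by (subst nn_integral_multc) (simp_all add: mult.assoc)
    finally show "P z * P z * indicator (ball 0 1) z = (\<integral>\<^sup>+ q. (\<integral>\<^sup>+ q'. ?k z q * ?k z q' * indicator (ball 0 1) z \<partial>\<mu>) \<partial>\<mu>)" ..
  qed
  \<comment> \<open>Tonelli's theorem twice brings the area integral inside, where it is the
    convolution of two Riesz kernels.\<close>
  moreover have "\<dots> = (\<integral>\<^sup>+ q. \<integral>\<^sup>+ z. (\<integral>\<^sup>+ q'. ?k z q * ?k z q' * indicator (ball 0 1) z \<partial>\<mu>) \<partial>lborel \<partial>\<mu>)"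
    by (rule P.Fubini'[symmetric]) measurable
  moreover have "\<dots> = (\<integral>\<^sup>+ q. \<integral>\<^sup>+ q'. (\<integral>\<^sup>+ z. ?k z q * ?k z q' * indicator (ball 0 1) z \<partial>lborel) \<partial>\<mu> \<partial>\<mu>)"
    by (intro nn_integral_cong P.Fubini'[symmetric]) measurable
  moreover have "\<dots> \<le> (\<integral>\<^sup>+ q. \<integral>\<^sup>+ q'. ennreal (4 * pi * (1 + 2 * ln 2)) + ennreal (4 * pi) * log_kernel q q' \<partial>\<mu> \<partial>\<mu>)"
  proof (rule nn_integral_mono_AE)
    show "AE q in \<mu>. (\<integral>\<^sup>+ q'. (\<integral>\<^sup>+ z. ?k z q * ?k z q' * indicator (ball 0 1) z \<partial>lborel) \<partial>\<mu>)
       \<le> (\<integral>\<^sup>+ q'. ennreal (4 * pi * (1 + 2 * ln 2)) + ennreal (4 * pi) * log_kernel q q' \<partial>\<mu>)"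
      using AEK
    proof eventually_elim
      case q: (elim q)
      show ?case
      proof (rule nn_integral_mono_AE)
        show "AE q' in \<mu>. (\<integral>\<^sup>+ z. ?k z q * ?k z q' * indicator (ball 0 1) z \<partial>lborel)
           \<le> ennreal (4 * pi * (1 + 2 * ln 2)) + ennreal (4 * pi) * log_kernel q q'"
          using AEK by eventually_elim (intro riesz_kernel_bound; use q K(2) in auto)
      qed
    qed
  qed
  moreover have "\<dots> = ennreal (4 * pi * (1 + 2 * ln 2)) + ennreal (4 * pi) * (\<integral>\<^sup>+ q. \<integral>\<^sup>+ q'. log_kernel q q' \<partial>\<mu> \<partial>\<mu>)"
    by (simp add: nn_integral_add nn_integral_cmult emeasure_space_1)
  ultimately have "ennreal (4 * pi * (1 + 2 * ln 2)) + ennreal (4 * pi) * (\<integral>\<^sup>+ q. \<integral>\<^sup>+ q'. log_kernel q q' \<partial>\<mu> \<partial>\<mu>) = \<infinity>"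
    by (simp add: top_unique)
  then show "(\<integral>\<^sup>+ z. \<integral>\<^sup>+ w. log_kernel z w \<partial>\<mu> \<partial>\<mu>) = \<infinity>"
    by (simp add: ennreal_mult_eq_top_iff)
qed

section \<open>Beurling's argument at a single boundary point\<close>

locale finite_potential =
  fixes F :: "complex \<Rightarrow> complex" and q :: complex
  assumes holF: "F holomorphic_on ball 0 1" and nq: "norm q = 1"
    and fin: "riesz_potential (\<lambda>z. ennreal (norm (deriv F z)) * indicator (ball 0 1) z) q < \<infinity>"
begin

definition w :: "complex \<Rightarrow> ennreal" where
  "w z = ennreal (norm (deriv F z)) * indicator (ball 0 1) z"

lemma holF': "deriv F holomorphic_on ball 0 1"
  using holF by (simp add: holomorphic_deriv)

lemma w_borel [measurable]: "w \<in> borel_measurable borel"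
proof -
  have "(\<lambda>z. indicator (ball 0 1) z *\<^sub>R norm (deriv F z)) \<in> borel_measurable borel"
    by (intro borel_measurable_continuous_on_indicator continuous_intros holomorphic_on_imp_continuous_on holF') auto
  then have "(\<lambda>z. ennreal (indicator (ball 0 1) z *\<^sub>R norm (deriv F z))) \<in> borel_measurable borel" by measurable
  moreover have "(\<lambda>z. ennreal (indicator (ball 0 1) z *\<^sub>R norm (deriv F z))) = w"
    by (auto simp: w_def fun_eq_iff split: split_indicator)
  ultimately show ?thesis by (simp only:)
qed

definition I :: "real \<Rightarrow> ennreal" where
  "I \<delta> = (\<integral>\<^sup>+ z\<in>ball q \<delta>. w z * ennreal (1 / norm (z - q)) \<partial>lborel)"

lemma I_mono: "\<delta> \<le> \<delta>' \<Longrightarrow> I \<delta> \<le> I \<delta>'"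
  unfolding I_def by (rule nn_integral_mono) (auto split: split_indicator)

text \<open>The tail of a convergent integral: dominated convergence with the integrand of the
  potential itself as majorant.\<close>

lemma I_small:
  assumes "0 < \<epsilon>"
  obtains \<delta> where "0 < \<delta>" "I \<delta> \<le> ennreal \<epsilon>"
proof -
  have "(\<lambda>n. I (1 / real (Suc n))) \<longlonglongrightarrow> (\<integral>\<^sup>+ z. (0::ennreal) \<partial>(lborel :: complex measure))"
    unfolding I_def
  proof (rule nn_integral_dominated_convergence[where w = "\<lambda>z. w z * ennreal (1 / norm (z - q))"])
    show "(\<integral>\<^sup>+ z. w z * ennreal (1 / norm (z - q)) \<partial>lborel) < \<infinity>"
      using fin by (simp add: riesz_potential_def w_def)
    show "AE z in lborel. (\<lambda>i. w z * ennreal (1 / norm (z - q)) * indicator (ball q (1 / real (Suc i))) z) \<longlonglongrightarrow> 0"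
    proof (rule AE_I2)
      fix z :: complex
      show "(\<lambda>i. w z * ennreal (1 / norm (z - q)) * indicator (ball q (1 / real (Suc i))) z) \<longlonglongrightarrow> 0"
      proof (cases "z = q")
        \<comment> \<open>The point \<open>q\<close> belongs to all the shrinking balls, but the
          weight vanishes there because \<open>q\<close> is not in the open disc.\<close>
        case True then show ?thesis using nq by (simp add: w_def)
      next
        case False
        have "(\<lambda>i. 1 / real (Suc i)) \<longlonglongrightarrow> 0" using LIMSEQ_inverse_real_of_nat by (simp add: inverse_eq_divide)
        then have "eventually (\<lambda>i. 1 / real (Suc i) < dist q z) sequentially"
          using False by (intro order_tendstoD(2)) auto
        then have "eventually (\<lambda>i. w z * ennreal (1 / norm (z - q)) * indicator (ball q (1 / real (Suc i))) z = 0) sequentially"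
          by eventually_elim simp
        then show ?thesis by (rule tendsto_eventually)
      qed
    qed
  qed (auto split: split_indicator)
  then have "(\<lambda>n. I (1 / real (Suc n))) \<longlonglongrightarrow> 0" by simp
  then have "eventually (\<lambda>n. I (1 / real (Suc n)) < ennreal \<epsilon>) sequentially"
    using assms by (intro order_tendstoD(2)) auto
  then obtain n where "I (1 / real (Suc n)) < ennreal \<epsilon>" by (auto simp: eventually_sequentially)
  then show ?thesis using that[of "1 / real (Suc n)"] by (simp add: less_imp_le)
qed

text \<open>A disc of half the distance to the circle stays inside the unit disc.\<close>

lemma deriv_mean_bound:
  assumes "\<zeta> \<in> ball 0 1"
  shows "ennreal (area_mean_const * ((1 - norm \<zeta>) / 2)\<^sup>2 * norm (deriv F \<zeta>)) \<le> (\<integral>\<^sup>+ z\<in>ball \<zeta> ((1 - norm \<zeta>) / 2). w z \<partial>lborel)"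
proof -
  have sub: "ball \<zeta> ((1 - norm \<zeta>) / 2) \<subseteq> ball 0 1"
  proof
    fix z assume "z \<in> ball \<zeta> ((1 - norm \<zeta>) / 2)"
    then have "norm (z - \<zeta>) < (1 - norm \<zeta>) / 2" by (simp add: dist_norm norm_minus_commute)
    moreover have "norm z \<le> norm (z - \<zeta>) + norm \<zeta>" using norm_triangle_ineq[of "z - \<zeta>" \<zeta>] by simp
    ultimately show "z \<in> ball 0 1" using assms by simp
  qed
  have "ennreal (area_mean_const * ((1 - norm \<zeta>) / 2)\<^sup>2 * norm (deriv F \<zeta>)) \<le> (\<integral>\<^sup>+ z\<in>ball \<zeta> ((1 - norm \<zeta>) / 2). ennreal (norm (deriv F z)) \<partial>lborel)"
    using assms sub by (intro area_mean_bound holomorphic_on_subset[OF holF']) auto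
  also have "\<dots> = (\<integral>\<^sup>+ z\<in>ball \<zeta> ((1 - norm \<zeta>) / 2). w z \<partial>lborel)"
    using sub by (intro nn_integral_cong) (auto simp: w_def split: split_indicator)
  finally show ?thesis .
qed

text \<open>On the averaging disc \<open>|z - q|\<close> is at most \<open>M + 1\<close> times
  \<open>1 - norm \<zeta>\<close>, so the area mean of the gradient can be replaced by the potential
  at the cost of that factor.\<close>

lemma gradient_bound:
  assumes \<zeta>: "\<zeta> \<in> ball 0 1" and M: "norm (\<zeta> - q) \<le> M * (1 - norm \<zeta>)"
    and \<delta>: "norm (\<zeta> - q) + (1 - norm \<zeta>) / 2 \<le> \<delta>" and i: "I \<delta> \<le> ennreal i" "0 \<le> i"
  shows "norm (deriv F \<zeta>) * (1 - norm \<zeta>) \<le> 4 * (M + 1) / area_mean_const * i"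
proof -
  define d where "d = 1 - norm \<zeta>"
  have d: "0 < d" using \<zeta> by (simp add: d_def)
  have "0 \<le> M * d" using M norm_ge_zero[of "\<zeta> - q"] unfolding d_def by linarith
  then have M0: "0 \<le> M" using d by (simp add: zero_le_mult_iff)
  have "ennreal (area_mean_const * (d / 2)\<^sup>2 * norm (deriv F \<zeta>)) \<le> (\<integral>\<^sup>+ z\<in>ball \<zeta> (d / 2). w z \<partial>lborel)"
    using deriv_mean_bound[OF \<zeta>] by (simp add: d_def)
  also have "\<dots> \<le> (\<integral>\<^sup>+ z. ennreal ((M + 1) * d) * (w z * ennreal (1 / norm (z - q)) * indicator (ball q \<delta>) z) \<partial>lborel)"
  proof (rule nn_integral_mono)
    fix z
    show "w z * indicator (ball \<zeta> (d / 2)) z \<le> ennreal ((M + 1) * d) * (w z * ennreal (1 / norm (z - q)) * indicator (ball q \<delta>) z)"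
    proof (cases "z \<in> ball \<zeta> (d / 2) \<and> z \<in> ball 0 1")
      case True
      then have zd: "norm (z - \<zeta>) < d / 2" by (simp add: dist_norm norm_minus_commute)
      have tri: "norm (z - q) \<le> norm (z - \<zeta>) + norm (\<zeta> - q)" using norm_triangle_ineq[of "z - \<zeta>" "\<zeta> - q"] by simp
      have "norm (z - q) \<le> (M + 1) * d" using tri zd M d by (simp add: d_def[symmetric] distrib_right)
      moreover have zq: "0 < norm (z - q)" using True nq by auto
      ultimately have "1 \<le> (M + 1) * d * (1 / norm (z - q))" by simp
      then have "1 \<le> ennreal ((M + 1) * d) * ennreal (1 / norm (z - q))"
        using d M0 by (simp add: ennreal_mult[symmetric] ennreal_ge_1)
      then have "w z * 1 \<le> w z * (ennreal ((M + 1) * d) * ennreal (1 / norm (z - q)))" by (rule mult_left_mono) simp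
      moreover have "norm (z - q) < \<delta>" using tri zd \<delta> unfolding d_def by linarith
      then have "z \<in> ball q \<delta>" by (simp add: dist_norm norm_minus_commute)
      ultimately show ?thesis using True by (simp add: mult_ac)
    next
      case False then show ?thesis by (auto simp: w_def)
    qed
  qed
  also have "\<dots> = ennreal ((M + 1) * d) * I \<delta>"
    unfolding I_def by (rule nn_integral_cmult) measurable
  also have "\<dots> \<le> ennreal ((M + 1) * d) * ennreal i" by (rule mult_left_mono[OF i(1)]) simp
  also have "\<dots> = ennreal ((M + 1) * d * i)" using d M0 i(2) by (simp add: ennreal_mult[symmetric])
  finally have "area_mean_const * (d / 2)\<^sup>2 * norm (deriv F \<zeta>) \<le> (M + 1) * d * i"
    using d M0 i(2) by (subst (asm) ennreal_le_iff) auto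
  then have "d * (area_mean_const * d * norm (deriv F \<zeta>)) \<le> d * (4 * (M + 1) * i)"
    by (simp add: power2_eq_square algebra_simps)
  then have "area_mean_const * d * norm (deriv F \<zeta>) \<le> 4 * (M + 1) * i" using d by simp
  then show ?thesis using area_mean_const_pos by (simp add: d_def[symmetric] field_simps)
qed

text \<open>With \<open>\<rho>\<close> the distance of \<open>z\<close> from \<open>q\<close>, the
  averaging disc about \<open>s * q\<close> contains \<open>z\<close> only if
  \<open>2 * \<rho> / 3 \<le> 1 - s \<le> 2 * \<rho>\<close>. The window has length
  \<open>4 * \<rho> / 3\<close> and the integrand is at most
  \<open>9 / (area_mean_const * \<rho>^2)\<close>; the product is of order
  \<open>1 / \<rho>\<close>.\<close>

lemma radial_window_bound:
  assumes z: "z \<in> ball 0 1" and t: "0 < t" "t' < 1"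
  shows "(\<integral>\<^sup>+ s. ennreal (4 / (area_mean_const * (1 - s)\<^sup>2)) * indicator {t..t'} s * indicator {s. norm (z - of_real s * q) < (1 - s) / 2} s \<partial>lborel)
    \<le> ennreal (12 / area_mean_const) * (ennreal (1 / norm (z - q)) * indicator (ball q (2 * (1 - t))) z)"
proof -
  define \<rho> where "\<rho> = norm (z - q)"
  have \<rho>: "0 < \<rho>" using z nq by (auto simp: \<rho>_def)
  have "(\<integral>\<^sup>+ s. ennreal (4 / (area_mean_const * (1 - s)\<^sup>2)) * indicator {t..t'} s * indicator {s. norm (z - of_real s * q) < (1 - s) / 2} s \<partial>lborel)
    \<le> (\<integral>\<^sup>+ s. (ennreal (9 / (area_mean_const * \<rho>\<^sup>2)) * indicator (ball q (2 * (1 - t))) z) * indicator {1 - 2 * \<rho>..1 - 2 * \<rho> / 3} s \<partial>lborel)"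
  proof (rule nn_integral_mono)
    fix s
    show "ennreal (4 / (area_mean_const * (1 - s)\<^sup>2)) * indicator {t..t'} s * indicator {s. norm (z - of_real s * q) < (1 - s) / 2} s
      \<le> (ennreal (9 / (area_mean_const * \<rho>\<^sup>2)) * indicator (ball q (2 * (1 - t))) z) * indicator {1 - 2 * \<rho>..1 - 2 * \<rho> / 3} s"
    proof (cases "s \<in> {t..t'} \<and> norm (z - of_real s * q) < (1 - s) / 2")
      case True
      have s: "s < 1" "t \<le> s" using True t by auto
      have "of_real s * q - q = of_real (s - 1) * q" by (simp add: algebra_simps)
      then have e: "norm (of_real s * q - q) = 1 - s" using nq s by (simp only: norm_mult norm_of_real) simp
      have 1: "\<rho> \<le> norm (z - of_real s * q) + (1 - s)"
        using norm_triangle_ineq[of "z - of_real s * q" "of_real s * q - q"] e by (simp add: \<rho>_def)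
      have 2: "1 - s \<le> norm (z - of_real s * q) + \<rho>"
        using norm_triangle_ineq4[of "z - q" "z - of_real s * q"] e by (simp add: \<rho>_def)
      have r1: "2 * \<rho> / 3 \<le> 1 - s" and r2: "1 - s \<le> 2 * \<rho>" using 1 2 True by auto
      have "\<rho> < 2 * (1 - t)" using r1 s by simp
      then have "z \<in> ball q (2 * (1 - t))" by (simp add: \<rho>_def dist_norm norm_minus_commute)
      moreover have "4 / (area_mean_const * (1 - s)\<^sup>2) \<le> 9 / (area_mean_const * \<rho>\<^sup>2)"
      proof -
        have "(2 * \<rho> / 3)\<^sup>2 \<le> (1 - s)\<^sup>2" using r1 \<rho> by (intro power_mono) auto
        then have "4 * \<rho>\<^sup>2 \<le> 9 * (1 - s)\<^sup>2" by (simp add: power2_eq_square)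
        then show ?thesis using area_mean_const_pos \<rho> s by (simp add: divide_simps mult_ac)
      qed
      then have "ennreal (4 / (area_mean_const * (1 - s)\<^sup>2)) \<le> ennreal (9 / (area_mean_const * \<rho>\<^sup>2))" by (rule ennreal_leI)
      ultimately show ?thesis using True r1 r2 by (auto split: split_indicator)
    qed auto
  qed
  also have "\<dots> = (ennreal (9 / (area_mean_const * \<rho>\<^sup>2)) * indicator (ball q (2 * (1 - t))) z) * ennreal (4 * \<rho> / 3)"
  proof -
    have "emeasure lborel {1 - 2 * \<rho>..1 - 2 * \<rho> / 3} = ennreal (4 * \<rho> / 3)" using \<rho> by simp
    then show ?thesis by (subst nn_integral_cmult_indicator) simp_all
  qed
  also have "\<dots> = ennreal (9 / (area_mean_const * \<rho>\<^sup>2) * (4 * \<rho> / 3)) * indicator (ball q (2 * (1 - t))) z"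
    using \<rho> area_mean_const_pos by (simp add: ennreal_mult[symmetric] mult_ac split: split_indicator)
  also have "9 / (area_mean_const * \<rho>\<^sup>2) * (4 * \<rho> / 3) = 12 / area_mean_const * (1 / \<rho>)"
    using \<rho> by (simp add: power2_eq_square)
  finally show ?thesis using area_mean_const_pos \<rho>
    by (simp add: \<rho>_def[symmetric] ennreal_mult[symmetric] mult.assoc[symmetric])
qed

text \<open>The derivative along the radius is replaced by area means; exchanging the integrals,
  each \<open>z\<close> is counted over its window of radii, which produces the Riesz
  kernel.\<close>

lemma radial_increment_bound:
  assumes t: "0 < t" "t \<le> t'" "t' < 1"
  shows "ennreal (norm (F (of_real t' * q) - F (of_real t * q))) \<le> ennreal (12 / area_mean_const) * I (2 * (1 - t))"
proof -
  have inb: "of_real s * q \<in> ball 0 1" if "s \<in> {t..t'}" for s using that t nq by (simp add: norm_mult)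
  have contF': "continuous_on {t..t'} (\<lambda>s. deriv F (of_real s * q))"
    by (intro continuous_on_compose2[OF holomorphic_on_imp_continuous_on[OF holF']] continuous_intros) (use inb in auto)
  have "((\<lambda>s. q * deriv F (of_real s * q)) has_integral (F (of_real t' * q) - F (of_real t * q))) {t..t'}"
  proof (rule fundamental_theorem_of_calculus[OF t(2)])
    fix s assume s: "s \<in> {t..t'}"
    have "((\<lambda>s. of_real s * q) has_vector_derivative q) (at s within {t..t'})"
      by (auto intro!: derivative_eq_intros simp: has_vector_derivative_def scaleR_conv_of_real)
    from field_vector_diff_chain_within[OF this, of F "deriv F (of_real s * q)"]
    show "((\<lambda>s. F (of_real s * q)) has_vector_derivative q * deriv F (of_real s * q)) (at s within {t..t'})"
      using holomorphic_derivI[OF holF open_ball inb[OF s]] by (simp add: o_def has_field_derivative_at_within)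
  qed
  then have "norm (F (of_real t' * q) - F (of_real t * q)) = norm (integral {t..t'} (\<lambda>s. q * deriv F (of_real s * q)))"
    by (simp only: integral_unique)
  also have "\<dots> \<le> integral {t..t'} (\<lambda>s. norm (deriv F (of_real s * q)))"
    by (rule integral_norm_bound_integral)
       (auto intro!: integrable_continuous_interval continuous_intros contF' simp: norm_mult nq)
  finally have "ennreal (norm (F (of_real t' * q) - F (of_real t * q))) \<le> ennreal (integral {t..t'} (\<lambda>s. norm (deriv F (of_real s * q))))"
    by (rule ennreal_leI)
  also have "\<dots> = (\<integral>\<^sup>+ s. ennreal (norm (deriv F (of_real s * q))) * indicator {t..t'} s \<partial>lborel)"
    by (rule nn_integral_has_integral_lebesgue'[symmetric])
       (auto intro!: integrable_integral integrable_continuous_interval continuous_intros contF')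
  also have "\<dots> \<le> (\<integral>\<^sup>+ s. \<integral>\<^sup>+ z. w z * (ennreal (4 / (area_mean_const * (1 - s)\<^sup>2)) * indicator {t..t'} s * indicator {s. norm (z - of_real s * q) < (1 - s) / 2} s) \<partial>lborel \<partial>lborel)"
  proof (rule nn_integral_mono)
    fix s
    show "ennreal (norm (deriv F (of_real s * q))) * indicator {t..t'} s \<le> (\<integral>\<^sup>+ z. w z * (ennreal (4 / (area_mean_const * (1 - s)\<^sup>2)) * indicator {t..t'} s * indicator {s. norm (z - of_real s * q) < (1 - s) / 2} s) \<partial>lborel)"
    proof (cases "s \<in> {t..t'}")
      case True
      define c where "c = 4 / (area_mean_const * (1 - s)\<^sup>2)"
      have c: "0 < c" using True t area_mean_const_pos by (simp add: c_def)
      have n: "norm (of_real s * q) = s" using True t nq by (simp add: norm_mult)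
      have cc: "c * (area_mean_const * ((1 - s) / 2)\<^sup>2 * norm (deriv F (of_real s * q))) = norm (deriv F (of_real s * q))"
        using True t area_mean_const_pos by (simp add: c_def power_divide)
      have "ennreal (norm (deriv F (of_real s * q))) = ennreal c * ennreal (area_mean_const * ((1 - s) / 2)\<^sup>2 * norm (deriv F (of_real s * q)))"
        using c by (subst ennreal_mult[symmetric]) (auto simp: cc area_mean_const_pos less_imp_le)
      also have "\<dots> \<le> ennreal c * (\<integral>\<^sup>+ z\<in>ball (of_real s * q) ((1 - s) / 2). w z \<partial>lborel)"
        using deriv_mean_bound[OF inb[OF True]] unfolding n by (rule mult_left_mono) simp
      also have "\<dots> = (\<integral>\<^sup>+ z. ennreal c * (w z * indicator (ball (of_real s * q) ((1 - s) / 2)) z) \<partial>lborel)"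
        by (rule nn_integral_cmult[symmetric]) measurable
      also have "\<dots> = (\<integral>\<^sup>+ z. w z * (ennreal c * indicator {t..t'} s * indicator {s. norm (z - of_real s * q) < (1 - s) / 2} s) \<partial>lborel)"
        using True by (intro nn_integral_cong) (auto simp: dist_norm norm_minus_commute mult_ac split: split_indicator)
      finally show ?thesis using True by (simp add: c_def)
    qed simp
  qed
  also have "\<dots> = (\<integral>\<^sup>+ z. \<integral>\<^sup>+ s. w z * (ennreal (4 / (area_mean_const * (1 - s)\<^sup>2)) * indicator {t..t'} s * indicator {s. norm (z - of_real s * q) < (1 - s) / 2} s) \<partial>lborel \<partial>lborel)"
  proof (rule lborel_pair.Fubini')
    \<comment> \<open>The indicator depends on both variables; written as a conditional, its joint
      measurability is visible.\<close>
    have "(\<lambda>(z, s). w z * (ennreal (4 / (area_mean_const * (1 - s)\<^sup>2)) * indicator {t..t'} s * (if norm (z - of_real s * q) < (1 - s) / 2 then 1 else 0)))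
       \<in> borel_measurable (lborel \<Otimes>\<^sub>M lborel)"
      by measurable
    then show "(\<lambda>(z, s). w z * (ennreal (4 / (area_mean_const * (1 - s)\<^sup>2)) * indicator {t..t'} s * indicator {s. norm (z - of_real s * q) < (1 - s) / 2} s))
       \<in> borel_measurable (lborel \<Otimes>\<^sub>M lborel)"
      by (simp add: indicator_def if_distrib cong: if_cong)
  qed
  also have "\<dots> \<le> (\<integral>\<^sup>+ z. ennreal (12 / area_mean_const) * (w z * ennreal (1 / norm (z - q)) * indicator (ball q (2 * (1 - t))) z) \<partial>lborel)"
  proof (rule nn_integral_mono)
    fix z
    have "(\<integral>\<^sup>+ s. w z * (ennreal (4 / (area_mean_const * (1 - s)\<^sup>2)) * indicator {t..t'} s * indicator {s. norm (z - of_real s * q) < (1 - s) / 2} s) \<partial>lborel)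
      = w z * (\<integral>\<^sup>+ s. ennreal (4 / (area_mean_const * (1 - s)\<^sup>2)) * indicator {t..t'} s * indicator {s. norm (z - of_real s * q) < (1 - s) / 2} s \<partial>lborel)"
      by (rule nn_integral_cmult) measurable
    also have "\<dots> \<le> w z * (ennreal (12 / area_mean_const) * (ennreal (1 / norm (z - q)) * indicator (ball q (2 * (1 - t))) z))"
    proof (cases "z \<in> ball 0 1")
      case True
      then show ?thesis by (intro mult_left_mono radial_window_bound t) auto
    qed (simp add: w_def)
    finally show "(\<integral>\<^sup>+ s. w z * (ennreal (4 / (area_mean_const * (1 - s)\<^sup>2)) * indicator {t..t'} s * indicator {s. norm (z - of_real s * q) < (1 - s) / 2} s) \<partial>lborel)
      \<le> ennreal (12 / area_mean_const) * (w z * ennreal (1 / norm (z - q)) * indicator (ball q (2 * (1 - t))) z)"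
      by (simp add: mult_ac)
  qed
  also have "\<dots> = ennreal (12 / area_mean_const) * I (2 * (1 - t))"
    unfolding I_def by (rule nn_integral_cmult) measurable
  finally show ?thesis .
qed

text \<open>Increments are bounded by the tail of the potential, so the values along the radius are
  Cauchy, and the same bound survives in the limit.\<close>

lemma radial_limit:
  obtains L where "\<And>t i. 0 < t \<Longrightarrow> t < 1 \<Longrightarrow> 0 \<le> i \<Longrightarrow> I (2 * (1 - t)) \<le> ennreal i \<Longrightarrow>
     norm (F (of_real t * q) - L) \<le> 12 / area_mean_const * i"
proof -
  have inc: "norm (F (of_real t' * q) - F (of_real t * q)) \<le> 12 / area_mean_const * i"
    if "0 < t" "t \<le> t'" "t' < 1" "0 \<le> i" "I (2 * (1 - t)) \<le> ennreal i" for t t' i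
  proof -
    have "ennreal (norm (F (of_real t' * q) - F (of_real t * q))) \<le> ennreal (12 / area_mean_const) * ennreal i"
      using radial_increment_bound[OF that(1-3)] that(5) by (meson mult_left_mono order_trans zero_le)
    also have "\<dots> = ennreal (12 / area_mean_const * i)"
      using that(4) area_mean_const_pos by (subst ennreal_mult[symmetric]) auto
    finally show ?thesis using that(4) area_mean_const_pos by (subst (asm) ennreal_le_iff) auto
  qed
  \<comment> \<open>Starting at \<open>n + 2\<close> keeps the radii positive.\<close>
  define t where "t n = 1 - 1 / real (n + 2)" for n
  have t: "0 < t n" "t n < 1" for n by (simp_all add: t_def)
  have tm: "t m \<le> t n" if "m \<le> n" for m n using that by (simp add: t_def frac_le)
  have tl: "t \<longlonglongrightarrow> 1" unfolding t_def by real_asymp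
  have ev: "eventually (\<lambda>n. s < t n) sequentially" if "s < 1" for s using order_tendstoD(1)[OF tl that] .
  have "Cauchy (\<lambda>n. F (of_real (t n) * q))"
  proof (rule metric_CauchyI)
    fix e :: real assume e: "0 < e"
    \<comment> \<open>Makes \<open>12 / area_mean_const * i\<close> equal to
      \<open>e / 2\<close>.\<close>
    define i where "i = e * area_mean_const / 24"
    have i: "0 < i" using e area_mean_const_pos by (simp add: i_def)
    obtain \<delta> where \<delta>: "0 < \<delta>" "I \<delta> \<le> ennreal i" using I_small[OF i] by blast
    obtain N where N: "1 - \<delta> / 2 < t N" using ev[of "1 - \<delta> / 2"] \<delta>(1) by (auto simp: eventually_sequentially)
    have b: "dist (F (of_real (t n) * q)) (F (of_real (t m) * q)) < e" if "N \<le> m" "m \<le> n" for m n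
    proof -
      have "t N \<le> t m" using tm that by blast
      then have "I (2 * (1 - t m)) \<le> ennreal i" using N \<delta>(2) I_mono[of "2 * (1 - t m)" \<delta>] by auto
      then have "norm (F (of_real (t n) * q) - F (of_real (t m) * q)) \<le> 12 / area_mean_const * i"
        using inc[of "t m" "t n" i] t tm that i by auto
      also have "\<dots> < e" using e area_mean_const_pos by (simp add: i_def)
      finally show ?thesis by (simp add: dist_norm)
    qed
    show "\<exists>M. \<forall>m\<ge>M. \<forall>n\<ge>M. dist (F (of_real (t m) * q)) (F (of_real (t n) * q)) < e"
      using b by (metis dist_commute nle_le)
  qed
  then obtain L where L: "(\<lambda>n. F (of_real (t n) * q)) \<longlonglongrightarrow> L" using Cauchy_convergent convergent_def by blast
  show ?thesis
  proof (rule that)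
    fix s i :: real assume s: "0 < s" "s < 1" "0 \<le> i" "I (2 * (1 - s)) \<le> ennreal i"
    have "(\<lambda>n. norm (F (of_real (t n) * q) - F (of_real s * q))) \<longlonglongrightarrow> norm (L - F (of_real s * q))"
      by (intro tendsto_intros L)
    moreover have "eventually (\<lambda>n. norm (F (of_real (t n) * q) - F (of_real s * q)) \<le> 12 / area_mean_const * i) sequentially"
      using ev[OF s(2)] by eventually_elim (use inc s t in auto)
    ultimately have "norm (L - F (of_real s * q)) \<le> 12 / area_mean_const * i"
      unfolding eventually_sequentially by (rule LIMSEQ_le_const2)
    then show "norm (F (of_real s * q) - L) \<le> 12 / area_mean_const * i" by (simp add: norm_minus_commute)
  qed
qed

text \<open>The segment from \<open>z\<close> to the radial point of the same modulus lies in two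
  convex discs and therefore in the Stolz region, where the gradient is at most of order
  \<open>i / d\<close>; the segment has length at most \<open>2 * M * d\<close>.\<close>

lemma stolz_radial_bound:
  assumes z: "z \<in> ball 0 1" and M: "1 < M" "norm (q - z) < M * (1 - norm z)"
    and i: "0 \<le> i" "I (2 * M * (1 - norm z)) \<le> ennreal i"
  shows "norm (F z - F (of_real (norm z) * q)) \<le> 2 * M * (4 * (M + 1) / area_mean_const * i)"
proof -
  define d where "d = 1 - norm z"
  have d: "0 < d" using z by (simp add: d_def)
  let ?p = "of_real (norm z) * q"
  have "q - ?p = of_real d * q" by (simp add: d_def algebra_simps)
  then have qp: "norm (q - ?p) = d" using d nq by (simp add: norm_mult)
  have dM: "d \<le> M * d" using M(1) d by simp
  have seg: "\<zeta> \<in> ball 0 1 \<and> d \<le> 1 - norm \<zeta> \<and> norm (\<zeta> - q) \<le> M * d" if "\<zeta> \<in> closed_segment z ?p" for \<zeta>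
  proof -
    have "closed_segment z ?p \<subseteq> cball 0 (norm z)"
      by (rule closed_segment_subset) (auto simp: norm_mult nq)
    moreover have "closed_segment z ?p \<subseteq> cball q (M * d)"
      by (rule closed_segment_subset) (use M qp dM in \<open>auto simp: dist_norm d_def[symmetric]\<close>)
    ultimately show ?thesis using that z by (auto simp: d_def dist_norm norm_minus_commute)
  qed
  have bound: "norm (deriv F \<zeta>) \<le> 4 * (M + 1) / area_mean_const * i / d" if "\<zeta> \<in> closed_segment z ?p" for \<zeta>
  proof -
    note S = seg[OF that]
    have "1 - norm \<zeta> \<le> norm (\<zeta> - q)" using norm_triangle_ineq2[of q \<zeta>] nq by (simp add: norm_minus_commute)
    have gen: "x + y / 2 \<le> 2 * e" if "y \<le> x" "x \<le> e" "0 < e" for x y e :: real using that by linarith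
    have "norm (\<zeta> - q) + (1 - norm \<zeta>) / 2 \<le> 2 * (M * d)"
      by (rule gen) (use \<open>1 - norm \<zeta> \<le> norm (\<zeta> - q)\<close> S d dM in auto)
    then have 1: "norm (\<zeta> - q) + (1 - norm \<zeta>) / 2 \<le> 2 * M * d" by (simp only: mult.assoc)
    have 2: "norm (\<zeta> - q) \<le> M * (1 - norm \<zeta>)"
    proof -
      have "M * d \<le> M * (1 - norm \<zeta>)" using S M(1) by (intro mult_left_mono) auto
      then show ?thesis using S by linarith
    qed
    have "norm (deriv F \<zeta>) * (1 - norm \<zeta>) \<le> 4 * (M + 1) / area_mean_const * i"
      by (rule gradient_bound[OF _ 2 1]) (use S i in \<open>auto simp: d_def\<close>)
    moreover have "norm (deriv F \<zeta>) * d \<le> norm (deriv F \<zeta>) * (1 - norm \<zeta>)" using S by (intro mult_left_mono) auto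
    ultimately have "norm (deriv F \<zeta>) * d \<le> 4 * (M + 1) / area_mean_const * i" by linarith
    then show ?thesis unfolding pos_le_divide_eq[OF d] .
  qed
  have "norm (F z - F ?p) \<le> 4 * (M + 1) / area_mean_const * i / d * norm (z - ?p)"
  proof (rule field_differentiable_bound[of "closed_segment z ?p" F "deriv F"])
    fix \<zeta> assume "\<zeta> \<in> closed_segment z ?p"
    then show "(F has_field_derivative deriv F \<zeta>) (at \<zeta> within closed_segment z ?p)"
      using holomorphic_derivI[OF holF open_ball] seg by (blast intro: has_field_derivative_at_within)
  qed (use bound in auto)
  also have "\<dots> \<le> 4 * (M + 1) / area_mean_const * i / d * (2 * M * d)"
  proof (rule mult_left_mono)
    have "norm (z - ?p) \<le> norm (q - ?p) + norm (q - z)" using norm_triangle_ineq4[of "q - ?p" "q - z"] by simp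
    then show "norm (z - ?p) \<le> 2 * M * d" using qp M(2) dM by (simp add: d_def[symmetric])
    show "0 \<le> 4 * (M + 1) / area_mean_const * i / d" using M(1) i(1) d area_mean_const_pos by simp
  qed
  also have "\<dots> = 2 * M * (4 * (M + 1) / area_mean_const * i)"
  proof -
    have "x / d * (2 * M * d) = 2 * M * x" for x using d by simp
    then show ?thesis .
  qed
  finally show ?thesis .
qed

text \<open>A point of the Stolz region is compared with the radial point of the same modulus, and
  that point with the radial limit.\<close>

lemma nontangential_limit_exists: "\<exists>L. nontangential_limit F q L"
proof -
  obtain L where L: "\<And>t i. 0 < t \<Longrightarrow> t < 1 \<Longrightarrow> 0 \<le> i \<Longrightarrow> I (2 * (1 - t)) \<le> ennreal i \<Longrightarrow>
     norm (F (of_real t * q) - L) \<le> 12 / area_mean_const * i" using radial_limit by blast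
  have "nontangential_limit F q L"
    unfolding nontangential_limit_def tendsto_iff
  proof (intro allI impI)
    fix M e :: real assume M: "1 < M" and e: "0 < e"
    define C where "C = 2 * M * (4 * (M + 1) / area_mean_const) + 12 / area_mean_const"
    have C: "0 < C" using M area_mean_const_pos by (auto simp: C_def intro!: add_pos_pos mult_pos_pos divide_pos_pos)
    define i where "i = e / (2 * C)"
    have i: "0 < i" using e C by (simp add: i_def)
    obtain \<delta> where \<delta>: "0 < \<delta>" "I \<delta> \<le> ennreal i" using I_small[OF i] by blast
    \<comment> \<open>The bound by 1 keeps \<open>z\<close> away from 0, so that its modulus is an
      admissible radius; the other makes both tails at most \<open>i\<close>.\<close>
    define r where "r = min 1 (\<delta> / (2 * M))"
    have r: "0 < r" using \<delta> M by (simp add: r_def)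
    show "eventually (\<lambda>z. dist (F z) L < e) (at q within {z \<in> ball 0 1. cmod (q - z) < M * (1 - cmod z)})"
      unfolding eventually_at
    proof (intro exI conjI ballI impI)
      fix z assume z: "z \<in> {z \<in> ball 0 1. cmod (q - z) < M * (1 - cmod z)}" "z \<noteq> q \<and> dist z q < r"
      have d: "1 - norm z \<le> norm (q - z)" using norm_triangle_ineq2[of q z] nq by simp
      have qz: "norm (q - z) < 1" "2 * M * norm (q - z) < \<delta>"
        using z(2) M by (auto simp: r_def dist_norm norm_minus_commute field_simps)
      have "2 * M * (1 - norm z) \<le> 2 * M * norm (q - z)" using d M by (intro mult_left_mono) auto
      then have \<delta>1: "2 * M * (1 - norm z) \<le> \<delta>" using qz by linarith
      have "1 * (1 - norm z) \<le> M * (1 - norm z)" using M z by (intro mult_right_mono) auto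
      then have \<delta>2: "2 * (1 - norm z) \<le> \<delta>" using \<delta>1 by simp
      have a: "norm (F z - F (of_real (norm z) * q)) \<le> 2 * M * (4 * (M + 1) / area_mean_const * i)"
        by (rule stolz_radial_bound) (use z M i order_trans[OF I_mono[OF \<delta>1] \<delta>(2)] in auto)
      have b: "norm (F (of_real (norm z) * q) - L) \<le> 12 / area_mean_const * i"
        by (rule L) (use z i d qz order_trans[OF I_mono[OF \<delta>2] \<delta>(2)] in auto)
      have "norm (F z - L) \<le> norm (F z - F (of_real (norm z) * q)) + norm (F (of_real (norm z) * q) - L)"
        using norm_triangle_ineq[of "F z - F (of_real (norm z) * q)" "F (of_real (norm z) * q) - L"] by simp
      also have "\<dots> \<le> C * i" using a b by (simp only: C_def distrib_right mult.assoc)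
      also have "\<dots> < e" using e C by (simp add: i_def)
      finally show "dist (F z) L < e" by (simp add: dist_norm)
    qed (rule r)
  qed
  then show ?thesis by blast
qed

end

subsection \<open>Uniqueness from boundary values\<close>

text \<open>For \<open>norm \<alpha> = 1\<close> and \<open>norm a < 1\<close> the general
  automorphism of the disc: it sends \<open>a\<close> to 0 and then rotates by
  \<open>\<alpha>\<close>.\<close>

definition disc_aut :: "complex \<Rightarrow> complex \<Rightarrow> complex \<Rightarrow> complex" where
  "disc_aut \<alpha> a z = \<alpha> * ((z - a) / (1 - cnj a * z))"

locale disc_automorphism =
  fixes \<alpha> a :: complex
  assumes n\<alpha>: "norm \<alpha> = 1" and na: "norm a < 1"
begin

lemma denom_bounds:
  assumes "norm z \<le> 1"
  shows "1 - norm a \<le> norm (1 - cnj a * z)" "norm (1 - cnj a * z) \<le> 2" "1 - cnj a * z \<noteq> 0"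
proof -
  have le: "norm (cnj a * z) \<le> norm a" using assms by (simp add: norm_mult mult_left_le)
  show 1: "1 - norm a \<le> norm (1 - cnj a * z)" using norm_triangle_ineq2[of 1 "cnj a * z"] le by simp
  show "norm (1 - cnj a * z) \<le> 2" using norm_triangle_ineq4[of 1 "cnj a * z"] le na by simp
  show "1 - cnj a * z \<noteq> 0" using 1 na by auto
qed

lemma holomorphic: "disc_aut \<alpha> a holomorphic_on ball 0 1"
  unfolding disc_aut_def by (intro holomorphic_intros) (use denom_bounds(3) in auto)

lemma continuous: "continuous_on (cball 0 1) (disc_aut \<alpha> a)"
  unfolding disc_aut_def by (intro continuous_intros) (use denom_bounds(3) in auto)

text \<open>Cross-multiplying, \<open>(z - a) * (1 - cnj a * w) - (w - a) * (1 - cnj a * z)\<close>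
  factors as \<open>(1 - |a|^2) * (z - w)\<close>. Both Lipschitz bounds follow from this
  equality.\<close>

lemma norm_diff:
  assumes "norm z \<le> 1" "norm w \<le> 1"
  shows "norm (disc_aut \<alpha> a z - disc_aut \<alpha> a w) = (1 - (norm a)\<^sup>2) * norm (z - w) / (norm (1 - cnj a * z) * norm (1 - cnj a * w))"
proof -
  note nz = denom_bounds(3)[OF assms(1)] denom_bounds(3)[OF assms(2)]
  have c: "a * cnj a = of_real ((norm a)\<^sup>2)" by (rule complex_norm_square[symmetric])
  have "(z - a) * (1 - cnj a * w) - (w - a) * (1 - cnj a * z) = (1 - a * cnj a) * (z - w)" by (simp add: algebra_simps)
  then have "(z - a) / (1 - cnj a * z) - (w - a) / (1 - cnj a * w) = (1 - a * cnj a) * (z - w) / ((1 - cnj a * z) * (1 - cnj a * w))"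
    using nz by (simp add: diff_frac_eq)
  moreover have "disc_aut \<alpha> a z - disc_aut \<alpha> a w = \<alpha> * ((z - a) / (1 - cnj a * z) - (w - a) / (1 - cnj a * w))"
    by (simp only: disc_aut_def right_diff_distrib)
  ultimately have "disc_aut \<alpha> a z - disc_aut \<alpha> a w = \<alpha> * ((1 - a * cnj a) * (z - w) / ((1 - cnj a * z) * (1 - cnj a * w)))"
    by (simp only:)
  moreover have "norm (1 - a * cnj a) = 1 - (norm a)\<^sup>2"
  proof -
    have "1 - a * cnj a = of_real (1 - (norm a)\<^sup>2)" by (simp add: c)
    moreover have "(norm a)\<^sup>2 \<le> 1" using na by (simp add: power_le_one)
    ultimately show ?thesis by (simp only: norm_of_real)
  qed
  ultimately show ?thesis by (simp add: norm_mult norm_divide n\<alpha>)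
qed

text \<open>Relates the distance to the circle before and after the map, which is what controls
  Stolz regions.\<close>

lemma one_minus_norm_sq:
  assumes "norm z \<le> 1"
  shows "1 - (norm (disc_aut \<alpha> a z))\<^sup>2 = (1 - (norm a)\<^sup>2) * (1 - (norm z)\<^sup>2) / (norm (1 - cnj a * z))\<^sup>2"
proof -
  have nz: "norm (1 - cnj a * z) \<noteq> 0" using denom_bounds(3)[OF assms] by simp
  have key: "(norm (1 - cnj a * z))\<^sup>2 - (norm (z - a))\<^sup>2 = (1 - (norm a)\<^sup>2) * (1 - (norm z)\<^sup>2)"
    unfolding cmod_power2 by (simp add: power2_eq_square algebra_simps)
  have "(norm (disc_aut \<alpha> a z))\<^sup>2 = (norm (z - a))\<^sup>2 / (norm (1 - cnj a * z))\<^sup>2"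
    by (simp add: disc_aut_def norm_mult norm_divide n\<alpha> power_divide)
  then show ?thesis unfolding key[symmetric] using nz by (simp add: diff_divide_distrib)
qed

text \<open>A lower Lipschitz constant: the two denominators in \<open>norm_diff\<close> have
  product at most 4.\<close>

definition c where "c = (1 - (norm a)\<^sup>2) / 4"

lemma four_c: "1 - (norm a)\<^sup>2 = 4 * c"
  by (simp add: c_def)

lemma c_pos: "0 < c"
proof -
  have "(norm a)\<^sup>2 < 1" using na by (simp add: abs_square_less_1)
  then show ?thesis by (simp add: c_def)
qed

lemma denom_sq_bound:
  assumes "norm z \<le> 1" "norm w \<le> 1" shows "norm (1 - cnj a * z) * norm (1 - cnj a * w) \<le> 4"
    "0 < norm (1 - cnj a * z) * norm (1 - cnj a * w)"
proof -
  have "norm (1 - cnj a * z) * norm (1 - cnj a * w) \<le> 2 * 2"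
    by (intro mult_mono denom_bounds assms) auto
  then show "norm (1 - cnj a * z) * norm (1 - cnj a * w) \<le> 4" by simp
  show "0 < norm (1 - cnj a * z) * norm (1 - cnj a * w)" using denom_bounds(3) assms by (intro mult_pos_pos) auto
qed

lemma norm_diff_ge:
  assumes "norm z \<le> 1" "norm w \<le> 1"
  shows "c * norm (z - w) \<le> norm (disc_aut \<alpha> a z - disc_aut \<alpha> a w)"
proof -
  have "4 * c * norm (z - w) / 4 \<le> 4 * c * norm (z - w) / (norm (1 - cnj a * z) * norm (1 - cnj a * w))"
    using denom_sq_bound[OF assms] c_pos by (intro divide_left_mono) auto
  then show ?thesis unfolding norm_diff[OF assms] four_c by simp
qed

lemma norm_diff_le:
  assumes "norm z \<le> 1" "norm w \<le> 1"
  shows "norm (disc_aut \<alpha> a z - disc_aut \<alpha> a w) \<le> 4 * c / (1 - norm a)\<^sup>2 * norm (z - w)"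
proof -
  have "(1 - norm a) * (1 - norm a) \<le> norm (1 - cnj a * z) * norm (1 - cnj a * w)"
    by (intro mult_mono denom_bounds assms) (use na in auto)
  then have "4 * c * norm (z - w) / (norm (1 - cnj a * z) * norm (1 - cnj a * w)) \<le> 4 * c * norm (z - w) / ((1 - norm a) * (1 - norm a))"
    using c_pos na denom_sq_bound[OF assms] by (intro divide_left_mono) auto
  then show ?thesis unfolding norm_diff[OF assms] four_c by (simp add: power2_eq_square)
qed

lemma norm_le: "norm z \<le> 1 \<Longrightarrow> norm (disc_aut \<alpha> a z) \<le> 1"
  and norm_less: "norm z < 1 \<Longrightarrow> norm (disc_aut \<alpha> a z) < 1"
  and norm_eq: "norm z = 1 \<Longrightarrow> norm (disc_aut \<alpha> a z) = 1"
proof -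
  have p: "0 < (1 - (norm a)\<^sup>2)" using c_pos by (simp add: c_def)
  show "norm (disc_aut \<alpha> a z) \<le> 1" if z: "norm z \<le> 1"
  proof -
    have "0 \<le> 1 - (norm z)\<^sup>2" using z by (simp add: power_le_one)
    then have "0 \<le> 1 - (norm (disc_aut \<alpha> a z))\<^sup>2" unfolding one_minus_norm_sq[OF z] using p by simp
    then show ?thesis using abs_square_le_1[of "norm (disc_aut \<alpha> a z)"] by simp
  qed
  show "norm (disc_aut \<alpha> a z) < 1" if z: "norm z < 1"
  proof -
    have "0 < 1 - (norm z)\<^sup>2" using z by (simp add: abs_square_less_1)
    then have "0 < 1 - (norm (disc_aut \<alpha> a z))\<^sup>2"
      unfolding one_minus_norm_sq[OF less_imp_le[OF z]] using p denom_bounds(3)[OF less_imp_le[OF z]] by simp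
    then show ?thesis using abs_square_less_1[of "norm (disc_aut \<alpha> a z)"] by simp
  qed
  show "norm (disc_aut \<alpha> a z) = 1" if z: "norm z = 1"
  proof -
    have "1 - (norm (disc_aut \<alpha> a z))\<^sup>2 = 0" using one_minus_norm_sq[of z] z by simp
    then show ?thesis by (simp add: power2_eq_1_iff) (smt (verit) norm_ge_zero)
  qed
qed

text \<open>The loss of a factor 2 comes from
  \<open>1 - T^2 = (1 - T) * (1 + T) \<le> 2 * (1 - T)\<close>.\<close>

lemma one_minus_norm_ge:
  assumes "norm z \<le> 1"
  shows "c / 2 * (1 - norm z) \<le> 1 - norm (disc_aut \<alpha> a z)"
proof -
  let ?T = "norm (disc_aut \<alpha> a z)"
  have d: "norm (1 - cnj a * z) * norm (1 - cnj a * z) \<le> 4" "0 < norm (1 - cnj a * z) * norm (1 - cnj a * z)"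
    using denom_sq_bound[OF assms assms] by auto
  have z2: "1 - norm z \<le> 1 - (norm z)\<^sup>2" using assms by (simp add: power2_eq_square mult_left_le)
  have z0: "0 \<le> 1 - (norm z)\<^sup>2" using assms z2 by linarith
  have "c * (1 - norm z) \<le> c * (1 - (norm z)\<^sup>2)" using z2 c_pos by (intro mult_left_mono) auto
  also have "\<dots> = 4 * c * (1 - (norm z)\<^sup>2) / 4" by simp
  also have "\<dots> \<le> 4 * c * (1 - (norm z)\<^sup>2) / (norm (1 - cnj a * z) * norm (1 - cnj a * z))"
    using d c_pos z0 by (intro divide_left_mono) auto
  also have "\<dots> = 1 - ?T\<^sup>2" unfolding one_minus_norm_sq[OF assms] four_c by (simp add: power2_eq_square)
  also have "\<dots> = (1 - ?T) * (1 + ?T)" by (simp add: power2_eq_square algebra_simps)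
  also have "\<dots> \<le> (1 - ?T) * 2" using norm_le[OF assms] by (intro mult_left_mono) auto
  finally show ?thesis by simp
qed

text \<open>The map is Lipschitz up to the circle and shrinks the distance to the circle by a
  bounded factor at most, so it takes a Stolz region into another one of larger aperture.\<close>

lemma nontangential_limit_compose:
  assumes u: "nontangential_limit u (disc_aut \<alpha> a q) \<zeta>" and q: "norm q = 1"
  shows "nontangential_limit (\<lambda>z. u (disc_aut \<alpha> a z)) q \<zeta>"
  unfolding nontangential_limit_def
proof (intro allI impI)
  fix M :: real assume M: "1 < M"
  define L where "L = 4 * c / (1 - norm a)\<^sup>2"
  have L: "0 < L" using c_pos na by (simp add: L_def)
  \<comment> \<open>The Lipschitz constant times the aperture times the factor \<open>2 / c\<close>
    for the distance to the circle; the maximum with 2 makes the aperture admissible.\<close>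
  define M' where "M' = max 2 (L * M * (2 / c))"
  have "(u \<longlongrightarrow> \<zeta>) (at (disc_aut \<alpha> a q) within {z \<in> ball 0 1. cmod (disc_aut \<alpha> a q - z) < M' * (1 - cmod z)})"
    using u unfolding nontangential_limit_def M'_def by auto
  moreover have "filterlim (disc_aut \<alpha> a) (at (disc_aut \<alpha> a q) within {z \<in> ball 0 1. cmod (disc_aut \<alpha> a q - z) < M' * (1 - cmod z)})
      (at q within {z \<in> ball 0 1. cmod (q - z) < M * (1 - cmod z)})"
    unfolding filterlim_at
  proof
    have "(disc_aut \<alpha> a \<longlongrightarrow> disc_aut \<alpha> a q) (at q within cball 0 1)"
      using continuous q by (auto simp: continuous_on_def)
    then show "(disc_aut \<alpha> a \<longlongrightarrow> disc_aut \<alpha> a q) (at q within {z \<in> ball 0 1. cmod (q - z) < M * (1 - cmod z)})"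
      by (rule tendsto_within_subset) auto
    have S: "disc_aut \<alpha> a z \<in> {z \<in> ball 0 1. cmod (disc_aut \<alpha> a q - z) < M' * (1 - cmod z)} \<and> disc_aut \<alpha> a z \<noteq> disc_aut \<alpha> a q"
      if z: "z \<in> {z \<in> ball 0 1. cmod (q - z) < M * (1 - cmod z)}" "z \<noteq> q" for z
    proof -
      have z1: "norm z \<le> 1" "norm z < 1" using z by auto
      have "norm (disc_aut \<alpha> a q - disc_aut \<alpha> a z) \<le> L * norm (q - z)" unfolding L_def by (rule norm_diff_le) (use q z1 in auto)
      also have "\<dots> < L * (M * (1 - norm z))" using z L by (intro mult_strict_left_mono) auto
      also have "\<dots> \<le> L * (M * (2 / c * (1 - norm (disc_aut \<alpha> a z))))"
      proof -
        have "1 - norm z \<le> 2 / c * (1 - norm (disc_aut \<alpha> a z))" using one_minus_norm_ge[OF z1(1)] c_pos by (simp add: field_simps)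
        then show ?thesis using L M by (intro mult_left_mono) auto
      qed
      also have "\<dots> \<le> M' * (1 - norm (disc_aut \<alpha> a z))"
      proof -
        have "L * M * (2 / c) * (1 - norm (disc_aut \<alpha> a z)) \<le> M' * (1 - norm (disc_aut \<alpha> a z))"
          using norm_le[OF z1(1)] by (intro mult_right_mono) (auto simp: M'_def)
        then show ?thesis by (simp only: mult.assoc)
      qed
      finally have 1: "norm (disc_aut \<alpha> a q - disc_aut \<alpha> a z) < M' * (1 - norm (disc_aut \<alpha> a z))" .
      have "0 < norm (disc_aut \<alpha> a q - disc_aut \<alpha> a z)"
        using norm_diff_ge[of q z] q z1 c_pos z(2) by (smt (verit) mult_pos_pos right_minus_eq zero_less_norm_iff)
      then show ?thesis using 1 norm_less[OF z1(2)] by auto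
    qed
    show "\<forall>\<^sub>F x in at q within {z \<in> ball 0 1. cmod (q - z) < M * (1 - cmod z)}.
        disc_aut \<alpha> a x \<in> {z \<in> ball 0 1. cmod (disc_aut \<alpha> a q - z) < M' * (1 - cmod z)} \<and> disc_aut \<alpha> a x \<noteq> disc_aut \<alpha> a q"
      unfolding eventually_at using S by (intro exI[of _ 1]) auto
  qed
  ultimately show "((\<lambda>z. u (disc_aut \<alpha> a z)) \<longlongrightarrow> \<zeta>) (at q within {z \<in> ball 0 1. cmod (q - z) < M * (1 - cmod z)})"
    by (rule filterlim_compose)
qed

lemma polar_set_pullback:
  assumes "polar_set E"
  shows "polar_set {q \<in> sphere 0 1. disc_aut \<alpha> a q \<in> E}"
  by (rule polar_set_preimage[OF assms continuous_on_subset[OF continuous] c_pos]) (auto intro: norm_diff_ge)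

lemma inj_ball: "inj_on (disc_aut \<alpha> a) (ball 0 1)"
proof (rule inj_onI)
  fix x y assume xy: "x \<in> ball 0 1" "y \<in> ball 0 1" "disc_aut \<alpha> a x = disc_aut \<alpha> a y"
  then have "c * norm (x - y) \<le> 0" using norm_diff_ge[of x y] by simp
  then show "x = y" using c_pos by (simp add: mult_le_0_iff)
qed

end

section \<open>Radial limits and the value at the centre\<close>

lemma increment_le_nn_integral:
  fixes g :: "real \<Rightarrow> complex"
  assumes ab: "a \<le> b" and der: "\<And>s. s \<in> {a..b} \<Longrightarrow> (g has_vector_derivative g' s) (at s within {a..b})"
    and cont: "continuous_on {a..b} g'"
  shows "ennreal (norm (g b - g a)) \<le> (\<integral>\<^sup>+ s\<in>{a..b}. ennreal (norm (g' s)) \<partial>lborel)"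
proof -
  have "(g' has_integral (g b - g a)) {a..b}" by (rule fundamental_theorem_of_calculus[OF ab der])
  then have "norm (g b - g a) = norm (integral {a..b} g')" by (simp only: integral_unique)
  also have "\<dots> \<le> integral {a..b} (\<lambda>s. norm (g' s))"
    by (rule integral_norm_bound_integral) (auto intro!: integrable_continuous_interval continuous_intros cont)
  finally have "ennreal (norm (g b - g a)) \<le> ennreal (integral {a..b} (\<lambda>s. norm (g' s)))" by (rule ennreal_leI)
  also have "\<dots> = (\<integral>\<^sup>+ s. ennreal (norm (g' s)) * indicator {a..b} s \<partial>lborel)"
    by (rule nn_integral_has_integral_lebesgue'[symmetric])
       (auto intro!: integrable_integral integrable_continuous_interval continuous_intros cont)
  finally show ?thesis .
qed

text \<open>The radius lies in the Stolz region of aperture 2, because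
  \<open>|q - t * q| = 1 - t\<close>.\<close>

lemma nontangential_imp_radial:
  assumes u: "nontangential_limit u q \<zeta>" and q: "norm q = 1"
    and t: "t \<longlonglongrightarrow> 1" "\<And>n. 0 < t n" "\<And>n. t n < (1::real)"
  shows "(\<lambda>n. u (of_real (t n) * q)) \<longlonglongrightarrow> \<zeta>"
proof -
  let ?S = "{z \<in> ball 0 1. cmod (q - z) < 2 * (1 - cmod z)}"
  have lim: "(u \<longlongrightarrow> \<zeta>) (at q within ?S)" by (rule u[unfolded nontangential_limit_def, rule_format]) simp
  have "filterlim (\<lambda>n. of_real (t n) * q) (at q within ?S) sequentially"
    unfolding filterlim_at
  proof
    have "(\<lambda>n. of_real (t n) * q) \<longlonglongrightarrow> of_real 1 * q" by (intro tendsto_intros t)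
    then show "(\<lambda>n. of_real (t n) * q) \<longlonglongrightarrow> q" by simp
    have "of_real (t n) * q \<in> ?S \<and> of_real (t n) * q \<noteq> q" for n
    proof -
      have "q - of_real (t n) * q = of_real (1 - t n) * q" by (simp add: algebra_simps)
      then have "norm (q - of_real (t n) * q) = 1 - t n" using q t(3)[of n] by (simp only: norm_mult norm_of_real) simp
      moreover have "norm (of_real (t n) * q) = t n" using q t(2)[of n] by (simp add: norm_mult)
      ultimately show ?thesis using t(3)[of n] by auto
    qed
    then show "\<forall>\<^sub>F n in sequentially. of_real (t n) * q \<in> ?S \<and> of_real (t n) * q \<noteq> q" by simp
  qed
  from filterlim_compose[OF lim this] show ?thesis .
qed

lemma nontangential_limit_unique:
  assumes "nontangential_limit u q \<zeta>" "nontangential_limit u q \<zeta>'" "norm q = 1"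
  shows "\<zeta> = \<zeta>'"
proof -
  define t where "t n = 1 - 1 / real (n + 2)" for n
  have t: "t \<longlonglongrightarrow> 1" "0 < t n" "t n < 1" for n unfolding t_def by (real_asymp, simp_all)
  show ?thesis
    using LIMSEQ_unique[OF nontangential_imp_radial[OF assms(1,3) t] nontangential_imp_radial[OF assms(2,3) t]] .
qed

text \<open>The majorant that carries the mean value property over to the radial limits.\<close>

lemma radial_dominating_function:
  assumes F: "F holomorphic_on ball 0 1" and fin: "(\<integral>\<^sup>+ z\<in>ball 0 1. ennreal ((norm (deriv F z))\<^sup>2) \<partial>lborel) < \<infinity>"
  obtains W :: "real \<Rightarrow> ennreal" where "W \<in> borel_measurable borel" "(\<integral>\<^sup>+ y\<in>{0<..<1}. W y \<partial>lborel) < \<infinity>"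
    "\<And>y r. y \<in> {0<..<1} \<Longrightarrow> 1 / 2 \<le> r \<Longrightarrow> r < 1 \<Longrightarrow> ennreal (norm (F (of_real r * exp (2 * of_real pi * \<i> * of_real y)))) \<le> W y"
proof -
  \<comment> \<open>Chosen so that the strip \<open>0 < Im \<zeta> \<le> X\<close> corresponds to
    the ring \<open>1/2 \<le> |z| < 1\<close>.\<close>
  define X where "X = ln 2 / (2 * pi)"
  have X: "0 < X" by (simp add: X_def)
  let ?S = "{\<zeta>. (0 < Re \<zeta> \<and> Re \<zeta> < 1) \<and> 0 < Im \<zeta>}"
  let ?S' = "{\<zeta>. ((0 < Re \<zeta> \<and> Re \<zeta> < 1) \<and> 0 < Im \<zeta>) \<and> Im \<zeta> \<le> X}"
  have oS: "open ?S" by (rule open_half_strip)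
  have S'm[measurable]: "?S' \<in> sets borel"
  proof -
    have "?S' = ?S \<inter> {\<zeta>. Im \<zeta> \<le> X}" by auto
    moreover have "closed {\<zeta>. Im \<zeta> \<le> X}" by (intro closed_Collect_le continuous_intros)
    ultimately show ?thesis using oS by auto
  qed
  define D where "D \<zeta> = ennreal (norm (deriv F (polar_map 0 \<zeta>)) * norm (deriv (polar_map 0) \<zeta>)) * indicator ?S' \<zeta>" for \<zeta>
  define G where "G z = ennreal ((norm (deriv F z))\<^sup>2) * indicator (ball 0 1) z" for z
  have pm: "polar_map 0 \<zeta> \<in> ball 0 1" if "0 < Im \<zeta>" for \<zeta>
    using norm_polar_map[of 0 \<zeta>] that by simp
  have hF': "deriv F holomorphic_on ball 0 1" using F by (simp add: holomorphic_deriv)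
  have cF': "continuous_on {\<zeta>. 0 < Im \<zeta>} (\<lambda>\<zeta>. deriv F (polar_map 0 \<zeta>))"
    by (rule continuous_on_compose2[OF holomorphic_on_imp_continuous_on[OF hF'] holomorphic_on_imp_continuous_on[OF polar_map_holomorphic]])
       (use pm in auto)
  have cp': "continuous_on U (deriv (polar_map 0))" for U
    unfolding deriv_polar_map[abs_def] by (intro continuous_intros)
  have Dm[measurable]: "D \<in> borel_measurable borel"
  proof -
    have "(\<lambda>\<zeta>. indicator ?S' \<zeta> *\<^sub>R (norm (deriv F (polar_map 0 \<zeta>)) * norm (deriv (polar_map 0) \<zeta>))) \<in> borel_measurable borel"
      by (intro borel_measurable_continuous_on_indicator S'm continuous_intros continuous_on_subset[OF cF'] cp') auto
    then have "(\<lambda>\<zeta>. ennreal (indicator ?S' \<zeta> *\<^sub>R (norm (deriv F (polar_map 0 \<zeta>)) * norm (deriv (polar_map 0) \<zeta>)))) \<in> borel_measurable borel" by measurable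
    moreover have "(\<lambda>\<zeta>. ennreal (indicator ?S' \<zeta> *\<^sub>R (norm (deriv F (polar_map 0 \<zeta>)) * norm (deriv (polar_map 0) \<zeta>)))) = D"
      by (auto simp: D_def fun_eq_iff split: split_indicator)
    ultimately show ?thesis by (simp only:)
  qed
  have Gm[measurable]: "G \<in> borel_measurable borel"
  proof -
    have "(\<lambda>z. indicator (ball 0 1) z *\<^sub>R (norm (deriv F z))\<^sup>2) \<in> borel_measurable borel"
      by (intro borel_measurable_continuous_on_indicator continuous_intros holomorphic_on_imp_continuous_on hF') auto
    then have "(\<lambda>z. ennreal (indicator (ball 0 1) z *\<^sub>R (norm (deriv F z))\<^sup>2)) \<in> borel_measurable borel" by measurable
    moreover have "(\<lambda>z. ennreal (indicator (ball 0 1) z *\<^sub>R (norm (deriv F z))\<^sup>2)) = G"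
      by (auto simp: G_def fun_eq_iff split: split_indicator)
    ultimately show ?thesis by (simp only:)
  qed
  have finG: "(\<integral>\<^sup>+ \<zeta>\<in>?S. G (polar_map 0 \<zeta>) * ennreal (4 * pi\<^sup>2 * exp (- 4 * pi * Im \<zeta>)) \<partial>lborel) < \<infinity>"
  proof -
    have "(\<integral>\<^sup>+ z\<in>ball 0 1. G z \<partial>lborel) = (\<integral>\<^sup>+ \<zeta>\<in>?S. G (polar_map 0 \<zeta>) * ennreal (4 * pi\<^sup>2 * exp (- 4 * pi * Im \<zeta>)) \<partial>lborel)"
      using nn_integral_ball_strip[of G 0 0] by simp
    moreover have "(\<integral>\<^sup>+ z\<in>ball 0 1. G z \<partial>lborel) = (\<integral>\<^sup>+ z\<in>ball 0 1. ennreal ((norm (deriv F z))\<^sup>2) \<partial>lborel)"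
      by (rule nn_integral_cong) (simp add: G_def split: split_indicator)
    ultimately show ?thesis using fin by simp
  qed
  have finD: "(\<integral>\<^sup>+ \<zeta>. D \<zeta> \<partial>lborel) < \<infinity>"
  proof -
    have "(\<integral>\<^sup>+ \<zeta>. D \<zeta> \<partial>lborel) \<le> (\<integral>\<^sup>+ \<zeta>. indicator ?S' \<zeta> + G (polar_map 0 \<zeta>) * ennreal (4 * pi\<^sup>2 * exp (- 4 * pi * Im \<zeta>)) * indicator ?S \<zeta> \<partial>lborel)"
    proof (rule nn_integral_mono)
      fix \<zeta>
      show "D \<zeta> \<le> indicator ?S' \<zeta> + G (polar_map 0 \<zeta>) * ennreal (4 * pi\<^sup>2 * exp (- 4 * pi * Im \<zeta>)) * indicator ?S \<zeta>"
      proof (cases "\<zeta> \<in> ?S'")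
        case True
        let ?a = "norm (deriv F (polar_map 0 \<zeta>)) * norm (deriv (polar_map 0) \<zeta>)"
        \<comment> \<open>On a region of finite area square integrability implies
          integrability.\<close>
        have "?a \<le> 1 + ?a\<^sup>2" using sum_squares_bound[of 1 ?a] by (simp add: power2_eq_square) (smt (verit) zero_le_square)
        then have "ennreal ?a \<le> ennreal (1 + ?a\<^sup>2)" by (rule ennreal_leI)
        also have "\<dots> = 1 + ennreal ((norm (deriv F (polar_map 0 \<zeta>)))\<^sup>2) * ennreal (4 * pi\<^sup>2 * exp (- 4 * pi * Im \<zeta>))"
          unfolding norm_deriv_polar_map[of 0, symmetric] by (simp add: power_mult_distrib ennreal_mult[symmetric])
        finally show ?thesis using True pm[of \<zeta>] by (simp add: D_def G_def)
      qed (simp add: D_def)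
    qed
    also have "\<dots> = (\<integral>\<^sup>+ \<zeta>. indicator ?S' \<zeta> \<partial>lborel) + (\<integral>\<^sup>+ \<zeta>. G (polar_map 0 \<zeta>) * ennreal (4 * pi\<^sup>2 * exp (- 4 * pi * Im \<zeta>)) * indicator ?S \<zeta> \<partial>lborel)"
    proof (rule nn_integral_add)
      have [measurable]: "?S \<in> sets borel" using oS by simp
      show "(\<lambda>\<zeta>. G (polar_map 0 \<zeta>) * ennreal (4 * pi\<^sup>2 * exp (- 4 * pi * Im \<zeta>)) * indicator ?S \<zeta>) \<in> borel_measurable lborel" by measurable
    qed simp
    also have "(\<integral>\<^sup>+ \<zeta>. indicator ?S' \<zeta> \<partial>lborel) = emeasure lborel ?S'" by simp
    also have "emeasure lborel ?S' + (\<integral>\<^sup>+ \<zeta>. G (polar_map 0 \<zeta>) * ennreal (4 * pi\<^sup>2 * exp (- 4 * pi * Im \<zeta>)) * indicator ?S \<zeta> \<partial>lborel) < \<infinity>"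
    proof -
      have "?S' \<subseteq> cbox 0 (Complex 1 X)" by (auto simp: cbox_def Basis_complex_def)
      then have "emeasure lborel ?S' < \<infinity>" by (intro emeasure_bounded_finite bounded_subset[OF bounded_cbox])
      then show ?thesis using finG by simp
    qed
    finally show ?thesis .
  qed
  \<comment> \<open>The length of the image of the radius at angle \<open>y\<close>, counted from
    the circle of radius 1/2 outwards.\<close>
  define J where "J y = (\<integral>\<^sup>+ x. D (Complex y x) \<partial>lborel)" for y
  have [measurable]: "(\<lambda>(y, x). Complex y x) \<in> borel_measurable (borel \<Otimes>\<^sub>M borel)"
    unfolding Complex_eq by measurable
  have Jm: "J \<in> borel_measurable borel"
  proof -
    have "(\<lambda>p. D ((\<lambda>(y, x). Complex y x) p)) \<in> borel_measurable (borel \<Otimes>\<^sub>M borel)"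
      by (rule measurable_compose[of _ _ borel]) simp_all
    then have "(\<lambda>(y, x). D (Complex y x)) \<in> borel_measurable (borel \<Otimes>\<^sub>M lborel)"
      by (simp add: case_prod_beta')
    then show ?thesis unfolding J_def by (rule lborel.borel_measurable_nn_integral)
  qed
  have finJ: "(\<integral>\<^sup>+ y. J y \<partial>lborel) < \<infinity>"
    unfolding J_def using finD nn_integral_complex_iterated[OF Dm] by simp
  obtain C where C: "0 \<le> C" "\<And>z. z \<in> sphere 0 (1/2) \<Longrightarrow> norm (F z) \<le> C"
  proof -
    have "continuous_on (sphere 0 (1/2)) F" by (rule continuous_on_subset[OF holomorphic_on_imp_continuous_on[OF F]]) auto
    then have "bounded (F ` sphere 0 (1/2))" using compact_continuous_image compact_imp_bounded compact_sphere by blast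
    then obtain C where "0 < C" "\<And>z. z \<in> sphere 0 (1/2) \<Longrightarrow> norm (F z) \<le> C" by (auto simp: bounded_pos)
    then show ?thesis using that[of C] by simp
  qed
  show ?thesis
  proof (rule that[of "\<lambda>y. ennreal C + J y"])
    show "(\<lambda>y. ennreal C + J y) \<in> borel_measurable borel" using Jm by measurable
    have "(\<integral>\<^sup>+ y\<in>{0<..<1}. (ennreal C + J y) \<partial>lborel) \<le> (\<integral>\<^sup>+ y. ennreal C * indicator {0<..<1} y + J y \<partial>lborel)"
      by (rule nn_integral_mono) (auto split: split_indicator)
    also have "\<dots> = ennreal C + (\<integral>\<^sup>+ y. J y \<partial>lborel)"
      using Jm by (subst nn_integral_add) (auto simp: nn_integral_cmult_indicator)
    also have "\<dots> < \<infinity>" using finJ by simp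
    finally show "(\<integral>\<^sup>+ y\<in>{0<..<1}. (ennreal C + J y) \<partial>lborel) < \<infinity>" .
  next
    fix y r :: real assume y: "y \<in> {0<..<1}" and r: "1 / 2 \<le> r" "r < 1"
    define x where "x = - ln r / (2 * pi)"
    have "ln (1 / 2) \<le> ln r" using r by (subst ln_le_cancel_iff) auto
    then have x: "x \<le> X" unfolding x_def X_def by (intro divide_right_mono) (simp_all add: ln_div)
    have "ln r < 0" using r by simp
    then have x0: "0 < x" unfolding x_def by (intro divide_pos_pos) simp_all
    have ex: "exp (- 2 * pi * x) = r" "exp (- 2 * pi * X) = 1 / 2" using r by (simp_all add: x_def X_def exp_minus)
    let ?E = "\<lambda>s. F (polar_map 0 (Complex y s))"
    let ?E' = "\<lambda>s. \<i> * (deriv F (polar_map 0 (Complex y s)) * deriv (polar_map 0) (Complex y s))"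
    have inS: "Complex y s \<in> ?S'" if "s \<in> {x..X}" for s using that x0 y by auto
    have cC: "continuous_on U (\<lambda>s. Complex y s)" for U unfolding Complex_eq by (intro continuous_intros)
    have "ennreal (norm (?E X - ?E x)) \<le> (\<integral>\<^sup>+ s\<in>{x..X}. ennreal (norm (?E' s)) \<partial>lborel)"
    proof (rule increment_le_nn_integral[OF x])
      fix s assume s: "s \<in> {x..X}"
      have 1: "((\<lambda>s. Complex y s) has_vector_derivative \<i>) (at s within {x..X})"
        unfolding Complex_eq by (auto intro!: derivative_eq_intros simp: has_vector_derivative_def scaleR_conv_of_real)
      have "(polar_map 0 has_field_derivative deriv (polar_map 0) (Complex y s)) (at (Complex y s))"
        by (rule holomorphic_derivI[OF polar_map_holomorphic open_UNIV]) simp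
      moreover have "(F has_field_derivative deriv F (polar_map 0 (Complex y s))) (at (polar_map 0 (Complex y s)))"
        by (rule holomorphic_derivI[OF F open_ball]) (use pm inS[OF s] in auto)
      ultimately have "((\<lambda>\<zeta>. F (polar_map 0 \<zeta>)) has_field_derivative deriv F (polar_map 0 (Complex y s)) * deriv (polar_map 0) (Complex y s)) (at (Complex y s))"
        by (rule DERIV_chain2[rotated])
      from field_vector_diff_chain_within[OF 1 has_field_derivative_at_within[OF this]]
      show "(?E has_vector_derivative ?E' s) (at s within {x..X})" by (simp add: o_def)
    next
      show "continuous_on {x..X} ?E'"
        by (intro continuous_intros continuous_on_compose2[OF cF' cC] continuous_on_compose2[OF cp'[of UNIV] cC]) (use inS in auto)
    qed
    also have "\<dots> \<le> J y"
      unfolding J_def by (rule nn_integral_mono) (use inS in \<open>auto simp: D_def norm_mult split: split_indicator\<close>)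
    finally have inc: "ennreal (norm (?E X - ?E x)) \<le> J y" .
    have "norm (?E x) \<le> norm (?E X) + norm (?E X - ?E x)" using norm_triangle_ineq4[of "?E X" "?E X - ?E x"] by simp
    also have "norm (?E X) \<le> C"
      by (rule C(2)) (use norm_polar_map[of 0 "Complex y X"] ex in simp)
    finally have "ennreal (norm (?E x)) \<le> ennreal (C + norm (?E X - ?E x))" by (intro ennreal_leI) simp
    also have "\<dots> = ennreal C + ennreal (norm (?E X - ?E x))" using C(1) by simp
    also have "\<dots> \<le> ennreal C + J y" using inc by (rule add_left_mono)
    finally show "ennreal (norm (F (of_real r * exp (2 * of_real pi * \<i> * of_real y)))) \<le> ennreal C + J y"
      unfolding polar_map_circle ex by simp
  qed
qed

text \<open>The value at 0 is at most the mean of \<open>|u|\<close> over each circle of radius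
  \<open>r n\<close>. These means tend to 0, with the sum of the majorants of the holomorphic and
  the antiholomorphic part as dominating function.\<close>

lemma harmonic_zero_at_centre:
  assumes u: "plane_harmonic_on u (ball 0 1)" "plane_energy (ball 0 1) u < \<infinity>"
    and lim: "AE t in lborel. nontangential_limit u (cis t) 0"
  shows "u 0 = 0"
proof -
  obtain F G where F: "F holomorphic_on ball 0 1" and G: "G holomorphic_on ball 0 1"
    and uFG: "\<And>z. z \<in> ball 0 1 \<Longrightarrow> u z = F z + cnj (G z)"
    using plane_harmonic_decompose[OF open_ball convex_ball u(1)] by blast
  have ed: "energy_density u z = (norm (deriv F z))\<^sup>2 + (norm (deriv G z))\<^sup>2" if "z \<in> ball 0 1" for z
    unfolding energy_density_def using hol_antihol_derivatives(4,5)[OF open_ball F G uFG that] by simp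
  have finF: "(\<integral>\<^sup>+ z\<in>ball 0 1. ennreal ((norm (deriv F z))\<^sup>2) \<partial>lborel) < \<infinity>"
  proof (rule le_less_trans[OF _ u(2)], unfold plane_energy_def, rule nn_integral_mono)
    fix z show "ennreal ((norm (deriv F z))\<^sup>2) * indicator (ball 0 1) z \<le> ennreal (energy_density u z) * indicator (ball 0 1) z"
      by (cases "z \<in> ball 0 1") (simp_all add: ed ennreal_leI)
  qed
  have finG: "(\<integral>\<^sup>+ z\<in>ball 0 1. ennreal ((norm (deriv G z))\<^sup>2) \<partial>lborel) < \<infinity>"
  proof (rule le_less_trans[OF _ u(2)], unfold plane_energy_def, rule nn_integral_mono)
    fix z show "ennreal ((norm (deriv G z))\<^sup>2) * indicator (ball 0 1) z \<le> ennreal (energy_density u z) * indicator (ball 0 1) z"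
      by (cases "z \<in> ball 0 1") (simp_all add: ed ennreal_leI)
  qed
  obtain WF :: "real \<Rightarrow> ennreal" where [measurable]: "WF \<in> borel_measurable borel"
    and WF: "(\<integral>\<^sup>+ y\<in>{0<..<1}. WF y \<partial>lborel) < \<infinity>"
      "\<And>y r. y \<in> {0<..<1} \<Longrightarrow> 1 / 2 \<le> r \<Longrightarrow> r < 1 \<Longrightarrow> ennreal (norm (F (of_real r * exp (2 * of_real pi * \<i> * of_real y)))) \<le> WF y"
    by (rule radial_dominating_function[OF F finF]) (rule that; assumption)
  obtain WG :: "real \<Rightarrow> ennreal" where [measurable]: "WG \<in> borel_measurable borel"
    and WG: "(\<integral>\<^sup>+ y\<in>{0<..<1}. WG y \<partial>lborel) < \<infinity>"
      "\<And>y r. y \<in> {0<..<1} \<Longrightarrow> 1 / 2 \<le> r \<Longrightarrow> r < 1 \<Longrightarrow> ennreal (norm (G (of_real r * exp (2 * of_real pi * \<i> * of_real y)))) \<le> WG y"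
    by (rule radial_dominating_function[OF G finG]) (rule that; assumption)
  define r where "r n = 1 - 1 / real (n + 2)" for n
  have r: "r \<longlonglongrightarrow> 1" "1 / 2 \<le> r n" "0 < r n" "r n < 1" for n
    unfolding r_def by (real_asymp, simp_all add: field_simps)
  let ?e = "\<lambda>y::real. exp (2 * of_real pi * \<i> * of_real y) :: complex"
  have inb: "of_real (r n) * ?e y \<in> ball 0 1" for n y using r(3,4)[of n] by (simp add: norm_mult)
  have cu: "continuous_on (ball 0 1) u"
    using u(1) by (auto simp: plane_harmonic_on_def C1_on_def intro!: differentiable_imp_continuous_on simp: differentiable_on_def differentiable_at_withinI)
  have cuy: "continuous_on U (\<lambda>y. u (of_real (r n) * ?e y))" for n U
    by (rule continuous_on_compose2[OF cu]) (use inb in \<open>auto intro!: continuous_intros\<close>)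
  have mean: "((\<lambda>y. u (of_real (r n) * ?e y)) has_integral u 0) {0..1}" for n
  proof -
    have "((\<lambda>y. F (0 + of_real (r n) * ?e y)) has_integral F 0) {0..1}" "((\<lambda>y. G (0 + of_real (r n) * ?e y)) has_integral G 0) {0..1}"
      by (rule circle_mean[OF F r(3,4)], rule circle_mean[OF G r(3,4)])
    then have "((\<lambda>y. F (of_real (r n) * ?e y) + cnj (G (of_real (r n) * ?e y))) has_integral F 0 + cnj (G 0)) {0..1}"
      by (intro has_integral_add) (auto dest: has_integral_linear[OF _ bounded_linear_cnj] simp: o_def)
    then show ?thesis using uFG[OF inb] uFG[of 0] by simp
  qed
  have bound: "ennreal (norm (u 0)) \<le> (\<integral>\<^sup>+ y. ennreal (norm (u (of_real (r n) * ?e y))) * indicator {0<..<1} y \<partial>lborel)" for n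
  proof -
    have "norm (u 0) = norm (integral {0..1} (\<lambda>y. u (of_real (r n) * ?e y)))" using integral_unique[OF mean] by simp
    also have "\<dots> \<le> integral {0..1} (\<lambda>y. norm (u (of_real (r n) * ?e y)))"
      by (rule integral_norm_bound_integral) (auto intro!: integrable_continuous_interval continuous_intros cuy)
    finally have "ennreal (norm (u 0)) \<le> ennreal (integral {0..1} (\<lambda>y. norm (u (of_real (r n) * ?e y))))" by (rule ennreal_leI)
    also have "\<dots> = (\<integral>\<^sup>+ y. ennreal (norm (u (of_real (r n) * ?e y))) * indicator {0..1} y \<partial>lborel)"
      by (rule nn_integral_has_integral_lebesgue'[symmetric])
         (auto intro!: integrable_integral integrable_continuous_interval continuous_intros cuy)
    also have "\<dots> = (\<integral>\<^sup>+ y. ennreal (norm (u (of_real (r n) * ?e y))) * indicator {0<..<1} y \<partial>lborel)"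
    proof (rule nn_integral_cong_AE)
      have "AE y in lborel. y \<noteq> (0::real)" "AE y in lborel. y \<noteq> (1::real)" by (rule AE_lborel_singleton)+
      then show "AE y in lborel. ennreal (norm (u (of_real (r n) * ?e y))) * indicator {0..1} y = ennreal (norm (u (of_real (r n) * ?e y))) * indicator {0<..<1} y"
        by eventually_elim (auto split: split_indicator)
    qed
    finally show ?thesis .
  qed
  have "(\<lambda>n. \<integral>\<^sup>+ y. ennreal (norm (u (of_real (r n) * ?e y))) * indicator {0<..<1} y \<partial>lborel) \<longlonglongrightarrow> (\<integral>\<^sup>+ y. 0 \<partial>(lborel :: real measure))"
  proof (rule nn_integral_dominated_convergence[where w = "\<lambda>y. (WF y + WG y) * indicator {0<..<1} y"])
    show "(\<lambda>y. ennreal (norm (u (of_real (r n) * ?e y))) * indicator {0<..<1} y) \<in> borel_measurable lborel" for n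
    proof -
      have "(\<lambda>y. u (of_real (r n) * ?e y)) \<in> borel_measurable borel" by (intro borel_measurable_continuous_onI cuy)
      then show ?thesis by measurable
    qed
    show "AE y in lborel. ennreal (norm (u (of_real (r n) * ?e y))) * indicator {0<..<1} y \<le> (WF y + WG y) * indicator {0<..<1} y" for n
    proof (rule AE_I2)
      fix y :: real
      show "ennreal (norm (u (of_real (r n) * ?e y))) * indicator {0<..<1} y \<le> (WF y + WG y) * indicator {0<..<1} y"
      proof (cases "y \<in> {0<..<1}")
        case True
        have "norm (u (of_real (r n) * ?e y)) \<le> norm (F (of_real (r n) * ?e y)) + norm (G (of_real (r n) * ?e y))"
          unfolding uFG[OF inb] using norm_triangle_ineq[of "F (of_real (r n) * ?e y)" "cnj (G (of_real (r n) * ?e y))"] by simp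
        then have "ennreal (norm (u (of_real (r n) * ?e y))) \<le> ennreal (norm (F (of_real (r n) * ?e y)) + norm (G (of_real (r n) * ?e y)))" by (rule ennreal_leI)
        also have "\<dots> \<le> WF y + WG y" using add_mono[OF WF(2)[OF True r(2,4)] WG(2)[OF True r(2,4)]] by simp
        finally show ?thesis using True by simp
      qed simp
    qed
    have "(\<integral>\<^sup>+ y. (WF y + WG y) * indicator {0<..<1} y \<partial>lborel) = (\<integral>\<^sup>+ y\<in>{0<..<1}. WF y \<partial>lborel) + (\<integral>\<^sup>+ y\<in>{0<..<1}. WG y \<partial>lborel)"
      by (simp add: distrib_right nn_integral_add)
    then show "(\<integral>\<^sup>+ y. (WF y + WG y) * indicator {0<..<1} y \<partial>lborel) < \<infinity>" using WF(1) WG(1) by simp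
    \<comment> \<open>The circle means run over full turns and the hypothesis over angles; scaling
      by \<open>2 * pi\<close> preserves null sets.\<close>
    have "AE y in lborel. nontangential_limit u (?e y) 0"
    proof -
      obtain N where N: "{t. \<not> nontangential_limit u (cis t) 0} \<subseteq> N" "N \<in> sets lborel" "emeasure lborel N = 0"
        using lim unfolding eventually_ae_filter null_sets_def by auto
      have "emeasure lborel ((\<lambda>y. 0 + (2 * pi) * y) -` N) = 0"
      proof -
        have "emeasure lborel N = (\<integral>\<^sup>+ t. indicator N t \<partial>lborel)" using N by simp
        also have "\<dots> = \<bar>2 * pi\<bar> * (\<integral>\<^sup>+ y. indicator N (0 + (2 * pi) * y) \<partial>lborel)"
          by (rule nn_integral_real_affine) (use N(2) in auto)
        also have "(\<integral>\<^sup>+ y. indicator N (0 + (2 * pi) * y) \<partial>lborel) = (\<integral>\<^sup>+ y. indicator ((\<lambda>y. 0 + (2 * pi) * y) -` N) y \<partial>lborel)"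
          by (rule nn_integral_cong) (auto split: split_indicator)
        also have "\<dots> = emeasure lborel ((\<lambda>y. 0 + (2 * pi) * y) -` N)"
          using measurable_sets[of "\<lambda>y. 0 + (2 * pi) * y" borel borel N] N(2) by (intro nn_integral_indicator) simp
        finally show ?thesis using N(3) by simp
      qed
      moreover have "(\<lambda>y. 0 + (2 * pi) * y) -` N \<in> sets lborel"
        using measurable_sets[of "\<lambda>y. 0 + (2 * pi) * y" borel borel N] N(2) by simp
      moreover have "?e y = cis (2 * pi * y)" for y by (simp add: cis_conv_exp mult_ac)
      ultimately show ?thesis using N(1) by (intro AE_I[of _ _ "(\<lambda>y. 0 + (2 * pi) * y) -` N"]) auto
    qed
    then show "AE y in lborel. (\<lambda>n. ennreal (norm (u (of_real (r n) * ?e y))) * indicator {0<..<1} y) \<longlonglongrightarrow> 0"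
    proof eventually_elim
      case (elim y)
      have "(\<lambda>n. u (of_real (r n) * ?e y)) \<longlonglongrightarrow> 0"
        by (rule nontangential_imp_radial[OF elim _ r(1,3,4)]) simp
      then have "(\<lambda>n. ennreal (norm (u (of_real (r n) * ?e y)))) \<longlonglongrightarrow> ennreal 0"
        by (intro tendsto_ennrealI tendsto_norm_zero)
      then show ?case by (cases "y \<in> {0<..<1}") simp_all
    qed
  qed measurable
  then have "(\<lambda>n. \<integral>\<^sup>+ y. ennreal (norm (u (of_real (r n) * ?e y))) * indicator {0<..<1} y \<partial>lborel) \<longlonglongrightarrow> 0" by simp
  then have "ennreal (norm (u 0)) \<le> 0" by (rule LIMSEQ_le_const) (use bound in auto)
  then show ?thesis by simp
qed

text \<open>The automorphism sending 0 to \<open>z\<close> carries finite energy, non-tangential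
  limits and polar sets along, which leaves the value at the centre.\<close>

lemma harmonic_zero_of_boundary:
  assumes u: "plane_harmonic_on u (ball 0 1)" "plane_energy (ball 0 1) u < \<infinity>"
    and E: "polar_set E1" "E1 \<in> sets borel" "polar_set E2" "E2 \<in> sets borel"
    and lim: "\<And>q. q \<in> sphere 0 1 \<Longrightarrow> q \<notin> E1 \<Longrightarrow> q \<notin> E2 \<Longrightarrow> nontangential_limit u q 0"
    and z: "z \<in> ball 0 1"
  shows "u z = 0"
proof -
  interpret disc_automorphism 1 "- z" using z by unfold_locales auto
  let ?T = "disc_aut 1 (- z)"
  have im: "?T ` ball 0 1 \<subseteq> ball 0 1" using norm_less by auto
  have oT: "open (?T ` ball 0 1)" by (rule open_mapping_thm3[OF holomorphic open_ball inj_ball])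
  have h: "plane_harmonic_on (\<lambda>w. u (?T w)) (ball 0 1)"
    by (rule plane_harmonic_compose(1)[OF open_ball u(1) open_ball holomorphic im])
  have "plane_energy (ball 0 1) (\<lambda>w. u (?T w)) < \<infinity>"
  proof -
    let ?F = "\<lambda>z. ennreal (energy_density u z) * indicator (ball 0 1) z"
    have "plane_energy (ball 0 1) (\<lambda>w. u (?T w)) = (\<integral>\<^sup>+ w\<in>ball 0 1. ?F (?T w) * ennreal ((cmod (deriv ?T w))\<^sup>2) \<partial>lborel)"
      unfolding plane_energy_def
    proof (rule nn_integral_cong)
      fix w
      show "ennreal (energy_density (\<lambda>w. u (?T w)) w) * indicator (ball 0 1) w = ?F (?T w) * ennreal ((cmod (deriv ?T w))\<^sup>2) * indicator (ball 0 1) w"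
      proof (cases "w \<in> ball 0 1")
        case True
        then have "?T w \<in> ball 0 1" using im by blast
        then show ?thesis using True
          by (simp add: energy_density_compose[OF open_ball u(1) open_ball holomorphic im True] ennreal_mult energy_density_nonneg)
      qed simp
    qed
    also have "\<dots> = (\<integral>\<^sup>+ w\<in>?T ` ball 0 1. ?F w \<partial>lborel)"
      by (rule nn_integral_conformal[OF holomorphic open_ball inj_ball measurable_energy_density[OF open_ball u(1)], symmetric])
    also have "\<dots> \<le> plane_energy (ball 0 1) u"
      unfolding plane_energy_def by (rule nn_integral_mono) (auto split: split_indicator)
    finally show ?thesis using u(2) by simp
  qed
  moreover have "AE t in lborel. nontangential_limit (\<lambda>w. u (?T w)) (cis t) 0"
  proof -
    have mT: "{q \<in> sphere 0 1. ?T q \<in> X} \<in> sets borel" if "X \<in> sets borel" for X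
    proof -
      have "(\<lambda>q. if q \<in> sphere 0 1 then ?T q else 0) \<in> borel_measurable borel"
        by (rule borel_measurable_continuous_on_if) (auto intro: continuous_on_subset[OF continuous])
      from measurable_sets[OF this that]
      have "(\<lambda>q. if q \<in> sphere 0 1 then ?T q else 0) -` X \<inter> sphere 0 1 \<in> sets borel" by auto
      moreover have "(\<lambda>q. if q \<in> sphere 0 1 then ?T q else 0) -` X \<inter> sphere 0 1 = {q \<in> sphere 0 1. ?T q \<in> X}" by auto
      ultimately show ?thesis by simp
    qed
    \<comment> \<open>The two exceptional sets are kept apart and combined only as null sets of
      angles.\<close>
    have "AE t in lborel. cis t \<notin> {q \<in> sphere 0 1. ?T q \<in> E1}" "AE t in lborel. cis t \<notin> {q \<in> sphere 0 1. ?T q \<in> E2}"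
      by (intro polar_set_arc_null polar_set_pullback E mT)+
    then show ?thesis
    proof eventually_elim
      case (elim t)
      show ?case
        by (rule nontangential_limit_compose[OF lim]) (use elim norm_eq[of "cis t"] in auto)
    qed
  qed
  ultimately have "u (?T 0) = 0" by (rule harmonic_zero_at_centre[OF h])
  then show ?thesis by (simp add: disc_aut_def)
qed

subsection \<open>Extension from an annulus to the disc\<close>

definition circ :: "real \<Rightarrow> real \<Rightarrow> complex" where
  "circ R t = of_real R * exp (2 * of_real pi * \<i> * of_real t)"

lemma norm_circ [simp]: "norm (circ R t) = \<bar>R\<bar>"
  by (simp add: circ_def norm_mult)

lemma continuous_on_circ [continuous_intros]: "continuous_on S (circ R)"
  unfolding circ_def by (intro continuous_intros)

lemma contour_integral_circ:
  "contour_integral (circlepath 0 R) g = 2 * of_real pi * \<i> * integral {0..1} (\<lambda>t. g (circ R t) * circ R t)"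
proof -
  have "contour_integral (circlepath 0 R) g = integral {0..1} (\<lambda>t. (2 * of_real pi * \<i>) * (g (circ R t) * circ R t))"
    unfolding contour_integral_integral vector_derivative_circlepath
    by (intro integral_cong) (simp add: circlepath circ_def mult_ac)
  then show ?thesis by simp
qed

text \<open>The difference quotient at \<open>z\<close> extends holomorphically over
  \<open>z\<close>, so its integrals over the two homotopic circles agree. The Cauchy kernel
  integrates to 1 over the outer circle and to 0 over the inner one.\<close>

lemma circ_annulus_decomposition:
  assumes \<phi>: "\<phi> holomorphic_on {z. r < norm z \<and> norm z < 1}"
    and s: "0 < r" "r < s" "s < norm z" "norm z < s'" "s' < 1"
  shows "\<phi> z = integral {0..1} (\<lambda>t. \<phi> (circ s' t) * circ s' t / (circ s' t - z))
      - integral {0..1} (\<lambda>t. \<phi> (circ s t) * circ s t / (circ s t - z))"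
proof -
  let ?A = "{z. r < norm z \<and> norm z < 1}"
  have oA: "open ?A" by (intro open_Collect_conj open_Collect_less continuous_intros)
  define g where "g w = (if w = z then deriv \<phi> z else (\<phi> w - \<phi> z) / (w - z))" for w
  have g: "g holomorphic_on ?A" unfolding g_def by (rule pole_lemma_open[OF \<phi> oA])
  have hom: "homotopic_loops ?A (circlepath 0 s) (circlepath 0 s')"
  proof (rule homotopic_loops_linear)
    fix t :: real
    show "closed_segment (circlepath 0 s t) (circlepath 0 s' t) \<subseteq> ?A"
    proof
      fix x assume "x \<in> closed_segment (circlepath 0 s t) (circlepath 0 s' t)"
      then obtain u where u: "0 \<le> u" "u \<le> 1" "x = (1 - u) *\<^sub>R circlepath 0 s t + u *\<^sub>R circlepath 0 s' t"
        by (auto simp: in_segment)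
      have "x = of_real ((1 - u) * s + u * s') * exp (2 * of_real pi * \<i> * of_real t)"
        unfolding u(3) by (simp add: circlepath scaleR_conv_of_real algebra_simps)
      then have "norm x = \<bar>(1 - u) * s + u * s'\<bar>" by (simp only: norm_mult norm_of_real) simp
      moreover have "(1 - u) * s + u * s' = s + u * (s' - s)" by (simp add: algebra_simps)
      moreover have "0 \<le> u * (s' - s)" using u s by simp
      moreover have "u * (s' - s) \<le> s' - s" using mult_right_mono[OF u(2), of "s' - s"] s by (simp only: mult_1)
      ultimately have "norm x \<le> s'" "s \<le> norm x" using s by linarith+
      then show "x \<in> ?A" using s by simp
    qed
  qed auto
  have eq: "contour_integral (circlepath 0 s) g = contour_integral (circlepath 0 s') g"
    by (rule Cauchy_theorem_homotopic_loops[OF hom oA g]) auto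
  have circA: "circ R t \<in> ?A" "circ R t \<noteq> z" if "R \<in> {s, s'}" for R t
    using that s by auto
  have split: "integral {0..1} (\<lambda>t. g (circ R t) * circ R t) =
      integral {0..1} (\<lambda>t. \<phi> (circ R t) * circ R t / (circ R t - z)) - \<phi> z * integral {0..1} (\<lambda>t. circ R t / (circ R t - z))"
    if R: "R \<in> {s, s'}" for R
  proof -
    have c1: "continuous_on {0..1} (\<lambda>t. \<phi> (circ R t))"
      by (rule continuous_on_compose2[OF holomorphic_on_imp_continuous_on[OF \<phi>] continuous_on_circ]) (use circA[OF R] in auto)
    have "(\<lambda>t. \<phi> (circ R t) * circ R t / (circ R t - z)) integrable_on {0..1}" "(\<lambda>t. circ R t / (circ R t - z)) integrable_on {0..1}"
      using circA[OF R] by (auto intro!: integrable_continuous_interval continuous_intros c1)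
    from integral_diff[OF this(1) integrable_on_mult_right[OF this(2), of "\<phi> z"]]
    have "integral {0..1} (\<lambda>t. \<phi> (circ R t) * circ R t / (circ R t - z) - \<phi> z * (circ R t / (circ R t - z))) =
       integral {0..1} (\<lambda>t. \<phi> (circ R t) * circ R t / (circ R t - z)) - \<phi> z * integral {0..1} (\<lambda>t. circ R t / (circ R t - z))"
      by (simp only: integral_mult_right)
    moreover have "integral {0..1} (\<lambda>t. g (circ R t) * circ R t) = integral {0..1} (\<lambda>t. \<phi> (circ R t) * circ R t / (circ R t - z) - \<phi> z * (circ R t / (circ R t - z)))"
      by (rule integral_cong) (use circA[OF R] in \<open>simp add: g_def diff_divide_distrib left_diff_distrib\<close>)
    ultimately show ?thesis by simp
  qed
  have one: "integral {0..1} (\<lambda>t. circ s' t / (circ s' t - z)) = 1"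
  proof -
    have "((\<lambda>u. 1 / (u - z)) has_contour_integral (2 * of_real pi * \<i> * 1)) (circlepath 0 s')"
      by (rule Cauchy_integral_circlepath_simple) (use s in auto)
    then have "contour_integral (circlepath 0 s') (\<lambda>u. 1 / (u - z)) = 2 * of_real pi * \<i>" by (simp add: contour_integral_unique)
    then show ?thesis unfolding contour_integral_circ by simp
  qed
  have zero: "integral {0..1} (\<lambda>t. circ s t / (circ s t - z)) = 0"
  proof -
    have "((\<lambda>u. 1 / (u - z)) has_contour_integral 0) (circlepath 0 s)"
      by (rule Cauchy_theorem_disc_simple[of _ 0 "norm z"])
         (use s in \<open>auto intro!: holomorphic_intros simp: path_image_circlepath_nonneg\<close>)
    then have "contour_integral (circlepath 0 s) (\<lambda>u. 1 / (u - z)) = 0" by (simp add: contour_integral_unique)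
    then show ?thesis unfolding contour_integral_circ by simp
  qed
  show ?thesis using eq split[of s] split[of s'] one zero unfolding contour_integral_circ by simp
qed

text \<open>The nonnegative Laurent part \<open>p\<close>, the residue \<open>\<kappa>\<close> and
  the remaining principal part \<open>\<eta>\<close> in the variable \<open>1 / z\<close>. The
  residue is listed separately because it alone has no single-valued primitive; \<open>K\<close> and
  \<open>s\<close> depend on \<open>r\<close> only.\<close>

lemma annulus_splitting:
  assumes r: "0 < r" "r < 1"
  obtains K s where "0 \<le> K" "r < s" "s < 1"
    "\<And>\<phi> N. \<lbrakk>\<phi> holomorphic_on {z. r < norm z \<and> norm z < 1}; 0 \<le> N;
        (\<integral>\<^sup>+ z\<in>{z. r < norm z \<and> norm z < 1}. ennreal ((norm (\<phi> z))\<^sup>2) \<partial>lborel) \<le> ennreal N\<rbrakk> \<Longrightarrow>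
      \<exists>p \<kappa> \<eta>. p holomorphic_on ball 0 1 \<and> \<eta> holomorphic_on ball 0 (1 / s) \<and>
        (\<forall>z. s < norm z \<longrightarrow> norm z < 1 \<longrightarrow> \<phi> z = p z + \<kappa> / z + \<eta> (1 / z) / z\<^sup>2) \<and>
        (\<forall>z\<in>ball 0 1. (norm (p z))\<^sup>2 \<le> K * (if r < norm z then (norm (\<phi> z))\<^sup>2 else 0) + K * N) \<and>
        (\<forall>\<zeta>\<in>cball 0 1. (norm (\<eta> \<zeta>))\<^sup>2 \<le> K * N)"
proof -
  \<comment> \<open>Four equal steps from \<open>r\<close> to 1: discs of radius \<open>m\<close>
    about points between the circles \<open>s\<close> and \<open>s'\<close> stay in the annulus, and
    the middle radius \<open>\<sigma>\<close> keeps a distance from both circles.\<close>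
  define m where "m = (1 - r) / 4"
  define s where "s = r + m"
  define \<sigma> where "\<sigma> = r + 2 * m"
  define s' where "s' = r + 3 * m"
  have m: "0 < m" "r + 4 * m = 1" using r by (simp_all add: m_def field_simps)
  have ss: "0 < s" "r < s" "s < \<sigma>" "\<sigma> < s'" "s' < 1" "s < 1" "\<sigma> < 1" using m r by (auto simp: s_def \<sigma>_def s'_def)
  let ?A = "{z::complex. r < norm z \<and> norm z < 1}"
  define k where "k = 1 / (area_mean_const * m\<^sup>2)"
  have k: "0 < k" using area_mean_const_pos m by (simp add: k_def)
  define c1 where "c1 = s' / (s' - \<sigma>)"
  define c3 where "c3 = s\<^sup>2 / (1 - s)"
  \<comment> \<open>One summand for each estimate below: twice \<open>|\<phi>|^2\<close>,
    \<open>p\<close> inside the middle circle, the principal part outside it, and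
    \<open>\<eta>\<close> on the closed unit disc.\<close>
  define K where "K = 2 + k * (c1\<^sup>2 + 2 * (1 + 1 / (1 - s / \<sigma>))\<^sup>2 + c3\<^sup>2)"
  have d: "0 < 1 - s / \<sigma>" using ss by (simp add: field_simps)
  have K0: "0 \<le> K" "2 \<le> K" "k * c1\<^sup>2 \<le> K" "2 * k * (1 + 1 / (1 - s / \<sigma>))\<^sup>2 \<le> K" "k * c3\<^sup>2 \<le> K"
    using k by (auto simp: K_def distrib_left intro!: add_nonneg_nonneg)
  show ?thesis
  proof (rule that[OF K0(1) ss(2,6)])
    fix \<phi> :: "complex \<Rightarrow> complex" and N :: real
    assume \<phi>: "\<phi> holomorphic_on ?A" and N: "0 \<le> N" "(\<integral>\<^sup>+ z\<in>?A. ennreal ((norm (\<phi> z))\<^sup>2) \<partial>lborel) \<le> ennreal N"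
    define B where "B = sqrt (k * N)"
    have B: "0 \<le> B" "B\<^sup>2 = k * N" using k N by (simp_all add: B_def)
    \<comment> \<open>The area mean inequality for the holomorphic function \<open>\<phi>^2\<close>
      on a disc of radius \<open>m\<close>.\<close>
    have bound: "norm (\<phi> w) \<le> B" if w: "s \<le> norm w" "norm w \<le> s'" for w
    proof -
      have sub: "ball w m \<subseteq> ?A"
      proof
        fix z assume "z \<in> ball w m"
        then have "norm (w - z) < m" by (simp add: dist_norm)
        then show "z \<in> ?A" using w m norm_triangle_ineq2[of w z] norm_triangle_ineq2[of z w]
          by (auto simp: s_def s'_def norm_minus_commute)
      qed
      have "(\<lambda>z. (\<phi> z)\<^sup>2) holomorphic_on ball w m" using \<phi> sub by (intro holomorphic_intros) (rule holomorphic_on_subset)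
      from area_mean_bound[OF this m(1)]
      have "ennreal (area_mean_const * m\<^sup>2 * (norm (\<phi> w))\<^sup>2) \<le> (\<integral>\<^sup>+ z\<in>ball w m. ennreal ((norm (\<phi> z))\<^sup>2) \<partial>lborel)"
        by (simp add: norm_power)
      also have "\<dots> \<le> (\<integral>\<^sup>+ z\<in>?A. ennreal ((norm (\<phi> z))\<^sup>2) \<partial>lborel)"
        by (rule nn_integral_mono) (use sub in \<open>auto split: split_indicator\<close>)
      also note N(2)
      finally have "area_mean_const * m\<^sup>2 * (norm (\<phi> w))\<^sup>2 \<le> N" using N(1) by simp
      then have "(norm (\<phi> w))\<^sup>2 \<le> k * N" using area_mean_const_pos m by (simp add: k_def field_simps)
      then show ?thesis unfolding B_def by (rule real_le_rsqrt)
    qed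
    have cphi: "continuous_on S (\<lambda>t. \<phi> (circ R t))" if "R \<in> {s, s'}" for R S
      by (rule continuous_on_compose2[OF holomorphic_on_imp_continuous_on[OF \<phi>] continuous_on_circ]) (use that ss r in auto)
    \<comment> \<open>The Cauchy integral over the outer circle. Its partners \<open>\<eta>\<close>
      and \<open>\<kappa>\<close> come from the inner circle, whose kernel is expanded by one term
      of the geometric series in \<open>circ s t / z\<close>.\<close>
    define p0 where "p0 z = integral {0..1} (\<lambda>t. \<phi> (circ s' t) * circ s' t / (circ s' t - z))" for z
    define \<eta> where "\<eta> \<zeta> = integral {0..1} (\<lambda>t. \<phi> (circ s t) * (circ s t)\<^sup>2 / (1 - \<zeta> * circ s t))" for \<zeta>
    define \<kappa> where "\<kappa> = integral {0..1} (\<lambda>t. \<phi> (circ s t) * circ s t)"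
    have p0nz: "circ s' t - z \<noteq> 0" if "norm z < s'" for z t using that ss by auto
    have chinz: "norm (1 - \<zeta> * circ s t) \<ge> 1 - norm \<zeta> * s" for \<zeta> t
      using norm_triangle_ineq2[of 1 "\<zeta> * circ s t"] ss by (simp add: norm_mult)
    have zs: "norm \<zeta> * s < 1" if "norm \<zeta> < 1 / s" for \<zeta> :: complex
      using that ss by (simp add: field_simps)
    have chinz': "1 - \<zeta> * circ s t \<noteq> 0" if "norm \<zeta> < 1 / s" for \<zeta> t
      using chinz[of \<zeta> t] zs[OF that] by auto
    have hp0: "p0 holomorphic_on ball 0 s'"
    proof -
      have "(\<lambda>x. integral (cbox 0 1) ((\<lambda>z t. \<phi> (circ s' t) * circ s' t / (circ s' t - z)) x)) holomorphic_on ball 0 s'"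
      proof (rule leibniz_rule_holomorphic[where fx = "\<lambda>z t. \<phi> (circ s' t) * circ s' t / (circ s' t - z)\<^sup>2"])
        fix x :: complex and t :: real assume x: "x \<in> ball 0 s'"
        show "((\<lambda>z. \<phi> (circ s' t) * circ s' t / (circ s' t - z)) has_field_derivative \<phi> (circ s' t) * circ s' t / (circ s' t - x)\<^sup>2) (at x within ball 0 s')"
          using p0nz[of x t] x by (auto intro!: derivative_eq_intros simp: power2_eq_square)
      next
        fix x :: complex assume x: "x \<in> ball 0 s'"
        show "(\<lambda>t. \<phi> (circ s' t) * circ s' t / (circ s' t - x)) integrable_on cbox 0 1"
          using p0nz[of x] x by (intro integrable_continuous continuous_intros cphi) auto
      next
        have "continuous_on (ball 0 s' \<times> cbox 0 1) (\<lambda>p. \<phi> (circ s' (snd p)) * circ s' (snd p) / (circ s' (snd p) - fst p)\<^sup>2)"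
          using p0nz
          by (intro continuous_intros continuous_on_compose2[OF cphi[of s' UNIV]] continuous_on_compose2[OF continuous_on_circ[of UNIV]]) auto
        then show "continuous_on (ball 0 s' \<times> cbox 0 1) (\<lambda>(z, t). \<phi> (circ s' t) * circ s' t / (circ s' t - z)\<^sup>2)"
          by (simp add: case_prod_beta')
      qed auto
      then show ?thesis unfolding p0_def by simp
    qed
    have h\<eta>: "\<eta> holomorphic_on ball 0 (1 / s)"
    proof -
      have "(\<lambda>x. integral (cbox 0 1) ((\<lambda>\<zeta> t. \<phi> (circ s t) * (circ s t)\<^sup>2 / (1 - \<zeta> * circ s t)) x)) holomorphic_on ball 0 (1 / s)"
      proof (rule leibniz_rule_holomorphic[where fx = "\<lambda>\<zeta> t. \<phi> (circ s t) * (circ s t)\<^sup>2 * circ s t / (1 - \<zeta> * circ s t)\<^sup>2"])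
        fix x :: complex and t :: real assume x: "x \<in> ball 0 (1 / s)"
        show "((\<lambda>\<zeta>. \<phi> (circ s t) * (circ s t)\<^sup>2 / (1 - \<zeta> * circ s t)) has_field_derivative \<phi> (circ s t) * (circ s t)\<^sup>2 * circ s t / (1 - x * circ s t)\<^sup>2) (at x within ball 0 (1 / s))"
          using chinz'[of x t] x by (auto intro!: derivative_eq_intros simp: power2_eq_square)
      next
        fix x :: complex assume x: "x \<in> ball 0 (1 / s)"
        show "(\<lambda>t. \<phi> (circ s t) * (circ s t)\<^sup>2 / (1 - x * circ s t)) integrable_on cbox 0 1"
          using chinz'[of x] x by (intro integrable_continuous continuous_intros cphi) auto
      next
        have "continuous_on (ball 0 (1 / s) \<times> cbox 0 1) (\<lambda>p. \<phi> (circ s (snd p)) * (circ s (snd p))\<^sup>2 * circ s (snd p) / (1 - fst p * circ s (snd p))\<^sup>2)"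
          using chinz'
          by (intro continuous_intros continuous_on_compose2[OF cphi[of s UNIV]] continuous_on_compose2[OF continuous_on_circ[of UNIV]]) auto
        then show "continuous_on (ball 0 (1 / s) \<times> cbox 0 1) (\<lambda>(\<zeta>, t). \<phi> (circ s t) * (circ s t)\<^sup>2 * circ s t / (1 - \<zeta> * circ s t)\<^sup>2)"
          by (simp add: case_prod_beta')
      qed auto
      then show ?thesis unfolding \<eta>_def by simp
    qed
    have ib: "norm (integral {0..1} f) \<le> C" if "continuous_on {0..1} f" "\<And>t. t \<in> {0..1} \<Longrightarrow> norm (f t) \<le> C" for f :: "real \<Rightarrow> complex" and C
      using integral_bound[of 0 1 f C] that by simp
    have \<eta>_bound: "norm (\<eta> \<zeta>) \<le> B * s\<^sup>2 / (1 - \<rho> * s)" if \<zeta>: "norm \<zeta> \<le> \<rho>" "\<rho> * s < 1" for \<zeta> \<rho>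
    proof -
      have \<rho>s: "norm \<zeta> * s \<le> \<rho> * s" using \<zeta>(1) ss by (intro mult_right_mono) auto
      then have "norm \<zeta> * s < 1" using \<zeta>(2) by linarith
      then have z1: "norm \<zeta> < 1 / s" using ss by (simp add: pos_less_divide_eq)
      show ?thesis unfolding \<eta>_def
      proof (rule ib)
        show "continuous_on {0..1} (\<lambda>t. \<phi> (circ s t) * (circ s t)\<^sup>2 / (1 - \<zeta> * circ s t))"
          using chinz'[OF z1] by (intro continuous_intros cphi) auto
        fix t :: real
        have "norm (\<phi> (circ s t) * (circ s t)\<^sup>2) \<le> B * s\<^sup>2"
          using bound[of "circ s t"] ss by (simp add: norm_mult norm_power mult_right_mono)
        moreover have "1 - \<rho> * s \<le> norm (1 - \<zeta> * circ s t)" using chinz[of \<zeta> t] \<rho>s by linarith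
        ultimately show "norm (\<phi> (circ s t) * (circ s t)\<^sup>2 / (1 - \<zeta> * circ s t)) \<le> B * s\<^sup>2 / (1 - \<rho> * s)"
          unfolding norm_divide using \<zeta>(2) B(1) by (intro frac_le) auto
      qed
    qed
    have \<kappa>_bound: "norm \<kappa> \<le> B * s" unfolding \<kappa>_def
    proof (rule ib)
      show "continuous_on {0..1} (\<lambda>t. \<phi> (circ s t) * circ s t)" by (intro continuous_intros cphi) auto
      show "norm (\<phi> (circ s t) * circ s t) \<le> B * s" for t
        using bound[of "circ s t"] ss by (simp add: norm_mult mult_right_mono)
    qed
    have minus: "- integral {0..1} (\<lambda>t. \<phi> (circ s t) * circ s t / (circ s t - z)) = \<kappa> / z + \<eta> (1 / z) / z\<^sup>2"
      if z: "s < norm z" for z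
    proof -
      have z0: "z \<noteq> 0" using z ss by auto
      have nz: "circ s t \<noteq> z" for t using z ss by auto
      have z1: "norm (1 / z) < 1 / s" using z ss z0 by (simp add: norm_divide field_simps)
      have i1: "(\<lambda>t. \<phi> (circ s t) * circ s t) integrable_on {0..1}"
        by (intro integrable_continuous_interval continuous_intros cphi) auto
      have i2: "(\<lambda>t. \<phi> (circ s t) * (circ s t)\<^sup>2 / (1 - 1 / z * circ s t)) integrable_on {0..1}"
        using chinz'[OF z1] by (intro integrable_continuous_interval continuous_intros cphi) auto
      have "\<kappa> / z + \<eta> (1 / z) / z\<^sup>2 = integral {0..1} (\<lambda>t. \<phi> (circ s t) * circ s t / z + \<phi> (circ s t) * (circ s t)\<^sup>2 / (1 - 1 / z * circ s t) / z\<^sup>2)"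
        unfolding \<kappa>_def \<eta>_def using i1 i2 by (subst integral_add) (auto simp: divide_inverse intro: integrable_on_mult_left)
      also have "\<dots> = integral {0..1} (\<lambda>t. - (\<phi> (circ s t) * circ s t / (circ s t - z)))"
      proof (rule integral_cong)
        fix t :: real
        have "1 - 1 / z * circ s t = (z - circ s t) / z" using z0 by (simp add: field_simps)
        then show "\<phi> (circ s t) * circ s t / z + \<phi> (circ s t) * (circ s t)\<^sup>2 / (1 - 1 / z * circ s t) / z\<^sup>2 = - (\<phi> (circ s t) * circ s t / (circ s t - z))"
          using z0 nz[of t] by (simp add: divide_simps power2_eq_square) (simp add: algebra_simps)
      qed
      finally show ?thesis by simp
    qed
    have dec0: "\<phi> z = p0 z + \<kappa> / z + \<eta> (1 / z) / z\<^sup>2" if "s < norm z" "norm z < s'" for z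
      using circ_annulus_decomposition[OF \<phi> r(1) ss(2) that ss(5)] minus[OF that(1)] by (simp add: p0_def)
    \<comment> \<open>The Cauchy integral continued beyond \<open>s'\<close> by the difference of
      \<open>\<phi>\<close> and its principal part; the two agree between \<open>s\<close> and
      \<open>s'\<close>.\<close>
    define p where "p z = (if norm z < s' then p0 z else \<phi> z - \<kappa> / z - \<eta> (1 / z) / z\<^sup>2)" for z
    have dec: "\<phi> z = p z + \<kappa> / z + \<eta> (1 / z) / z\<^sup>2" if "s < norm z" "norm z < 1" for z
      using dec0[OF that(1)] by (simp add: p_def)
    have hp: "p holomorphic_on ball 0 1"
    proof -
      have o: "open {z::complex. s < norm z \<and> norm z < 1}" by (intro open_Collect_conj open_Collect_less continuous_intros)
      have "(\<lambda>z. \<phi> z - \<kappa> / z - \<eta> (1 / z) / z\<^sup>2) holomorphic_on {z. s < norm z \<and> norm z < 1}"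
      proof -
        have "(\<lambda>z. 1 / z) holomorphic_on {z. s < norm z \<and> norm z < 1}" using ss by (intro holomorphic_intros) auto
        then have "(\<eta> \<circ> (\<lambda>z. 1 / z)) holomorphic_on {z. s < norm z \<and> norm z < 1}"
          proof (rule holomorphic_on_compose_gen[OF _ h\<eta>])
          show "(\<lambda>z::complex. 1 / z) ` {z. s < norm z \<and> norm z < 1} \<subseteq> ball 0 (1 / s)"
          proof
            fix w :: complex assume "w \<in> (\<lambda>z::complex. 1 / z) ` {z. s < norm z \<and> norm z < 1}"
            then obtain z where z: "s < norm z" "w = 1 / z" by auto
            then have "1 / norm z < 1 / s" using ss(1) by (intro divide_strict_left_mono mult_pos_pos) auto
            then show "w \<in> ball 0 (1 / s)" using z by (simp add: norm_divide)
          qed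
        qed
        then have "(\<lambda>z. \<eta> (1 / z)) holomorphic_on {z. s < norm z \<and> norm z < 1}" by (simp add: o_def)
        moreover have "\<phi> holomorphic_on {z. s < norm z \<and> norm z < 1}" by (rule holomorphic_on_subset[OF \<phi>]) (use ss in auto)
        ultimately show ?thesis using ss by (intro holomorphic_intros) auto
      qed
      then have 1: "p holomorphic_on {z. s < norm z \<and> norm z < 1}"
        by (rule holomorphic_transform) (use dec in \<open>auto simp: algebra_simps\<close>)
      have 2: "p holomorphic_on ball 0 s'" using hp0 by (rule holomorphic_transform) (auto simp: p_def)
      have "p holomorphic_on ball 0 s' \<union> {z. s < norm z \<and> norm z < 1}" by (intro holomorphic_on_Un 1 2 o open_ball)
      moreover have "ball 0 s' \<union> {z::complex. s < norm z \<and> norm z < 1} = ball 0 1" using ss by auto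
      ultimately show ?thesis by simp
    qed
    \<comment> \<open>Up to \<open>\<sigma>\<close> the outer Cauchy integral is bounded by
      \<open>N\<close> alone; beyond \<open>\<sigma>\<close> the principal part is bounded and the
      rest is \<open>\<phi>\<close> itself.\<close>
    have p_bound: "(norm (p z))\<^sup>2 \<le> K * (if r < norm z then (norm (\<phi> z))\<^sup>2 else 0) + K * N" if z: "z \<in> ball 0 1" for z
    proof (cases "norm z \<le> \<sigma>")
      case True
      have "norm (p0 z) \<le> B * s' / (s' - \<sigma>)"
        unfolding p0_def
      proof (rule ib)
        show "continuous_on {0..1} (\<lambda>t. \<phi> (circ s' t) * circ s' t / (circ s' t - z))"
          using p0nz[of z] True ss by (intro continuous_intros cphi) auto
        fix t :: real
        have "norm (\<phi> (circ s' t) * circ s' t) \<le> B * s'" using bound[of "circ s' t"] ss by (simp add: norm_mult mult_right_mono)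
        moreover have "s' - \<sigma> \<le> norm (circ s' t - z)" using norm_triangle_ineq2[of "circ s' t" z] True ss by simp
        ultimately show "norm (\<phi> (circ s' t) * circ s' t / (circ s' t - z)) \<le> B * s' / (s' - \<sigma>)"
          unfolding norm_divide using ss B(1) by (intro frac_le) auto
      qed
      moreover have "p z = p0 z" using True ss by (simp add: p_def)
      ultimately have "(norm (p z))\<^sup>2 \<le> (B * c1)\<^sup>2" by (intro power_mono) (simp_all add: c1_def)
      also have "\<dots> = k * c1\<^sup>2 * N" by (simp add: power_mult_distrib B(2))
      also have "\<dots> \<le> K * N" using K0(3) N(1) by (rule mult_right_mono)
      finally show ?thesis using K0(1) by (simp add: add_increasing)
    next
      case False
      define e where "e = 1 + 1 / (1 - s / \<sigma>)"
      have zz: "\<sigma> < norm z" "norm z < 1" "s < norm z" using False z ss by auto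
      have z0: "z \<noteq> 0" using zz ss by auto
      have p: "p z = \<phi> z - (\<kappa> / z + \<eta> (1 / z) / z\<^sup>2)" using dec[OF zz(3,2)] by (simp add: algebra_simps)
      have "norm (\<kappa> / z) \<le> B"
      proof -
        have "norm \<kappa> \<le> B * norm z" using \<kappa>_bound zz(3) B(1) by (meson less_imp_le mult_left_mono order_trans)
        then show ?thesis using z0 by (simp add: norm_divide divide_le_eq)
      qed
      moreover have "norm (\<eta> (1 / z) / z\<^sup>2) \<le> B * (1 / (1 - s / \<sigma>))"
      proof -
        have "norm (\<eta> (1 / z)) \<le> B * s\<^sup>2 / (1 - 1 / \<sigma> * s)"
          by (rule \<eta>_bound) (use zz ss d in \<open>auto simp: norm_divide frac_le\<close>)
        also have "\<dots> = B * (1 / (1 - s / \<sigma>)) * s\<^sup>2" by simp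
        also have "\<dots> \<le> B * (1 / (1 - s / \<sigma>)) * (norm z)\<^sup>2"
          using zz(3) ss B(1) d by (intro mult_left_mono power_mono) auto
        finally show ?thesis using z0 by (simp add: norm_divide norm_power divide_le_eq)
      qed
      ultimately have "norm (\<kappa> / z + \<eta> (1 / z) / z\<^sup>2) \<le> B * e"
        using norm_triangle_ineq[of "\<kappa> / z" "\<eta> (1 / z) / z\<^sup>2"] by (simp add: e_def distrib_left)
      then have "norm (p z) \<le> norm (\<phi> z) + B * e"
        unfolding p using norm_triangle_ineq4[of "\<phi> z" "\<kappa> / z + \<eta> (1 / z) / z\<^sup>2"] by linarith
      then have "(norm (p z))\<^sup>2 \<le> (norm (\<phi> z) + B * e)\<^sup>2" by (intro power_mono) auto
      also have "\<dots> \<le> 2 * (norm (\<phi> z))\<^sup>2 + 2 * (B * e)\<^sup>2"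
        using sum_squares_bound[of "norm (\<phi> z)" "B * e"] by (simp add: power2_sum)
      also have "2 * (B * e)\<^sup>2 = 2 * k * e\<^sup>2 * N" by (simp add: power_mult_distrib B(2))
      also have "2 * (norm (\<phi> z))\<^sup>2 + \<dots> \<le> K * (norm (\<phi> z))\<^sup>2 + K * N"
        using K0(2,4) N(1) by (intro add_mono mult_right_mono) (auto simp: e_def)
      finally show ?thesis using zz ss by simp
    qed
    have \<eta>_bound1: "(norm (\<eta> \<zeta>))\<^sup>2 \<le> K * N" if "\<zeta> \<in> cball 0 1" for \<zeta>
    proof -
      have "norm (\<eta> \<zeta>) \<le> B * s\<^sup>2 / (1 - 1 * s)" by (rule \<eta>_bound) (use that ss in auto)
      then have "(norm (\<eta> \<zeta>))\<^sup>2 \<le> (B * c3)\<^sup>2" by (intro power_mono) (simp_all add: c3_def)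
      also have "\<dots> = k * c3\<^sup>2 * N" by (simp add: power_mult_distrib B(2))
      also have "\<dots> \<le> K * N" using K0(5) N(1) by (rule mult_right_mono)
      finally show ?thesis .
    qed
    show "\<exists>p \<kappa> \<eta>. p holomorphic_on ball 0 1 \<and> \<eta> holomorphic_on ball 0 (1 / s) \<and>
        (\<forall>z. s < norm z \<longrightarrow> norm z < 1 \<longrightarrow> \<phi> z = p z + \<kappa> / z + \<eta> (1 / z) / z\<^sup>2) \<and>
        (\<forall>z\<in>ball 0 1. (norm (p z))\<^sup>2 \<le> K * (if r < norm z then (norm (\<phi> z))\<^sup>2 else 0) + K * N) \<and>
        (\<forall>\<zeta>\<in>cball 0 1. (norm (\<eta> \<zeta>))\<^sup>2 \<le> K * N)"
      using hp h\<eta> dec p_bound \<eta>_bound1 by blast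
  qed
qed


text \<open>Pulled back by \<^term>\<open>exp\<close>, the residue terms become linear; single-valuedness of \<open>u\<close> then forces
  \<^prop>\<open>\<kappa> = cnj \<mu>\<close>, which leaves the real logarithm only.\<close>

lemma annulus_representation:
  assumes s: "0 < s" "s < 1" and u: "plane_harmonic_on u {z. s < norm z \<and> norm z < 1}"
    and pz: "\<And>z. s < norm z \<Longrightarrow> norm z < 1 \<Longrightarrow> d_z u z = p z + \<kappa> / z + a (1 / z) / z\<^sup>2"
    and pzb: "\<And>z. s < norm z \<Longrightarrow> norm z < 1 \<Longrightarrow> cnj (d_zbar u z) = q z + \<mu> / z + b (1 / z) / z\<^sup>2"
    and prim: "\<And>z. z \<in> ball 0 1 \<Longrightarrow> (\<Phi> has_field_derivative p z) (at z)" "\<And>z. z \<in> ball 0 1 \<Longrightarrow> (\<Psi> has_field_derivative q z) (at z)"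
      "\<And>z. z \<in> ball 0 (1 / s) \<Longrightarrow> (X has_field_derivative a z) (at z)" "\<And>z. z \<in> ball 0 (1 / s) \<Longrightarrow> (Y has_field_derivative b z) (at z)"
  obtains c where "\<And>z. s < norm z \<Longrightarrow> norm z < 1 \<Longrightarrow>
      u z = \<Phi> z - X (1 / z) + cnj (\<Psi> z - Y (1 / z)) + 2 * \<kappa> * of_real (ln (norm z)) + c"
proof -
  let ?A = "{z::complex. s < norm z \<and> norm z < 1}" and ?S = "{\<zeta>::complex. ln s < Re \<zeta> \<and> Re \<zeta> < 0}"
  have oA: "open ?A" by (intro open_Collect_conj open_Collect_less continuous_intros)
  have S: "open ?S" "convex ?S"
  proof -
    have e: "?S = {\<zeta>. ln s < Re \<zeta>} \<inter> {\<zeta>. Re \<zeta> < 0}" by auto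
    show "open ?S" unfolding e by (intro open_Int open_halfspace_Re_gt open_halfspace_Re_lt)
    show "convex ?S" unfolding e by (intro convex_Int convex_halfspace_Re_gt convex_halfspace_Re_lt)
  qed
  have exS: "s < norm (exp \<zeta>) \<and> norm (exp \<zeta>) < 1" if "\<zeta> \<in> ?S" for \<zeta>
  proof -
    have "exp (ln s) < exp (Re \<zeta>)" using that by simp
    then show ?thesis using that s by simp
  qed
  have exim: "exp ` ?S \<subseteq> ?A" using exS by blast
  have hexp: "exp holomorphic_on ?S" by (intro holomorphic_intros)
  have hV: "plane_harmonic_on (\<lambda>\<zeta>. u (exp \<zeta>)) ?S"
    by (rule plane_harmonic_compose(1)[OF oA u S(1) hexp exim])
  then obtain F G where F: "F holomorphic_on ?S" and G: "G holomorphic_on ?S"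
    and FG: "\<And>\<zeta>. \<zeta> \<in> ?S \<Longrightarrow> u (exp \<zeta>) = F \<zeta> + cnj (G \<zeta>)"
    using plane_harmonic_decompose[OF S hV] by blast
  have inb: "exp \<zeta> \<in> ball 0 1" "exp (- \<zeta>) \<in> ball 0 (1 / s)" if "\<zeta> \<in> ?S" for \<zeta>
  proof -
    show "exp \<zeta> \<in> ball 0 1" using exS[OF that] by simp
    have "1 / norm (exp \<zeta>) < 1 / s" using exS[OF that] s by (intro divide_strict_left_mono) auto
    then show "exp (- \<zeta>) \<in> ball 0 (1 / s)" by (simp add: exp_minus norm_inverse divide_inverse)
  qed
  \<comment> \<open>The derivative of \<open>exp\<close> cancels the denominators, so the residue
    term becomes the constant \<open>\<tau>\<close> and has the primitive
    \<open>\<tau> * \<zeta>\<close> on the strip.\<close>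
  have const: "\<exists>k. \<forall>\<zeta>\<in>?S. H \<zeta> = \<Theta> (exp \<zeta>) + \<tau> * \<zeta> - Z (exp (- \<zeta>)) + k"
    if H: "H holomorphic_on ?S" "\<And>\<zeta>. \<zeta> \<in> ?S \<Longrightarrow> deriv H \<zeta> = (t (exp \<zeta>) + \<tau> / exp \<zeta> + d (1 / exp \<zeta>) / (exp \<zeta>)\<^sup>2) * exp \<zeta>"
      and pr: "\<And>z. z \<in> ball 0 1 \<Longrightarrow> (\<Theta> has_field_derivative t z) (at z)" "\<And>z. z \<in> ball 0 (1 / s) \<Longrightarrow> (Z has_field_derivative d z) (at z)"
    for H \<Theta> Z t d \<tau>
  proof -
    have "\<exists>k. \<forall>\<zeta>\<in>?S. H \<zeta> - (\<Theta> (exp \<zeta>) + \<tau> * \<zeta> - Z (exp (- \<zeta>))) = k"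
    proof (rule has_field_derivative_zero_constant[OF S(2)])
      fix \<zeta> assume z: "\<zeta> \<in> ?S"
      have "((\<lambda>\<zeta>. \<Theta> (exp \<zeta>)) has_field_derivative t (exp \<zeta>) * exp \<zeta>) (at \<zeta>)"
        by (rule DERIV_chain2[where f = \<Theta> and g = exp, OF pr(1)[OF inb(1)[OF z]]]) (auto intro!: derivative_eq_intros)
      moreover have "((\<lambda>\<zeta>. Z (exp (- \<zeta>))) has_field_derivative d (exp (- \<zeta>)) * (- exp (- \<zeta>))) (at \<zeta>)"
        by (rule DERIV_chain2[where f = Z and g = "\<lambda>\<zeta>. exp (- \<zeta>)", OF pr(2)[OF inb(2)[OF z]]]) (auto intro!: derivative_eq_intros)
      moreover have "(H has_field_derivative deriv H \<zeta>) (at \<zeta>)" by (rule holomorphic_derivI[OF H(1) S(1) z])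
      ultimately have "((\<lambda>\<zeta>. H \<zeta> - (\<Theta> (exp \<zeta>) + \<tau> * \<zeta> - Z (exp (- \<zeta>)))) has_field_derivative
          deriv H \<zeta> - (t (exp \<zeta>) * exp \<zeta> + \<tau> * 1 - d (exp (- \<zeta>)) * (- exp (- \<zeta>)))) (at \<zeta>)"
        by (intro DERIV_diff DERIV_add DERIV_cmult DERIV_ident)
      moreover have "deriv H \<zeta> - (t (exp \<zeta>) * exp \<zeta> + \<tau> * 1 - d (exp (- \<zeta>)) * (- exp (- \<zeta>))) = 0"
        unfolding H(2)[OF z] by (simp add: exp_minus field_simps power2_eq_square)
      ultimately show "((\<lambda>\<zeta>. H \<zeta> - (\<Theta> (exp \<zeta>) + \<tau> * \<zeta> - Z (exp (- \<zeta>)))) has_field_derivative 0) (at \<zeta> within ?S)"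
        by (simp only: has_field_derivative_at_within)
    qed
    then show ?thesis by (auto simp: algebra_simps)
  qed
  have dFG: "deriv F \<zeta> = d_z u (exp \<zeta>) * exp \<zeta>" "deriv G \<zeta> = cnj (d_zbar u (exp \<zeta>)) * exp \<zeta>" if z: "\<zeta> \<in> ?S" for \<zeta>
  proof -
    have e: "deriv exp \<zeta> = exp \<zeta>" by (rule DERIV_imp_deriv) (rule DERIV_exp)
    show "deriv F \<zeta> = d_z u (exp \<zeta>) * exp \<zeta>"
      using hol_antihol_derivatives(4)[OF S(1) F G FG z] plane_harmonic_compose(2)[OF oA u S(1) hexp exim z] by (simp add: e)
    have "cnj (deriv G \<zeta>) = d_zbar u (exp \<zeta>) * cnj (exp \<zeta>)"
      using hol_antihol_derivatives(5)[OF S(1) F G FG z] plane_harmonic_compose(3)[OF oA u S(1) hexp exim z] by (simp only: e)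
    from arg_cong[OF this, of cnj] show "deriv G \<zeta> = cnj (d_zbar u (exp \<zeta>)) * exp \<zeta>" by simp
  qed
  have "\<exists>k. \<forall>\<zeta>\<in>?S. F \<zeta> = \<Phi> (exp \<zeta>) + \<kappa> * \<zeta> - X (exp (- \<zeta>)) + k"
    by (rule const[OF F _ prim(1,3)]) (use dFG(1) pz exS in simp)
  then obtain k1 where k1: "\<And>\<zeta>. \<zeta> \<in> ?S \<Longrightarrow> F \<zeta> = \<Phi> (exp \<zeta>) + \<kappa> * \<zeta> - X (exp (- \<zeta>)) + k1" by blast
  have "\<exists>k. \<forall>\<zeta>\<in>?S. G \<zeta> = \<Psi> (exp \<zeta>) + \<mu> * \<zeta> - Y (exp (- \<zeta>)) + k"
    by (rule const[OF G _ prim(2,4)]) (use dFG(2) pzb exS in simp)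
  then obtain k2 where k2: "\<And>\<zeta>. \<zeta> \<in> ?S \<Longrightarrow> G \<zeta> = \<Psi> (exp \<zeta>) + \<mu> * \<zeta> - Y (exp (- \<zeta>)) + k2" by blast
  have rep: "u (exp \<zeta>) = \<Phi> (exp \<zeta>) - X (exp (- \<zeta>)) + cnj (\<Psi> (exp \<zeta>) - Y (exp (- \<zeta>))) + (\<kappa> * \<zeta> + cnj (\<mu> * \<zeta>)) + (k1 + cnj k2)"
    if "\<zeta> \<in> ?S" for \<zeta>
    unfolding FG[OF that] k1[OF that] k2[OF that] by (simp add: algebra_simps)
  have \<kappa>\<mu>: "\<kappa> = cnj \<mu>"
  proof -
    \<comment> \<open>Any point of the strip serves; its translate by \<open>2 * pi * \<i>\<close>
      has the same image in the annulus.\<close>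
    define \<zeta> where "\<zeta> = complex_of_real (ln s / 2)"
    have l: "ln s < 0" using s by simp
    have z: "\<zeta> \<in> ?S" "\<zeta> + 2 * of_real pi * \<i> \<in> ?S" using l by (simp_all add: \<zeta>_def)
    have "exp (\<zeta> + 2 * of_real pi * \<i>) = exp \<zeta>" "exp (- (\<zeta> + 2 * of_real pi * \<i>)) = exp (- \<zeta>)"
      by (simp_all add: exp_add exp_diff exp_minus)
    with rep[OF z(1)] rep[OF z(2)]
    have "\<kappa> * (\<zeta> + 2 * of_real pi * \<i>) + cnj (\<mu> * (\<zeta> + 2 * of_real pi * \<i>)) = \<kappa> * \<zeta> + cnj (\<mu> * \<zeta>)" by simp
    then have "(\<kappa> - cnj \<mu>) * (2 * of_real pi * \<i>) = 0" by (simp add: algebra_simps)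
    then show ?thesis by simp
  qed
  show ?thesis
  proof (rule that[of "k1 + cnj k2"])
    fix z :: complex assume z: "s < norm z" "norm z < 1"
    then have z0: "z \<noteq> 0" using s by auto
    have re: "Re (Ln z) = ln (norm z)" by (rule Re_Ln[OF z0])
    have lS: "Ln z \<in> ?S" using z s z0 by (simp add: re)
    have e: "exp (Ln z) = z" "exp (- Ln z) = 1 / z" using z0 by (simp_all add: exp_minus divide_inverse)
    \<comment> \<open>With conjugate residues the branch of the logarithm drops out and only its
      real part remains.\<close>
    have "\<kappa> * Ln z + cnj (\<mu> * Ln z) = \<kappa> * (Ln z + cnj (Ln z))" unfolding \<kappa>\<mu> by (simp add: algebra_simps)
    also have "\<dots> = 2 * \<kappa> * of_real (ln (norm z))" by (simp add: complex_add_cnj re)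
    finally show "u z = \<Phi> z - X (1 / z) + cnj (\<Psi> z - Y (1 / z)) + 2 * \<kappa> * of_real (ln (norm z)) + (k1 + cnj k2)"
      using rep[OF lS] unfolding e by simp
  qed
qed

lemma norm_diff_square_le: "(norm (x - y))\<^sup>2 \<le> 2 * (norm x)\<^sup>2 + 2 * (norm y)\<^sup>2" for x y :: complex
proof -
  have "(norm (x - y))\<^sup>2 \<le> (norm x + norm y)\<^sup>2" by (intro power_mono norm_triangle_ineq4) simp
  then show ?thesis using sum_squares_bound[of "norm x" "norm y"] by (simp add: power2_sum)
qed

text \<open>The result is stated by its holomorphic parts, since boundary limits are established for
  holomorphic functions. The difference from \<open>u\<close> has an unrestricted limit 0 at every
  point of the circle, so no exceptional set arises at this stage.\<close>

lemma annulus_extension: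
  assumes r: "0 < r" "r < 1"
  obtains C where "0 \<le> C"
    "\<And>u. \<lbrakk>plane_harmonic_on u {z. r < norm z \<and> norm z < 1}; plane_energy {z. r < norm z \<and> norm z < 1} u < \<infinity>\<rbrakk> \<Longrightarrow>
      \<exists>P Q. P holomorphic_on ball 0 1 \<and> Q holomorphic_on ball 0 1 \<and>
        (\<forall>q\<in>sphere 0 1. ((\<lambda>z. u z - (P z + cnj (Q z))) \<longlongrightarrow> 0) (at q within ball 0 1)) \<and>
        plane_energy (ball 0 1) (\<lambda>z. P z + cnj (Q z)) \<le> ennreal C * plane_energy {z. r < norm z \<and> norm z < 1} u"
proof -
  obtain K s where K: "0 \<le> K" and s: "r < s" "s < 1" and split:
    "\<And>\<phi> N. \<lbrakk>\<phi> holomorphic_on {z. r < norm z \<and> norm z < 1}; 0 \<le> N;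
        (\<integral>\<^sup>+ z\<in>{z. r < norm z \<and> norm z < 1}. ennreal ((norm (\<phi> z))\<^sup>2) \<partial>lborel) \<le> ennreal N\<rbrakk> \<Longrightarrow>
      \<exists>p \<kappa> \<eta>. p holomorphic_on ball 0 1 \<and> \<eta> holomorphic_on ball 0 (1 / s) \<and>
        (\<forall>z. s < norm z \<longrightarrow> norm z < 1 \<longrightarrow> \<phi> z = p z + \<kappa> / z + \<eta> (1 / z) / z\<^sup>2) \<and>
        (\<forall>z\<in>ball 0 1. (norm (p z))\<^sup>2 \<le> K * (if r < norm z then (norm (\<phi> z))\<^sup>2 else 0) + K * N) \<and>
        (\<forall>\<zeta>\<in>cball 0 1. (norm (\<eta> \<zeta>))\<^sup>2 \<le> K * N)"
    by (rule annulus_splitting[OF r]) (rule that; assumption)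
  let ?A = "{z::complex. r < norm z \<and> norm z < 1}"
  have oA: "open ?A" by (intro open_Collect_conj open_Collect_less continuous_intros)
  have s0: "0 < s" using r s by simp
  define v where "v = measure lborel (ball (0::complex) 1)"
  have v: "emeasure lborel (ball (0::complex) 1) = ennreal v" "0 \<le> v"
  proof -
    show "emeasure lborel (ball (0::complex) 1) = ennreal v"
      unfolding v_def by (rule emeasure_eq_ennreal_measure) (use emeasure_lborel_ball_finite[of "0::complex" 1] in auto)
  qed (simp add: v_def)
  \<comment> \<open>Squares of differences cost a factor 2, which gives \<open>2 * K\<close> for the
    energy in the annulus; four terms of size \<open>2 * K * N\<close> over the disc of area
    \<open>v\<close> give the rest.\<close>
  define C where "C = 2 * K + 8 * K * v"
  show ?thesis
  proof (rule that[of C])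
    show "0 \<le> C" using K v by (simp add: C_def)
    fix u assume u: "plane_harmonic_on u ?A" "plane_energy ?A u < \<infinity>"
    define N where "N = enn2real (plane_energy ?A u)"
    have N: "0 \<le> N" "plane_energy ?A u = ennreal N" using u(2) by (simp_all add: N_def)
    have le1: "(\<integral>\<^sup>+ z\<in>?A. ennreal ((norm (d_z u z))\<^sup>2) \<partial>lborel) \<le> ennreal N"
      unfolding N(2)[symmetric] plane_energy_def
      by (rule nn_integral_mono) (auto simp: energy_density_def intro!: ennreal_leI split: split_indicator)
    have le2: "(\<integral>\<^sup>+ z\<in>?A. ennreal ((norm (cnj (d_zbar u z)))\<^sup>2) \<partial>lborel) \<le> ennreal N"
      unfolding N(2)[symmetric] plane_energy_def
      by (rule nn_integral_mono) (auto simp: energy_density_def intro!: ennreal_leI split: split_indicator)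
    note hol = plane_harmonic_wirtinger_holomorphic[OF oA u(1)]
    obtain p \<kappa> a where p: "p holomorphic_on ball 0 1" "a holomorphic_on ball 0 (1 / s)"
      "\<And>z. s < norm z \<Longrightarrow> norm z < 1 \<Longrightarrow> d_z u z = p z + \<kappa> / z + a (1 / z) / z\<^sup>2"
      "\<And>z. z \<in> ball 0 1 \<Longrightarrow> (norm (p z))\<^sup>2 \<le> K * (if r < norm z then (norm (d_z u z))\<^sup>2 else 0) + K * N"
      "\<And>\<zeta>. \<zeta> \<in> cball 0 1 \<Longrightarrow> (norm (a \<zeta>))\<^sup>2 \<le> K * N"
      using split[OF hol(1) N(1) le1] by blast
    obtain q \<mu> b where q: "q holomorphic_on ball 0 1" "b holomorphic_on ball 0 (1 / s)"
      "\<And>z. s < norm z \<Longrightarrow> norm z < 1 \<Longrightarrow> cnj (d_zbar u z) = q z + \<mu> / z + b (1 / z) / z\<^sup>2"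
      "\<And>z. z \<in> ball 0 1 \<Longrightarrow> (norm (q z))\<^sup>2 \<le> K * (if r < norm z then (norm (cnj (d_zbar u z)))\<^sup>2 else 0) + K * N"
      "\<And>\<zeta>. \<zeta> \<in> cball 0 1 \<Longrightarrow> (norm (b \<zeta>))\<^sup>2 \<le> K * N"
      using split[OF hol(2) N(1) le2] by blast
    obtain \<Phi> where \<Phi>: "\<And>z. z \<in> ball 0 1 \<Longrightarrow> (\<Phi> has_field_derivative p z) (at z)"
      using holomorphic_convex_primitive'[OF convex_ball open_ball p(1)] by (auto simp: at_within_open[OF _ open_ball])
    obtain \<Psi> where \<Psi>: "\<And>z. z \<in> ball 0 1 \<Longrightarrow> (\<Psi> has_field_derivative q z) (at z)"
      using holomorphic_convex_primitive'[OF convex_ball open_ball q(1)] by (auto simp: at_within_open[OF _ open_ball])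
    obtain X where X: "\<And>z. z \<in> ball 0 (1 / s) \<Longrightarrow> (X has_field_derivative a z) (at z)"
      using holomorphic_convex_primitive'[OF convex_ball open_ball p(2)] by (auto simp: at_within_open[OF _ open_ball])
    obtain Y where Y: "\<And>z. z \<in> ball 0 (1 / s) \<Longrightarrow> (Y has_field_derivative b z) (at z)"
      using holomorphic_convex_primitive'[OF convex_ball open_ball q(2)] by (auto simp: at_within_open[OF _ open_ball])
    have uA: "plane_harmonic_on u {z. s < norm z \<and> norm z < 1}" by (rule plane_harmonic_on_subset[OF u(1)]) (use s in auto)
    obtain c where c: "\<And>z. s < norm z \<Longrightarrow> norm z < 1 \<Longrightarrow>
      u z = \<Phi> z - X (1 / z) + cnj (\<Psi> z - Y (1 / z)) + 2 * \<kappa> * of_real (ln (norm z)) + c"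
      by (rule annulus_representation[OF s0 s(2) uA p(3) q(3) \<Phi> \<Psi> X Y]) (assumption | rule that)+
    have big: "1 < 1 / s" using s s0 by simp
    have cnjb: "cnj z \<in> ball 0 (1 / s)" if "z \<in> ball 0 1" for z using that big by simp
    \<comment> \<open>Reflection turns \<open>X (1 / z)\<close> into the antiholomorphic
      \<open>X (cnj z)\<close>, so \<open>X\<close> moves to the antiholomorphic side, and
      \<open>Y\<close> to the holomorphic one.\<close>
    define P where "P z = \<Phi> z - cnj (Y (cnj z)) + c" for z
    define Q where "Q z = \<Psi> z - cnj (X (cnj z))" for z
    have dP: "(P has_field_derivative p z - cnj (b (cnj z))) (at z)" if z: "z \<in> ball 0 1" for z
    proof -
      have "((cnj \<circ> Y \<circ> cnj) has_field_derivative cnj (b (cnj z))) (at z)"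
        using Y[OF cnjb[OF z]] by (simp add: has_field_derivative_cnj_cnj)
      then show ?thesis unfolding P_def o_def using \<Phi>[OF z] by (auto intro!: derivative_eq_intros)
    qed
    have dQ: "(Q has_field_derivative q z - cnj (a (cnj z))) (at z)" if z: "z \<in> ball 0 1" for z
    proof -
      have "((cnj \<circ> X \<circ> cnj) has_field_derivative cnj (a (cnj z))) (at z)"
        using X[OF cnjb[OF z]] by (simp add: has_field_derivative_cnj_cnj)
      then show ?thesis unfolding Q_def o_def using \<Psi>[OF z] by (auto intro!: derivative_eq_intros)
    qed
    have hP: "P holomorphic_on ball 0 1" and hQ: "Q holomorphic_on ball 0 1"
      using dP dQ unfolding holomorphic_on_open[OF open_ball] by blast+
    have lim: "((\<lambda>z. u z - (P z + cnj (Q z))) \<longlongrightarrow> 0) (at w within ball 0 1)" if w: "w \<in> sphere 0 1" for w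
    proof -
      have w1: "norm w = 1" "w \<noteq> 0" using w by auto
      have cw: "1 / w = cnj w" using w1 complex_norm_square[of w] by (simp add: field_simps)
      have cX: "isCont X (cnj w)" "isCont Y (cnj w)"
        using X[of "cnj w"] Y[of "cnj w"] w1 big by (auto intro: DERIV_isCont)
      \<comment> \<open>Near the circle this is \<open>u\<close> minus its replacement. It is
        continuous at \<open>w\<close> because \<open>X\<close> and \<open>Y\<close> are holomorphic
        across the circle, and it vanishes there since \<open>1 / w = cnj w\<close> and
        \<open>ln (norm w) = 0\<close>.\<close>
      define R where "R z = X (cnj z) - X (1 / z) + cnj (Y (cnj z) - Y (1 / z)) + 2 * \<kappa> * of_real (ln (norm z))" for z
      have c1: "isCont (\<lambda>z::complex. cnj z) w" "isCont (\<lambda>z::complex. 1 / z) w"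
        using w1 by (auto intro!: continuous_intros)
      have c2: "isCont (\<lambda>z. X (cnj z)) w" "isCont (\<lambda>z. Y (cnj z)) w" "isCont (\<lambda>z. X (1 / z)) w" "isCont (\<lambda>z. Y (1 / z)) w"
        using isCont_o2[OF c1(1) cX(1)] isCont_o2[OF c1(1) cX(2)] isCont_o2[OF c1(2), of X] isCont_o2[OF c1(2), of Y] cX cw by simp_all
      have c3: "isCont (\<lambda>z::complex. ln (norm z)) w" using w1 by (intro isCont_ln' continuous_intros) simp
      have "isCont R w" unfolding R_def
        by (intro continuous_add continuous_diff continuous_mult continuous_const continuous_of_real isCont_cnj c2 c3)
      then have "(R \<longlongrightarrow> R w) (at w within ball 0 1)" unfolding isCont_def by (rule tendsto_within_subset[of _ _ _ UNIV]) simp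
      moreover have "R w = 0" using w1 cw by (simp add: R_def)
      moreover have "eventually (\<lambda>z. R z = u z - (P z + cnj (Q z))) (at w within ball 0 1)"
      proof -
        have "eventually (\<lambda>z. z \<in> {z. s < norm z}) (nhds w)"
          by (rule eventually_nhds_in_open) (use w1 s in \<open>auto intro!: open_Collect_less continuous_intros\<close>)
        then have "eventually (\<lambda>z. s < norm z) (at w within ball 0 1)" by (auto simp: eventually_at_filter elim: eventually_mono)
        moreover have "eventually (\<lambda>z. z \<in> ball 0 1) (at w within ball 0 1)" by (auto simp: eventually_at_filter)
        ultimately show ?thesis
          by eventually_elim (simp add: c P_def Q_def R_def)
      qed
      ultimately show ?thesis using Lim_transform_eventually by fastforce
    qed
    have "plane_energy (ball 0 1) (\<lambda>z. P z + cnj (Q z)) \<le> (\<integral>\<^sup>+ z. ennreal (2 * K) * (ennreal (energy_density u z) * indicator ?A z) + ennreal (8 * K * N) * indicator (ball 0 1) z \<partial>lborel)"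
      unfolding plane_energy_def
    proof (rule nn_integral_mono)
      fix z :: complex
      show "ennreal (energy_density (\<lambda>z. P z + cnj (Q z)) z) * indicator (ball 0 1) z \<le> ennreal (2 * K) * (ennreal (energy_density u z) * indicator ?A z) + ennreal (8 * K * N) * indicator (ball 0 1) z"
      proof (cases "z \<in> ball 0 1")
        case z: True
        let ?e = "if r < norm z then energy_density u z else 0"
        have "energy_density (\<lambda>z. P z + cnj (Q z)) z = (norm (p z - cnj (b (cnj z))))\<^sup>2 + (norm (q z - cnj (a (cnj z))))\<^sup>2"
          unfolding energy_density_def hol_antihol_derivatives(4,5)[OF open_ball hP hQ refl z]
          using DERIV_imp_deriv[OF dP[OF z]] DERIV_imp_deriv[OF dQ[OF z]] by (simp only: complex_mod_cnj)
        also have "\<dots> \<le> (2 * (norm (p z))\<^sup>2 + 2 * (norm (b (cnj z)))\<^sup>2) + (2 * (norm (q z))\<^sup>2 + 2 * (norm (a (cnj z)))\<^sup>2)"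
          using norm_diff_square_le[of "p z" "cnj (b (cnj z))"] norm_diff_square_le[of "q z" "cnj (a (cnj z))"] by (intro add_mono) simp_all
        also have "\<dots> \<le> 2 * K * ?e + 8 * K * N"
        proof -
          have "cnj z \<in> cball 0 1" using z by simp
          from p(4)[OF z] q(4)[OF z] p(5)[OF this] q(5)[OF this]
          show ?thesis by (cases "r < norm z") (simp_all add: energy_density_def algebra_simps)
        qed
        finally have "ennreal (energy_density (\<lambda>z. P z + cnj (Q z)) z) \<le> ennreal (2 * K * ?e + 8 * K * N)" by (rule ennreal_leI)
        also have "\<dots> = ennreal (2 * K) * ennreal ?e + ennreal (8 * K * N)"
          using K N(1) energy_density_nonneg[of u z] by (simp add: ennreal_plus[symmetric] ennreal_mult[symmetric] del: ennreal_plus)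
        finally show ?thesis using z by (auto split: if_splits)
      qed simp
    qed
    also have "\<dots> = ennreal (2 * K) * ennreal N + ennreal (8 * K * N) * ennreal v"
    proof -
      note [measurable] = measurable_energy_density[OF oA u(1)]
      show ?thesis using N(2) v(1)
        by (simp add: nn_integral_add nn_integral_cmult plane_energy_def nn_integral_cmult_indicator)
    qed
    also have "\<dots> = ennreal C * plane_energy ?A u"
      unfolding N(2) using K N(1) v(2)
      by (simp add: C_def ennreal_plus[symmetric] ennreal_mult[symmetric] algebra_simps del: ennreal_plus)
    finally have en: "plane_energy (ball 0 1) (\<lambda>z. P z + cnj (Q z)) \<le> ennreal C * plane_energy ?A u" .
    show "\<exists>P Q. P holomorphic_on ball 0 1 \<and> Q holomorphic_on ball 0 1 \<and>
        (\<forall>q\<in>sphere 0 1. ((\<lambda>z. u z - (P z + cnj (Q z))) \<longlongrightarrow> 0) (at q within ball 0 1)) \<and>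
        plane_energy (ball 0 1) (\<lambda>z. P z + cnj (Q z)) \<le> ennreal C * plane_energy ?A u"
      by (intro exI[of _ P] exI[of _ Q] conjI ballI hP hQ lim en)
  qed
qed

subsection \<open>The bounce operator\<close>

context disc_param
begin

text \<open>Applied to a second parametrization \<open>g\<close>, this gives the transition map of
  the disc; the finite chart and the chart at infinity cover its domain.\<close>

lemma coord_compose_holomorphic:
  assumes g: "holomorphic_to_sphere g (ball 0 1)" "g ` ball 0 1 \<subseteq> \<Omega>"
  shows "(\<lambda>z. coord (g z)) holomorphic_on ball 0 1"
proof -
  have cg: "continuous_map (top_of_set (ball 0 1)) riemann_sphere g"
    and g1: "(\<lambda>z. the (g z)) holomorphic_on {z \<in> ball 0 1. g z \<noteq> None}"
    and g2: "(\<lambda>z. the (recip (g z))) holomorphic_on {z \<in> ball 0 1. g z \<noteq> Some 0}"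
    using g(1) by (auto simp: holomorphic_to_sphere_def)
  have o: "open {z \<in> ball 0 1. g z \<noteq> p}" for p
    using sphere_map_open_preimage[OF cg open_ball openin_sphere_delete[of p]] by simp
  have r: "recip (Some (the (recip p))) = p" if "p \<noteq> Some 0" for p
    using that by (cases p) auto
  have "((\<lambda>w. coord (Some w)) \<circ> (\<lambda>z. the (g z))) holomorphic_on {z \<in> ball 0 1. g z \<noteq> None}"
    by (rule holomorphic_on_compose_gen[OF g1 coord_holomorphic(1)]) (use g(2) in \<open>auto simp: image_subset_iff\<close>)
  then have 1: "(\<lambda>z. coord (g z)) holomorphic_on {z \<in> ball 0 1. g z \<noteq> None}"
    by (rule holomorphic_transform) auto
  have "((\<lambda>w. coord (recip (Some w))) \<circ> (\<lambda>z. the (recip (g z)))) holomorphic_on {z \<in> ball 0 1. g z \<noteq> Some 0}"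
    by (rule holomorphic_on_compose_gen[OF g2 coord_holomorphic(2)]) (use g(2) in \<open>auto simp: r\<close>)
  then have 2: "(\<lambda>z. coord (g z)) holomorphic_on {z \<in> ball 0 1. g z \<noteq> Some 0}"
    by (rule holomorphic_transform) (auto simp: r)
  have "{z \<in> ball 0 1. g z \<noteq> None} \<union> {z \<in> ball 0 1. g z \<noteq> Some 0} = ball 0 1" by auto
  then show ?thesis using holomorphic_on_Un[OF 1 2 o o] by simp
qed

end

lemma disc_aut_inverse:
  assumes "norm a < 1" "norm z < 1"
  shows "disc_aut 1 (- a) (disc_aut 1 a z) = z"
proof -
  interpret a: disc_automorphism 1 a using assms by unfold_locales auto
  interpret b: disc_automorphism 1 "- a" using assms by unfold_locales auto
  let ?d = "1 - cnj a * z"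
  have d: "?d \<noteq> 0" using a.denom_bounds(3)[of z] assms by simp
  have "norm (disc_aut 1 a z) \<le> 1" using a.norm_le assms by simp
  then have e: "1 + cnj a * ((z - a) / ?d) \<noteq> 0" using b.denom_bounds(3)[of "disc_aut 1 a z"] by (simp add: disc_aut_def)
  have "((z - a) / ?d + a) = z * (1 + cnj a * ((z - a) / ?d))"
    using d by (simp add: field_simps)
  then show ?thesis using e by (simp add: disc_aut_def)
qed

text \<open>After an automorphism moves the preimage of 0 to 0, the Schwarz lemma applies to the map
  and to its inverse.\<close>

lemma disc_bijection_is_disc_aut:
  assumes T: "T holomorphic_on ball 0 1" "S holomorphic_on ball 0 1"
    and im: "\<And>z. norm z < 1 \<Longrightarrow> norm (T z) < 1" "\<And>z. norm z < 1 \<Longrightarrow> norm (S z) < 1"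
    and inv: "\<And>z. norm z < 1 \<Longrightarrow> S (T z) = z" "\<And>z. norm z < 1 \<Longrightarrow> T (S z) = z"
  obtains \<alpha> a where "disc_automorphism \<alpha> a" "\<And>z. norm z < 1 \<Longrightarrow> T z = disc_aut \<alpha> a z"
proof -
  define a where "a = S 0"
  have a: "norm a < 1" "T a = 0" using im(2)[of 0] inv(2)[of 0] by (simp_all add: a_def)
  interpret a: disc_automorphism 1 a using a by unfold_locales auto
  interpret b: disc_automorphism 1 "- a" using a by unfold_locales auto
  define R where "R z = T (disc_aut 1 (- a) z)" for z
  define R' where "R' z = disc_aut 1 a (S z)" for z
  have hR: "R holomorphic_on ball 0 1"
    using holomorphic_on_compose_gen[OF b.holomorphic T(1)] b.norm_less by (auto simp: R_def[abs_def] o_def image_subset_iff)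
  have hR': "R' holomorphic_on ball 0 1"
    using holomorphic_on_compose_gen[OF T(2) a.holomorphic] im(2) by (auto simp: R'_def[abs_def] o_def image_subset_iff)
  have R0: "R 0 = 0" "R' 0 = 0" using a by (simp_all add: R_def R'_def disc_aut_def flip: a_def)
  have Rn: "norm (R z) < 1" "norm (R' z) < 1" if "norm z < 1" for z
    using that im a.norm_less b.norm_less by (auto simp: R_def R'_def)
  have R'R: "R' (R z) = z" if "norm z < 1" for z
    using disc_aut_inverse[of "- a" z] a(1) inv(1)[OF b.norm_less[OF that]] that by (simp add: R_def R'_def)
  \<comment> \<open>Equality at one nonzero point is enough for the rigid case of the Schwarz
    lemma.\<close>
  have "norm (R (1 / 2)) = norm (1 / 2 :: complex)"
  proof (rule antisym)
    show "norm (R (1 / 2)) \<le> norm (1 / 2 :: complex)" by (rule Schwarz_Lemma(1)[OF hR R0(1) Rn(1)]) simp_all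
    have "norm (R' (R (1 / 2))) \<le> norm (R (1 / 2))"
      by (rule Schwarz_Lemma(1)[OF hR' R0(2) Rn(2)]) (use Rn(1)[of "1/2"] in simp_all)
    then show "norm (1 / 2 :: complex) \<le> norm (R (1 / 2))" using R'R[of "1/2"] by simp
  qed
  then have "\<exists>\<alpha>. (\<forall>z. norm z < 1 \<longrightarrow> R z = \<alpha> * z) \<and> norm \<alpha> = 1"
    by (intro Schwarz_Lemma(3)[OF hR R0(1) Rn(1), of 0] disjI1 exI[of _ "1/2"]) auto
  then obtain \<alpha> where \<alpha>: "\<And>z. norm z < 1 \<Longrightarrow> R z = \<alpha> * z" "norm \<alpha> = 1" by blast
  show ?thesis
  proof (rule that[of \<alpha> a])
    show "disc_automorphism \<alpha> a" using \<alpha>(2) a(1) by unfold_locales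
    fix z :: complex assume z: "norm z < 1"
    have "T z = R (disc_aut 1 a z)" using disc_aut_inverse[OF a(1) z] by (simp add: R_def)
    also have "\<dots> = \<alpha> * disc_aut 1 a z" by (rule \<alpha>(1)[OF a.norm_less[OF z]])
    finally show "T z = disc_aut \<alpha> a z" by (simp add: disc_aut_def)
  qed
qed

section \<open>Algebra of non-tangential limits\<close>

lemma nontangential_limit_cong:
  assumes "\<And>z. z \<in> ball 0 1 \<Longrightarrow> u z = v z"
  shows "nontangential_limit u q \<zeta> \<longleftrightarrow> nontangential_limit v q \<zeta>"
proof -
  have "(u \<longlongrightarrow> \<zeta>) (at q within {z \<in> ball 0 1. P z}) \<longleftrightarrow> (v \<longlongrightarrow> \<zeta>) (at q within {z \<in> ball 0 1. P z})" for P
    by (rule tendsto_cong) (auto simp: eventually_at_filter assms)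
  then show ?thesis by (simp only: nontangential_limit_def)
qed

lemma nontangential_limit_add:
  "nontangential_limit u q a \<Longrightarrow> nontangential_limit v q b \<Longrightarrow> nontangential_limit (\<lambda>z. u z + v z) q (a + b)"
  by (auto simp: nontangential_limit_def intro: tendsto_add)

lemma nontangential_limit_diff:
  "nontangential_limit u q a \<Longrightarrow> nontangential_limit v q b \<Longrightarrow> nontangential_limit (\<lambda>z. u z - v z) q (a - b)"
  by (auto simp: nontangential_limit_def intro: tendsto_diff)

lemma nontangential_limit_cnj:
  "nontangential_limit u q a \<Longrightarrow> nontangential_limit (\<lambda>z. cnj (u z)) q (cnj a)"
  by (auto simp: nontangential_limit_def intro: tendsto_cnj)

lemma nontangential_limit_of_tendsto:
  assumes "(u \<longlongrightarrow> \<zeta>) (at q within ball 0 1)"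
  shows "nontangential_limit u q \<zeta>"
  unfolding nontangential_limit_def by (intro allI impI tendsto_within_subset[OF assms]) auto

locale extended_param = disc_param +
  assumes ext: "extended_biholomorphism f \<Omega>"
begin

lemma homeo: "homeomorphic_map (top_of_set (cball 0 1)) (subtopology riemann_sphere (riemann_sphere closure_of \<Omega>)) f"
  using ext by (simp add: extended_biholomorphism_def)

lemma inj_cball: "inj_on f (cball 0 1)"
  using homeomorphic_imp_injective_map[OF homeo] by simp

lemma image_cball: "f ` cball 0 1 = riemann_sphere closure_of \<Omega>"
  using homeomorphic_imp_surjective_map[OF homeo] by simp

lemma continuous_cball: "continuous_map (top_of_set (cball 0 1)) riemann_sphere f"
  using homeomorphic_imp_continuous_map[OF homeo] by (simp add: continuous_map_in_subtopology)

lemma image_sphere: "f ` sphere 0 1 = riemann_sphere frontier_of \<Omega>"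
proof -
  have "f ` sphere 0 1 = f ` cball 0 1 - f ` ball 0 1"
    using inj_on_image_set_diff[OF inj_cball, of "cball 0 1" "ball 0 1"] by (simp add: cball_diff_eq_sphere ball_subset_cball)
  then show ?thesis
    unfolding image_cball image_ball using open_domain by (simp add: frontier_of_def interior_of_openin)
qed

text \<open>Closed subsets of the closed disc are compact, so their images are closed in the sphere;
  injectivity carries complements along, and the Borel sets follow by induction.\<close>

lemma image_borel:
  assumes "E \<in> sets borel"
  shows "f ` (E \<inter> cball 0 1) \<in> sigma_sets UNIV {U. openin riemann_sphere U}"
proof -
  let ?\<Sigma> = "sigma_sets UNIV {U. openin riemann_sphere U}"
  have closed: "f ` (C \<inter> cball 0 1) \<in> ?\<Sigma>" if "closed C" for C
  proof -
    have "compactin (top_of_set (cball 0 1)) (C \<inter> cball 0 1)" using that by (simp add: compactin_subtopology closed_Int_compact)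
    then have "compactin riemann_sphere (f ` (C \<inter> cball 0 1))" by (rule image_compactin[OF _ continuous_cball])
    then have "closedin riemann_sphere (f ` (C \<inter> cball 0 1))" by (rule compactin_imp_closedin[OF Hausdorff_riemann_sphere])
    then have "UNIV - f ` (C \<inter> cball 0 1) \<in> ?\<Sigma>" by (auto simp: closedin_def)
    from sigma_sets.Compl[OF this] show ?thesis by (simp add: double_diff)
  qed
  have "E \<in> sigma_sets UNIV (Collect closed)" using assms unfolding borel_eq_closed by simp
  then show ?thesis
  proof (induction E rule: sigma_sets.induct)
    case (Basic C) then show ?case using closed by simp
  next
    case Empty show ?case by (simp add: sigma_sets.Empty)
  next
    case (Compl C)
    have "f ` ((UNIV - C) \<inter> cball 0 1) = f ` (UNIV \<inter> cball 0 1) - f ` (C \<inter> cball 0 1)"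
      using inj_on_image_set_diff[OF inj_cball, of "cball 0 1" "C \<inter> cball 0 1"] by (simp add: Diff_Int_distrib2 Diff_Int)
    also have "\<dots> = UNIV - ((UNIV - f ` (UNIV \<inter> cball 0 1)) \<union> f ` (C \<inter> cball 0 1))" by blast
    also have "\<dots> \<in> ?\<Sigma>" by (intro sigma_sets.Compl sigma_sets_Un closed closed_UNIV Compl.IH)
    finally show ?case .
  next
    case (Union C)
    have "f ` ((\<Union>i. C i) \<inter> cball 0 1) = (\<Union>i. f ` (C i \<inter> cball 0 1))" by blast
    then show ?case using sigma_sets.Union[of "\<lambda>i. f ` (C i \<inter> cball 0 1)"] Union.IH by simp
  qed
qed

lemma preimage_borel:
  assumes "X \<in> sigma_sets UNIV {U. openin riemann_sphere U}"
  shows "{q \<in> sphere 0 1. f q \<in> X} \<in> sets borel"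
  using assms
proof (induction X rule: sigma_sets.induct)
  case (Basic U)
  have c: "continuous_map (top_of_set (sphere 0 1)) riemann_sphere f"
    using continuous_map_from_subtopology_mono[OF continuous_cball] by simp
  have "openin (top_of_set (sphere 0 1)) {q \<in> sphere 0 1. f q \<in> U}"
    using openin_continuous_map_preimage[OF c, of U] Basic by simp
  then obtain V where "open V" "{q \<in> sphere 0 1. f q \<in> U} = sphere 0 1 \<inter> V" unfolding openin_open by blast
  then show ?case by (simp add: borel_closed)
next
  case Empty show ?case by simp
next
  case (Compl X)
  have "{q \<in> sphere 0 1. f q \<in> UNIV - X} = sphere 0 1 - {q \<in> sphere 0 1. f q \<in> X}" by blast
  then show ?case using Compl.IH by (simp add: borel_closed sets.Diff)
next
  case (Union X)
  have "{q \<in> sphere 0 1. f q \<in> (\<Union>i. X i)} = (\<Union>i. {q \<in> sphere 0 1. f q \<in> X i})" by blast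
  then show ?case using Union.IH by (simp add: sets.countable_UN)
qed

text \<open>The transition map is a bijection of the open disc, hence an automorphism, which is
  itself continuous up to the circle.\<close>

lemma change_of_param:
  assumes g: "extended_biholomorphism g \<Omega>"
  obtains \<alpha> a where "disc_automorphism \<alpha> a" "\<And>z. z \<in> cball 0 1 \<Longrightarrow> f z = g (disc_aut \<alpha> a z)"
proof -
  interpret g: extended_param g \<Omega>
    using g open_domain by unfold_locales (auto simp: extended_biholomorphism_def)
  have fi: "f z \<in> \<Omega>" if "norm z < 1" for z using image_ball that by auto
  have gi: "g z \<in> \<Omega>" if "norm z < 1" for z using g.image_ball that by auto
  have hT: "(\<lambda>z. g.coord (f z)) holomorphic_on ball 0 1"
    by (rule g.coord_compose_holomorphic[OF to_sphere]) (simp add: image_ball)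
  have hS: "(\<lambda>z. coord (g z)) holomorphic_on ball 0 1"
    by (rule coord_compose_holomorphic[OF g.to_sphere]) (simp add: g.image_ball)
  obtain \<alpha> a where da: "disc_automorphism \<alpha> a" and T: "\<And>z. norm z < 1 \<Longrightarrow> g.coord (f z) = disc_aut \<alpha> a z"
    by (rule disc_bijection_is_disc_aut[OF hT hS])
       (use f_coord g.f_coord fi gi in \<open>auto\<close>)
  interpret disc_automorphism \<alpha> a by (rule da)
  have on_ball: "f z = g (disc_aut \<alpha> a z)" if "z \<in> ball 0 1" for z
    using g.f_coord[OF fi[of z]] T[of z] that by simp
  have c: "continuous_map (top_of_set (cball 0 1)) riemann_sphere (g \<circ> disc_aut \<alpha> a)"
  proof (rule continuous_map_compose[OF _ g.continuous_cball])
    show "continuous_map (top_of_set (cball 0 1)) (top_of_set (cball 0 1)) (disc_aut \<alpha> a)"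
      using continuous norm_le by (auto simp: continuous_map_in_subtopology)
  qed
  \<comment> \<open>Two continuous maps into a Hausdorff space that agree on the dense open disc
    agree on the closed disc.\<close>
  have "f z = (g \<circ> disc_aut \<alpha> a) z" if "z \<in> cball 0 1" for z
  proof (rule forall_in_closure_of_eq[OF _ Hausdorff_riemann_sphere continuous_cball c, of z "ball 0 1"])
    show "z \<in> top_of_set (cball 0 1) closure_of ball 0 1"
      using that by (simp add: closure_of_subtopology ball_subset_cball Int_absorb1)
  qed (use on_ball in simp)
  then show ?thesis using that[OF da] by simp
qed

text \<open>The definition provides a limit along some parametrization; the automorphism relating it
  to \<open>f\<close> respects Stolz regions.\<close>

lemma CNT_limit_param:
  assumes h: "has_CNT_limit \<Omega> h p \<zeta>" and q: "q \<in> sphere 0 1" "f q = p"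
  shows "nontangential_limit (\<lambda>z. h (f z)) q \<zeta>"
proof -
  obtain g q' where g: "extended_biholomorphism g \<Omega>" "q' \<in> sphere 0 1" "g q' = p" "nontangential_limit (h \<circ> g) q' \<zeta>"
    using h by (auto simp: has_CNT_limit_def)
  interpret g: extended_param g \<Omega>
    using g(1) open_domain by unfold_locales (auto simp: extended_biholomorphism_def)
  obtain \<alpha> a where da: "disc_automorphism \<alpha> a" and T: "\<And>z. z \<in> cball 0 1 \<Longrightarrow> f z = g (disc_aut \<alpha> a z)"
    by (rule change_of_param[OF g(1)]) (rule that; assumption)
  interpret disc_automorphism \<alpha> a by (rule da)
  have nq: "norm q = 1" using q by simp
  have "g (disc_aut \<alpha> a q) = g q'" using T[of q] q g(3) by simp
  then have "disc_aut \<alpha> a q = q'"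
    by (rule inj_onD[OF g.inj_cball]) (use norm_eq[OF nq] g(2) in simp_all)
  then have "nontangential_limit (\<lambda>z. (h \<circ> g) (disc_aut \<alpha> a z)) q \<zeta>"
    using nontangential_limit_compose[OF _ nq] g(4) by blast
  then show ?thesis
    by (subst nontangential_limit_cong[where v = "\<lambda>z. (h \<circ> g) (disc_aut \<alpha> a z)"]) (simp_all add: T)
qed

text \<open>The same passage from some parametrization to the fixed \<open>f\<close>, now for sets
  of capacity zero.\<close>

lemma null_param:
  assumes I: "null_wrt \<Omega> I"
  shows "polar_set {q \<in> sphere 0 1. f q \<in> I}" "{q \<in> sphere 0 1. f q \<in> I} \<in> sets borel"
proof -
  obtain g where g: "extended_biholomorphism g \<Omega>" "log_capacity {q \<in> sphere 0 1. g q \<in> I} = 0"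
    and s: "I \<in> sigma_sets UNIV {U. openin riemann_sphere U}"
    using I by (auto simp: null_wrt_def)
  show "{q \<in> sphere 0 1. f q \<in> I} \<in> sets borel" by (rule preimage_borel[OF s])
  obtain \<alpha> a where da: "disc_automorphism \<alpha> a" and T: "\<And>z. z \<in> cball 0 1 \<Longrightarrow> f z = g (disc_aut \<alpha> a z)"
    by (rule change_of_param[OF g(1)]) (rule that; assumption)
  interpret disc_automorphism \<alpha> a by (rule da)
  have "polar_set {q \<in> sphere 0 1. g q \<in> I}" using g(2) by (subst (asm) log_capacity_eq_0_iff) auto
  then have "polar_set {q \<in> sphere 0 1. disc_aut \<alpha> a q \<in> {q \<in> sphere 0 1. g q \<in> I}}" by (rule polar_set_pullback)
  moreover have "{q \<in> sphere 0 1. disc_aut \<alpha> a q \<in> {q \<in> sphere 0 1. g q \<in> I}} = {q \<in> sphere 0 1. f q \<in> I}"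
    using T norm_eq by auto
  ultimately show "polar_set {q \<in> sphere 0 1. f q \<in> I}" by simp
qed

lemma energy_param:
  assumes "H \<in> D_harm \<Omega>"
  shows "plane_harmonic_on (\<lambda>z. H (f z)) (ball 0 1)" "plane_energy (ball 0 1) (\<lambda>z. H (f z)) < \<infinity>"
proof -
  have H: "harmonic_on H (f ` ball 0 1)" "dirichlet_energy (f ` ball 0 1) H < \<infinity>"
    using assms by (auto simp: D_harm_def image_ball)
  show "plane_harmonic_on (\<lambda>z. H (f z)) (ball 0 1)" by (rule harmonic_pullback[OF open_ball subset_refl H(1)])
  show "plane_energy (ball 0 1) (\<lambda>z. H (f z)) < \<infinity>"
    using H(2) unfolding energy_conformal[OF open_ball subset_refl H(1)] by (auto simp: ennreal_mult_less_top)
qed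

text \<open>The difference of two candidates has finite energy and limit 0 off two null sets.
  Equality inside \<open>\<Omega>\<close> extends to equality of functions because both are
  extensional.\<close>

lemma boundary_values_unique:
  assumes H: "H1 \<in> D_harm \<Omega> \<inter> extensional \<Omega>" "H2 \<in> D_harm \<Omega> \<inter> extensional \<Omega>"
    and agree: "CNT_agree \<Omega> h H1" "CNT_agree \<Omega> h H2"
  shows "H1 = H2"
proof -
  obtain I1 where I1: "null_wrt \<Omega> I1"
      "\<And>p. p \<in> riemann_sphere frontier_of \<Omega> \<Longrightarrow> p \<notin> I1 \<Longrightarrow> \<exists>\<zeta>. has_CNT_limit \<Omega> h p \<zeta> \<and> has_CNT_limit \<Omega> H1 p \<zeta>"
    using agree(1) by (auto simp: CNT_agree_def)
  obtain I2 where I2: "null_wrt \<Omega> I2"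
      "\<And>p. p \<in> riemann_sphere frontier_of \<Omega> \<Longrightarrow> p \<notin> I2 \<Longrightarrow> \<exists>\<zeta>. has_CNT_limit \<Omega> h p \<zeta> \<and> has_CNT_limit \<Omega> H2 p \<zeta>"
    using agree(2) by (auto simp: CNT_agree_def)
  let ?u1 = "\<lambda>z. H1 (f z)" and ?u2 = "\<lambda>z. H2 (f z)"
  have u1: "plane_harmonic_on ?u1 (ball 0 1)" "plane_energy (ball 0 1) ?u1 < \<infinity>" using energy_param[of H1] H(1) by auto
  have u2: "plane_harmonic_on ?u2 (ball 0 1)" "plane_energy (ball 0 1) ?u2 < \<infinity>" using energy_param[of H2] H(2) by auto
  obtain F1 G1 where 1: "F1 holomorphic_on ball 0 1" "G1 holomorphic_on ball 0 1" "\<And>z. z \<in> ball 0 1 \<Longrightarrow> ?u1 z = F1 z + cnj (G1 z)"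
    using plane_harmonic_decompose[OF open_ball convex_ball u1(1)] by blast
  obtain F2 G2 where 2: "F2 holomorphic_on ball 0 1" "G2 holomorphic_on ball 0 1" "\<And>z. z \<in> ball 0 1 \<Longrightarrow> ?u2 z = F2 z + cnj (G2 z)"
    using plane_harmonic_decompose[OF open_ball convex_ball u2(1)] by blast
  let ?w = "\<lambda>z. H1 (f z) - H2 (f z)"
  have F: "(\<lambda>z. F1 z - F2 z) holomorphic_on ball 0 1" and G: "(\<lambda>z. G1 z - G2 z) holomorphic_on ball 0 1"
    using 1 2 by (auto intro: holomorphic_on_diff)
  have w: "?w z = (F1 z - F2 z) + cnj (G1 z - G2 z)" if "z \<in> ball 0 1" for z using 1(3)[OF that] 2(3)[OF that] by simp
  have hw: "plane_harmonic_on ?w (ball 0 1)" by (rule plane_harmonic_hol_antihol[OF open_ball F G w])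
  have "plane_energy (ball 0 1) ?w < \<infinity>"
  proof -
    have "plane_energy (ball 0 1) ?w \<le> (\<integral>\<^sup>+ z. 2 * (ennreal (energy_density ?u1 z) * indicator (ball 0 1) z) + 2 * (ennreal (energy_density ?u2 z) * indicator (ball 0 1) z) \<partial>lborel)"
      unfolding plane_energy_def
    proof (rule nn_integral_mono)
      fix z :: complex
      show "ennreal (energy_density ?w z) * indicator (ball 0 1) z \<le> 2 * (ennreal (energy_density ?u1 z) * indicator (ball 0 1) z) + 2 * (ennreal (energy_density ?u2 z) * indicator (ball 0 1) z)"
      proof (cases "z \<in> ball 0 1")
        case z: True
        have d: "F1 field_differentiable (at z)" "F2 field_differentiable (at z)" "G1 field_differentiable (at z)" "G2 field_differentiable (at z)"
          using 1 2 z by (auto intro: holomorphic_on_imp_differentiable_at[OF _ open_ball])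
        have "d_z ?w z = deriv (\<lambda>z. F1 z - F2 z) z" "d_zbar ?w z = cnj (deriv (\<lambda>z. G1 z - G2 z) z)"
          by (rule hol_antihol_derivatives(4)[OF open_ball F G w z], assumption, rule hol_antihol_derivatives(5)[OF open_ball F G w z], assumption)
        then have ew: "energy_density ?w z = (norm (deriv F1 z - deriv F2 z))\<^sup>2 + (norm (deriv G1 z - deriv G2 z))\<^sup>2"
          unfolding energy_density_def using d by (simp only: deriv_diff complex_mod_cnj)
        have "d_z ?u1 z = deriv F1 z" "d_zbar ?u1 z = cnj (deriv G1 z)"
          by (rule hol_antihol_derivatives(4)[OF open_ball 1 z], assumption, rule hol_antihol_derivatives(5)[OF open_ball 1 z], assumption)
        then have e1: "energy_density ?u1 z = (norm (deriv F1 z))\<^sup>2 + (norm (deriv G1 z))\<^sup>2"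
          unfolding energy_density_def by (simp only: complex_mod_cnj)
        have "d_z ?u2 z = deriv F2 z" "d_zbar ?u2 z = cnj (deriv G2 z)"
          by (rule hol_antihol_derivatives(4)[OF open_ball 2 z], assumption, rule hol_antihol_derivatives(5)[OF open_ball 2 z], assumption)
        then have e2: "energy_density ?u2 z = (norm (deriv F2 z))\<^sup>2 + (norm (deriv G2 z))\<^sup>2"
          unfolding energy_density_def by (simp only: complex_mod_cnj)
        have "energy_density ?w z \<le> 2 * energy_density ?u1 z + 2 * energy_density ?u2 z"
          unfolding ew e1 e2
        proof -
          have lin: "a + d \<le> 2 * (b + e) + 2 * (c + f)" if "a \<le> 2 * b + 2 * c" "d \<le> 2 * e + 2 * f" for a b c d e f :: real
            using that by (simp add: distrib_left)
          show "(norm (deriv F1 z - deriv F2 z))\<^sup>2 + (norm (deriv G1 z - deriv G2 z))\<^sup>2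
              \<le> 2 * ((norm (deriv F1 z))\<^sup>2 + (norm (deriv G1 z))\<^sup>2) + 2 * ((norm (deriv F2 z))\<^sup>2 + (norm (deriv G2 z))\<^sup>2)"
            by (rule lin[OF norm_diff_square_le norm_diff_square_le])
        qed
        then have "ennreal (energy_density ?w z) \<le> ennreal (2 * energy_density ?u1 z + 2 * energy_density ?u2 z)" by (rule ennreal_leI)
        also have "\<dots> = 2 * ennreal (energy_density ?u1 z) + 2 * ennreal (energy_density ?u2 z)"
          by (simp add: energy_density_nonneg ennreal_mult)
        finally show ?thesis using z by simp
      qed simp
    qed
    also have "\<dots> = 2 * plane_energy (ball 0 1) ?u1 + 2 * plane_energy (ball 0 1) ?u2"
    proof -
      note [measurable] = measurable_energy_density[OF open_ball u1(1)] measurable_energy_density[OF open_ball u2(1)]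
      show ?thesis unfolding plane_energy_def by (simp add: nn_integral_add nn_integral_cmult)
    qed
    also have "\<dots> < \<infinity>" using u1(2) u2(2) by (simp add: ennreal_mult_less_top)
    finally show ?thesis .
  qed
  moreover have "nontangential_limit ?w q 0"
    if q: "q \<in> sphere 0 1" "q \<notin> {q \<in> sphere 0 1. f q \<in> I1}" "q \<notin> {q \<in> sphere 0 1. f q \<in> I2}" for q
  proof -
    have p: "f q \<in> riemann_sphere frontier_of \<Omega>" "f q \<notin> I1" "f q \<notin> I2" using q image_sphere by auto
    obtain \<zeta>1 \<zeta>2 where \<zeta>: "has_CNT_limit \<Omega> h (f q) \<zeta>1" "has_CNT_limit \<Omega> H1 (f q) \<zeta>1" "has_CNT_limit \<Omega> h (f q) \<zeta>2" "has_CNT_limit \<Omega> H2 (f q) \<zeta>2"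
      using I1(2)[OF p(1,2)] I2(2)[OF p(1,3)] by blast
    note l = \<zeta>[THEN CNT_limit_param, OF q(1) refl]
    have "\<zeta>1 = \<zeta>2" by (rule nontangential_limit_unique[OF l(1,3)]) (use q in simp)
    then show ?thesis using nontangential_limit_diff[OF l(2,4)] by simp
  qed
  ultimately have zero: "?w z = 0" if "z \<in> ball 0 1" for z
    by (rule harmonic_zero_of_boundary[OF hw _ null_param[OF I1(1)] null_param[OF I2(1)] _ that])
  show ?thesis
  proof (rule extensionalityI)
    show "H1 \<in> extensional \<Omega>" "H2 \<in> extensional \<Omega>" using H by auto
    fix p assume "p \<in> \<Omega>"
    then show "H1 p = H2 p" using f_coord[of p] zero[of "coord p"] by simp
  qed
qed

text \<open>The function with parts \<open>P\<close> and \<open>Q\<close>, transported to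
  \<open>\<Omega>\<close>, has the boundary values of \<open>h\<close>: both converge off the
  exceptional set of the gradients, and to the same limit.\<close>

lemma bounce_exists:
  assumes P: "P holomorphic_on ball 0 1" and Q: "Q holomorphic_on ball 0 1"
    and lim: "\<And>q. q \<in> sphere 0 1 \<Longrightarrow> ((\<lambda>z. h (f z) - (P z + cnj (Q z))) \<longlongrightarrow> 0) (at q within ball 0 1)"
    and fin: "plane_energy (ball 0 1) (\<lambda>z. P z + cnj (Q z)) < \<infinity>"
  obtains H where "H \<in> D_harm \<Omega> \<inter> extensional \<Omega>" "CNT_agree \<Omega> h H"
    "dirichlet_energy \<Omega> H = ennreal (1 / pi) * plane_energy (ball 0 1) (\<lambda>z. P z + cnj (Q z))"
proof -
  let ?U = "\<lambda>z. P z + cnj (Q z)"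
  have hU: "plane_harmonic_on ?U (ball 0 1)" by (rule plane_harmonic_hol_antihol[OF open_ball P Q refl])
  \<comment> \<open>The restriction makes \<open>H\<close> extensional, as the definition of
    \<open>bounce\<close> demands.\<close>
  define H where "H = restrict (\<lambda>p. ?U (coord p)) \<Omega>"
  have Hf: "H (f z) = ?U z" if "z \<in> ball 0 1" for z
    using that image_ball by (auto simp: H_def)
  have harm: "harmonic_on H (f ` ball 0 1)"
    by (rule harmonic_pushforward[OF open_ball subset_refl hU]) (auto simp: H_def image_ball)
  have en: "dirichlet_energy \<Omega> H = ennreal (1 / pi) * plane_energy (ball 0 1) ?U"
  proof -
    have "plane_energy (ball 0 1) (\<lambda>z. H (f z)) = plane_energy (ball 0 1) ?U"
      unfolding plane_energy_def
    proof (rule nn_integral_cong)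
      fix z :: complex
      show "ennreal (energy_density (\<lambda>z. H (f z)) z) * indicator (ball 0 1) z = ennreal (energy_density ?U z) * indicator (ball 0 1) z"
        using energy_density_cong[OF open_ball hU Hf, of z] by (cases "z \<in> ball 0 1") simp_all
    qed
    then show ?thesis using energy_conformal[OF open_ball subset_refl harm] by (simp add: image_ball)
  qed
  have DH: "H \<in> D_harm \<Omega> \<inter> extensional \<Omega>"
    using harm en fin by (auto simp: D_harm_def H_def image_ball ennreal_mult_less_top)
  \<comment> \<open>The sum of both gradients, so that a single exceptional set serves
    \<open>P\<close> and \<open>Q\<close>; its square is at most twice the energy density.\<close>
  define \<Phi> where "\<Phi> z = ennreal (norm (deriv P z) + norm (deriv Q z)) * indicator (ball 0 1) z" for z
  have \<Phi>m: "\<Phi> \<in> borel_measurable borel"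
  proof -
    have "(\<lambda>z. indicator (ball 0 1) z *\<^sub>R (norm (deriv P z) + norm (deriv Q z))) \<in> borel_measurable borel"
      by (intro borel_measurable_continuous_on_indicator continuous_intros holomorphic_on_imp_continuous_on holomorphic_deriv P Q) auto
    then have "(\<lambda>z. ennreal (indicator (ball 0 1) z *\<^sub>R (norm (deriv P z) + norm (deriv Q z)))) \<in> borel_measurable borel" by measurable
    moreover have "(\<lambda>z. ennreal (indicator (ball 0 1) z *\<^sub>R (norm (deriv P z) + norm (deriv Q z)))) = \<Phi>"
      by (auto simp: \<Phi>_def fun_eq_iff split: split_indicator)
    ultimately show ?thesis by (simp only:)
  qed
  have \<Phi>fin: "(\<integral>\<^sup>+ z. \<Phi> z * \<Phi> z \<partial>lborel) < \<infinity>"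
  proof -
    note [measurable] = measurable_energy_density[OF open_ball hU]
    have "(\<integral>\<^sup>+ z. \<Phi> z * \<Phi> z \<partial>lborel) \<le> (\<integral>\<^sup>+ z. 2 * (ennreal (energy_density ?U z) * indicator (ball 0 1) z) \<partial>lborel)"
    proof (rule nn_integral_mono)
      fix z :: complex
      show "\<Phi> z * \<Phi> z \<le> 2 * (ennreal (energy_density ?U z) * indicator (ball 0 1) z)"
      proof (cases "z \<in> ball 0 1")
        case z: True
        let ?s = "norm (deriv P z) + norm (deriv Q z)"
        have "?s * ?s \<le> 2 * energy_density ?U z"
          unfolding energy_density_def hol_antihol_derivatives(4,5)[OF open_ball P Q refl z]
          using sum_squares_bound[of "norm (deriv P z)" "norm (deriv Q z)"] by (simp add: power2_eq_square algebra_simps)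
        then have "ennreal (?s * ?s) \<le> ennreal (2 * energy_density ?U z)" by (rule ennreal_leI)
        then show ?thesis using z by (simp add: \<Phi>_def ennreal_mult energy_density_nonneg del: ennreal_plus)
      qed (simp add: \<Phi>_def)
    qed
    also have "\<dots> = 2 * plane_energy (ball 0 1) ?U" by (simp add: nn_integral_cmult plane_energy_def)
    also have "\<dots> < \<infinity>" using fin by (simp add: ennreal_mult_less_top)
    finally show ?thesis .
  qed
  define E where "E = {q \<in> sphere 0 1. riesz_potential \<Phi> q = \<infinity>}"
  have polE: "polar_set E" unfolding E_def by (rule polar_set_riesz_potential[OF \<Phi>m _ \<Phi>fin]) (simp add: \<Phi>_def)
  have mE: "E \<in> sets borel"
  proof -
    note [measurable] = riesz_potential_borel[OF \<Phi>m]
    have "{q \<in> space borel. riesz_potential \<Phi> q = \<infinity>} \<in> sets borel" by measurable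
    moreover have "E = sphere 0 1 \<inter> {q \<in> space borel. riesz_potential \<Phi> q = \<infinity>}" by (auto simp: E_def)
    ultimately show ?thesis by (simp add: borel_closed sets.Int)
  qed
  have E: "E \<subseteq> sphere 0 1" by (auto simp: E_def)
  have null: "null_wrt \<Omega> (f ` E)"
    unfolding null_wrt_def
  proof (intro conjI exI)
    show "f ` E \<subseteq> riemann_sphere frontier_of \<Omega>" using E image_sphere by blast
    have "E \<inter> cball 0 1 = E" using E by auto
    then show "f ` E \<in> sigma_sets UNIV {U. openin riemann_sphere U}" using image_borel[OF mE] by simp
    show "extended_biholomorphism f \<Omega>" by (rule ext)
    have "{q \<in> sphere 0 1. f q \<in> f ` E} = E"
    proof -
      have "E \<subseteq> cball 0 1" using E by auto
      then have "f q \<in> f ` E \<longleftrightarrow> q \<in> E" if "q \<in> sphere 0 1" for q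
        by (rule inj_on_image_mem_iff[OF inj_cball, rotated]) (use that in simp)
      then show ?thesis using E by auto
    qed
    then show "log_capacity {q \<in> sphere 0 1. f q \<in> f ` E} = 0" using log_capacity_eq_0_iff[OF E] polE by simp
  qed
  have "CNT_agree \<Omega> h H"
    unfolding CNT_agree_def
  proof (intro exI[of _ "f ` E"] conjI ballI null)
    fix p assume "p \<in> riemann_sphere frontier_of \<Omega> - f ` E"
    then have p: "p \<in> f ` sphere 0 1" "p \<notin> f ` E" unfolding image_sphere by simp_all
    from p(1) obtain q where q: "q \<in> sphere 0 1" "p = f q" by (rule imageE)
    have qE: "q \<notin> E" by (rule contrapos_nn[OF p(2)]) (simp only: q(2) imageI)
    have nq: "norm q = 1" using q(1) by simp
    have "riesz_potential \<Phi> q \<noteq> \<infinity>" using qE q(1) unfolding E_def mem_Collect_eq by (simp only: simp_thms)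
    then have fq: "riesz_potential \<Phi> q < \<infinity>" by (rule order_neq_le_trans) simp
    have "riesz_potential (\<lambda>z. ennreal (norm (deriv P z)) * indicator (ball 0 1) z) q \<le> riesz_potential \<Phi> q"
      unfolding riesz_potential_def \<Phi>_def by (intro nn_integral_mono mult_right_mono ennreal_leI) simp_all
    then have fP: "finite_potential P q" by (rule finite_potential.intro[OF P nq le_less_trans[OF _ fq]])
    have "riesz_potential (\<lambda>z. ennreal (norm (deriv Q z)) * indicator (ball 0 1) z) q \<le> riesz_potential \<Phi> q"
      unfolding riesz_potential_def \<Phi>_def by (intro nn_integral_mono mult_right_mono ennreal_leI) simp_all
    then have fQ: "finite_potential Q q" by (rule finite_potential.intro[OF Q nq le_less_trans[OF _ fq]])
    obtain L M where LM: "nontangential_limit P q L" "nontangential_limit Q q M"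
      by (rule exE[OF finite_potential.nontangential_limit_exists[OF fP]], rule exE[OF finite_potential.nontangential_limit_exists[OF fQ]]) (rule that)
    have U: "nontangential_limit ?U q (L + cnj M)" by (intro nontangential_limit_add nontangential_limit_cnj LM)
    have 1: "nontangential_limit (H \<circ> f) q (L + cnj M)"
      by (rule iffD2[OF nontangential_limit_cong U]) (simp only: o_apply Hf)
    \<comment> \<open>\<open>h\<close> after \<open>f\<close> differs from the harmonic function by
      a term with limit 0 at \<open>q\<close>, so it inherits the non-tangential limit.\<close>
    have "nontangential_limit (\<lambda>z. (h (f z) - ?U z) + ?U z) q (0 + (L + cnj M))"
      by (rule nontangential_limit_add[OF nontangential_limit_of_tendsto[OF lim[OF q(1)]] U])
    then have 2: "nontangential_limit (h \<circ> f) q (L + cnj M)" by (simp add: o_def)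
    show "\<exists>\<zeta>. has_CNT_limit \<Omega> h p \<zeta> \<and> has_CNT_limit \<Omega> H p \<zeta>"
      unfolding has_CNT_limit_def
      by (intro exI[of _ "L + cnj M"] conjI exI[of _ f] exI[of _ q] ext q(1) q(2)[symmetric] 1 2)
  qed
  from that[OF DH this en] show ?thesis .
qed

end

theorem theorem3p17:
  fixes \<Omega> \<Gamma> A :: "csphere set"
  assumes "jordan_domain \<Omega> \<Gamma>"
    and "collar_nbhd A \<Omega>"
  shows "\<exists>C::real. \<forall>h \<in> D_harm A.
           dirichlet_energy \<Omega> (bounce A \<Omega> h) \<le> ennreal C * dirichlet_energy A h"
proof -
  obtain f0 r where f0: "biholomorphism f0 \<Omega>" and r: "0 < r" "r < 1"
    and A0: "A = f0 ` {z. r < norm z \<and> norm z < 1}"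
    using assms(2) by (auto simp: collar_nbhd_def)
  \<comment> \<open>The extension agrees with \<open>f0\<close> on the open disc, so the collar is
    unchanged.\<close>
  obtain f where f: "extended_biholomorphism f \<Omega>" and ff0: "\<And>z. z \<in> ball 0 1 \<Longrightarrow> f z = f0 z"
    by (rule caratheodory_extension[OF assms(1) f0]) (rule that; assumption)
  let ?A = "{z::complex. r < norm z \<and> norm z < 1}"
  have A: "A = f ` ?A" unfolding A0 using ff0 by (intro image_cong) auto
  have oA: "open ?A" and Ab: "?A \<subseteq> ball 0 1"
    by (intro open_Collect_conj open_Collect_less continuous_intros) auto
  interpret extended_param f \<Omega>
    using f assms(1) by unfold_locales (auto simp: extended_biholomorphism_def jordan_domain_def)
  \<comment> \<open>The constant depends on \<open>r\<close> alone and is fixed before any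
    \<open>h\<close> is chosen.\<close>
  obtain C where C: "0 \<le> C" and ann:
    "\<And>u. \<lbrakk>plane_harmonic_on u ?A; plane_energy ?A u < \<infinity>\<rbrakk> \<Longrightarrow>
      \<exists>P Q. P holomorphic_on ball 0 1 \<and> Q holomorphic_on ball 0 1 \<and>
        (\<forall>q\<in>sphere 0 1. ((\<lambda>z. u z - (P z + cnj (Q z))) \<longlongrightarrow> 0) (at q within ball 0 1)) \<and>
        plane_energy (ball 0 1) (\<lambda>z. P z + cnj (Q z)) \<le> ennreal C * plane_energy ?A u"
    by (rule annulus_extension[OF r]) (rule that; assumption)
  show ?thesis
  proof (intro exI[of _ C] ballI)
    fix h assume h: "h \<in> D_harm A"
    then have hA: "harmonic_on h (f ` ?A)" "dirichlet_energy (f ` ?A) h < \<infinity>" by (auto simp: D_harm_def A)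
    note en = energy_conformal[OF oA Ab hA(1)]
    have fin: "plane_energy ?A (\<lambda>z. h (f z)) < \<infinity>" using hA(2) unfolding en by (auto simp: ennreal_mult_less_top)
    obtain P Q where PQ: "P holomorphic_on ball 0 1" "Q holomorphic_on ball 0 1"
      "\<And>q. q \<in> sphere 0 1 \<Longrightarrow> ((\<lambda>z. h (f z) - (P z + cnj (Q z))) \<longlongrightarrow> 0) (at q within ball 0 1)"
      and le: "plane_energy (ball 0 1) (\<lambda>z. P z + cnj (Q z)) \<le> ennreal C * plane_energy ?A (\<lambda>z. h (f z))"
      using ann[OF harmonic_pullback[OF oA Ab hA(1)] fin] by blast
    have finU: "plane_energy (ball 0 1) (\<lambda>z. P z + cnj (Q z)) < \<infinity>"
      by (rule le_less_trans[OF le]) (use fin in \<open>simp add: ennreal_mult_less_top\<close>)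
    obtain H where H: "H \<in> D_harm \<Omega> \<inter> extensional \<Omega>" "CNT_agree \<Omega> h H"
      and eH: "dirichlet_energy \<Omega> H = ennreal (1 / pi) * plane_energy (ball 0 1) (\<lambda>z. P z + cnj (Q z))"
    proof (rule bounce_exists[of P Q h, OF PQ(1,2) _ finU])
      fix q :: complex assume "q \<in> sphere 0 1"
      then show "((\<lambda>z. h (f z) - (P z + cnj (Q z))) \<longlongrightarrow> 0) (at q within ball 0 1)" by (rule PQ(3))
    qed (rule that)
    have "bounce A \<Omega> h = (THE H. H \<in> D_harm \<Omega> \<inter> extensional \<Omega> \<and> CNT_agree \<Omega> h H)"
      using h by (simp add: bounce_def)
    \<comment> \<open>Existence and uniqueness together make the description in
      \<open>bounce\<close> denote \<open>H\<close>.\<close>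
    also have "\<dots> = H" by (rule the_equality) (use H boundary_values_unique in blast)+
    finally have "dirichlet_energy \<Omega> (bounce A \<Omega> h) = ennreal (1 / pi) * plane_energy (ball 0 1) (\<lambda>z. P z + cnj (Q z))"
      using eH by simp
    also have "\<dots> \<le> ennreal (1 / pi) * (ennreal C * plane_energy ?A (\<lambda>z. h (f z)))" by (rule mult_left_mono[OF le]) simp
    also have "\<dots> = ennreal C * dirichlet_energy A h" unfolding A en by (simp add: mult_ac)
    finally show "dirichlet_energy \<Omega> (bounce A \<Omega> h) \<le> ennreal C * dirichlet_energy A h" .
  qed
qed

end
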